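(* Let $M^m$ be a connected, closed, oriented smooth manifold of dimension $m$ and let $g$ be a fixed Riemannian metric on $M$. Fix real numbers $p,q$ with $1\le p<m$ and $1\le q<\frac{mp}{m-p}$. Then there is a constant $C=C(M,g,q)>0$, independent of $h$, such that for every Riemannian metric $h$ on $M$, $$\|d_{h}(x,y)\|_{L^{q}(M\times M,\, g\oplus g)}\le C(M,g,q)\,\|h\|^{\frac{1}{2}}_{L^{\frac{p}{2}}(M,g)}.$$
   Context: $d_h:M\times M\to[0,\infty)$ is the Riemannian distance function of $h$. $L^q(M\times M,g\oplus g)$ is taken with respect to the Riemannian volume measure of the product metric $g\oplus g$. For a symmetric 2-tensor $h$, $|h|_{g}$ denotes its pointwise (tensor) norm with respect to $g$, and for $r>0$, $\|h\|_{L^{r}(M,g)}=\left(\int_M |h|_{g}^{r}\,dV_{g}\right)^{1/r}$, where $dV_g$ is the Riemannian volume measure of $g$. *)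

theory Defs
  imports "HOL-Analysis.Analysis"
begin

section \<open>Smooth maps\<close>

text \<open>On an open set, \<open>f\<close> is \<open>C^k\<close> iff it is differentiable with all directional derivatives
  \<open>x \<mapsto> Df(x) v\<close> being \<open>C^(k-1)\<close>.\<close>

primrec Ck_on :: "nat \<Rightarrow> 'v::real_normed_vector set \<Rightarrow> ('v \<Rightarrow> 'w::real_normed_vector) \<Rightarrow> bool" where
  "Ck_on 0 S f \<longleftrightarrow> continuous_on S f"
| "Ck_on (Suc k) S f \<longleftrightarrow> (\<forall>x\<in>S. f differentiable (at x)) \<and>
     (\<forall>v. Ck_on k S (\<lambda>x. frechet_derivative f (at x) v))"

definition smooth_on :: "'v::real_normed_vector set \<Rightarrow> ('v \<Rightarrow> 'w::real_normed_vector) \<Rightarrow> bool" where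
  "smooth_on S f \<longleftrightarrow> (\<forall>k. Ck_on k S f)"

section \<open>Smooth manifolds\<close>

text \<open>A manifold is a topological space with an indexed atlas. Its dimension is \<open>CARD('n)\<close>; an
  atlas need not be maximal, since any smooth atlas determines the smooth structure and every
  notion below depends only on that structure. The values of a chart map \<open>cmap M i\<close> outside
  \<open>cdom M i\<close> are irrelevant.\<close>

record ('a, 'i, 'n) mfd =
  points :: "'a topology"
  charts :: "'i set"
  cdom :: "'i \<Rightarrow> 'a set"
  cmap :: "'i \<Rightarrow> 'a \<Rightarrow> real^'n"

definition cimg :: "('a, 'i, 'n::finite) mfd \<Rightarrow> 'i \<Rightarrow> (real^'n) set" where
  "cimg M i = cmap M i ` cdom M i"

definition cinv :: "('a, 'i, 'n::finite) mfd \<Rightarrow> 'i \<Rightarrow> real^'n \<Rightarrow> 'a" where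
  "cinv M i = inv_into (cdom M i) (cmap M i)"

definition transition :: "('a, 'i, 'n::finite) mfd \<Rightarrow> 'i \<Rightarrow> 'i \<Rightarrow> real^'n \<Rightarrow> real^'n" where
  "transition M i j = cmap M j \<circ> cinv M i"

definition jacobian :: "('a, 'i, 'n::finite) mfd \<Rightarrow> 'i \<Rightarrow> 'i \<Rightarrow> 'a \<Rightarrow> real^'n^'n" where
  "jacobian M i j x = matrix (frechet_derivative (transition M i j) (at (cmap M i x)))"

definition smooth_manifold :: "('a, 'i, 'n::finite) mfd \<Rightarrow> bool" where
  "smooth_manifold M \<longleftrightarrow>
     Hausdorff_space (points M) \<and> second_countable (points M) \<and>
     (\<Union>i\<in>charts M. cdom M i) = topspace (points M) \<and>
     (\<forall>i\<in>charts M. openin (points M) (cdom M i) \<and> open (cimg M i) \<and>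
        homeomorphic_map (subtopology (points M) (cdom M i)) (top_of_set (cimg M i)) (cmap M i)) \<and>
     (\<forall>i\<in>charts M. \<forall>j\<in>charts M.
        smooth_on (cmap M i ` (cdom M i \<inter> cdom M j)) (transition M i j))"

text \<open>Closed means compact without boundary; there is no boundary because chart images are open
  in \<open>\<real>^n\<close>.\<close>

definition closed_manifold :: "('a, 'i, 'n::finite) mfd \<Rightarrow> bool" where
  "closed_manifold M \<longleftrightarrow> smooth_manifold M \<and> compact_space (points M)"

text \<open>An orientation is given by an atlas whose transition maps preserve orientation.\<close>

definition oriented :: "('a, 'i, 'n::finite) mfd \<Rightarrow> bool" where
  "oriented M \<longleftrightarrow> (\<forall>i\<in>charts M. \<forall>j\<in>charts M. \<forall>x\<in>cdom M i \<inter> cdom M j. 0 < det (jacobian M i j x))"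

definition prod_mfd ::
  "('a, 'i, 'n::finite) mfd \<Rightarrow> ('b, 'j, 'k::finite) mfd \<Rightarrow> ('a \<times> 'b, 'i \<times> 'j, 'n + 'k) mfd" where
  "prod_mfd M N = \<lparr> points = prod_topology (points M) (points N),
     charts = charts M \<times> charts N,
     cdom = (\<lambda>(i, j). cdom M i \<times> cdom N j),
     cmap = (\<lambda>(i, j) (x, y). \<chi> k. case k of Inl a \<Rightarrow> cmap M i x $ a | Inr b \<Rightarrow> cmap N j y $ b) \<rparr>"

section \<open>Riemannian metrics\<close>

text \<open>A covariant 2-tensor field is given by its components: \<open>h i x\<close> is the matrix of the
  bilinear form at \<open>x\<close> with respect to the coordinate basis of the chart \<open>i\<close>
  (only \<open>i \<in> charts M\<close>, \<open>x \<in> cdom M i\<close> matter).\<close>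

type_synonym ('a, 'i, 'n) tensor2 = "'i \<Rightarrow> 'a \<Rightarrow> real^'n^'n"

definition smooth_tensor2 :: "('a, 'i, 'n::finite) mfd \<Rightarrow> ('a, 'i, 'n) tensor2 \<Rightarrow> bool" where
  "smooth_tensor2 M h \<longleftrightarrow>
     (\<forall>i\<in>charts M. \<forall>j\<in>charts M. \<forall>x\<in>cdom M i \<inter> cdom M j.
        h i x = transpose (jacobian M i j x) ** h j x ** jacobian M i j x) \<and>
     (\<forall>i\<in>charts M. smooth_on (cimg M i) (\<lambda>v. h i (cinv M i v)))"

definition riemannian_metric :: "('a, 'i, 'n::finite) mfd \<Rightarrow> ('a, 'i, 'n) tensor2 \<Rightarrow> bool" where
  "riemannian_metric M h \<longleftrightarrow> smooth_tensor2 M h \<and>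
     (\<forall>i\<in>charts M. \<forall>x\<in>cdom M i.
        transpose (h i x) = h i x \<and> (\<forall>v. v \<noteq> 0 \<longrightarrow> 0 < v \<bullet> (h i x *v v)))"

definition prod_riemannian_metric ::
  "('a, 'i, 'n::finite) tensor2 \<Rightarrow> ('b, 'j, 'k::finite) tensor2 \<Rightarrow> ('a \<times> 'b, 'i \<times> 'j, 'n + 'k) tensor2" where
  "prod_riemannian_metric g h = (\<lambda>(i, j) (x, y). \<chi> k l. case (k, l) of
       (Inl a, Inl b) \<Rightarrow> g i x $ a $ b
     | (Inr a, Inr b) \<Rightarrow> h j y $ a $ b
     | _ \<Rightarrow> 0)"

text \<open>Some chart around \<open>x\<close>; what is computed in it below does not depend on the choice.\<close>

definition chart_at :: "('a, 'i, 'n::finite) mfd \<Rightarrow> 'a \<Rightarrow> 'i" where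
  "chart_at M x = (SOME i. i \<in> charts M \<and> x \<in> cdom M i)"

text \<open>\<open>|h|_g^2 = g^{ik} g^{jl} h_{ij} h_{kl}\<close>\<close>

definition tensor_norm ::
  "('a, 'i, 'n::finite) mfd \<Rightarrow> ('a, 'i, 'n) tensor2 \<Rightarrow> ('a, 'i, 'n) tensor2 \<Rightarrow> 'a \<Rightarrow> real" where
  "tensor_norm M g h x =
     (let c = chart_at M x; G = matrix_inv (g c x); H = h c x
      in sqrt (\<Sum>i\<in>UNIV. \<Sum>j\<in>UNIV. \<Sum>k\<in>UNIV. \<Sum>l\<in>UNIV.
           G $ i $ k * G $ j $ l * H $ i $ j * H $ k $ l))"

text \<open>The Riemannian volume measure is the unique Borel measure which in every chart has density
  \<open>sqrt (det g_{ij})\<close> with respect to Lebesgue measure.\<close>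

definition is_riemannian_volume ::
  "('a, 'i, 'n::finite) mfd \<Rightarrow> ('a, 'i, 'n) tensor2 \<Rightarrow> 'a measure \<Rightarrow> bool" where
  "is_riemannian_volume M g \<mu> \<longleftrightarrow>
     space \<mu> = topspace (points M) \<and>
     sets \<mu> = sigma_sets (topspace (points M)) {U. openin (points M) U} \<and>
     (\<forall>i\<in>charts M. \<forall>B\<in>sets \<mu>. B \<subseteq> cdom M i \<longrightarrow>
        emeasure \<mu> B =
          (\<integral>\<^sup>+ v. ennreal (sqrt (det (g i (cinv M i v)))) * indicator (cmap M i ` B) v \<partial>lborel))"

definition riemannian_volume ::
  "('a, 'i, 'n::finite) mfd \<Rightarrow> ('a, 'i, 'n) tensor2 \<Rightarrow> 'a measure" where
  "riemannian_volume M g = (THE \<mu>. is_riemannian_volume M g \<mu>)"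

text \<open>The \<open>L^r\<close> (quasi-)norm for \<open>r > 0\<close>; it is only meaningful for \<open>r\<close>-integrable functions, in
  particular for continuous functions on a closed manifold.\<close>

definition Lr_norm :: "real \<Rightarrow> 'a measure \<Rightarrow> ('a \<Rightarrow> real) \<Rightarrow> real" where
  "Lr_norm r \<mu> f = (\<integral>x. \<bar>f x\<bar> powr r \<partial>\<mu>) powr (1 / r)"

section \<open>Riemannian distance\<close>

text \<open>\<open>C^1\<close> on a closed interval, with one-sided derivatives at the end points.\<close>

definition C1_curve_on :: "('a, 'i, 'n::finite) mfd \<Rightarrow> (real \<Rightarrow> 'a) \<Rightarrow> real \<Rightarrow> real \<Rightarrow> bool" where
  "C1_curve_on M \<gamma> a b \<longleftrightarrow>
     (\<forall>i\<in>charts M. \<exists>D. continuous_on {t\<in>{a..b}. \<gamma> t \<in> cdom M i} D \<and>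
        (\<forall>t\<in>{a..b}. \<gamma> t \<in> cdom M i \<longrightarrow>
           ((cmap M i \<circ> \<gamma>) has_vector_derivative D t) (at t within {a..b})))"

definition piecewise_C1_curve :: "('a, 'i, 'n::finite) mfd \<Rightarrow> (real \<Rightarrow> 'a) \<Rightarrow> bool" where
  "piecewise_C1_curve M \<gamma> \<longleftrightarrow>
     continuous_map (top_of_set {0..1}) (points M) \<gamma> \<and>
     (\<exists>k s. s 0 = 0 \<and> s k = 1 \<and>
        (\<forall>i<k. s i < s (Suc i) \<and> C1_curve_on M \<gamma> (s i) (s (Suc i))))"

text \<open>The speed \<open>sqrt (h(\<gamma>'(t), \<gamma>'(t)))\<close>, defined except at finitely many \<open>t\<close>, which do not affect
  the length.\<close>

definition speed ::
  "('a, 'i, 'n::finite) mfd \<Rightarrow> ('a, 'i, 'n) tensor2 \<Rightarrow> (real \<Rightarrow> 'a) \<Rightarrow> real \<Rightarrow> real" where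
  "speed M h \<gamma> t =
     (let i = chart_at M (\<gamma> t); v = vector_derivative (cmap M i \<circ> \<gamma>) (at t)
      in sqrt (v \<bullet> (h i (\<gamma> t) *v v)))"

definition curve_length ::
  "('a, 'i, 'n::finite) mfd \<Rightarrow> ('a, 'i, 'n) tensor2 \<Rightarrow> (real \<Rightarrow> 'a) \<Rightarrow> real" where
  "curve_length M h \<gamma> = integral {0..1} (speed M h \<gamma>)"

definition riemannian_dist ::
  "('a, 'i, 'n::finite) mfd \<Rightarrow> ('a, 'i, 'n) tensor2 \<Rightarrow> 'a \<Rightarrow> 'a \<Rightarrow> real" where
  "riemannian_dist M h x y =
     Inf {curve_length M h \<gamma> | \<gamma>. piecewise_C1_curve M \<gamma> \<and> \<gamma> 0 = x \<and> \<gamma> 1 = y}"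

end

theory Submission
  imports Defs "HOL-Probability.Probability"
begin

text \<open>
  Write \<open>f = |h|_g^(1/2)\<close> (\<open>speed_bound h\<close> below), \<open>n = CARD('n)\<close> and \<open>B\<close> for the \<open>L^p\<close> norm of \<open>f\<close>.
  Since \<open>|h|_g^(p/2) = f^p\<close>, the right-hand side of the theorem is \<open>C * B\<close>. By the Cauchy-Schwarz
  inequality \<open>h(v, v) \<le> |h|_g g(v, v)\<close> (\<open>quad_form_le_tensor_norm\<close>), so the \<open>h\<close>-length of a curve is
  at most the integral of \<open>f\<close> along it with respect to the arc length of \<open>g\<close>. In other words, \<open>f\<close> is an
  upper gradient of every function that is 1-Lipschitz for \<open>d_h\<close>, and the theorem is a Sobolev
  inequality for \<open>d_h(x\<^sub>0, _)\<close>. The metric \<open>h\<close> enters only through \<open>f\<close> and every integral is taken over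
  the volume of \<open>g\<close>, which is why the constant does not see \<open>h\<close>.

  A Poincare inequality controls the mean. In a cube inside a chart, a point is moved to another one by
  changing one coordinate at a time; averaging over both points bounds the double integral of \<open>d_h\<close> by
  the integral of \<open>f\<close> (\<open>poincare_cube\<close>, \<open>cube_chart_good\<close>). Such estimates are chained through
  overlapping open sets (\<open>good_pair_trans\<close>), and connectedness and compactness spread them over \<open>M\<close>
  (\<open>good_all\<close>). Hence some base point \<open>x\<^sub>0\<close> satisfies \<open>\<integral> d_h(x\<^sub>0, y) dy \<le> C \<integral> f \<le> C' B\<close> (\<open>base_point\<close>).

  A Sobolev inequality improves the integrability. The \<open>W^{1,1}\<close> inequality of Gagliardo and Nirenberg
  on the unit cube (\<open>sobolev_cube\<close>) only looks at oscillations along coordinate lines. It therefore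
  applies to a power \<open>u^\<gamma>\<close> of \<open>u = d_h(x\<^sub>0, _) + B\<close>, which has the upper gradient \<open>\<gamma> u^(\<gamma>-1) f\<close>
  (\<open>powr_upper_gradient\<close>); the summand \<open>B\<close> keeps \<open>u\<close> away from \<open>0\<close>. Adding up finitely many cubes gives
  \<open>\<integral> u^(\<gamma>e) \<le> K (\<integral> u^\<gamma> + u^(\<gamma>-1) f)^e\<close> with \<open>e = n/(n-1)\<close> (\<open>sobolev\<close>). For \<open>r = max q e\<close> and \<open>\<gamma> = r/e\<close>
  the condition \<open>q < n p/(n-p)\<close> yields \<open>r \<le> p (r-\<gamma>+1)\<close> (\<open>sobolev_exponent\<close>), which is what Young's
  inequality needs in order to bound \<open>u^(\<gamma>-1) f\<close> by \<open>u^r\<close> and \<open>f^p\<close>. Interpolating \<open>u^\<gamma>\<close> between \<open>u\<close> and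
  \<open>u^r\<close> and absorbing leaves \<open>\<parallel>u\<parallel>_r \<le> C B\<close> (\<open>sobolev_absorb\<close>), with a constant that involves neither \<open>p\<close>
  nor \<open>h\<close>. Finally \<open>d_h(x, y) \<le> u x + u y\<close>, and the volume of \<open>g \<oplus> g\<close> is the product measure
  (\<open>riemannian_volume_prod\<close>), so the \<open>L^q\<close> norm of \<open>d_h\<close> is bounded as well.

  Only upper bounds for \<open>d_h\<close> matter. So \<open>d_h\<close> is replaced throughout by a larger function \<open>sym_dist\<close>,
  the symmetrised infimum of lengths over curves of integrable speed, for which the triangle inequality,
  symmetry and continuity are easy to obtain.
\<close>

section \<open>Positive definite matrices and tensor contractions\<close>

lemma quad_form_sum:
  fixes A :: "real^'n^'n"
  shows "x \<bullet> (A *v y) = (\<Sum>i\<in>UNIV. \<Sum>j\<in>UNIV. x$i * A$i$j * y$j)"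
  by (simp add: inner_vec_def matrix_vector_mult_def sum_distrib_left mult.assoc)

text \<open>Semidefiniteness is enough: the quadratic form of \<open>P\<close> is nonnegative on all combinations of \<open>x\<close>
  and \<open>y\<close>, and when it vanishes at \<open>x\<close> it must be affine and bounded below along the line \<open>y + s x\<close>.\<close>

lemma psd_cauchy_schwarz_entry:
  fixes P :: "real^'n^'n"
  assumes sym: "transpose P = P" and psd: "\<And>v. 0 \<le> v \<bullet> (P *v v)"
  shows "(x \<bullet> (P *v y))\<^sup>2 \<le> (x \<bullet> (P *v x)) * (y \<bullet> (P *v y))"
proof -
  let ?a = "x \<bullet> (P *v x)" and ?b = "x \<bullet> (P *v y)" and ?c = "y \<bullet> (P *v y)"
  have yx: "y \<bullet> (P *v x) = ?b"
    by (metis sym dot_lmul_matrix inner_commute transpose_matrix_vector)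
  have expand: "0 \<le> s^2 * ?a + 2 * s * t * ?b + t^2 * ?c" for s t
  proof -
    have "(s *\<^sub>R x + t *\<^sub>R y) \<bullet> (P *v (s *\<^sub>R x + t *\<^sub>R y)) = s^2 * ?a + 2 * s * t * ?b + t^2 * ?c"
      by (simp add: matrix_vector_right_distrib matrix_vector_mult_scaleR inner_add_left inner_add_right yx power2_eq_square algebra_simps)
    then show ?thesis using psd[of "s *\<^sub>R x + t *\<^sub>R y"] by simp
  qed
  show ?thesis
  proof (cases "?a = 0")
    case True
    have "?b = 0"
    proof (rule ccontr)
      assume b: "?b \<noteq> 0"
      \<comment> \<open>The parameter is chosen such that the form takes the value \<open>-1\<close>.\<close>
      have "0 \<le> 2 * (- (?c + 1) / (2 * ?b)) * ?b + ?c"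
        using expand[of "- (?c + 1) / (2 * ?b)" 1] True by simp
      then show False using b by (simp add: field_simps)
    qed
    then show ?thesis using True by simp
  next
    case False
    then have a: "?a > 0" using psd[of x] by simp
    have "0 \<le> ?b^2 * ?a + 2 * (- ?b) * ?a * ?b + ?a^2 * ?c"
      using expand[of "- ?b" "?a"] by simp
    also have "\<dots> = ?a * (?a * ?c - ?b^2)" by (simp add: power2_eq_square algebra_simps)
    finally show ?thesis using a by (simp add: zero_le_mult_iff)
  qed
qed

text \<open>Symmetric Gaussian elimination. It replaces a square root or an orthonormal basis: a matrix in this
  form behaves like \<open>\<Sum> v v\<^sup>T\<close> for a frame of vectors \<open>v\<close>.\<close>

lemma psd_sum_rank_one:
  fixes P :: "real^'n^'n"
  assumes "transpose P = P" and "\<And>v. 0 \<le> v \<bullet> (P *v v)"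
  shows "\<exists>V :: (real^'n) list. \<forall>i j. P$i$j = (\<Sum>v\<leftarrow>V. v$i * v$j)"
  using assms
proof (induction "card {a. P$a$a \<noteq> 0}" arbitrary: P rule: less_induct)
  case less
  note sym = less.prems(1) and psd = less.prems(2)
  have entry: "axis i 1 \<bullet> (P *v axis j 1) = P$i$j" for i j
    by (simp add: matrix_vector_mul_component inner_axis' inner_axis)
  have symc: "P$i$j = P$j$i" for i j
    using sym by (metis transpose_def vec_lambda_beta)
  have zero: "P$i$j = 0" if "P$i$i = 0" for i j
    using psd_cauchy_schwarz_entry[OF sym psd, of "axis i 1" "axis j 1"] that by (simp add: entry)
  show ?case
  proof (cases "\<exists>a. P$a$a \<noteq> 0")
    case False
    then have "\<forall>i j. P$i$j = (\<Sum>v\<leftarrow>[]. v$i * v$j)" using zero by simp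
    then show ?thesis by blast
  next
    case True
    then obtain a where a: "P$a$a \<noteq> 0" by blast
    then have apos: "P$a$a > 0" using psd[of "axis a 1"] entry[of a a] by simp
    define c where "c = column a P"
    have c: "c$i = P$i$a" for i by (simp add: c_def column_def)
    \<comment> \<open>Subtracting the rank one matrix of column \<open>a\<close> clears the diagonal entry \<open>a\<close>; zero diagonal entries stay zero.\<close>
    define P' :: "real^'n^'n" where "P' = (\<chi> i j. P$i$j - c$i * c$j / P$a$a)"
    have P'c: "P'$i$j = P$i$j - c$i * c$j / P$a$a" for i j by (simp add: P'_def)
    have cv: "v \<bullet> (P *v axis a 1) = c \<bullet> v" for v
      by (simp add: c_def matrix_vector_mul_component inner_commute matrix_vector_mult_basis)
    have q: "v \<bullet> (P' *v v) = v \<bullet> (P *v v) - (c \<bullet> v)\<^sup>2 / P$a$a" for v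
    proof -
      have "v \<bullet> (P' *v v) = v \<bullet> (P *v v) - (\<Sum>i\<in>UNIV. \<Sum>j\<in>UNIV. (c$i * v$i) * (c$j * v$j) / P$a$a)"
        unfolding quad_form_sum by (simp add: P'c sum_subtractf [symmetric] algebra_simps)
      also have "(\<Sum>i\<in>UNIV. \<Sum>j\<in>UNIV. (c$i * v$i) * (c$j * v$j) / P$a$a) = (c \<bullet> v)\<^sup>2 / P$a$a"
        by (simp add: inner_vec_def power2_eq_square sum_product sum_divide_distrib)
      finally show ?thesis .
    qed
    have psd': "0 \<le> v \<bullet> (P' *v v)" for v
      using psd_cauchy_schwarz_entry[OF sym psd, of v "axis a 1"] apos
      by (simp add: q cv inner_axis c field_simps)
    have sym': "transpose P' = P'"
      by (simp add: vec_eq_iff transpose_def P'c symc mult.commute)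
    have "{b. P'$b$b \<noteq> 0} \<subset> {b. P$b$b \<noteq> 0}"
    proof
      show "{b. P'$b$b \<noteq> 0} \<subseteq> {b. P$b$b \<noteq> 0}" using zero by (auto simp: P'c c)
      have "P'$a$a = 0" using a by (simp add: P'c c)
      then show "{b. P'$b$b \<noteq> 0} \<noteq> {b. P$b$b \<noteq> 0}" using a by blast
    qed
    then have "card {b. P'$b$b \<noteq> 0} < card {b. P$b$b \<noteq> 0}" by (simp add: psubset_card_mono)
    from less.hyps[OF this sym' psd'] obtain V :: "(real^'n) list"
      where V: "\<And>i j. P'$i$j = (\<Sum>v\<leftarrow>V. v$i * v$j)" by blast
    have "P$i$j = (\<Sum>v\<leftarrow>((1 / sqrt (P$a$a)) *\<^sub>R c) # V. v$i * v$j)" for i j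
      using V[of i j, symmetric] apos by (simp add: P'c field_simps)
    then show ?thesis by blast
  qed
qed

definition contraction2 :: "real^'n^'n \<Rightarrow> real^'n^'n \<Rightarrow> real" where
  "contraction2 G H = (\<Sum>i\<in>UNIV. \<Sum>j\<in>UNIV. \<Sum>k\<in>UNIV. \<Sum>l\<in>UNIV.
           G $ i $ k * G $ j $ l * H $ i $ j * H $ k $ l)"

lemma contraction2_eq_trace: 
  "contraction2 G H = trace (transpose G ** H ** G ** transpose H)"
proof -
  have "trace (transpose G ** H ** G ** transpose H) =
    (\<Sum>k\<in>UNIV. \<Sum>l\<in>UNIV. \<Sum>j\<in>UNIV. \<Sum>i\<in>UNIV. G$i$k * H$i$j * G$j$l * H$k$l)"
    by (simp add: trace_def matrix_matrix_mult_def transpose_def sum_distrib_right)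
  also have "\<dots> = (\<Sum>k\<in>UNIV. \<Sum>i\<in>UNIV. \<Sum>j\<in>UNIV.  \<Sum>l\<in>UNIV. G$i$k * H$i$j * G$j$l * H$k$l)"
    by (subst (2) sum.swap, subst (3) sum.swap, subst (2) sum.swap) (rule refl)
  also have "\<dots> = (\<Sum>i\<in>UNIV. \<Sum>j\<in>UNIV. \<Sum>k\<in>UNIV. \<Sum>l\<in>UNIV. G$i$k * H$i$j * G$j$l * H$k$l)"
    by (subst sum.swap, subst (2) sum.swap) (rule refl)
  finally show ?thesis by (simp add: contraction2_def mult_ac)
qed

text \<open>In a frame for \<open>G\<close>, the full contraction is the sum of squares of the entries of \<open>H\<close>.\<close>

lemma contraction2_rank_one:
  fixes G :: "real^'n^'n"
  assumes V: "\<And>i j. G$i$j = (\<Sum>v\<leftarrow>V. v$i * v$j)"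
  shows "contraction2 G H = (\<Sum>a\<leftarrow>V. \<Sum>b\<leftarrow>V. (a \<bullet> (H *v b))\<^sup>2)"
proof -
  have eq: "(\<Sum>v\<leftarrow>V. k v) = (\<Sum>i<length V. k (V!i))" for k :: "real^'n \<Rightarrow> real"
    by (simp add: sum_list_sum_nth atLeast0LessThan)
  let ?L = "{..<length V}"
  have "(\<Sum>a\<leftarrow>V. \<Sum>b\<leftarrow>V. (a \<bullet> (H *v b))\<^sup>2) = 
     (\<Sum>a\<in>?L. \<Sum>b\<in>?L. \<Sum>i\<in>UNIV. \<Sum>k\<in>UNIV. \<Sum>j\<in>UNIV. \<Sum>l\<in>UNIV. (V!a$i * H$i$j * V!b$j) * (V!a$k * H$k$l * V!b$l))"
    unfolding eq quad_form_sum power2_eq_square sum_product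
    by simp
  also have "\<dots> = (\<Sum>a\<in>?L. \<Sum>i\<in>UNIV. \<Sum>k\<in>UNIV. \<Sum>j\<in>UNIV. \<Sum>l\<in>UNIV. \<Sum>b\<in>?L. (V!a$i * H$i$j * V!b$j) * (V!a$k * H$k$l * V!b$l))"
    by (simp only: sum.swap[where A="?L" and B = "UNIV::'n set"])
  also have "\<dots> = (\<Sum>i\<in>UNIV. \<Sum>k\<in>UNIV. \<Sum>j\<in>UNIV. \<Sum>l\<in>UNIV. \<Sum>a\<in>?L. \<Sum>b\<in>?L. (V!a$i * H$i$j * V!b$j) * (V!a$k * H$k$l * V!b$l))"
    by (simp only: sum.swap[where A="?L" and B = "UNIV::'n set"])
  also have "\<dots> = (\<Sum>i\<in>UNIV. \<Sum>k\<in>UNIV. \<Sum>j\<in>UNIV. \<Sum>l\<in>UNIV. G$i$k * G$j$l * H$i$j * H$k$l)"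
  proof -
    have "(\<Sum>a\<in>?L. \<Sum>b\<in>?L. (V!a$i * H$i$j * V!b$j) * (V!a$k * H$k$l * V!b$l)) = G$i$k * G$j$l * H$i$j * H$k$l" for i j k l
      unfolding V eq by (simp add: sum_distrib_left sum_distrib_right mult_ac, subst sum.swap, simp add: mult_ac)
    then show ?thesis by simp
  qed
  also have "\<dots> = contraction2 G H"
    unfolding contraction2_def by (subst (2) sum.swap) (rule refl)
  finally show ?thesis by simp
qed

definition posdef :: "real^'n^'n \<Rightarrow> bool" where
  "posdef A \<longleftrightarrow> transpose A = A \<and> (\<forall>v. v \<noteq> 0 \<longrightarrow> 0 < v \<bullet> (A *v v))"

lemma posdef_invertible: "posdef A \<Longrightarrow> invertible A"
  unfolding posdef_def by (metis inner_zero_right invertible_left_inverse less_irrefl matrix_left_invertible_ker)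

lemma posdef_nonneg: "posdef A \<Longrightarrow> 0 \<le> v \<bullet> (A *v v)"
  unfolding posdef_def by (cases "v = 0") (auto intro: less_imp_le)

lemma matrix_inv_mult:
  assumes "invertible (A :: real^'n^'n)"
  shows "matrix_inv A ** A = mat 1" "A ** matrix_inv A = mat 1"
proof -
  have "\<exists>B. A ** B = mat 1 \<and> B ** A = mat 1" using assms by (simp add: invertible_def)
  then show "matrix_inv A ** A = mat 1" "A ** matrix_inv A = mat 1"
    unfolding matrix_inv_def by (rule someI2_ex; blast)+
qed

lemma posdef_inv:
  assumes A: "posdef (A :: real^'n^'n)"
  shows "posdef (matrix_inv A)"
proof -
  note inv = matrix_inv_mult[OF posdef_invertible[OF A]]
  have symA: "transpose A = A" using A by (simp add: posdef_def)
  have 1: "transpose (matrix_inv A) ** A = mat 1"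
    using arg_cong[OF inv(2), of transpose] by (simp add: matrix_transpose_mul symA)
  have "transpose (matrix_inv A) = transpose (matrix_inv A) ** (A ** matrix_inv A)" by (simp add: inv)
  also have "\<dots> = matrix_inv A" by (simp add: matrix_mul_assoc 1)
  finally have sym: "transpose (matrix_inv A) = matrix_inv A" .
  have "0 < v \<bullet> (matrix_inv A *v v)" if "v \<noteq> 0" for v
  proof -
    let ?w = "matrix_inv A *v v"
    have v: "A *v ?w = v" by (simp add: matrix_vector_mul_assoc inv)
    then have "?w \<noteq> 0" using that by auto
    then have "0 < ?w \<bullet> (A *v ?w)" using A by (simp add: posdef_def)
    then show ?thesis by (simp add: v inner_commute)
  qed
  then show ?thesis using sym by (simp add: posdef_def)
qed

text \<open>The determinant does not vanish on the segment from the identity matrix to \<open>A\<close>, because the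
  positive definite matrices form a convex set.\<close>

lemma posdef_det_pos:
  assumes A: "posdef (A :: real^'n^'n)"
  shows "0 < det A"
proof (rule ccontr)
  assume "\<not> 0 < det A"
  define \<phi> where "\<phi> t = det ((1 - t) *\<^sub>R mat 1 + t *\<^sub>R A)" for t :: real
  have cont: "continuous_on {0..1} \<phi>"
    unfolding \<phi>_def det_def by (simp, intro continuous_intros)
  have "\<phi> 1 \<le> 0" "0 \<le> \<phi> 0" using \<open>\<not> 0 < det A\<close> by (simp_all add: \<phi>_def)
  with IVT2'[OF _ _ _ cont, of 0] obtain t where t: "0 \<le> t" "t \<le> 1" "\<phi> t = 0" by auto
  have "posdef ((1 - t) *\<^sub>R mat 1 + t *\<^sub>R A)"
  proof -
    have s: "transpose ((1 - t) *\<^sub>R mat 1 + t *\<^sub>R A) = (1 - t) *\<^sub>R mat 1 + t *\<^sub>R A"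
      using A by (simp add: posdef_def transpose_def vec_eq_iff mat_def)
    have "v \<bullet> (((1 - t) *\<^sub>R mat 1 + t *\<^sub>R A) *v v) = (1-t) * (v \<bullet> v) + t * (v \<bullet> (A *v v))" for v
      by (simp add: matrix_vector_mult_add_rdistrib scaleR_matrix_vector_assoc[symmetric] inner_add_right)
    moreover have "0 < (1-t) * (v \<bullet> v) + t * (v \<bullet> (A *v v))" if "v \<noteq> 0" for v
    proof (cases "t = 0")
      case True then show ?thesis using that by simp
    next
      case False
      then have "0 < t * (v \<bullet> (A *v v))" using t A that by (simp add: posdef_def)
      moreover have "0 \<le> (1-t) * (v \<bullet> v)" using t by simp
      ultimately show ?thesis by simp
    qed
    ultimately show ?thesis using s by (simp add: posdef_def)
  qed
  then have "det ((1 - t) *\<^sub>R mat 1 + t *\<^sub>R A) \<noteq> 0"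
    using posdef_invertible invertible_det_nz by blast
  then show False using t by (simp add: \<phi>_def)
qed

text \<open>\<open>h(w, w) \<le> |h|_g g(w, w)\<close>, the pointwise inequality on which everything rests. If
  \<open>g\<^sup>-\<^sup>1 = \<Sum> v v\<^sup>T\<close>, then \<open>w = \<Sum> c_v v\<close> with \<open>c_v = g(v, w)\<close> and \<open>\<Sum> c_v\<^sup>2 = g(w, w)\<close>, so that
  \<open>h(w, w) = \<Sum> c_v c_v' h(v, v')\<close> is estimated by the Cauchy-Schwarz inequality over pairs \<open>(v, v')\<close>.\<close>

lemma quad_form_le_contraction2:
  fixes g H :: "real^'n^'n"
  assumes g: "posdef g"
  shows "w \<bullet> (H *v w) \<le> sqrt (contraction2 (matrix_inv g) H) * (w \<bullet> (g *v w))"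
proof -
  let ?G = "matrix_inv g"
  note G = posdef_inv[OF g]
  note inv = matrix_inv_mult[OF posdef_invertible[OF g]]
  obtain V :: "(real^'n) list" where V: "\<And>i j. ?G$i$j = (\<Sum>v\<leftarrow>V. v$i * v$j)"
    using psd_sum_rank_one[of ?G] G posdef_nonneg[OF G] unfolding posdef_def by blast
  have eq: "(\<Sum>v\<leftarrow>V. k v) = (\<Sum>i<length V. k (V!i))" for k :: "real^'n \<Rightarrow> real"
    by (simp add: sum_list_sum_nth atLeast0LessThan)
  define c where "c a = V!a \<bullet> (g *v w)" for a
  let ?L = "{..<length V}"
  have Gu: "?G *v u = (\<Sum>a\<in>?L. (V!a \<bullet> u) *\<^sub>R V!a)" for u
  proof -
    have "(?G *v u) $ i = (\<Sum>a\<in>?L. (V!a \<bullet> u) *\<^sub>R V!a) $ i" for i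
      unfolding matrix_vector_mult_def V eq 
      by (simp add: inner_vec_def sum_distrib_right sum_distrib_left mult_ac, subst sum.swap) (rule refl)
    then show ?thesis by (simp add: vec_eq_iff)
  qed
  have w: "w = (\<Sum>a\<in>?L. c a *\<^sub>R V!a)"
    using Gu[of "g *v w"] by (simp add: matrix_vector_mul_assoc inv c_def)
  have wg: "w \<bullet> (g *v w) = (\<Sum>a\<in>?L. (c a)\<^sup>2)"
  proof -
    have "w \<bullet> (g *v w) = (\<Sum>a\<in>?L. c a *\<^sub>R V!a) \<bullet> (g *v w)" using w by simp
    then show ?thesis by (simp add: inner_sum_left c_def power2_eq_square)
  qed
  have "w \<bullet> (H *v w) = (\<Sum>a\<in>?L. c a *\<^sub>R V!a) \<bullet> (H *v (\<Sum>b\<in>?L. c b *\<^sub>R V!b))"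
    using w by simp
  also have "\<dots> = (\<Sum>a\<in>?L. \<Sum>b\<in>?L. (c a * c b) * (V!a \<bullet> (H *v V!b)))"
    unfolding linear_sum[OF matrix_vector_mul_linear] unfolding inner_sum_left unfolding inner_sum_right
    by (simp add: matrix_vector_mult_scaleR mult_ac)
  also have "\<dots> = (\<Sum>(a,b)\<in>?L\<times>?L. (c a * c b) * (V!a \<bullet> (H *v V!b)))"
    by (simp add: sum.cartesian_product)
  also have "\<dots> \<le> sqrt ((\<Sum>(a,b)\<in>?L\<times>?L. (c a * c b)\<^sup>2) * (\<Sum>(a,b)\<in>?L\<times>?L. (V!a \<bullet> (H *v V!b))\<^sup>2))"
    using Cauchy_Schwarz_ineq_sum[of "\<lambda>(a,b). c a * c b" "\<lambda>(a,b). V!a \<bullet> (H *v V!b)" "?L\<times>?L"]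
    by (intro real_le_rsqrt) (simp add: case_prod_unfold)
  also have "(\<Sum>(a,b)\<in>?L\<times>?L. (c a * c b)\<^sup>2) = (w \<bullet> (g *v w))\<^sup>2"
    by (simp add: wg power2_eq_square sum_product sum.cartesian_product mult_ac)
  also have "(\<Sum>(a,b)\<in>?L\<times>?L. (V!a \<bullet> (H *v V!b))\<^sup>2) = contraction2 ?G H"
    by (simp add: contraction2_rank_one[OF V] eq sum.cartesian_product)
  finally show ?thesis using posdef_nonneg[OF g, of w] by (simp add: real_sqrt_mult mult.commute)
qed

lemma matrix_inv_unique_right:
  fixes A :: "real^'n^'n"
  assumes "A ** B = mat 1" shows "matrix_inv A = B"
proof -
  have "invertible A" using assms by (metis invertible_right_inverse)
  then show ?thesis by (metis assms matrix_inv_mult(1) matrix_mul_assoc matrix_mul_lid matrix_mul_rid)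
qed

text \<open>Independence of the tensor norm of the chart in which it is computed; \<open>J\<close> is the Jacobian of a
  transition map.\<close>

lemma contraction2_invariant:
  fixes J :: "real^'n^'n"
  assumes J: "invertible J" and g: "invertible g"
  shows "contraction2 (matrix_inv (transpose J ** g ** J)) (transpose J ** H ** J) = contraction2 (matrix_inv g) H"
proof -
  let ?G = "matrix_inv g" and ?I = "matrix_inv J"
  note Ji = matrix_inv_mult[OF J] and gi = matrix_inv_mult[OF g]
  have tJ: "transpose J ** transpose ?I = mat 1" "transpose ?I ** transpose J = mat 1"
    using Ji by (metis matrix_transpose_mul transpose_mat)+
  have "(transpose J ** g ** J) ** (?I ** ?G ** transpose ?I) = transpose J ** (g ** ((J ** ?I) ** ?G)) ** transpose ?I"
    by (simp add: matrix_mul_assoc)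
  also have "\<dots> = mat 1" by (simp add: Ji gi tJ)
  finally have G': "matrix_inv (transpose J ** g ** J) = ?I ** ?G ** transpose ?I"
    by (rule matrix_inv_unique_right)
  have "transpose (?I ** ?G ** transpose ?I) ** (transpose J ** H ** J) ** (?I ** ?G ** transpose ?I) ** transpose (transpose J ** H ** J)
     = ?I ** transpose ?G ** (transpose ?I ** transpose J) ** H ** (J ** ?I) ** ?G ** (transpose ?I ** transpose J) ** transpose H ** J"
    by (simp add: matrix_transpose_mul matrix_mul_assoc)
  also have "\<dots> = ?I ** (transpose ?G ** H ** ?G ** transpose H ** J)"
    by (simp add: Ji tJ matrix_mul_assoc)
  finally have "contraction2 (matrix_inv (transpose J ** g ** J)) (transpose J ** H ** J) 
      = trace (?I ** (transpose ?G ** H ** ?G ** transpose H ** J))"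
    unfolding contraction2_eq_trace G' by simp
  also have "\<dots> = trace ((transpose ?G ** H ** ?G ** transpose H ** J) ** ?I)" by (rule trace_mul_sym)
  also have "\<dots> = trace (transpose ?G ** H ** ?G ** transpose H)"
    by (simp add: matrix_mul_assoc[symmetric] Ji)
  finally show ?thesis by (simp add: contraction2_eq_trace)
qed

section \<open>Change of variables for finite index types\<close>

text \<open>\<open>A\<close> acting on the coordinates in the range of \<open>\<iota>\<close> and the identity on the others. It serves twice: to
  transport determinants along bijections of index types, and to compute block determinants.\<close>

definition pad_matrix :: "('n \<Rightarrow> 'm) \<Rightarrow> real^'n^'n \<Rightarrow> real^'m^'m" where
  "pad_matrix \<iota> A = (\<chi> i j. if i \<in> range \<iota> \<and> j \<in> range \<iota> then A $ inv \<iota> i $ inv \<iota> j else of_bool (i = j))"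

lemma pad_matrix_range: "inj \<iota> \<Longrightarrow> pad_matrix \<iota> A $ \<iota> i $ \<iota> j = A $ i $ j"
  by (simp add: pad_matrix_def)

lemma pad_matrix_mult:
  fixes \<iota> :: "'n::finite \<Rightarrow> 'm::finite"
  assumes "inj \<iota>"
  shows "pad_matrix \<iota> (A ** B) = pad_matrix \<iota> A ** pad_matrix \<iota> B"
proof -
  have "(pad_matrix \<iota> A ** pad_matrix \<iota> B) $ i $ j = pad_matrix \<iota> (A ** B) $ i $ j" for i j
  proof -
    have "(pad_matrix \<iota> A ** pad_matrix \<iota> B) $ i $ j = (\<Sum>k\<in>UNIV. pad_matrix \<iota> A $ i $ k * pad_matrix \<iota> B $ k $ j)"
      by (simp add: matrix_matrix_mult_def)
    also have "\<dots> = (\<Sum>k\<in>range \<iota>. pad_matrix \<iota> A $ i $ k * pad_matrix \<iota> B $ k $ j) 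
        + (\<Sum>k\<in>- range \<iota>. pad_matrix \<iota> A $ i $ k * pad_matrix \<iota> B $ k $ j)"
      by (subst sum.subset_diff[of "range \<iota>"]) (simp_all add: Compl_eq_Diff_UNIV add.commute)
    also have "(\<Sum>k\<in>range \<iota>. pad_matrix \<iota> A $ i $ k * pad_matrix \<iota> B $ k $ j) =
       (\<Sum>k\<in>UNIV. pad_matrix \<iota> A $ i $ \<iota> k * pad_matrix \<iota> B $ \<iota> k $ j)"
      using assms by (simp add: sum.reindex)
    also have "\<dots> = (if i \<in> range \<iota> \<and> j \<in> range \<iota> then (A ** B) $ inv \<iota> i $ inv \<iota> j else 0)"
      using assms by (auto simp: pad_matrix_def matrix_matrix_mult_def intro!: sum.neutral)
    also have "(\<Sum>k\<in>- range \<iota>. pad_matrix \<iota> A $ i $ k * pad_matrix \<iota> B $ k $ j)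
       = (\<Sum>k\<in>- range \<iota>. if k = i then of_bool (i = j) else 0)"
      by (intro sum.cong) (auto simp: pad_matrix_def)
    also have "\<dots> = (if i \<in> range \<iota> then 0 else of_bool (i = j))" by (subst sum.delta) auto
    finally show ?thesis by (auto simp: pad_matrix_def)
  qed
  then show ?thesis by (simp add: vec_eq_iff)
qed

text \<open>Padding is multiplicative, so it suffices to look at elementary matrices.\<close>

lemma det_pad_matrix:
  fixes \<iota> :: "'n::finite \<Rightarrow> 'm::finite" and A :: "real^'n^'n"
  assumes inj: "inj \<iota>"
  shows "det (pad_matrix \<iota> A) = det A"
proof (induction A rule: induct_matrix_elementary)
  case (1 A B)
  then show ?case using inj by (simp add: pad_matrix_mult det_mul)
next
  case zero_row: (2 A i)
  have "row (\<iota> i) (pad_matrix \<iota> A) = 0"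
    using zero_row inj by (auto simp: row_def vec_eq_iff pad_matrix_def)
  then show ?case using zero_row by (metis det_zero_row(2))
next
  case diagonal: (3 A)
  have "det (pad_matrix \<iota> A) = (\<Prod>i\<in>UNIV. pad_matrix \<iota> A $ i $ i)"
    using inj by (intro det_diagonal) (auto simp: pad_matrix_def intro!: diagonal)
  also have "\<dots> = (\<Prod>i\<in>range \<iota>. pad_matrix \<iota> A $ i $ i)"
    by (rule prod.mono_neutral_right) (auto simp: pad_matrix_def)
  also have "\<dots> = (\<Prod>i\<in>UNIV. A $ i $ i)"
    using inj by (simp add: prod.reindex pad_matrix_range)
  also have "\<dots> = det A" by (rule det_diagonal[symmetric]) (use diagonal in auto)
  finally show ?case .
next
  case swap1: (4 m n)
  have "pad_matrix \<iota> (\<chi> i j. mat 1 $ i $ Transposition.transpose m n j) =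
      (\<chi> i j. mat 1 $ i $ Transposition.transpose (\<iota> m) (\<iota> n) j)"
    using inj by (auto simp: pad_matrix_def vec_eq_iff mat_def Transposition.transpose_def inj_eq)
  then show ?case
    using swap1 inj by (simp add: det_permute_columns permutes_swap_id sign_swap_id inj_eq)
next
  case idplus: (5 m n c)
  have elem: "det (\<chi> i j. if i = m \<and> j = n then c else of_bool (i = j)) = (1::real)" if "m \<noteq> n" for m n :: "'k::finite"
  proof -
    have "(\<chi> i j. if i = m \<and> j = n then c else of_bool (i = j)) =
      (\<chi> k. if k = m then row m (mat 1) + c *s row n (mat 1) else row k (mat 1 :: real^'k^'k))"
      using that by (auto simp: vec_eq_iff row_def mat_def)
    then show ?thesis using det_row_operation[OF that, of "mat 1 :: real^'k^'k" c] by simp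
  qed
  have "pad_matrix \<iota> (\<chi> i j. if i = m \<and> j = n then c else of_bool (i = j)) = 
     (\<chi> i j. if i = \<iota> m \<and> j = \<iota> n then c else of_bool (i = j))"
    using inj idplus by (auto simp: pad_matrix_def vec_eq_iff inj_eq)
  then show ?case using elem[OF idplus] elem[of "\<iota> m" "\<iota> n"] idplus inj by (simp add: inj_eq)
qed

lemma emeasure_lborel_box_vec:
  fixes l u :: "real^'n"
  assumes "\<And>i. l $ i \<le> u $ i"
  shows "emeasure lborel (box l u) = (\<Prod>i\<in>UNIV. ennreal (u $ i - l $ i))"
proof -
  have "emeasure lborel (box l u) = (\<Prod>b\<in>(Basis :: (real^'n) set). (u - l) \<bullet> b)"
    using assms by (intro emeasure_lborel_box) (auto simp: Basis_vec_def inner_axis)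
  also have "(\<Prod>b\<in>(Basis :: (real^'n) set). (u - l) \<bullet> b) = (\<Prod>i\<in>UNIV. u $ i - l $ i)"
    unfolding Basis_vec_def by (subst prod.UNION_disjoint) (auto simp: inner_axis axis_eq_axis)
  finally show ?thesis using assms by (simp add: prod_ennreal)
qed

lemma lborel_vec_eqI:
  fixes M :: "(real^'n) measure"
  assumes "\<And>l u. (\<And>i. l $ i \<le> u $ i) \<Longrightarrow> emeasure M (box l u) = (\<Prod>i\<in>UNIV. ennreal (u $ i - l $ i))"
    and "sets M = sets borel"
  shows "lborel = M"
proof (rule lborel_eqI)
  fix l u :: "real^'n" assume b: "\<And>b. b \<in> Basis \<Longrightarrow> l \<bullet> b \<le> u \<bullet> b"
  have le: "l $ i \<le> u $ i" for i using b[of "axis i 1"] by (simp add: inner_axis)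
  then show "emeasure M (box l u) = ennreal (\<Prod>b\<in>Basis. (u - l) \<bullet> b)"
    using assms(1)[of l u] emeasure_lborel_box_vec[of l u] emeasure_lborel_box[of l u, OF b] by simp
qed (simp add: assms)

definition reindex :: "('m \<Rightarrow> 'n) \<Rightarrow> real^'n \<Rightarrow> real^'m" where
  "reindex \<sigma> v = (\<chi> k. v $ \<sigma> k)"

lemma linear_reindex: "linear (reindex \<sigma>)"
  by (rule linearI) (simp_all add: reindex_def vec_eq_iff)

lemma continuous_reindex: "continuous_on S (reindex (\<sigma> :: 'm::finite \<Rightarrow> 'n::finite))"
  unfolding reindex_def by (intro continuous_intros)

lemma borel_measurable_reindex[measurable]:
  "reindex (\<sigma> :: 'm::finite \<Rightarrow> 'n::finite) \<in> borel_measurable borel"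
  by (intro borel_measurable_continuous_onI continuous_reindex)

lemma distr_reindex:
  fixes \<sigma> :: "'m::finite \<Rightarrow> 'n::finite"
  assumes "bij \<sigma>"
  shows "distr lborel borel (reindex \<sigma>) = lborel"
proof (rule lborel_vec_eqI[symmetric])
  fix l u :: "real^'m" assume le: "\<And>i. l $ i \<le> u $ i"
  have "reindex \<sigma> -` box l u = box (reindex (inv \<sigma>) l) (reindex (inv \<sigma>) u)"
  proof -
    have "(\<forall>i. l $ i < v $ \<sigma> i \<and> v $ \<sigma> i < u $ i) \<longleftrightarrow> (\<forall>j. l $ inv \<sigma> j < v $ j \<and> v $ j < u $ inv \<sigma> j)" for v :: "real^'n"
      by (metis assms bij_inv_eq_iff)
    then show ?thesis by (auto simp: mem_box_cart reindex_def)
  qed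
  then have "emeasure (distr lborel borel (reindex \<sigma>)) (box l u) = emeasure lborel (box (reindex (inv \<sigma>) l) (reindex (inv \<sigma>) u))"
    by (subst emeasure_distr) auto
  also have "\<dots> = (\<Prod>j\<in>UNIV. ennreal (u $ inv \<sigma> j - l $ inv \<sigma> j))"
    using le by (subst emeasure_lborel_box_vec) (auto simp: reindex_def)
  also have "\<dots> = (\<Prod>i\<in>UNIV. ennreal (u $ i - l $ i))"
    by (rule prod.reindex_bij_betw) (use assms bij_imp_bij_inv in blast)
  finally show "emeasure (distr lborel borel (reindex \<sigma>)) (box l u) = (\<Prod>i\<in>UNIV. ennreal (u $ i - l $ i))" .
qed simp

text \<open>A copy of a finite type, well-ordered by an injection into the natural numbers. The change of
  variables formula \<open>has_absolute_integral_change_of_variables\<close> is about well-ordered index types; through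
  this copy it becomes available for \<open>real^'n\<close> with an arbitrary finite index type.\<close>

typedef 'a indexed = "UNIV :: 'a set" by simp

instance indexed :: (finite) finite
proof
  have "(UNIV :: 'a indexed set) = Abs_indexed ` UNIV" by (metis Abs_indexed_cases surj_def)
  then show "finite (UNIV :: 'a indexed set)" by (metis finite finite_imageI)
qed

definition index_rank :: "'a::finite \<Rightarrow> nat" where
  "index_rank = (SOME f. inj f)"

lemma inj_index_rank: "inj (index_rank :: 'a::finite \<Rightarrow> nat)"
proof -
  have "\<exists>f :: 'a \<Rightarrow> nat. inj f" using finite_imp_inj_to_nat_seg[of "UNIV :: 'a set"] by auto
  then show ?thesis unfolding index_rank_def by (rule someI_ex)
qed

instantiation indexed :: (finite) wellorder
begin

definition "x \<le> y \<longleftrightarrow> index_rank (Rep_indexed x) \<le> index_rank (Rep_indexed y)"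
definition "x < y \<longleftrightarrow> index_rank (Rep_indexed x) < index_rank (Rep_indexed y)"

instance
proof
  fix P :: "'a indexed \<Rightarrow> bool" and a :: "'a indexed"
  assume step: "\<And>x. (\<And>y. y < x \<Longrightarrow> P y) \<Longrightarrow> P x"
  show "P a"
    by (induction "index_rank (Rep_indexed a)" arbitrary: a rule: less_induct)
       (use step in \<open>auto simp: less_indexed_def\<close>)
qed (auto simp: less_eq_indexed_def less_indexed_def Rep_indexed_inject dest: injD[OF inj_index_rank])

end

text \<open>The Lebesgue integral version of \<open>has_absolute_integral_change_of_variables\<close>. An
  extended nonnegative integral is determined by the finite values it attains, and for a finite value
  being equal to it is the statement about the gauge integral.\<close>

lemma nn_integral_change_of_variables_wellorder:
  fixes g :: "real^'m::{finite,wellorder} \<Rightarrow> real^'m::_" and f :: "real^'m::_ \<Rightarrow> real"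
  assumes S: "S \<in> sets borel"
    and der: "\<And>x. x \<in> S \<Longrightarrow> (g has_derivative g' x) (at x)"
    and inj: "inj_on g S"
    and f0: "\<And>y. y \<in> g ` S \<Longrightarrow> 0 \<le> f y"
    and m1: "(\<lambda>y. f y * indicator (g ` S) y) \<in> borel_measurable borel"
    and m2: "(\<lambda>x. \<bar>det (matrix (g' x))\<bar> * f (g x) * indicator S x) \<in> borel_measurable borel"
  shows "(\<integral>\<^sup>+y. ennreal (f y * indicator (g ` S) y) \<partial>lborel) =
         (\<integral>\<^sup>+x. ennreal (\<bar>det (matrix (g' x))\<bar> * f (g x) * indicator S x) \<partial>lborel)"
proof -
  have *: "h absolutely_integrable_on T \<and> integral T h = b \<longleftrightarrow> (\<integral>\<^sup>+y. ennreal (h y * indicator T y) \<partial>lborel) = ennreal b"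
    if h0: "\<And>y. y \<in> T \<Longrightarrow> 0 \<le> h y" and m: "(\<lambda>y. h y * indicator T y) \<in> borel_measurable borel" and b: "0 \<le> b" 
    for h :: "real^'m::_ \<Rightarrow> real" and T b
  proof -
    have "h absolutely_integrable_on T \<and> integral T h = b \<longleftrightarrow> (h has_integral b) T"
      using h0 absolutely_integrable_on_iff_nonneg[of T h] by (auto simp: has_integral_iff)
    also have "\<dots> \<longleftrightarrow> ((\<lambda>y. h y * indicator T y) has_integral b) UNIV"
    proof -
      have "(\<lambda>y. h y * indicator T y) = (\<lambda>y. if y \<in> T then h y else 0)" by auto
      then show ?thesis using has_integral_restrict_UNIV[of T h b] by simp
    qed
    also have "\<dots> \<longleftrightarrow> (\<integral>\<^sup>+y. ennreal (h y * indicator T y) \<partial>lebesgue) = ennreal b"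
    proof -
      have "((\<lambda>y. h y * indicator T y) has_integral b) UNIV \<longleftrightarrow>
         (\<lambda>y. h y * indicator T y) \<in> borel_measurable lebesgue \<and> (\<integral>\<^sup>+y. ennreal (h y * indicator T y) \<partial>lebesgue) = ennreal b"
        using has_integral_iff_nn_integral_lebesgue[of "\<lambda>y. h y * indicator T y" b] h0 b
        by (auto simp: indicator_def)
      moreover have "(\<lambda>y. h y * indicator T y) \<in> borel_measurable lebesgue"
        using m by (simp add: measurable_completion)
      ultimately show ?thesis by simp
    qed
    finally show ?thesis by (simp add: nn_integral_completion)
  qed
  have Sl: "S \<in> sets lebesgue" using S by simp
  let ?F = "\<lambda>x. \<bar>det (matrix (g' x))\<bar> * f (g x)"
  have cov: "?F absolutely_integrable_on S \<and> integral S ?F = b \<longleftrightarrow> f absolutely_integrable_on (g ` S) \<and> integral (g ` S) f = b" for b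
  proof -
    have "(\<lambda>x. \<bar>det (matrix (g' x))\<bar> *\<^sub>R (vec (f (g x)) :: real^1)) absolutely_integrable_on S \<and>
           integral S (\<lambda>x. \<bar>det (matrix (g' x))\<bar> *\<^sub>R (vec (f (g x)) :: real^1)) = (vec b :: real ^ 1)
         \<longleftrightarrow> (\<lambda>x. vec (f x) :: real ^ 1) absolutely_integrable_on (g ` S) \<and>
           integral (g ` S) (\<lambda>x. vec (f x)) = (vec b :: real ^ 1)"
      using der by (intro has_absolute_integral_change_of_variables Sl inj) (auto intro: has_derivative_at_withinI)
    then show ?thesis by (simp add: absolutely_integrable_on_1_iff integral_on_1_eq)
  qed
  have both: "(\<integral>\<^sup>+y. ennreal (f y * indicator (g ` S) y) \<partial>lborel) = ennreal b \<longleftrightarrow>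
         (\<integral>\<^sup>+x. ennreal (?F x * indicator S x) \<partial>lborel) = ennreal b" if "0 \<le> b" for b
    using *[of "g ` S" f b] *[of S ?F b] cov[of b] that f0 m1 m2 by simp
  show ?thesis
  proof (cases "\<integral>\<^sup>+y. ennreal (f y * indicator (g ` S) y) \<partial>lborel")
    case (real b)
    then show ?thesis using both[of b] by simp
  next
    case top
    then show ?thesis using both by (cases "\<integral>\<^sup>+x. ennreal (?F x * indicator S x) \<partial>lborel") auto
  qed
qed

text \<open>Conjugation by the coordinate permutation \<open>real^'n \<rightarrow> real^'n indexed\<close>, which preserves both
  Lebesgue measure and determinants.\<close>

lemma nn_integral_change_of_variables:
  fixes g :: "real^'n::finite \<Rightarrow> real^'n" and f :: "real^'n \<Rightarrow> real"
  assumes S: "S \<in> sets borel"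
    and der: "\<And>x. x \<in> S \<Longrightarrow> (g has_derivative g' x) (at x)"
    and inj: "inj_on g S"
    and f0: "\<And>y. y \<in> g ` S \<Longrightarrow> 0 \<le> f y"
    and m1: "(\<lambda>y. f y * indicator (g ` S) y) \<in> borel_measurable borel"
    and m2: "(\<lambda>x. \<bar>det (matrix (g' x))\<bar> * f (g x) * indicator S x) \<in> borel_measurable borel"
  shows "(\<integral>\<^sup>+y. ennreal (f y * indicator (g ` S) y) \<partial>lborel) =
         (\<integral>\<^sup>+x. ennreal (\<bar>det (matrix (g' x))\<bar> * f (g x) * indicator S x) \<partial>lborel)"
proof -
  define L :: "real^'n \<Rightarrow> real^'n indexed" where "L = reindex Rep_indexed"
  define K :: "real^'n indexed \<Rightarrow> real^'n" where "K = reindex Abs_indexed"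
  have bA: "bij (Abs_indexed :: 'n \<Rightarrow> 'n indexed)"
    by (rule o_bij[of Rep_indexed]) (auto simp: Abs_indexed_inverse Rep_indexed_inverse)
  have LK[simp]: "L (K v) = v" and KL[simp]: "K (L w) = w" for v w
    by (simp_all add: L_def K_def reindex_def Abs_indexed_inverse Rep_indexed_inverse)
  have Km[measurable]: "K \<in> borel_measurable borel" by (simp add: K_def)
  have linK: "linear K" and linL: "linear L" by (simp_all add: K_def L_def linear_reindex)
  have transfer: "(\<integral>\<^sup>+y. \<phi> y \<partial>lborel) = (\<integral>\<^sup>+y. \<phi> (K y) \<partial>lborel)" if [measurable]: "\<phi> \<in> borel_measurable borel" for \<phi> :: "real^'n \<Rightarrow> ennreal"
  proof -
    have "(\<integral>\<^sup>+y. \<phi> y \<partial>lborel) = (\<integral>\<^sup>+y. \<phi> y \<partial>distr lborel borel K)"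
      using distr_reindex[OF bA] by (simp add: K_def)
    also have "\<dots> = (\<integral>\<^sup>+y. \<phi> (K y) \<partial>lborel)" by (rule nn_integral_distr) simp_all
    finally show ?thesis .
  qed
  define S' where "S' = K -` S"
  define h where "h = L \<circ> g \<circ> K"
  have S'b: "S' \<in> sets borel" unfolding S'_def using S measurable_sets[OF Km, of S] by simp
  have indS: "indicator S' x = (indicator S (K x) :: real)" for x by (simp add: S'_def indicator_def)
  have hS: "y \<in> h ` S' \<longleftrightarrow> K y \<in> g ` S" for y
  proof
    assume "y \<in> h ` S'" then show "K y \<in> g ` S" by (auto simp: h_def S'_def)
  next
    assume "K y \<in> g ` S"
    then obtain s where s: "s \<in> S" "K y = g s" by auto
    then have "y = h (L s)" by (metis KL LK comp_apply h_def)
    then show "y \<in> h ` S'" using s by (auto simp: S'_def)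
  qed
  have indh: "indicator (h ` S') y = (indicator (g ` S) (K y) :: real)" for y by (simp add: hS indicator_def)
  \<comment> \<open>The conjugated derivative is the padded matrix along a bijection.\<close>
  have dmat: "det (matrix (L \<circ> A \<circ> K)) = det (matrix A)" if "linear A" for A
  proof -
    have "matrix (L \<circ> A \<circ> K) $ i $ j = pad_matrix Abs_indexed (matrix A) $ i $ j" for i j
    proof -
      have "K (axis j 1) = axis (Rep_indexed j) 1"
        by (auto simp: K_def reindex_def vec_eq_iff axis_def Abs_indexed_inverse Rep_indexed_inverse)
      moreover have "inv Abs_indexed k = Rep_indexed k" for k :: "'n indexed"
        by (rule inv_f_eq[OF bij_is_inj[OF bA]]) (simp add: Rep_indexed_inverse)
      ultimately show ?thesis using bij_is_surj[OF bA]
        by (simp add: matrix_def pad_matrix_def L_def reindex_def)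
    qed
    then have "matrix (L \<circ> A \<circ> K) = pad_matrix Abs_indexed (matrix A)" by (simp add: vec_eq_iff)
    then show ?thesis using det_pad_matrix[OF bij_is_inj[OF bA]] by metis
  qed
  have dm: "det (matrix (L \<circ> g' (K x) \<circ> K)) = det (matrix (g' (K x)))" if "x \<in> S'" for x
    using der[of "K x"] that by (intro dmat has_derivative_linear) (auto simp: S'_def)
  have "(\<integral>\<^sup>+y. ennreal (f (K y) * indicator (h ` S') y) \<partial>lborel) =
         (\<integral>\<^sup>+x. ennreal (\<bar>det (matrix (L \<circ> g' (K x) \<circ> K))\<bar> * f (K (h x)) * indicator S' x) \<partial>lborel)"
  proof (rule nn_integral_change_of_variables_wellorder[OF S'b])
    show "(h has_derivative (L \<circ> g' (K x) \<circ> K)) (at x)" if "x \<in> S'" for x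
    proof -
      have 1: "(K has_derivative K) (at x)" using linK linear_imp_has_derivative by blast
      have 2: "(g has_derivative g' (K x)) (at (K x))" using der that by (simp add: S'_def)
      have 3: "(L has_derivative L) (at (g (K x)))" using linL linear_imp_has_derivative by blast
      show ?thesis unfolding h_def using diff_chain_at[OF diff_chain_at[OF 1 2], of L L] 3
        by (simp add: o_assoc)
    qed
    show "inj_on h S'"
      using inj unfolding h_def S'_def inj_on_def by (metis KL LK comp_apply vimage_eq)
    show "0 \<le> f (K y)" if "y \<in> h ` S'" for y using f0 hS that by blast
    have "(\<lambda>y. f (K y) * indicator (h ` S') y) = (\<lambda>y. f y * indicator (g ` S) y) \<circ> K" by (auto simp: indh)
    then show "(\<lambda>y. f (K y) * indicator (h ` S') y) \<in> borel_measurable borel"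
      using measurable_comp[OF Km m1] by simp
    have "(\<lambda>x. \<bar>det (matrix (L \<circ> g' (K x) \<circ> K))\<bar> * f (K (h x)) * indicator S' x) =
      (\<lambda>x. \<bar>det (matrix (g' x))\<bar> * f (g x) * indicator S x) \<circ> K"
      by (rule ext) (auto simp: dm h_def S'_def indicator_def)
    then show "(\<lambda>x. \<bar>det (matrix (L \<circ> g' (K x) \<circ> K))\<bar> * f (K (h x)) * indicator S' x) \<in> borel_measurable borel"
      using measurable_comp[OF Km m2] by simp
  qed
  also have "(\<integral>\<^sup>+x. ennreal (\<bar>det (matrix (L \<circ> g' (K x) \<circ> K))\<bar> * f (K (h x)) * indicator S' x) \<partial>lborel)
     = (\<integral>\<^sup>+x. ennreal (\<bar>det (matrix (g' (K x)))\<bar> * f (g (K x)) * indicator S (K x)) \<partial>lborel)"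
    by (intro nn_integral_cong arg_cong[where f=ennreal]) (auto simp: dm h_def S'_def indicator_def)
  finally show ?thesis
    using transfer[of "\<lambda>y. ennreal (f y * indicator (g ` S) y)"] 
      transfer[of "\<lambda>x. ennreal (\<bar>det (matrix (g' x))\<bar> * f (g x) * indicator S x)"] m1 m2
    by (simp add: indh)
qed

section \<open>Charts and the Riemannian volume\<close>

text \<open>Borel sets of an abstract topology; the type of points of a manifold carries no topology of
  its own.\<close>

definition borelt :: "'a topology \<Rightarrow> 'a measure" where
  "borelt X = sigma (topspace X) {U. openin X U}"

lemma space_borelt[simp]: "space (borelt X) = topspace X"
  unfolding borelt_def by (rule space_measure_of) (auto dest: openin_subset)

lemma sets_borelt: "sets (borelt X) = sigma_sets (topspace X) {U. openin X U}"
  unfolding borelt_def by (rule sets_measure_of) (auto dest: openin_subset)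

lemma openin_sets_borelt: "openin X U \<Longrightarrow> U \<in> sets (borelt X)"
  by (simp add: sets_borelt)

lemma measurable_borelt_continuous:
  assumes "continuous_map (top_of_set S) X f"
  shows "f \<in> measurable (restrict_space borel S) (borelt X)"
  unfolding borelt_def
proof (rule measurable_measure_of)
  show "f \<in> space (restrict_space borel S) \<rightarrow> topspace X"
    using assms by (auto simp: continuous_map_def space_restrict_space)
  fix U assume "U \<in> {U. openin X U}"
  then have "openin (top_of_set S) {x \<in> S. f x \<in> U}"
    using assms by (auto simp: continuous_map_def)
  then obtain T where "open T" "{x \<in> S. f x \<in> U} = S \<inter> T" by (auto simp: openin_open)
  moreover have "f -` U \<inter> space (restrict_space borel S) = {x \<in> S. f x \<in> U}" by (auto simp: space_restrict_space)
  ultimately show "f -` U \<inter> space (restrict_space borel S) \<in> sets (restrict_space borel S)"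
    by (auto simp: sets_restrict_space)
qed (auto dest: openin_subset)

lemma continuous_map_measurable_borelt:
  fixes f :: "'a \<Rightarrow> 'b::topological_space"
  assumes "continuous_map X euclidean f"
  shows "f \<in> borel_measurable (borelt X)"
proof (rule borel_measurableI)
  fix S :: "'b set" assume "open S"
  then have "openin X {x \<in> topspace X. f x \<in> S}" using assms by (auto simp: continuous_map_def)
  moreover have "f -` S \<inter> space (borelt X) = {x \<in> topspace X. f x \<in> S}" by auto
  ultimately show "f -` S \<inter> space (borelt X) \<in> sets (borelt X)" by (metis openin_sets_borelt)
qed

locale smooth_mfd =
  fixes M :: "('a, 'i, 'n::finite) mfd"
  assumes smooth: "smooth_manifold M"
begin

lemma chart_cover: "(\<Union>i\<in>charts M. cdom M i) = topspace (points M)"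
  using smooth by (simp add: smooth_manifold_def)

lemma
  assumes "i \<in> charts M"
  shows open_cdom: "openin (points M) (cdom M i)"
    and open_cimg: "open (cimg M i)"
    and homeo_cmap: "homeomorphic_map (subtopology (points M) (cdom M i)) (top_of_set (cimg M i)) (cmap M i)"
  using smooth assms by (simp_all add: smooth_manifold_def)

lemma cdom_subset: "i \<in> charts M \<Longrightarrow> cdom M i \<subseteq> topspace (points M)"
  using open_cdom by (rule openin_subset)

lemma inj_cmap: "i \<in> charts M \<Longrightarrow> inj_on (cmap M i) (cdom M i)"
  using homeomorphic_imp_injective_map[OF homeo_cmap] cdom_subset by (simp add: Int_absorb1)

lemma cinv_cmap: "i \<in> charts M \<Longrightarrow> x \<in> cdom M i \<Longrightarrow> cinv M i (cmap M i x) = x"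
  unfolding cinv_def by (rule inv_into_f_f[OF inj_cmap])

lemma cinv_in_cdom: "v \<in> cimg M i \<Longrightarrow> cinv M i v \<in> cdom M i"
  unfolding cinv_def cimg_def by (rule inv_into_into)

lemma cmap_cinv: "v \<in> cimg M i \<Longrightarrow> cmap M i (cinv M i v) = v"
  unfolding cinv_def cimg_def by (rule f_inv_into_f)

lemma cmap_in_cimg: "x \<in> cdom M i \<Longrightarrow> cmap M i x \<in> cimg M i"
  by (simp add: cimg_def)

lemma cmap_image_eq:
  assumes "i \<in> charts M" "B \<subseteq> cdom M i"
  shows "cmap M i ` B = {v \<in> cimg M i. cinv M i v \<in> B}"
  using assms cmap_cinv cinv_cmap cmap_in_cimg by (force simp: image_iff)

lemma continuous_cmap: "i \<in> charts M \<Longrightarrow> continuous_map (subtopology (points M) (cdom M i)) euclidean (cmap M i)"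
  using homeo_cmap homeomorphic_imp_continuous_map continuous_map_in_subtopology by blast

lemma continuous_cinv:
  assumes i: "i \<in> charts M"
  shows "continuous_map (top_of_set (cimg M i)) (points M) (cinv M i)"
proof -
  obtain h where h: "homeomorphic_maps (subtopology (points M) (cdom M i)) (top_of_set (cimg M i)) (cmap M i) h"
    using homeo_cmap[OF i] homeomorphic_map_maps by blast
  have "continuous_map (top_of_set (cimg M i)) (subtopology (points M) (cdom M i)) h"
    using h by (simp add: homeomorphic_maps_def)
  moreover have "h v = cinv M i v" if "v \<in> cimg M i" for v
  proof -
    have "h (cmap M i x) = x" if "x \<in> cdom M i" for x
      using h that cdom_subset[OF i] by (auto simp: homeomorphic_maps_def)
    then show ?thesis using that cinv_in_cdom cmap_cinv by metis
  qed
  ultimately have "continuous_map (top_of_set (cimg M i)) (subtopology (points M) (cdom M i)) (cinv M i)"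
    by (metis (no_types, lifting) continuous_map_eq topspace_euclidean_subtopology)
  then show ?thesis using continuous_map_in_subtopology by blast
qed

lemma cinv_measurable: "i \<in> charts M \<Longrightarrow> cinv M i \<in> measurable (restrict_space borel (cimg M i)) (borelt (points M))"
  by (rule measurable_borelt_continuous[OF continuous_cinv])

lemma cmap_image_sets:
  assumes i: "i \<in> charts M" and B: "B \<in> sets (borelt (points M))" "B \<subseteq> cdom M i"
  shows "cmap M i ` B \<in> sets borel"
proof -
  have "cinv M i -` B \<inter> space (restrict_space borel (cimg M i)) \<in> sets (restrict_space borel (cimg M i))"
    using cinv_measurable[OF i] B by (auto dest: measurable_sets)
  moreover have "cinv M i -` B \<inter> space (restrict_space borel (cimg M i)) = cmap M i ` B"
    using cmap_image_eq[OF i B(2)] by (auto simp: space_restrict_space)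
  ultimately show ?thesis using open_cimg[OF i] by (auto simp: sets_restrict_space_iff)
qed

lemma open_cmap_image:
  assumes i: "i \<in> charts M" and U: "openin (points M) U" "U \<subseteq> cdom M i"
  shows "open (cmap M i ` U)"
proof -
  have "openin (top_of_set (cimg M i)) {v \<in> cimg M i. cinv M i v \<in> U}"
    using continuous_cinv[OF i] U by (auto simp: continuous_map_def)
  then have "openin (top_of_set (cimg M i)) (cmap M i ` U)" by (simp only: cmap_image_eq[OF i U(2)])
  then show ?thesis using openin_open_eq[OF open_cimg[OF i]] by blast
qed

lemma open_cinv_image:
  assumes i: "i \<in> charts M" and V: "open V" "V \<subseteq> cimg M i"
  shows "openin (points M) (cinv M i ` V)"
proof -
  have "openin (subtopology (points M) (cdom M i)) {x \<in> topspace (subtopology (points M) (cdom M i)). cmap M i x \<in> V}"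
    by (rule openin_continuous_map_preimage[OF continuous_cmap[OF i]]) (use V in simp)
  then have "openin (points M) {x \<in> topspace (subtopology (points M) (cdom M i)). cmap M i x \<in> V}"
    by (rule openin_trans_full[OF _ open_cdom[OF i]])
  moreover have "{x \<in> topspace (subtopology (points M) (cdom M i)). cmap M i x \<in> V} = cinv M i ` V"
  proof safe
    fix x assume "cmap M i x \<in> V" "x \<in> topspace (subtopology (points M) (cdom M i))"
    then show "x \<in> cinv M i ` V" using cinv_cmap[OF i, of x] by (metis Int_iff image_eqI topspace_subtopology)
  next
    fix v assume "v \<in> V"
    then show "cinv M i v \<in> topspace (subtopology (points M) (cdom M i))" "cmap M i (cinv M i v) \<in> V"
      using V cinv_in_cdom[of v i] cdom_subset[OF i] cmap_cinv[of v i] by auto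
  qed
  ultimately show ?thesis by simp
qed

lemma transition_smooth:
  "i \<in> charts M \<Longrightarrow> j \<in> charts M \<Longrightarrow> smooth_on (cmap M i ` (cdom M i \<inter> cdom M j)) (transition M i j)"
  using smooth by (simp add: smooth_manifold_def)

lemma transition_has_derivative:
  assumes "i \<in> charts M" "j \<in> charts M" "x \<in> cdom M i \<inter> cdom M j"
  shows "(transition M i j has_derivative (\<lambda>v. jacobian M i j x *v v)) (at (cmap M i x))"
proof -
  have "Ck_on (Suc 0) (cmap M i ` (cdom M i \<inter> cdom M j)) (transition M i j)"
    using transition_smooth[OF assms(1,2)] unfolding smooth_on_def by blast
  then have d: "transition M i j differentiable (at (cmap M i x))" using assms by auto
  from d have f: "(transition M i j has_derivative frechet_derivative (transition M i j) (at (cmap M i x))) (at (cmap M i x))"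
    by (simp add: frechet_derivative_works)
  have "Vector_Spaces.linear (*s) (*s) (frechet_derivative (transition M i j) (at (cmap M i x)))"
    using has_derivative_linear[OF f] by (simp add: linear_matrix_vector_mul_eq)
  then have "(\<lambda>v. jacobian M i j x *v v) = frechet_derivative (transition M i j) (at (cmap M i x))"
    unfolding jacobian_def by (simp add: matrix_works)
  then show ?thesis using f by simp
qed

lemma transition_cmap: "i \<in> charts M \<Longrightarrow> x \<in> cdom M i \<Longrightarrow> transition M i j (cmap M i x) = cmap M j x"
  by (simp add: transition_def cinv_cmap)

lemma chart_at:
  assumes "x \<in> topspace (points M)"
  shows "chart_at M x \<in> charts M" "x \<in> cdom M (chart_at M x)"
proof -
  have "x \<in> (\<Union>i\<in>charts M. cdom M i)" using assms by (simp only: chart_cover)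
  then have "\<exists>i. i \<in> charts M \<and> x \<in> cdom M i" by blast
  then have "chart_at M x \<in> charts M \<and> x \<in> cdom M (chart_at M x)"
    unfolding chart_at_def by (rule someI_ex)
  then show "chart_at M x \<in> charts M" "x \<in> cdom M (chart_at M x)" by auto
qed

end

locale riem_mfd = smooth_mfd M for M :: "('a, 'i, 'n::finite) mfd" +
  fixes g :: "('a, 'i, 'n) tensor2"
  assumes metric: "riemannian_metric M g"
begin

lemma metric_tensor: "smooth_tensor2 M g"
  using metric unfolding riemannian_metric_def by (rule conjunct1)

lemma metric_posdef: "i \<in> charts M \<Longrightarrow> x \<in> cdom M i \<Longrightarrow> posdef (g i x)"
proof -
  assume i: "i \<in> charts M" "x \<in> cdom M i"
  show ?thesis
    using metric[unfolded riemannian_metric_def, THEN conjunct2, THEN bspec, OF i(1), THEN bspec, OF i(2)]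
    unfolding posdef_def .
qed

lemma metric_change:
  assumes "i \<in> charts M" "j \<in> charts M" "x \<in> cdom M i \<inter> cdom M j"
  shows "g i x = transpose (jacobian M i j x) ** g j x ** jacobian M i j x"
  using metric_tensor[unfolded smooth_tensor2_def, THEN conjunct1, THEN bspec, OF assms(1), THEN bspec, OF assms(2),
      THEN bspec, OF assms(3)] .

lemma metric_continuous:
  assumes "i \<in> charts M"
  shows "continuous_on (cimg M i) (\<lambda>v. g i (cinv M i v))"
proof -
  have "smooth_on (cimg M i) (\<lambda>v. g i (cinv M i v))"
    using metric_tensor[unfolded smooth_tensor2_def, THEN conjunct2, THEN bspec, OF assms] .
  then have "Ck_on 0 (cimg M i) (\<lambda>v. g i (cinv M i v))" unfolding smooth_on_def by (rule spec)
  then show ?thesis by simp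
qed

text \<open>The density of the volume in the chart \<open>i\<close>, as a function of the coordinates.\<close>

definition vol_density :: "'i \<Rightarrow> real^'n \<Rightarrow> real" where
  "vol_density i v = sqrt (det (g i (cinv M i v)))"

lemma vol_density_pos: "i \<in> charts M \<Longrightarrow> v \<in> cimg M i \<Longrightarrow> 0 < vol_density i v"
  unfolding vol_density_def real_sqrt_gt_0_iff by (rule posdef_det_pos[OF metric_posdef[OF _ cinv_in_cdom]])

lemma vol_density_continuous: "i \<in> charts M \<Longrightarrow> continuous_on (cimg M i) (vol_density i)"
proof -
  assume i: "i \<in> charts M"
  have comp: "continuous_on (cimg M i) (\<lambda>v. g i (cinv M i v) $ a $ b)" for a b
    by (intro continuous_intros metric_continuous i)
  then show ?thesis unfolding vol_density_def det_def
    by (intro continuous_on_real_sqrt continuous_on_sum continuous_on_mult continuous_on_prod continuous_on_const comp)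
qed

lemma vol_density_change:
  assumes "i \<in> charts M" "j \<in> charts M" "x \<in> cdom M i \<inter> cdom M j"
  shows "vol_density i (cmap M i x) = \<bar>det (jacobian M i j x)\<bar> * vol_density j (cmap M j x)"
proof -
  have "det (g i x) = (det (jacobian M i j x))\<^sup>2 * det (g j x)"
    unfolding metric_change[OF assms] by (simp add: det_mul det_transpose power2_eq_square)
  then have "sqrt (det (g i x)) = \<bar>det (jacobian M i j x)\<bar> * sqrt (det (g j x))"
    by (simp add: real_sqrt_mult)
  then show ?thesis using assms by (simp add: vol_density_def cinv_cmap)
qed

lemma vol_density_measurable:
  assumes i: "i \<in> charts M" and S: "S \<in> sets borel" "S \<subseteq> cimg M i"
  shows "(\<lambda>v. vol_density i v * indicator S v) \<in> borel_measurable borel"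
proof -
  have "vol_density i \<in> borel_measurable (restrict_space borel S)"
    by (rule borel_measurable_continuous_on_restrict) (use vol_density_continuous[OF i] S continuous_on_subset in blast)
  then show ?thesis using S by (simp add: borel_measurable_restrict_space_iff mult.commute)
qed

definition chart_vol :: "'i \<Rightarrow> 'a set \<Rightarrow> ennreal" where
  "chart_vol i B = (\<integral>\<^sup>+ v. ennreal (vol_density i v) * indicator (cmap M i ` B) v \<partial>lborel)"

lemma chart_vol_alt: "chart_vol i B = (\<integral>\<^sup>+ v. ennreal (vol_density i v * indicator (cmap M i ` B) v) \<partial>lborel)"
  unfolding chart_vol_def by (intro nn_integral_cong) (simp split: split_indicator)

text \<open>The change of variables formula for the transition map, whose Jacobian determinant is the quotient
  of the two densities.\<close>

lemma chart_vol_change: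
  assumes i: "i \<in> charts M" and j: "j \<in> charts M" and B: "B \<in> sets (borelt (points M))" "B \<subseteq> cdom M i \<inter> cdom M j"
  shows "chart_vol i B = chart_vol j B"
proof -
  let ?S = "cmap M i ` B" and ?D = "\<lambda>v w. jacobian M i j (cinv M i v) *v w"
  have Bi: "x \<in> cdom M i" "x \<in> cdom M i \<inter> cdom M j" if "x \<in> B" for x using B(2) that by auto
  have tc: "transition M i j (cmap M i x) = cmap M j x" if "x \<in> B" for x
    by (rule transition_cmap[OF i Bi(1)[OF that]])
  have im: "transition M i j ` ?S = cmap M j ` B"
    unfolding image_image by (rule image_cong[OF refl tc])
  have eq: "\<bar>det (matrix (?D v))\<bar> * vol_density j (transition M i j v) * indicator ?S v = vol_density i v * indicator ?S v" for v
  proof (cases "v \<in> ?S")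
    case True
    then obtain x where x: "x \<in> B" "v = cmap M i x" by auto
    then show ?thesis using vol_density_change[OF i j Bi(2)[OF x(1)]] cinv_cmap[OF i Bi(1)[OF x(1)]] tc[OF x(1)] by simp
  qed simp
  have S: "?S \<in> sets borel" "cmap M j ` B \<in> sets borel"
    using cmap_image_sets[OF i, of B] cmap_image_sets[OF j, of B] B by auto
  have sub: "?S \<subseteq> cimg M i" "cmap M j ` B \<subseteq> cimg M j" using B by (auto simp: cimg_def)
  have "(\<integral>\<^sup>+y. ennreal (vol_density j y * indicator (transition M i j ` ?S) y) \<partial>lborel) =
         (\<integral>\<^sup>+x. ennreal (\<bar>det (matrix (?D x))\<bar> * vol_density j (transition M i j x) * indicator ?S x) \<partial>lborel)"
  proof (rule nn_integral_change_of_variables)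
    show "?S \<in> sets borel" by (rule S)
    show "(transition M i j has_derivative ?D v) (at v)" if "v \<in> ?S" for v
    proof -
      from that obtain x where x: "x \<in> B" "v = cmap M i x" by auto
      then show ?thesis using transition_has_derivative[OF i j Bi(2)[OF x(1)]] cinv_cmap[OF i Bi(1)[OF x(1)]] by simp
    qed
    show "inj_on (transition M i j) ?S"
    proof (rule inj_onI)
      fix v w assume "v \<in> ?S" "w \<in> ?S" and e: "transition M i j v = transition M i j w"
      then obtain x y where x: "x \<in> B" "v = cmap M i x" and y: "y \<in> B" "w = cmap M i y" by blast
      then have "cmap M j x = cmap M j y" using e tc by simp
      then have "x = y" using inj_onD[OF inj_cmap[OF j]] Bi(2)[OF x(1)] Bi(2)[OF y(1)] by blast
      then show "v = w" using x y by simp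
    qed
    show "0 \<le> vol_density j y" if "y \<in> transition M i j ` ?S" for y
      using that vol_density_pos[OF j, of y] sub(2) unfolding im by (meson less_imp_le subsetD)
    show "(\<lambda>y. vol_density j y * indicator (transition M i j ` ?S) y) \<in> borel_measurable borel"
      unfolding im by (rule vol_density_measurable[OF j S(2) sub(2)])
    show "(\<lambda>x. \<bar>det (matrix (?D x))\<bar> * vol_density j (transition M i j x) * indicator ?S x) \<in> borel_measurable borel"
      unfolding eq by (rule vol_density_measurable[OF i S(1) sub(1)])
  qed
  then show ?thesis unfolding chart_vol_alt im eq by simp
qed

lemma chart_vol_suminf:
  assumes i: "i \<in> charts M" and B: "range B \<subseteq> sets (borelt (points M))" "disjoint_family B" "\<And>n. B n \<subseteq> cdom M i"
  shows "(\<Sum>n. chart_vol i (B n)) = chart_vol i (\<Union>n. B n)"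
proof -
  have Bn: "cmap M i ` B n \<in> sets borel" for n using cmap_image_sets[OF i] B by auto
  have m: "(\<lambda>v. ennreal (vol_density i v) * indicator (cmap M i ` B n) v) \<in> borel_measurable borel" for n
  proof -
    have "(\<lambda>v. ennreal (vol_density i v * indicator (cmap M i ` B n) v)) \<in> borel_measurable borel"
    proof (intro measurable_compose[OF _ measurable_ennreal] vol_density_measurable[OF i Bn])
      show "cmap M i ` B n \<subseteq> cimg M i" using B(3)[of n] unfolding cimg_def by (rule image_mono)
    qed
    moreover have "ennreal (vol_density i v) * indicator (cmap M i ` B n) v = ennreal (vol_density i v * indicator (cmap M i ` B n) v)" for v
      by (auto simp: indicator_def)
    ultimately show ?thesis by simp
  qed
  have disj: "disjoint_family (\<lambda>n. cmap M i ` B n)"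
    unfolding disjoint_family_on_def
  proof (intro ballI impI)
    fix m n :: nat assume "m \<noteq> n"
    then have "B m \<inter> B n = {}" using B(2) by (auto simp: disjoint_family_on_def)
    then show "cmap M i ` B m \<inter> cmap M i ` B n = {}"
      using inj_on_image_Int[OF inj_cmap[OF i] B(3)[of m] B(3)[of n]] by simp
  qed
  have "(\<Sum>n. chart_vol i (B n)) = (\<integral>\<^sup>+ v. (\<Sum>n. ennreal (vol_density i v) * indicator (cmap M i ` B n) v) \<partial>lborel)"
    unfolding chart_vol_def using m by (intro nn_integral_suminf[symmetric]) auto
  also have "\<dots> = chart_vol i (\<Union>n. B n)"
    unfolding chart_vol_def image_UN by (intro nn_integral_cong) (simp add: suminf_indicator[OF disj] ennreal_suminf_cmult)
  finally show ?thesis .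
qed

end

text \<open>The defining property fixes a volume on Borel sets inside one chart domain, and the charts of a finite
  cover cut every Borel set into such pieces. The product manifold also needs this uniqueness, so the
  lemma lives outside the locale and asks for open chart domains and a finite cover directly.\<close>

lemma riemannian_volume_unique:
  fixes M :: "('a, 'i, 'n::finite) mfd"
  assumes 1: "is_riemannian_volume M g \<mu>" and 2: "is_riemannian_volume M g \<nu>"
    and open_charts: "\<And>i. i \<in> charts M \<Longrightarrow> openin (points M) (cdom M i)"
    and I: "set I \<subseteq> charts M" and cover: "topspace (points M) \<subseteq> (\<Union>i\<in>set I. cdom M i)"
  shows "\<mu> = \<nu>"
proof (rule measure_eqI)
  show sets: "sets \<mu> = sets \<nu>" using 1[unfolded is_riemannian_volume_def, THEN conjunct2, THEN conjunct1] 
      2[unfolded is_riemannian_volume_def, THEN conjunct2, THEN conjunct1] by simp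
  fix B assume B: "B \<in> sets \<mu>"
  have "emeasure \<mu> (B \<inter> (\<Union>i\<in>set J. cdom M i)) = emeasure \<nu> (B \<inter> (\<Union>i\<in>set J. cdom M i))" if "set J \<subseteq> charts M" for J
    using that
  proof (induction J)
    case (Cons i J)
    let ?A = "B \<inter> (\<Union>i\<in>set J. cdom M i)" and ?D = "B \<inter> cdom M i - (\<Union>i\<in>set J. cdom M i)"
    have s: "cdom M j \<in> sets \<mu>" if "j \<in> charts M" for j
      using 1[unfolded is_riemannian_volume_def, THEN conjunct2, THEN conjunct1] open_charts[OF that] by simp
    then have U: "(\<Union>i\<in>set J. cdom M i) \<in> sets \<mu>" using Cons.prems by (intro sets.finite_UN) auto
    have D: "?D \<in> sets \<mu>" using s[of i] Cons.prems B U by auto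
    have A: "?A \<in> sets \<mu>" using U B by auto
    have eq: "emeasure \<mu> ?D = emeasure \<nu> ?D"
    proof -
      have i: "i \<in> charts M" "?D \<subseteq> cdom M i" using Cons.prems by auto
      have "emeasure \<mu> ?D = (\<integral>\<^sup>+ v. ennreal (sqrt (det (g i (cinv M i v)))) * indicator (cmap M i ` ?D) v \<partial>lborel)"
        using 1 D i unfolding is_riemannian_volume_def by blast
      moreover have "emeasure \<nu> ?D = (\<integral>\<^sup>+ v. ennreal (sqrt (det (g i (cinv M i v)))) * indicator (cmap M i ` ?D) v \<partial>lborel)"
        using 2 D i sets unfolding is_riemannian_volume_def by blast
      ultimately show ?thesis by simp
    qed
    have split: "B \<inter> (\<Union>i\<in>set (i # J). cdom M i) = ?A \<union> ?D" by (simp, blast)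
    show ?case unfolding split
    proof -
      have AD: "?A \<inter> ?D = {}" by auto
      have "emeasure \<mu> ?A = emeasure \<nu> ?A" using Cons by simp
      then show "emeasure \<mu> (?A \<union> ?D) = emeasure \<nu> (?A \<union> ?D)"
        using plus_emeasure[OF A D AD] plus_emeasure[of ?A \<nu> ?D, OF _ _ AD] A D sets eq by metis
    qed
  qed simp
  moreover have "B \<inter> (\<Union>i\<in>set I. cdom M i) = B"
    using cover sets.sets_into_space[OF B] 1[unfolded is_riemannian_volume_def, THEN conjunct1] by blast
  ultimately show "emeasure \<mu> B = emeasure \<nu> B" using I by metis
qed

locale closed_riem_mfd = riem_mfd M g for M :: "('a, 'i, 'n::finite) mfd" and g +
  assumes compact: "compact_space (points M)"
begin

lemma finite_chart_cover:
  obtains I where "set I \<subseteq> charts M" "(\<Union>i\<in>set I. cdom M i) = topspace (points M)"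
proof -
  have sub: "topspace (points M) \<subseteq> \<Union>(cdom M ` charts M)" by (simp only: chart_cover subset_refl)
  have cp: "compactin (points M) (topspace (points M))" using compact unfolding compact_space_def .
  have op: "openin (points M) U" if "U \<in> cdom M ` charts M" for U
  proof -
    from that obtain i where "i \<in> charts M" "U = cdom M i" by (rule imageE)
    then show ?thesis using open_cdom by simp
  qed
  from compactinD[OF cp op sub]
  obtain \<F> where F: "finite \<F>" "\<F> \<subseteq> cdom M ` charts M" "topspace (points M) \<subseteq> \<Union>\<F>" by blast
  from finite_subset_image[OF F(1,2)] obtain C where C: "C \<subseteq> charts M" "finite C" "\<F> = cdom M ` C" by blast
  obtain I where I: "set I = C" using finite_list[OF C(2)] by blast
  then have "set I \<subseteq> charts M" using C by simp
  moreover have "topspace (points M) \<subseteq> (\<Union>i\<in>set I. cdom M i)" using C(3) I F(3) by simp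
  ultimately have "set I \<subseteq> charts M" "topspace (points M) \<subseteq> (\<Union>i\<in>set I. cdom M i)" .
  moreover from this(1) have "(\<Union>i\<in>set I. cdom M i) \<subseteq> topspace (points M)" by (intro UN_least cdom_subset) auto
  ultimately show ?thesis using that[of I] by blast
qed

text \<open>A finite chart cover is made disjoint, each piece is measured in its own chart, and
  \<open>chart_vol_change\<close> makes the outcome agree with the prescribed density in every other chart.\<close>

lemma riemannian_volume_exists: "\<exists>\<mu>. is_riemannian_volume M g \<mu>"
proof -
  let ?B = "borelt (points M)"
  obtain I where I: "set I \<subseteq> charts M" "(\<Union>i\<in>set I. cdom M i) = topspace (points M)" by (rule finite_chart_cover)
  let ?N = "length I"
  \<comment> \<open>The disjoint pieces of the cover.\<close>
  define A where "A k = cdom M (I!k) - (\<Union>j<k. cdom M (I!j))" for k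
  have ch: "I ! k \<in> charts M" if "k < ?N" for k using I(1) nth_mem[OF that] by blast
  have cs: "cdom M i \<in> sets ?B" if "i \<in> charts M" for i using open_cdom[OF that] openin_sets_borelt by auto
  have As: "A k \<in> sets ?B" if "k < ?N" for k unfolding A_def by (intro sets.Diff sets.finite_UN cs ch) (use that in auto)
  have Acover: "(\<Union>k<?N. A k) = topspace (points M)"
  proof -
    have "(\<Union>k<n. A k) = (\<Union>k<n. cdom M (I!k))" for n
      by (induction n) (auto simp: A_def lessThan_Suc)
    moreover have "(\<Union>k<?N. cdom M (I!k)) = (\<Union>i\<in>set I. cdom M i)" by (auto simp: set_conv_nth)
    ultimately show ?thesis using I by simp
  qed
  have Adisj: "A j \<inter> A k = {}" if "j \<noteq> k" for j k
    using that by (cases j k rule: linorder_cases) (auto simp: A_def)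
  define m where "m B = (\<Sum>k<?N. chart_vol (I!k) (B \<inter> A k))" for B
  define \<mu> where "\<mu> = measure_of (topspace (points M)) (sets ?B) m"
  have sp: "sets ?B \<subseteq> Pow (topspace (points M))" using sets.space_closed[of ?B] by simp
  have sets_mu: "sets \<mu> = sets ?B" unfolding \<mu>_def using sp sets.sigma_sets_eq[of ?B] by simp
  have em: "emeasure \<mu> B = m B" if "B \<in> sets ?B" for B
  proof (rule emeasure_measure_of[OF \<mu>_def])
    show "positive (sets \<mu>) m" by (simp add: positive_def m_def chart_vol_def)
    show "countably_additive (sets \<mu>) m"
    proof (rule countably_additiveI)
      fix F :: "nat \<Rightarrow> 'a set" assume F: "range F \<subseteq> sets \<mu>" "disjoint_family F" "\<Union>(range F) \<in> sets \<mu>"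
      have "(\<Sum>n. m (F n)) = (\<Sum>k<?N. \<Sum>n. chart_vol (I!k) (F n \<inter> A k))"
        unfolding m_def by (rule suminf_sum) auto
      also have "\<dots> = (\<Sum>k<?N. chart_vol (I!k) (\<Union>n. F n \<inter> A k))"
      proof (rule sum.cong[OF refl])
        fix k assume "k \<in> {..<?N}"
        then have k: "k < ?N" by simp
        show "(\<Sum>n. chart_vol (I!k) (F n \<inter> A k)) = chart_vol (I!k) (\<Union>n. F n \<inter> A k)"
        proof (rule chart_vol_suminf[OF ch[OF k]])
          show "range (\<lambda>n. F n \<inter> A k) \<subseteq> sets ?B" using F(1) As[OF k] sets_mu by auto
          show "disjoint_family (\<lambda>n. F n \<inter> A k)" using F(2) unfolding disjoint_family_on_def by blast
          show "F n \<inter> A k \<subseteq> cdom M (I!k)" for n by (auto simp: A_def)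
        qed
      qed
      also have "\<dots> = m (\<Union>(range F))" unfolding m_def by (intro sum.cong) auto
      finally show "(\<Sum>n. m (F n)) = m (\<Union>(range F))" .
    qed
  qed (use that sp sets_mu in auto)
  have "is_riemannian_volume M g \<mu>"
    unfolding is_riemannian_volume_def
  proof (intro conjI ballI impI)
    show "space \<mu> = topspace (points M)" unfolding \<mu>_def using sp by simp
    show "sets \<mu> = sigma_sets (topspace (points M)) {U. openin (points M) U}" using sets_mu sets_borelt by simp
    fix i B assume i: "i \<in> charts M" and "B \<in> sets \<mu>" and Bi: "B \<subseteq> cdom M i"
    then have B: "B \<in> sets ?B" using sets_mu by simp
    have "m B = (\<Sum>k<?N. chart_vol i (B \<inter> A k))"
      unfolding m_def
      using ch i B As Bi by (intro sum.cong refl chart_vol_change) (auto simp: A_def)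
    also have "\<dots> = chart_vol i B"
    proof -
      define F where "F k = (if k < ?N then B \<inter> A k else {})" for k
      have U: "(\<Union>n. F n) = B"
      proof
        show "(\<Union>n. F n) \<subseteq> B" by (auto simp: F_def split: if_splits)
        show "B \<subseteq> (\<Union>n. F n)"
        proof
          fix x assume x: "x \<in> B"
          then have "x \<in> (\<Union>k<?N. A k)" using sets.sets_into_space[OF B] by (simp only: Acover) auto
          then obtain k where "k < ?N" "x \<in> A k" by blast
          then have "x \<in> F k" using x by (simp add: F_def)
          then show "x \<in> (\<Union>n. F n)" by blast
        qed
      qed
      have "(\<Sum>n. chart_vol i (F n)) = chart_vol i (\<Union>n. F n)"
      proof (rule chart_vol_suminf[OF i])
        show "range F \<subseteq> sets ?B" using B As by (auto simp: F_def)
        show "disjoint_family F" using Adisj unfolding disjoint_family_on_def F_def by auto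
        show "F n \<subseteq> cdom M i" for n using Bi by (auto simp: F_def)
      qed
      moreover have "(\<Sum>n. chart_vol i (F n)) = (\<Sum>k<?N. chart_vol i (F k))"
        by (rule suminf_finite) (auto simp: F_def chart_vol_def)
      moreover have "(\<Sum>k<?N. chart_vol i (F k)) = (\<Sum>k<?N. chart_vol i (B \<inter> A k))" by (auto simp: F_def)
      ultimately show ?thesis using U by simp
    qed
    finally show "emeasure \<mu> B = (\<integral>\<^sup>+ v. ennreal (sqrt (det (g i (cinv M i v)))) * indicator (cmap M i ` B) v \<partial>lborel)"
      using em[OF B] by (simp add: chart_vol_def vol_density_def)
  qed
  then show ?thesis by blast
qed

abbreviation "vol \<equiv> riemannian_volume M g"

lemma vol_is_riemannian_volume: "is_riemannian_volume M g vol"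
  unfolding riemannian_volume_def
proof (rule theI')
  obtain I where I: "set I \<subseteq> charts M" "(\<Union>i\<in>set I. cdom M i) = topspace (points M)" by (rule finite_chart_cover)
  show "\<exists>!\<mu>. is_riemannian_volume M g \<mu>"
    using riemannian_volume_exists riemannian_volume_unique[OF _ _ open_cdom I(1)] I(2) by blast
qed

lemma space_vol: "space vol = topspace (points M)" and sets_vol: "sets vol = sets (borelt (points M))"
  using vol_is_riemannian_volume by (simp_all add: is_riemannian_volume_def sets_borelt)

lemma emeasure_vol_chart:
  "i \<in> charts M \<Longrightarrow> B \<in> sets vol \<Longrightarrow> B \<subseteq> cdom M i \<Longrightarrow> emeasure vol B = chart_vol i B"
  using vol_is_riemannian_volume by (simp add: is_riemannian_volume_def chart_vol_def vol_density_def)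

end

section \<open>The Gagliardo-Nirenberg inequality on the unit cube\<close>

definition unit_interval :: "real measure" where
  "unit_interval = restrict_space lborel {0..1}"

definition cube :: "('n::finite \<Rightarrow> real) measure" where
  "cube = PiM UNIV (\<lambda>_. unit_interval)"

lemma space_unit_interval[simp]: "space unit_interval = {0..1}"
  by (simp add: unit_interval_def space_restrict_space)

lemma prob_space_unit_interval: "prob_space unit_interval"
  by (rule prob_spaceI) (simp add: unit_interval_def space_restrict_space emeasure_restrict_space)

interpretation unit_interval: prob_space unit_interval
  by (rule prob_space_unit_interval)

interpretation cube: product_prob_space "\<lambda>_::'n::finite. unit_interval" UNIV
  by (intro product_prob_space.intro product_sigma_finite.intro product_prob_space_axioms.intro
      unit_interval.sigma_finite_measure_axioms unit_interval.prob_space_axioms)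

interpretation cubeM: prob_space "cube :: ('n::finite \<Rightarrow> real) measure"
  unfolding cube_def by (rule prob_space_PiM) (rule prob_space_unit_interval)

lemma space_cube: "x \<in> space cube \<longleftrightarrow> (\<forall>k. x k \<in> {0..1})"
  by (auto simp: cube_def space_PiM PiE_def)

lemma fun_upd_space_cube: "x \<in> space cube \<Longrightarrow> t \<in> {0..1} \<Longrightarrow> x(k := t) \<in> space cube"
  by (auto simp: space_cube)

lemma measurable_fun_upd_cube[measurable]:
  "(\<lambda>(x, t). x(k := t)) \<in> measurable (cube \<Otimes>\<^sub>M unit_interval) (cube :: ('n::finite \<Rightarrow> real) measure)"
  using measurable_add_dim[of k UNIV "\<lambda>_::'n. unit_interval"] by (simp add: cube_def)

lemma measurable_compose_fun_upd_cube:
  fixes \<phi> :: "('n::finite \<Rightarrow> real) \<Rightarrow> 'b::topological_space"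
  assumes "\<phi> \<in> borel_measurable cube"
  shows "(\<lambda>(x, t). \<phi> (x(k := t))) \<in> borel_measurable (cube \<Otimes>\<^sub>M unit_interval)"
  using measurable_compose[OF measurable_fun_upd_cube assms] by (simp add: case_prod_unfold)

lemma measurable_line_cube:
  fixes \<phi> :: "('n::finite \<Rightarrow> real) \<Rightarrow> 'b::topological_space"
  assumes "\<phi> \<in> borel_measurable cube" "x \<in> space cube"
  shows "(\<lambda>t. \<phi> (x(k := t))) \<in> borel_measurable unit_interval"
  using measurable_Pair2[OF measurable_compose_fun_upd_cube[OF assms(1)] assms(2)] by simp

text \<open>Integration over the line through \<open>x\<close> in direction \<open>k\<close>; the result is a function on the cube that
  does not depend on coordinate \<open>k\<close>.\<close>

definition line_avg :: "'n \<Rightarrow> (('n::finite \<Rightarrow> real) \<Rightarrow> real) \<Rightarrow> ('n \<Rightarrow> real) \<Rightarrow> real" where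
  "line_avg k \<phi> x = (\<integral>t. \<phi> (x(k := t)) \<partial>unit_interval)"

lemma line_avg_measurable:
  assumes "\<phi> \<in> borel_measurable cube"
  shows "line_avg k \<phi> \<in> borel_measurable cube"
  using unit_interval.borel_measurable_lebesgue_integral[OF measurable_compose_fun_upd_cube[OF assms]]
  by (simp add: line_avg_def[abs_def])

lemma line_integrable:
  fixes \<phi> :: "('n::finite \<Rightarrow> real) \<Rightarrow> real"
  assumes "\<phi> \<in> borel_measurable cube" "\<And>x. x \<in> space cube \<Longrightarrow> \<bar>\<phi> x\<bar> \<le> B" "x \<in> space cube"
  shows "integrable unit_interval (\<lambda>t. \<phi> (x(k := t)))"
proof (rule unit_interval.integrable_const_bound[where B=B])
  show "AE t in unit_interval. norm (\<phi> (x(k := t))) \<le> B"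
    using assms(2)[OF fun_upd_space_cube[OF assms(3)]] by (intro AE_I2) simp
qed (rule measurable_line_cube[OF assms(1,3)])

lemma cube_integrable:
  fixes \<phi> :: "('n::finite \<Rightarrow> real) \<Rightarrow> real"
  assumes "\<phi> \<in> borel_measurable cube" "\<And>x. x \<in> space cube \<Longrightarrow> \<bar>\<phi> x\<bar> \<le> B"
  shows "integrable cube \<phi>"
  by (rule cubeM.integrable_const_bound[where B=B]) (use assms in \<open>auto intro!: AE_I2\<close>)

lemma line_avg_bounds:
  fixes \<phi> :: "('n::finite \<Rightarrow> real) \<Rightarrow> real"
  assumes "\<phi> \<in> borel_measurable cube" "\<And>x. x \<in> space cube \<Longrightarrow> c \<le> \<phi> x \<and> \<phi> x \<le> C" "x \<in> space cube"
  shows "c \<le> line_avg k \<phi> x \<and> line_avg k \<phi> x \<le> C"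
proof -
  have int: "integrable unit_interval (\<lambda>t. \<phi> (x(k := t)))"
    by (rule line_integrable[where B="max \<bar>c\<bar> \<bar>C\<bar>"]) (use assms in \<open>fastforce+\<close>)
  have b: "c \<le> \<phi> (x(k := t)) \<and> \<phi> (x(k := t)) \<le> C" if "t \<in> space unit_interval" for t
    using assms fun_upd_space_cube[of x t k] that by simp
  have "(\<integral>t. c \<partial>unit_interval) \<le> (\<integral>t. \<phi> (x(k := t)) \<partial>unit_interval)"
    using b by (intro integral_mono int) auto
  moreover have "(\<integral>t. \<phi> (x(k := t)) \<partial>unit_interval) \<le> (\<integral>t. C \<partial>unit_interval)"
    using b by (intro integral_mono int) auto
  ultimately show ?thesis by (simp add: line_avg_def unit_interval.prob_space[simplified])
qed

lemma integral_line_avg: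
  fixes \<phi> :: "('n::finite \<Rightarrow> real) \<Rightarrow> real"
  assumes m: "\<phi> \<in> borel_measurable cube" and b: "\<And>x. x \<in> space cube \<Longrightarrow> \<bar>\<phi> x\<bar> \<le> B"
  shows "(\<integral>x. line_avg k \<phi> x \<partial>cube) = (\<integral>x. \<phi> x \<partial>cube)"
proof -
  have ins: "insert k (UNIV - {k}) = UNIV" by auto
  have int: "integrable (PiM (insert k (UNIV - {k})) (\<lambda>_. unit_interval)) \<phi>"
    using cube_integrable[OF m b] unfolding ins cube_def by blast
  have b': "\<bar>line_avg k \<phi> x\<bar> \<le> B" if "x \<in> space cube" for x
    using line_avg_bounds[OF m, of "-B" B x k] b that by (simp add: abs_le_iff minus_le_iff)
  have int': "integrable (PiM (insert k (UNIV - {k})) (\<lambda>_. unit_interval)) (line_avg k \<phi>)"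
    using cube_integrable[OF line_avg_measurable[OF m] b'] unfolding ins cube_def by blast
  have "(\<integral>x. line_avg k \<phi> x \<partial>cube) = (\<integral>x. (\<integral>y. line_avg k \<phi> (x(k := y)) \<partial>unit_interval) \<partial>PiM (UNIV - {k}) (\<lambda>_. unit_interval))"
    using cube.product_integral_insert[of "UNIV - {k}" k "line_avg k \<phi>", OF _ _ int'] unfolding cube_def ins by simp
  also have "\<dots> = (\<integral>x. (\<integral>y. \<phi> (x(k := y)) \<partial>unit_interval) \<partial>PiM (UNIV - {k}) (\<lambda>_. unit_interval))"
    by (simp add: line_avg_def unit_interval.prob_space[simplified])
  also have "\<dots> = (\<integral>x. \<phi> x \<partial>cube)"
    using cube.product_integral_insert[of "UNIV - {k}" k \<phi>, OF _ _ int] unfolding cube_def ins by simp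
  finally show ?thesis .
qed

lemma nn_integral_line_avg:
  fixes \<phi> :: "('n::finite \<Rightarrow> real) \<Rightarrow> ennreal"
  assumes m: "\<phi> \<in> borel_measurable cube"
  shows "(\<integral>\<^sup>+x. (\<integral>\<^sup>+t. \<phi> (x(k := t)) \<partial>unit_interval) \<partial>cube) = (\<integral>\<^sup>+x. \<phi> x \<partial>cube)"
proof -
  have ins: "insert k (UNIV - {k}) = UNIV" by auto
  have m1: "\<phi> \<in> borel_measurable (PiM (insert k (UNIV - {k})) (\<lambda>_. unit_interval))"
    using m unfolding ins cube_def by blast
  have m2: "(\<lambda>x. \<integral>\<^sup>+t. \<phi> (x(k := t)) \<partial>unit_interval) \<in> borel_measurable (PiM (insert k (UNIV - {k})) (\<lambda>_. unit_interval))"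
    unfolding ins cube_def[symmetric]
    using unit_interval.borel_measurable_nn_integral[OF measurable_compose_fun_upd_cube[OF m]] .
  have "(\<integral>\<^sup>+x. (\<integral>\<^sup>+t. \<phi> (x(k := t)) \<partial>unit_interval) \<partial>cube) = (\<integral>\<^sup>+x. (\<integral>\<^sup>+y. (\<integral>\<^sup>+t. \<phi> (x(k := t)) \<partial>unit_interval) \<partial>unit_interval) \<partial>PiM (UNIV - {k}) (\<lambda>_. unit_interval))"
    using cube.product_nn_integral_insert[of "UNIV - {k}" k, OF _ _ m2] unfolding cube_def ins by simp
  also have "\<dots> = (\<integral>\<^sup>+x. (\<integral>\<^sup>+y. \<phi> (x(k := y)) \<partial>unit_interval) \<partial>PiM (UNIV - {k}) (\<lambda>_. unit_interval))"
    by (simp add: unit_interval.emeasure_space_1[simplified])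
  also have "\<dots> = (\<integral>\<^sup>+x. \<phi> x \<partial>cube)"
    using cube.product_nn_integral_insert[of "UNIV - {k}" k \<phi>, OF _ _ m1] unfolding cube_def ins by simp
  finally show ?thesis .
qed

lemma prod_powr_le_avg:
  fixes a :: "'l \<Rightarrow> real"
  assumes "finite L" "L \<noteq> {}" "\<And>l. l \<in> L \<Longrightarrow> 0 < a l"
  shows "(\<Prod>l\<in>L. a l powr (1 / card L)) \<le> (\<Sum>l\<in>L. a l) / card L"
proof -
  have "(\<Prod>l\<in>L. a l powr (1 / card L)) = (\<Prod>l\<in>L. a l) powr (1 / card L)"
    using assms(3) by (simp add: prod_powr_distrib less_imp_le)
  also have "\<dots> \<le> (\<Sum>l\<in>L. a l / card L)"
    using arith_geom_mean[OF assms(1,2), of a] assms(3) by (simp add: less_imp_le sum_divide_distrib)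
  finally show ?thesis by (simp add: sum_divide_distrib)
qed

text \<open>The generalised Hoelder inequality with equal exponents: after normalising the integrals to \<open>1\<close> it is
  the inequality of arithmetic and geometric means.\<close>

lemma (in prob_space) holder_prod:
  fixes f :: "'l \<Rightarrow> 'a \<Rightarrow> real"
  assumes L: "finite L" "L \<noteq> {}" 
    and m: "\<And>l. l \<in> L \<Longrightarrow> f l \<in> borel_measurable M"
    and c: "0 < c" and b: "\<And>l x. l \<in> L \<Longrightarrow> x \<in> space M \<Longrightarrow> c \<le> f l x \<and> f l x \<le> C"
  shows "(\<integral>x. (\<Prod>l\<in>L. f l x powr (1 / card L)) \<partial>M) \<le> (\<Prod>l\<in>L. (\<integral>x. f l x \<partial>M) powr (1 / card L))"
proof -
  let ?N = "real (card L)" and ?I = "\<lambda>l. \<integral>x. f l x \<partial>M"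
  have N: "0 < ?N" using L by (simp add: card_gt_0_iff)
  have int: "integrable M (f l)" if "l \<in> L" for l
    by (rule integrable_const_bound[where B=C]) (use b c that m in \<open>force intro!: AE_I2\<close>)+
  have Ipos: "0 < ?I l" if "l \<in> L" for l
  proof -
    have "(\<integral>x. c \<partial>M) \<le> ?I l" using b that by (intro integral_mono int) auto
    then show ?thesis using c by (simp add: prob_space)
  qed
  define P where "P = (\<Prod>l\<in>L. ?I l powr (1 / ?N))"
  have pw: "(\<Prod>l\<in>L. f l x powr (1 / ?N)) \<le> P * ((\<Sum>l\<in>L. f l x / ?I l) / ?N)" if "x \<in> space M" for x
  proof -
    have fp: "0 < f l x" if "l \<in> L" for l using b[OF that \<open>x \<in> space M\<close>] c by simp
    have "(\<Prod>l\<in>L. f l x powr (1 / ?N)) = (\<Prod>l\<in>L. ?I l powr (1 / ?N) * (f l x / ?I l) powr (1 / ?N))"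
    proof (rule prod.cong)
      fix l assume l: "l \<in> L"
      have "f l x = ?I l * (f l x / ?I l)" using Ipos[OF l] by simp
      then show "f l x powr (1 / ?N) = ?I l powr (1 / ?N) * (f l x / ?I l) powr (1 / ?N)"
        using Ipos[OF l] fp[OF l] by (metis divide_pos_pos less_imp_le powr_mult)
    qed simp
    also have "\<dots> = P * (\<Prod>l\<in>L. (f l x / ?I l) powr (1 / ?N))"
      by (simp add: P_def prod.distrib)
    also have "\<dots> \<le> P * ((\<Sum>l\<in>L. f l x / ?I l) / ?N)"
      using prod_powr_le_avg[OF L, of "\<lambda>l. f l x / ?I l"] Ipos fp
      by (intro mult_left_mono) (auto simp: P_def intro!: prod_nonneg)
    finally show ?thesis .
  qed
  have "(\<integral>x. (\<Prod>l\<in>L. f l x powr (1 / ?N)) \<partial>M) \<le> (\<integral>x. P * ((\<Sum>l\<in>L. f l x / ?I l) / ?N) \<partial>M)"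
  proof (rule integral_mono')
    show "integrable M (\<lambda>x. P * ((\<Sum>l\<in>L. f l x / ?I l) / ?N))"
      using int by (intro integrable_mult_right integrable_divide_zero integrable_sum) auto
    fix x assume x: "x \<in> space M"
    show "(\<Prod>l\<in>L. f l x powr (1 / ?N)) \<le> P * ((\<Sum>l\<in>L. f l x / ?I l) / ?N)" by (rule pw[OF x])
    show "0 \<le> P * ((\<Sum>l\<in>L. f l x / ?I l) / ?N)" by (rule order_trans[OF _ pw[OF x]]) (auto intro!: prod_nonneg)
  qed
  also have "\<dots> = P * ((\<Sum>l\<in>L. ?I l / ?I l) / ?N)"
    using int by simp
  also have "(\<Sum>l\<in>L. ?I l / ?I l) = ?N" using Ipos by (simp add: less_imp_neq[symmetric])
  finally show ?thesis using N by (simp add: P_def)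
qed

text \<open>The inequality of Loomis-Whitney and Gagliardo. The coordinates are integrated out one after another.
  When coordinate \<open>k\<close> is averaged, the factor \<open>f k\<close> is constant along the line and the other \<open>n - 1\<close> factors
  are treated by Hoelder's inequality with exponents \<open>n - 1\<close>.\<close>

lemma gagliardo_prod:
  fixes f :: "'n::finite \<Rightarrow> ('n \<Rightarrow> real) \<Rightarrow> real"
  assumes n: "2 \<le> CARD('n)"
    and m: "\<And>l. f l \<in> borel_measurable cube"
    and c: "0 < c" and b: "\<And>l x. x \<in> space cube \<Longrightarrow> c \<le> f l x \<and> f l x \<le> C"
    and indep: "\<And>l x t. x \<in> space cube \<Longrightarrow> t \<in> {0..1} \<Longrightarrow> f l (x(l := t)) = f l x"
  shows "(\<integral>x. (\<Prod>l\<in>UNIV. f l x powr (1 / real (CARD('n) - 1))) \<partial>cube)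
     \<le> (\<Prod>l\<in>UNIV. (\<integral>x. f l x \<partial>cube) powr (1 / real (CARD('n) - 1)))"
proof -
  let ?e = "1 / real (CARD('n) - 1)"
  \<comment> \<open>\<open>f'\<close> arises from \<open>f\<close> by averaging over the coordinates in \<open>J\<close>: integrals are kept, and the integral of
    the product has not decreased.\<close>
  define good where "good J f' \<longleftrightarrow>
       (\<forall>l. f' l \<in> borel_measurable cube \<and> (\<forall>x\<in>space cube. c \<le> f' l x \<and> f' l x \<le> C) \<and>
         (\<forall>k\<in>insert l J. \<forall>x\<in>space cube. \<forall>t\<in>{0..1}. f' l (x(k := t)) = f' l x) \<and>
         (\<integral>x. f' l x \<partial>cube) = (\<integral>x. f l x \<partial>cube)) \<and>
       (\<integral>x. (\<Prod>l\<in>UNIV. f l x powr ?e) \<partial>cube) \<le> (\<integral>x. (\<Prod>l\<in>UNIV. f' l x powr ?e) \<partial>cube)"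
    for J :: "'n set" and f' :: "'n \<Rightarrow> ('n \<Rightarrow> real) \<Rightarrow> real"
  have "\<exists>f'. good J f'" for J :: "'n set"
  proof (induction J rule: finite_induct[OF finite])
    case 1
    have "good {} f" using m b indep by (auto simp: good_def)
    then show ?case by blast
  next
    case (2 k J)
    then obtain f' where f': "good J f'" by blast
    have m': "f' l \<in> borel_measurable cube" for l using f' by (auto simp: good_def)
    have b': "c \<le> f' l x \<and> f' l x \<le> C" if "x \<in> space cube" for l x using f' that by (auto simp: good_def)
    have i': "f' l (x(j := t)) = f' l x" if "j \<in> insert l J" "x \<in> space cube" "t \<in> {0..1}" for l j x t
      using f' that unfolding good_def by blast
    have int': "(\<integral>x. f' l x \<partial>cube) = (\<integral>x. f l x \<partial>cube)" for l using f' by (auto simp: good_def)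
    have B': "\<bar>f' l x\<bar> \<le> C" if "x \<in> space cube" for l x using b'[OF that, of l] c by simp
    define h where "h l = line_avg k (f' l)" for l
    define L where "L = UNIV - {k}"
    have L: "finite L" "L \<noteq> {}" "card L = CARD('n) - 1"
    proof -
      show "card L = CARD('n) - 1" by (simp add: L_def card_Diff_singleton)
      then show "L \<noteq> {}" using n by (metis card.empty diff_is_0_eq not_less_eq_eq numeral_2_eq_2 One_nat_def)
    qed (simp add: L_def)
    have hk: "h k x = f' k x" if "x \<in> space cube" for x
    proof -
      have "h k x = (\<integral>t. f' k x \<partial>unit_interval)" unfolding h_def line_avg_def
        using i'[of k k x] that by (intro Bochner_Integration.integral_cong) auto
      then show ?thesis by (simp add: unit_interval.prob_space[simplified])
    qed
    let ?P = "\<lambda>x. \<Prod>l\<in>UNIV. f' l x powr ?e"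
    have Pm: "?P \<in> borel_measurable cube" using m' by measurable
    have split: "(\<Prod>l\<in>UNIV. a l) = a k * (\<Prod>l\<in>L. a l)" for a :: "'n \<Rightarrow> real"
      unfolding L_def by (rule prod.remove) auto
    have Pb: "\<bar>?P x\<bar> \<le> (\<Prod>l\<in>(UNIV::'n set). C powr ?e)" if "x \<in> space cube" for x
    proof -
      have "?P x \<le> (\<Prod>l\<in>(UNIV::'n set). C powr ?e)"
        using b'[OF that] c by (intro prod_mono conjI powr_mono2) (auto intro: order_trans[OF less_imp_le])
      moreover have "0 \<le> ?P x" by (intro prod_nonneg) auto
      ultimately show ?thesis by simp
    qed
    have key: "line_avg k ?P x \<le> (\<Prod>l\<in>UNIV. h l x powr ?e)" if x: "x \<in> space cube" for x
    proof -
      have "line_avg k ?P x = (\<integral>t. f' k x powr ?e * (\<Prod>l\<in>L. f' l (x(k := t)) powr ?e) \<partial>unit_interval)"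
        unfolding line_avg_def split using i'[of k k x] x by (intro Bochner_Integration.integral_cong) auto
      also have "\<dots> = f' k x powr ?e * (\<integral>t. (\<Prod>l\<in>L. f' l (x(k := t)) powr (1 / card L)) \<partial>unit_interval)"
        by (simp add: L)
      also have "\<dots> \<le> f' k x powr ?e * (\<Prod>l\<in>L. (\<integral>t. f' l (x(k := t)) \<partial>unit_interval) powr (1 / card L))"
        using b' fun_upd_space_cube[OF x] measurable_line_cube[OF m' x]
        by (intro mult_left_mono unit_interval.holder_prod[OF L(1,2) _ c, where C=C]) auto
      also have "\<dots> = (\<Prod>l\<in>UNIV. h l x powr ?e)"
        unfolding split using hk[OF x] by (simp add: L h_def line_avg_def)
      finally show ?thesis .
    qed
    have hm: "h l \<in> borel_measurable cube" for l unfolding h_def by (rule line_avg_measurable[OF m'])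
    have hb: "c \<le> h l x \<and> h l x \<le> C" if "x \<in> space cube" for l x
      unfolding h_def by (rule line_avg_bounds[OF m' b' that])
    have "good (insert k J) h" unfolding good_def
    proof (intro conjI allI ballI)
      fix l show "h l \<in> borel_measurable cube" by (rule hm)
      fix x :: "'n \<Rightarrow> real" assume x: "x \<in> space cube"
      show "c \<le> h l x" "h l x \<le> C" using hb[OF x] by auto
    next
      fix l show "(\<integral>x. h l x \<partial>cube) = (\<integral>x. f l x \<partial>cube)"
        using integral_line_avg[OF m'[of l] B', of k] int'[of l] by (simp add: h_def)
    next
      fix l j and x :: "'n \<Rightarrow> real" and t :: real assume j: "j \<in> insert l (insert k J)" and x: "x \<in> space cube" and t: "t \<in> {0..1}"
      show "h l (x(j := t)) = h l x"
      proof (cases "j = k")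
        case True
        then show ?thesis by (simp add: h_def line_avg_def)
      next
        case False
        then have jl: "j \<in> insert l J" using j by auto
        have "h l (x(j := t)) = (\<integral>s. f' l ((x(k := s))(j := t)) \<partial>unit_interval)"
          unfolding h_def line_avg_def using False by (simp add: fun_upd_twist)
        also have "\<dots> = h l x" unfolding h_def line_avg_def
          using i'[OF jl fun_upd_space_cube[OF x] t] by (intro Bochner_Integration.integral_cong) auto
        finally show ?thesis .
      qed
    next
      have "(\<integral>x. (\<Prod>l\<in>UNIV. f l x powr ?e) \<partial>cube) \<le> (\<integral>x. ?P x \<partial>cube)" using f' by (simp add: good_def)
      also have "\<dots> = (\<integral>x. line_avg k ?P x \<partial>cube)" by (rule integral_line_avg[OF Pm Pb, symmetric])
      also have "\<dots> \<le> (\<integral>x. (\<Prod>l\<in>UNIV. h l x powr ?e) \<partial>cube)"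
      proof (rule integral_mono)
        show "integrable cube (line_avg k ?P)"
        proof (rule cube_integrable[OF line_avg_measurable[OF Pm]])
          fix x :: "'n \<Rightarrow> real" assume x: "x \<in> space cube"
          let ?B = "\<Prod>l\<in>(UNIV::'n set). C powr ?e"
          have "- ?B \<le> ?P y \<and> ?P y \<le> ?B" if "y \<in> space cube" for y using Pb[OF that] by linarith
          from line_avg_bounds[OF Pm this x, of k] show "\<bar>line_avg k ?P x\<bar> \<le> ?B" by linarith
        qed
        show "integrable cube (\<lambda>x. \<Prod>l\<in>UNIV. h l x powr ?e)"
        proof (rule cube_integrable)
          show "(\<lambda>x. \<Prod>l\<in>UNIV. h l x powr ?e) \<in> borel_measurable cube" using hm by measurable
          fix x :: "'n \<Rightarrow> real" assume x: "x \<in> space cube"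
          have "(\<Prod>l\<in>UNIV. h l x powr ?e) \<le> (\<Prod>l\<in>(UNIV::'n set). C powr ?e)"
            using hb[OF x] c by (intro prod_mono conjI powr_mono2) (auto intro: order_trans[OF less_imp_le])
          moreover have "0 \<le> (\<Prod>l\<in>UNIV. h l x powr ?e)" by (intro prod_nonneg) auto
          ultimately show "\<bar>\<Prod>l\<in>UNIV. h l x powr ?e\<bar> \<le> (\<Prod>l\<in>(UNIV::'n set). C powr ?e)" by simp
        qed
      qed (rule key)
      finally show "(\<integral>x. (\<Prod>l\<in>UNIV. f l x powr ?e) \<partial>cube) \<le> (\<integral>x. (\<Prod>l\<in>UNIV. h l x powr ?e) \<partial>cube)" .
    qed
    then show ?case by blast
  qed
  then obtain f' where f': "good UNIV f'" by blast
  \<comment> \<open>Once all coordinates have been averaged, the functions are constants, namely their integrals.\<close>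
  have reset: "f' l (z(k := 0)) = f' l z" if "z \<in> space cube" for l k z
  proof -
    have "\<forall>k\<in>insert l UNIV. \<forall>x\<in>space cube. \<forall>t\<in>{0..1}. f' l (x(k := t)) = f' l x"
      using f' unfolding good_def by blast
    from this[THEN bspec, of k, THEN bspec, OF _ that, THEN bspec, of 0] show ?thesis by simp
  qed
  have const: "f' l x = f' l (\<lambda>_. 0)" if "x \<in> space cube" for l x
  proof -
    have "f' l x = f' l (\<lambda>k. if k \<in> J then 0 else x k)" for J
    proof (induction J rule: finite_induct[OF finite])
      case (2 k J)
      let ?y = "\<lambda>k. if k \<in> J then 0 else x k"
      have "?y \<in> space cube" using that by (auto simp: space_cube)
      then have "f' l (?y(k := 0)) = f' l ?y" by (rule reset)
      moreover have "?y(k := 0) = (\<lambda>j. if j \<in> insert k J then 0 else x j)" by auto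
      ultimately show ?case using 2 by simp
    qed simp
    from this[of UNIV] show ?thesis by simp
  qed
  have val: "f' l (\<lambda>_. 0) = (\<integral>x. f l x \<partial>cube)" for l
  proof -
    have "(\<integral>x. f' l x \<partial>cube) = integral\<^sup>L cube (\<lambda>_ :: 'n \<Rightarrow> real. f' l (\<lambda>_. 0))"
      using const by (intro Bochner_Integration.integral_cong) auto
    then show ?thesis using f' by (simp add: good_def cubeM.prob_space)
  qed
  have "(\<integral>x. (\<Prod>l\<in>UNIV. f l x powr ?e) \<partial>cube) \<le> (\<integral>x. (\<Prod>l\<in>UNIV. f' l x powr ?e) \<partial>cube)"
    using f' by (simp add: good_def)
  also have "\<dots> = integral\<^sup>L cube (\<lambda>_ :: 'n \<Rightarrow> real. (\<Prod>l\<in>UNIV. (\<integral>x. f l x \<partial>cube) powr ?e))"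
  proof (rule Bochner_Integration.integral_cong[OF refl])
    fix x :: "'n \<Rightarrow> real" assume x: "x \<in> space cube"
    have "f' l x = (\<integral>x. f l x \<partial>cube)" for l using const[OF x, of l] val[of l] by simp
    then show "(\<Prod>l\<in>UNIV. f' l x powr ?e) = (\<Prod>l\<in>UNIV. (\<integral>x. f l x \<partial>cube) powr ?e)" by simp
  qed
  also have "\<dots> = (\<Prod>l\<in>UNIV. (\<integral>x. f l x \<partial>cube) powr ?e)" by (simp add: cubeM.prob_space)
  finally show ?thesis .
qed

text \<open>The endpoint Sobolev inequality in a form without derivatives: \<open>G\<close> is an upper gradient of \<open>v\<close> along
  coordinate lines. Averaging the hypothesis over \<open>t\<close> shows that for each \<open>k\<close> the value \<open>v x\<close> is at most the
  average of \<open>v + G\<close> over the line in direction \<open>k\<close>. The product of these \<open>n\<close> bounds, to the power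
  \<open>1 / (n - 1)\<close>, is integrated by \<open>gagliardo_prod\<close>.\<close>

lemma sobolev_cube:
  fixes v G :: "('n::finite \<Rightarrow> real) \<Rightarrow> real"
  assumes n: "2 \<le> CARD('n)"
    and v: "v \<in> borel_measurable cube" "0 < c" "\<And>x. x \<in> space cube \<Longrightarrow> c \<le> v x \<and> v x \<le> C"
    and G: "G \<in> borel_measurable cube" "\<And>x. x \<in> space cube \<Longrightarrow> 0 \<le> G x \<and> G x \<le> D"
    and osc: "\<And>k x t. x \<in> space cube \<Longrightarrow> t \<in> {0..1} \<Longrightarrow> v x \<le> v (x(k := t)) + line_avg k G x"
  shows "(\<integral>x. v x powr (real CARD('n) / real (CARD('n) - 1)) \<partial>cube)
     \<le> (\<integral>x. v x + G x \<partial>cube) powr (real CARD('n) / real (CARD('n) - 1))"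
proof -
  let ?e = "1 / real (CARD('n) - 1)" and ?q = "real CARD('n) / real (CARD('n) - 1)"
  define T where "T k = line_avg k (\<lambda>x. v x + G x)" for k
  have m: "(\<lambda>x. v x + G x) \<in> borel_measurable cube" using v G by simp
  have b: "c \<le> v x + G x \<and> v x + G x \<le> C + D" if "x \<in> space cube" for x
    using v(3)[OF that] G(2)[OF that] by simp
  have Tb: "c \<le> T k x \<and> T k x \<le> C + D" if "x \<in> space cube" for k x
    unfolding T_def by (rule line_avg_bounds[OF m b that])
  have Tm: "T k \<in> borel_measurable cube" for k unfolding T_def by (rule line_avg_measurable[OF m])
  have vT: "v x \<le> T k x" if x: "x \<in> space cube" for k x
  proof -
    have iv: "integrable unit_interval (\<lambda>t. v (x(k := t)))"
      by (rule line_integrable[OF v(1) _ x, of C]) (use v in force)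
    have iG: "integrable unit_interval (\<lambda>t. G (x(k := t)))"
      by (rule line_integrable[OF G(1) _ x, of D]) (use G in force)
    have "(\<integral>t. v x \<partial>unit_interval) \<le> (\<integral>t. v (x(k := t)) + line_avg k G x \<partial>unit_interval)"
      using osc[OF x] iv by (intro integral_mono) auto
    also have "\<dots> = line_avg k v x + line_avg k G x"
      using iv by (simp add: line_avg_def unit_interval.prob_space[simplified])
    also have "\<dots> = T k x" unfolding T_def line_avg_def using iv iG by simp
    finally show ?thesis by (simp add: unit_interval.prob_space[simplified])
  qed
  have pw: "v x powr ?q \<le> (\<Prod>k\<in>UNIV. T k x powr ?e)" if x: "x \<in> space cube" for x
  proof -
    have pos: "0 < v x" using v(2) v(3)[OF x] by simp
    have "v x powr ?q = (\<Prod>k\<in>(UNIV::'n set). v x powr ?e)"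
      using pos by (simp add: powr_power[symmetric] powr_realpow[symmetric] powr_powr)
    also have "\<dots> \<le> (\<Prod>k\<in>UNIV. T k x powr ?e)"
      using vT[OF x] pos by (intro prod_mono conjI powr_mono2) auto
    finally show ?thesis .
  qed
  have "(\<integral>x. v x powr ?q \<partial>cube) \<le> (\<integral>x. (\<Prod>k\<in>UNIV. T k x powr ?e) \<partial>cube)"
  proof (rule integral_mono')
    show "integrable cube (\<lambda>x. \<Prod>k\<in>UNIV. T k x powr ?e)"
    proof (rule cube_integrable)
      show "(\<lambda>x. \<Prod>l\<in>UNIV. T l x powr ?e) \<in> borel_measurable cube" using Tm by measurable
      fix x :: "'n \<Rightarrow> real" assume x: "x \<in> space cube"
      have "(\<Prod>l\<in>UNIV. T l x powr ?e) \<le> (\<Prod>l\<in>(UNIV::'n set). (C+D) powr ?e)"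
        using Tb[OF x] v(2) by (intro prod_mono conjI powr_mono2) (auto intro: order_trans[OF less_imp_le])
      moreover have "0 \<le> (\<Prod>l\<in>UNIV. T l x powr ?e)" by (intro prod_nonneg) auto
      ultimately show "\<bar>\<Prod>l\<in>UNIV. T l x powr ?e\<bar> \<le> (\<Prod>l\<in>(UNIV::'n set). (C+D) powr ?e)" by simp
    qed
    fix x :: "'n \<Rightarrow> real" assume x: "x \<in> space cube"
    show "v x powr ?q \<le> (\<Prod>k\<in>UNIV. T k x powr ?e)" by (rule pw[OF x])
  qed (auto intro!: prod_nonneg)
  also have "\<dots> \<le> (\<Prod>k\<in>UNIV. (\<integral>x. T k x \<partial>cube) powr ?e)"
  proof (rule gagliardo_prod[OF n Tm v(2) Tb])
    show "T l (x(l := t)) = T l x" for l x t by (simp add: T_def line_avg_def)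
  qed
  also have "\<dots> = (\<Prod>k\<in>(UNIV::'n set). (\<integral>x. v x + G x \<partial>cube) powr ?e)"
    unfolding T_def by (subst integral_line_avg[OF m, of "C + D"]) (use b v(2) in \<open>force+\<close>)
  also have "\<dots> = (\<integral>x. v x + G x \<partial>cube) powr ?q"
  proof -
    have "integral\<^sup>L cube (\<lambda>_ :: 'n \<Rightarrow> real. c) \<le> (\<integral>x. v x + G x \<partial>cube)"
      using b v(2) by (intro integral_mono cube_integrable[OF m, of "C+D"]) force+
    then have "0 < (\<integral>x. v x + G x \<partial>cube)" using v(2) by (simp add: cubeM.prob_space)
    then show ?thesis by (simp add: powr_power[symmetric] powr_realpow[symmetric] powr_powr)
  qed
  finally show ?thesis .
qed

section \<open>The Poincare inequality on the unit cube\<close>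

definition mix :: "'n set \<Rightarrow> ('n \<Rightarrow> real) \<Rightarrow> ('n \<Rightarrow> real) \<Rightarrow> 'n \<Rightarrow> real" where
  "mix S x y = (\<lambda>k. if k \<in> S then y k else x k)"

lemma mix_space: "x \<in> space cube \<Longrightarrow> y \<in> space cube \<Longrightarrow> mix S x y \<in> space cube"
  by (auto simp: space_cube mix_def)

lemma measurable_mix[measurable]:
  "(\<lambda>(x, y). mix S x y) \<in> measurable (cube \<Otimes>\<^sub>M cube) (cube :: ('n::finite \<Rightarrow> real) measure)"
proof -
  have "(\<lambda>p. (\<lambda>k\<in>UNIV. (if k \<in> S then snd p k else fst p k))) \<in> measurable (cube \<Otimes>\<^sub>M cube) (PiM UNIV (\<lambda>_::'n. unit_interval))"
  proof (rule measurable_restrict)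
    fix k :: 'n
    have c: "(\<lambda>x. x k) \<in> measurable cube unit_interval" unfolding cube_def by measurable
    show "(\<lambda>p. if k \<in> S then snd p k else fst p k) \<in> measurable (cube \<Otimes>\<^sub>M cube) unit_interval"
      using measurable_compose[OF measurable_fst c] measurable_compose[OF measurable_snd c] by (cases "k \<in> S") auto
  qed
  moreover have c: "PiM UNIV (\<lambda>_::'n. unit_interval) = cube" by (simp add: cube_def)
  ultimately show ?thesis unfolding c by (simp add: mix_def case_prod_unfold restrict_UNIV)
qed

text \<open>If \<open>x\<close> and \<open>y\<close> are independent and uniformly distributed in the cube, then so is the point that takes the
  coordinates in \<open>S\<close> from \<open>y\<close> and the others from \<open>x\<close>.\<close>

lemma distr_mix: "distr (cube \<Otimes>\<^sub>M cube) cube (\<lambda>(x, y). mix S x y) = (cube :: ('n::finite \<Rightarrow> real) measure)"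
proof -
  interpret pair_sigma_finite "cube :: ('n \<Rightarrow> real) measure" "cube :: ('n \<Rightarrow> real) measure"
    by (intro pair_sigma_finite.intro cubeM.sigma_finite_measure_axioms)
  have "PiM UNIV (\<lambda>_::'n. unit_interval) = distr (cube \<Otimes>\<^sub>M cube) cube (\<lambda>(x, y). mix S x y)"
  proof (rule cube.PiM_eqI[symmetric])
    show "sets (distr (cube \<Otimes>\<^sub>M cube) cube (\<lambda>(x, y). mix S x y)) = sets (PiM UNIV (\<lambda>_::'n. unit_interval))"
      by (simp add: cube_def)
    fix A :: "'n \<Rightarrow> real set" assume A: "\<And>k. k \<in> UNIV \<Longrightarrow> A k \<in> sets unit_interval"
    define A1 A2 where "A1 k = (if k \<in> S then {0..1} else A k)" and "A2 k = (if k \<in> S then A k else {0..1})" for k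
    have top: "{0..1} \<in> sets unit_interval" using sets.top[of unit_interval] by simp
    have s1: "Pi\<^sub>E UNIV A1 \<in> sets cube" and s2: "Pi\<^sub>E UNIV A2 \<in> sets cube" and s: "Pi\<^sub>E UNIV A \<in> sets cube"
      unfolding cube_def using A top by (auto intro!: sets_PiM_I_finite simp: A1_def A2_def)
    have sub: "A k \<subseteq> {0..1}" for k using sets.sets_into_space[of "A k" unit_interval] A by auto
    have "(\<lambda>(x, y). mix S x y) -` (Pi\<^sub>E UNIV A) \<inter> space (cube \<Otimes>\<^sub>M cube) = Pi\<^sub>E UNIV A1 \<times> Pi\<^sub>E UNIV A2"
    proof (rule set_eqI)
      fix p :: "('n \<Rightarrow> real) \<times> ('n \<Rightarrow> real)"
      obtain x y where p: "p = (x, y)" by (cases p)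
      have "(\<forall>k. mix S x y k \<in> A k) \<and> x \<in> space cube \<and> y \<in> space cube \<longleftrightarrow>
         (\<forall>k. x k \<in> A1 k) \<and> (\<forall>k. y k \<in> A2 k)"
        using sub unfolding A1_def A2_def mix_def space_cube by (smt (verit, best) subset_iff)
      moreover have "f \<in> Pi\<^sub>E UNIV B \<longleftrightarrow> (\<forall>k. f k \<in> B k)" for f :: "'n \<Rightarrow> real" and B by (auto simp: PiE_def)
      ultimately show "p \<in> (\<lambda>(x, y). mix S x y) -` (Pi\<^sub>E UNIV A) \<inter> space (cube \<Otimes>\<^sub>M cube) \<longleftrightarrow> p \<in> Pi\<^sub>E UNIV A1 \<times> Pi\<^sub>E UNIV A2"
        unfolding p by (simp add: space_pair_measure)
    qed
    then have "emeasure (distr (cube \<Otimes>\<^sub>M cube) cube (\<lambda>(x, y). mix S x y)) (Pi\<^sub>E UNIV A) 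
        = emeasure cube (Pi\<^sub>E UNIV A1) * emeasure cube (Pi\<^sub>E UNIV A2)"
      using s s1 s2 by (subst emeasure_distr) (auto simp: cubeM.emeasure_pair_measure_Times)
    also have "\<dots> = (\<Prod>k\<in>UNIV. emeasure unit_interval (A1 k)) * (\<Prod>k\<in>UNIV. emeasure unit_interval (A2 k))"
      unfolding cube_def using A top by (subst (1 2) cube.emeasure_PiM) (auto simp: A1_def A2_def)
    also have "\<dots> = (\<Prod>k\<in>UNIV. emeasure unit_interval (A k))"
      unfolding prod.distrib[symmetric] using unit_interval.emeasure_space_1 by (intro prod.cong) (auto simp: A1_def A2_def)
    finally show "emeasure (distr (cube \<Otimes>\<^sub>M cube) cube (\<lambda>(x, y). mix S x y)) (Pi\<^sub>E UNIV A) = (\<Prod>k\<in>UNIV. emeasure unit_interval (A k))" .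
  qed simp
  then show ?thesis by (simp add: cube_def)
qed

text \<open>Going from \<open>x\<close> to \<open>y\<close> by replacing one coordinate at a time, each of the \<open>n\<close> steps starts at a point
  \<open>mix S x y\<close> which is again uniformly distributed (\<open>distr_mix\<close>), so it costs at most \<open>\<integral> F\<close> on average.\<close>

lemma poincare_cube:
  fixes \<rho> :: "('n::finite \<Rightarrow> real) \<Rightarrow> ('n \<Rightarrow> real) \<Rightarrow> ennreal" and F :: "('n \<Rightarrow> real) \<Rightarrow> ennreal"
  assumes m: "(\<lambda>(x, y). \<rho> x y) \<in> borel_measurable (cube \<Otimes>\<^sub>M cube)"
    and F: "F \<in> borel_measurable cube"
    and refl: "\<And>x. x \<in> space cube \<Longrightarrow> \<rho> x x = 0"
    and tri: "\<And>x y z. x \<in> space cube \<Longrightarrow> y \<in> space cube \<Longrightarrow> z \<in> space cube \<Longrightarrow> \<rho> x z \<le> \<rho> x y + \<rho> y z"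
    and step: "\<And>x k t. x \<in> space cube \<Longrightarrow> t \<in> {0..1} \<Longrightarrow> \<rho> x (x(k := t)) \<le> (\<integral>\<^sup>+s. F (x(k := s)) \<partial>unit_interval)"
  shows "(\<integral>\<^sup>+x. (\<integral>\<^sup>+y. \<rho> x y \<partial>cube) \<partial>cube) \<le> of_nat (CARD('n)) * (\<integral>\<^sup>+x. F x \<partial>cube)"
proof -
  interpret pair_sigma_finite "cube :: ('n \<Rightarrow> real) measure" "cube :: ('n \<Rightarrow> real) measure"
    by (intro pair_sigma_finite.intro cubeM.sigma_finite_measure_axioms)
  let ?P = "(cube :: ('n \<Rightarrow> real) measure) \<Otimes>\<^sub>M (cube :: ('n \<Rightarrow> real) measure)"
  define E where "E k x = (\<integral>\<^sup>+s. F (x(k := s)) \<partial>unit_interval)" for k x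
  have Em: "E k \<in> borel_measurable cube" for k
    unfolding E_def using unit_interval.borel_measurable_nn_integral[OF measurable_compose_fun_upd_cube[OF F]] .
  have "(\<integral>\<^sup>+p. \<rho> (fst p) (mix S (fst p) (snd p)) \<partial>?P) \<le> of_nat (card S) * (\<integral>\<^sup>+x. F x \<partial>cube)" for S :: "'n set"
  proof (induction S rule: finite_induct[OF finite])
    case 1
    have "(\<integral>\<^sup>+p. \<rho> (fst p) (mix {} (fst p) (snd p)) \<partial>?P) = (\<integral>\<^sup>+p. 0 \<partial>?P)"
      by (intro nn_integral_cong) (auto simp: mix_def space_pair_measure refl)
    then show ?case by simp
  next
    case (2 k S)
    have mm: "(\<lambda>p. mix S (fst p) (snd p)) \<in> measurable ?P cube"
      using measurable_mix[of S] by (simp add: case_prod_unfold)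
    have m1: "(\<lambda>p. \<rho> (fst p) (mix S (fst p) (snd p))) \<in> borel_measurable ?P"
      using measurable_compose[OF measurable_Pair[OF measurable_fst mm] m] by simp
    have m2: "(\<lambda>p. E k (mix S (fst p) (snd p))) \<in> borel_measurable ?P"
      by (rule measurable_compose[OF mm Em])
    have "(\<integral>\<^sup>+p. \<rho> (fst p) (mix (insert k S) (fst p) (snd p)) \<partial>?P)
        \<le> (\<integral>\<^sup>+p. \<rho> (fst p) (mix S (fst p) (snd p)) + E k (mix S (fst p) (snd p)) \<partial>?P)"
    proof (intro nn_integral_mono)
      fix p assume "p \<in> space ?P"
      then have p: "fst p \<in> space cube" "snd p \<in> space cube" by (auto simp: space_pair_measure)
      let ?z = "mix S (fst p) (snd p)"
      have z: "?z \<in> space cube" using p by (rule mix_space)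
      have w: "mix (insert k S) (fst p) (snd p) = ?z(k := snd p k)" by (auto simp: mix_def)
      have "snd p k \<in> {0..1}" using p by (auto simp: space_cube)
      then have "\<rho> ?z (mix (insert k S) (fst p) (snd p)) \<le> E k ?z" unfolding w E_def using z step by blast
      then show "\<rho> (fst p) (mix (insert k S) (fst p) (snd p)) \<le> \<rho> (fst p) ?z + E k ?z"
        using tri[OF p(1) z mix_space[OF p, of "insert k S"]] by (meson add_left_mono order_trans)
    qed
    also have "\<dots> = (\<integral>\<^sup>+p. \<rho> (fst p) (mix S (fst p) (snd p)) \<partial>?P) + (\<integral>\<^sup>+p. E k (mix S (fst p) (snd p)) \<partial>?P)"
      by (rule nn_integral_add[OF m1 m2])
    also have "(\<integral>\<^sup>+p. E k (mix S (fst p) (snd p)) \<partial>?P) = (\<integral>\<^sup>+x. E k x \<partial>distr ?P cube (\<lambda>(x, y). mix S x y))"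
      by (subst nn_integral_distr[OF measurable_mix]) (simp_all add: Em case_prod_unfold)
    also have "\<dots> = (\<integral>\<^sup>+x. F x \<partial>cube)"
      unfolding distr_mix E_def by (rule nn_integral_line_avg[OF F])
    also have "(\<integral>\<^sup>+p. \<rho> (fst p) (mix S (fst p) (snd p)) \<partial>?P) + (\<integral>\<^sup>+x. F x \<partial>cube) 
       \<le> of_nat (card S) * (\<integral>\<^sup>+x. F x \<partial>cube) + (\<integral>\<^sup>+x. F x \<partial>cube)"
      using 2(3) by (rule add_right_mono)
    also have "\<dots> = of_nat (card (insert k S)) * (\<integral>\<^sup>+x. F x \<partial>cube)"
      using 2 by (simp add: distrib_right add.commute)
    finally show ?case .
  qed
  from this[of UNIV] have "(\<integral>\<^sup>+p. \<rho> (fst p) (snd p) \<partial>?P) \<le> of_nat (CARD('n)) * (\<integral>\<^sup>+x. F x \<partial>cube)"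
    by (simp add: mix_def)
  then show ?thesis
    using cubeM.nn_integral_fst[OF m] by (simp add: case_prod_unfold)
qed

section \<open>Upper gradients of powers\<close>

lemma powr_diff_le:
  fixes p q \<gamma> :: real
  assumes "0 < p" "p \<le> q" "1 \<le> \<gamma>"
  shows "q powr \<gamma> - p powr \<gamma> \<le> \<gamma> * q powr (\<gamma> - 1) * (q - p)"
proof (cases "p = q")
  case False
  then have "p < q" using assms by simp
  have "\<exists>z. z > p \<and> z < q \<and> q powr \<gamma> - p powr \<gamma> = (q - p) * (\<gamma> * z powr (\<gamma> - 1))"
    using \<open>p < q\<close> assms by (intro MVT2) (auto intro!: derivative_eq_intros)
  then obtain z where z: "z > p" "z < q" "q powr \<gamma> - p powr \<gamma> = (q - p) * (\<gamma> * z powr (\<gamma> - 1))" by blast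
  have "z powr (\<gamma> - 1) \<le> q powr (\<gamma> - 1)" using z assms by (intro powr_mono2) auto
  then have "(q - p) * (\<gamma> * z powr (\<gamma> - 1)) \<le> (q - p) * (\<gamma> * q powr (\<gamma> - 1))"
    using assms by (intro mult_left_mono) auto
  then show ?thesis using z by (simp add: mult_ac)
qed simp

text \<open>The chain rule for upper gradients. Locally the mean value bound \<open>powr_diff_le\<close> gives the estimate with
  an error \<open>\<delta>\<close> in the factor \<open>\<gamma> u^(\<gamma>-1)\<close>; the local estimates add up over \<open>{a..b}\<close> by compactness
  (\<open>Bolzano\<close>), and \<open>\<delta>\<close> is arbitrary.\<close>

lemma powr_upper_gradient:
  fixes u F :: "real \<Rightarrow> real"
  assumes ab: "a \<le> b" and cu: "continuous_on {a..b} u" and cF: "continuous_on {a..b} F"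
    and u: "\<And>t. t \<in> {a..b} \<Longrightarrow> 0 < u t" and F: "\<And>t. t \<in> {a..b} \<Longrightarrow> 0 \<le> F t"
    and osc: "\<And>s t. a \<le> s \<Longrightarrow> s \<le> t \<Longrightarrow> t \<le> b \<Longrightarrow> \<bar>u t - u s\<bar> \<le> integral {s..t} F"
    and \<gamma>: "1 \<le> \<gamma>"
  shows "\<bar>u b powr \<gamma> - u a powr \<gamma>\<bar> \<le> integral {a..b} (\<lambda>t. \<gamma> * u t powr (\<gamma> - 1) * F t)"
proof (rule field_le_epsilon)
  fix e :: real assume e: "0 < e"
  define I where "I = integral {a..b} F"
  have I0: "0 \<le> I" unfolding I_def using F by (intro integral_nonneg integrable_continuous_real cF) auto
  \<comment> \<open>The denominator \<open>I + 1\<close> avoids a division by zero.\<close>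
  define \<delta> where "\<delta> = e / (I + 1)"
  have \<delta>: "0 < \<delta>" "\<delta> * I \<le> e"
    using e I0 by (auto simp: \<delta>_def field_simps)
  define w where "w t = \<gamma> * u t powr (\<gamma> - 1)" for t
  have cw: "continuous_on {a..b} w"
  proof -
    have "\<forall>t\<in>{a..b}. u t \<noteq> 0" using u by force
    then show ?thesis unfolding w_def using cu by (intro continuous_intros)
  qed
  have cwF: "continuous_on {a..b} (\<lambda>t. (w t + \<delta>) * F t)" using cw cF by (intro continuous_intros)
  define P where "P s t \<longleftrightarrow> (a \<le> s \<and> s \<le> t \<and> t \<le> b \<longrightarrow> \<bar>u t powr \<gamma> - u s powr \<gamma>\<bar> \<le> integral {s..t} (\<lambda>t. (w t + \<delta>) * F t))" for s t
  have "P a b"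
  proof (rule Bolzano[OF ab])
    fix r s t assume P: "P r s" "P s t" and o: "r \<le> s" "s \<le> t"
    show "P r t" unfolding P_def
    proof
      assume rt: "a \<le> r \<and> r \<le> t \<and> t \<le> b"
      then have "integral {r..s} (\<lambda>t. (w t + \<delta>) * F t) + integral {s..t} (\<lambda>t. (w t + \<delta>) * F t) = integral {r..t} (\<lambda>t. (w t + \<delta>) * F t)"
        using o by (intro Henstock_Kurzweil_Integration.integral_combine integrable_continuous_real continuous_on_subset[OF cwF]) auto
      then show "\<bar>u t powr \<gamma> - u r powr \<gamma>\<bar> \<le> integral {r..t} (\<lambda>t. (w t + \<delta>) * F t)"
        using P rt o unfolding P_def by linarith
    qed
  next
    fix x assume x: "a \<le> x" "x \<le> b"
    have "\<forall>e>0. \<exists>d>0. \<forall>y\<in>{a..b}. dist y x < d \<longrightarrow> dist (w y) (w x) < e"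
      using cw x unfolding continuous_on_iff by auto
    then obtain d where d: "d > 0" "\<And>y. y \<in> {a..b} \<Longrightarrow> \<bar>y - x\<bar> < d \<Longrightarrow> \<bar>w y - w x\<bar> < \<delta> / 2"
      using \<delta> by (metis dist_real_def half_gt_zero)
    have "P s t" if st: "s \<le> x" "x \<le> t" "t - s < d" for s t
      unfolding P_def
    proof
      assume o: "a \<le> s \<and> s \<le> t \<and> t \<le> b"
      have wb: "\<bar>w y - w x\<bar> < \<delta> / 2" if "y \<in> {s..t}" for y using that st o by (intro d) auto
      have us: "0 < u s" "0 < u t" using u o by auto
      have 1: "\<bar>u t powr \<gamma> - u s powr \<gamma>\<bar> \<le> max (w s) (w t) * \<bar>u t - u s\<bar>"
      proof (cases "u s \<le> u t")
        case True
        have "u t powr \<gamma> - u s powr \<gamma> \<le> w t * (u t - u s)" unfolding w_def using us True \<gamma> by (intro powr_diff_le) auto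
        moreover have "w t * (u t - u s) \<le> max (w s) (w t) * (u t - u s)" using True by (intro mult_right_mono) auto
        moreover have "u s powr \<gamma> \<le> u t powr \<gamma>" using us True \<gamma> by (intro powr_mono2) auto
        moreover have "\<bar>u t - u s\<bar> = u t - u s" using True by simp
        ultimately show ?thesis by linarith
      next
        case False
        have "u s powr \<gamma> - u t powr \<gamma> \<le> w s * (u s - u t)" unfolding w_def using us False \<gamma> by (intro powr_diff_le) auto
        moreover have "w s * (u s - u t) \<le> max (w s) (w t) * (u s - u t)" using False by (intro mult_right_mono) auto
        moreover have "u t powr \<gamma> \<le> u s powr \<gamma>" using us False \<gamma> by (intro powr_mono2) auto
        moreover have "\<bar>u t - u s\<bar> = u s - u t" using False by simp
        moreover have "\<bar>u t powr \<gamma> - u s powr \<gamma>\<bar> = u s powr \<gamma> - u t powr \<gamma>" using calculation(3) by simp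
        ultimately show ?thesis by simp
      qed
      have w0: "0 \<le> w y" for y using \<gamma> by (simp add: w_def)
      have "max (w s) (w t) * \<bar>u t - u s\<bar> \<le> (w x + \<delta> / 2) * integral {s..t} F"
        using wb[of s] wb[of t] st osc[of s t] o w0[of s] w0[of x] \<delta> by (intro mult_mono) (auto simp: abs_if split: if_splits)
      also have "\<dots> = integral {s..t} (\<lambda>y. (w x + \<delta> / 2) * F y)" by simp
      also have "\<dots> \<le> integral {s..t} (\<lambda>y. (w y + \<delta>) * F y)"
      proof (rule integral_le)
        show "(\<lambda>y. (w x + \<delta> / 2) * F y) integrable_on {s..t}"
          using o by (intro integrable_continuous_real continuous_intros continuous_on_subset[OF cF]) auto
        show "(\<lambda>y. (w y + \<delta>) * F y) integrable_on {s..t}"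
          using o by (intro integrable_continuous_real continuous_on_subset[OF cwF]) auto
        fix y assume y: "y \<in> {s..t}"
        show "(w x + \<delta> / 2) * F y \<le> (w y + \<delta>) * F y"
          using wb[OF y] F[of y] y o by (intro mult_right_mono) (auto simp: abs_if split: if_splits)
      qed
      finally show "\<bar>u t powr \<gamma> - u s powr \<gamma>\<bar> \<le> integral {s..t} (\<lambda>t. (w t + \<delta>) * F t)" using 1 by linarith
    qed
    then show "\<exists>d>0. \<forall>a b. a \<le> x \<and> x \<le> b \<and> b - a < d \<longrightarrow> P a b" using d by blast
  qed
  then have "\<bar>u b powr \<gamma> - u a powr \<gamma>\<bar> \<le> integral {a..b} (\<lambda>t. (w t + \<delta>) * F t)" using ab by (simp add: P_def)
  also have "\<dots> = integral {a..b} (\<lambda>t. w t * F t + \<delta> * F t)" by (simp add: algebra_simps)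
  also have "\<dots> = integral {a..b} (\<lambda>t. w t * F t) + \<delta> * I"
    unfolding I_def by (subst integral_add) (auto intro!: integrable_continuous_real continuous_intros cw cF)
  finally show "\<bar>u b powr \<gamma> - u a powr \<gamma>\<bar> \<le> integral {a..b} (\<lambda>t. \<gamma> * u t powr (\<gamma> - 1) * F t) + e"
    using \<delta> by (simp add: w_def)
qed

section \<open>Affine images of the unit cube\<close>

lemma measurable_coordinates:
  "(\<lambda>v k. v $ k) \<in> measurable (restrict_space lborel (cbox 0 (\<chi> k. 1))) (cube :: ('n::finite \<Rightarrow> real) measure)"
proof -
  let ?R = "restrict_space lborel (cbox 0 (\<chi> k. 1)) :: (real^'n) measure"
  have "(\<lambda>v. \<lambda>k\<in>UNIV. v $ k) \<in> measurable ?R (PiM UNIV (\<lambda>_::'n. unit_interval))"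
    unfolding unit_interval_def
  proof (rule measurable_restrict, rule measurable_restrict_space2)
    fix k :: 'n
    show "(\<lambda>v. v $ k) \<in> space ?R \<rightarrow> {0..1}" by (auto simp: space_restrict_space mem_box_cart)
    show "(\<lambda>v. v $ k) \<in> measurable ?R lborel" by (intro measurable_restrict_space1) simp
  qed
  then show ?thesis by (simp add: cube_def restrict_UNIV)
qed

lemma cube_eq_distr:
  "cube = distr (restrict_space lborel (cbox 0 (\<chi> k. 1))) (cube :: ('n::finite \<Rightarrow> real) measure) (\<lambda>v k. v $ k)"
proof -
  let ?R = "restrict_space lborel (cbox 0 (\<chi> k. 1)) :: (real^'n) measure"
  have "PiM UNIV (\<lambda>_::'n. unit_interval) = distr ?R cube (\<lambda>v k. v $ k)"
  proof (rule cube.PiM_eqI[symmetric])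
    fix A :: "'n \<Rightarrow> real set" assume A: "\<And>k. k \<in> UNIV \<Longrightarrow> A k \<in> sets unit_interval"
    have As: "A k \<in> sets borel" "A k \<subseteq> {0..1}" for k
      using A[of k] by (auto simp: unit_interval_def sets_restrict_space_iff)
    have range01: "0 \<le> v $ i" "v $ i \<le> 1" if "\<forall>k. v $ k \<in> A k" for v :: "real^'n" and i
      using As(2)[of i] that by (auto dest: spec[of _ i])
    have "emeasure (distr ?R cube (\<lambda>v k. v $ k)) (Pi\<^sub>E UNIV A) = emeasure ?R {v. \<forall>k. v $ k \<in> A k}"
    proof (subst emeasure_distr)
      show "(\<lambda>v k. v $ k) \<in> measurable ?R cube" by (rule measurable_coordinates)
      show "Pi\<^sub>E UNIV A \<in> sets cube" unfolding cube_def using A by (intro sets_PiM_I_finite) auto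
      show "emeasure ?R ((\<lambda>v k. v $ k) -` Pi\<^sub>E UNIV A \<inter> space ?R) = emeasure ?R {v. \<forall>k. v $ k \<in> A k}"
        by (intro arg_cong2[where f=emeasure]) (auto simp: space_restrict_space mem_box_cart PiE_def Pi_def range01)
    qed
    also have "\<dots> = emeasure lborel {v :: real^'n. \<forall>k. v $ k \<in> A k}"
    proof (rule emeasure_restrict_space)
      show "{v :: real^'n. \<forall>k. v $ k \<in> A k} \<subseteq> cbox 0 (\<chi> k. 1)"
        by (auto simp: mem_box_cart range01)
    qed simp
    also have "\<dots> = integral\<^sup>N lborel (\<lambda>v::real^'n. \<Prod>b\<in>Basis. indicator (A (axis_index b)) (v \<bullet> b))"
    proof -
      have fa: "indicator {v :: real^'n. \<forall>k. v $ k \<in> A k} v = (\<Prod>b\<in>Basis. indicator (A (axis_index b)) (v \<bullet> b) :: ennreal)" for v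
      proof -
        have "(\<Prod>b\<in>Basis. indicator (A (axis_index b)) (v \<bullet> b) :: ennreal) = (\<Prod>k\<in>UNIV. indicator (A k) (v $ k))"
          unfolding Basis_vec_def by (subst prod.UNION_disjoint) (auto simp: inner_axis axis_eq_axis axis_index_axis)
        also have "\<dots> = indicator {v. \<forall>k. v $ k \<in> A k} v"
          by (auto simp: indicator_def prod_zero_iff)
        finally show ?thesis by simp
      qed
      have "{v :: real^'n. \<forall>k. v $ k \<in> A k} \<in> sets borel"
      proof -
        have "{v :: real^'n. \<forall>k. v $ k \<in> A k} = (\<Inter>k\<in>UNIV. (\<lambda>v. v $ k) -` A k \<inter> space borel)" by auto
        also have "\<dots> \<in> sets borel" using As by (intro sets.finite_INT measurable_sets[of _ borel borel]) auto
        finally show ?thesis .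
      qed
      then show ?thesis unfolding fa[symmetric] by simp
    qed
    also have "\<dots> = (\<Prod>b\<in>(Basis :: (real^'n) set). (\<integral>\<^sup>+t. indicator (A (axis_index b)) t \<partial>lborel))"
      using As by (intro nn_integral_lborel_prod) auto
    also have "\<dots> = (\<Prod>k\<in>UNIV. emeasure lborel (A k))"
      unfolding Basis_vec_def using As by (subst prod.UNION_disjoint) (auto simp: axis_eq_axis axis_index_axis)
    also have "\<dots> = (\<Prod>k\<in>UNIV. emeasure unit_interval (A k))"
      unfolding unit_interval_def using As by (intro prod.cong refl emeasure_restrict_space[symmetric]) auto
    finally show "emeasure (distr ?R cube (\<lambda>v k. v $ k)) (Pi\<^sub>E UNIV A) = (\<Prod>k\<in>UNIV. emeasure unit_interval (A k))" .
  qed (simp_all add: cube_def)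
  then show ?thesis by (simp add: cube_def)
qed

text \<open>Passage from the probability measure on functions \<open>'n \<Rightarrow> real\<close> to Lebesgue measure on a cube of side \<open>l\<close>
  in \<open>real^'n\<close>.\<close>

lemma nn_integral_cube_affine:
  fixes \<psi> :: "real^'n::finite \<Rightarrow> ennreal"
  assumes \<psi>: "\<psi> \<in> borel_measurable borel" and l: "0 < l"
  shows "(\<integral>\<^sup>+x. \<psi> (a + l *\<^sub>R (\<chi> k. x k)) \<partial>cube) = 
     ennreal (1 / l ^ CARD('n)) * (\<integral>\<^sup>+v. \<psi> v * indicator (cbox a (a + l *\<^sub>R (\<chi> k. 1))) v \<partial>lborel)"
proof -
  let ?K = "cbox 0 (\<chi> k. 1) :: (real^'n) set" and ?L = "cbox a (a + l *\<^sub>R (\<chi> k. 1)) :: (real^'n) set"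
  let ?R = "restrict_space lborel ?K"
  have mv: "(\<lambda>x::'n \<Rightarrow> real. \<chi> k. x k) \<in> borel_measurable cube"
  proof (subst borel_measurable_euclidean_space, rule ballI)
    fix b :: "real^'n" assume "b \<in> Basis"
    then obtain k where b: "b = axis k 1" by (auto simp: Basis_vec_def)
    have "(\<lambda>x. x k) \<in> measurable cube unit_interval" unfolding cube_def by measurable
    moreover have "(\<lambda>t. t) \<in> measurable unit_interval borel"
      unfolding unit_interval_def by (intro measurable_restrict_space1) simp
    ultimately have "(\<lambda>x::'n \<Rightarrow> real. x k) \<in> borel_measurable cube" by (rule measurable_compose)
    then show "(\<lambda>x::'n \<Rightarrow> real. (\<chi> k. x k) \<bullet> b) \<in> borel_measurable cube" by (simp add: b inner_axis)
  qed
  have m1: "(\<lambda>v. \<psi> (a + l *\<^sub>R v)) \<in> borel_measurable borel" using \<psi> by measurable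
  have m2: "(\<lambda>x. \<psi> (a + l *\<^sub>R (\<chi> k. x k))) \<in> borel_measurable cube" by (rule measurable_compose[OF mv m1])
  have "(\<integral>\<^sup>+x. \<psi> (a + l *\<^sub>R (\<chi> k. x k)) \<partial>cube) = (\<integral>\<^sup>+x. \<psi> (a + l *\<^sub>R (\<chi> k. x k)) \<partial>distr ?R cube (\<lambda>v k. v $ k))"
    using cube_eq_distr by metis
  also have "\<dots> = (\<integral>\<^sup>+v. \<psi> (a + l *\<^sub>R v) \<partial>?R)"
    using m2 by (subst nn_integral_distr[OF measurable_coordinates]) (auto simp: vec_lambda_eta)
  also have "\<dots> = (\<integral>\<^sup>+v. \<psi> (a + l *\<^sub>R v) * indicator ?K v \<partial>lborel)"
    by (subst nn_integral_restrict_space) auto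
  also have "\<dots> = (\<integral>\<^sup>+v. \<psi> (a + l *\<^sub>R v) * indicator ?L (a + l *\<^sub>R v) \<partial>lborel)"
    using l by (intro nn_integral_cong) (auto simp: indicator_def mem_box_cart zero_le_mult_iff)
  also have "\<dots> = (\<integral>\<^sup>+v. \<psi> v * indicator ?L v \<partial>distr lborel borel (\<lambda>v. a + l *\<^sub>R v))"
    using \<psi> by (subst nn_integral_distr) auto
  also have "\<dots> = ennreal (1 / l ^ CARD('n)) * (\<integral>\<^sup>+v. \<psi> v * indicator ?L v \<partial>density (distr lborel borel (\<lambda>v. a + l *\<^sub>R v)) (\<lambda>_. \<bar>l\<bar>^DIM(real^'n)))"
  proof -
    let ?I = "\<integral>\<^sup>+v. \<psi> v * indicator ?L v \<partial>distr lborel borel (\<lambda>v. a + l *\<^sub>R v)"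
    have "ennreal (1 / l ^ CARD('n)) * (ennreal (l ^ CARD('n)) * ?I) = ?I"
      using l by (simp add: mult.assoc[symmetric] ennreal_mult[symmetric])
    moreover have "(\<integral>\<^sup>+v. \<psi> v * indicator ?L v \<partial>density (distr lborel borel (\<lambda>v. a + l *\<^sub>R v)) (\<lambda>_. \<bar>l\<bar>^DIM(real^'n))) = ennreal (l ^ CARD('n)) * ?I"
      using \<psi> l by (subst nn_integral_density) (auto simp: nn_integral_cmult)
    ultimately show ?thesis by simp
  qed
  also have "density (distr lborel borel (\<lambda>v. a + l *\<^sub>R v)) (\<lambda>_. \<bar>l\<bar>^DIM(real^'n)) = (lborel :: (real^'n) measure)"
    using lborel_affine[of l a] l by simp
  finally show ?thesis .
qed

section \<open>Concatenation of curves and the length distance\<close>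

lemma C1_curve_on_affine:
  assumes C1: "C1_curve_on M \<gamma> (c * a + d) (c * b + d)" and c: "0 < c"
    and eq: "\<And>t. t \<in> {a..b} \<Longrightarrow> \<eta> t = \<gamma> (c * t + d)"
  shows "C1_curve_on M \<eta> a b"
  unfolding C1_curve_on_def
proof
  fix i assume i: "i \<in> charts M"
  let ?S = "{t \<in> {c * a + d..c * b + d}. \<gamma> t \<in> cdom M i}"
  from C1 i obtain D where cD: "continuous_on ?S D"
    and D: "\<And>t. t \<in> {c * a + d..c * b + d} \<Longrightarrow> \<gamma> t \<in> cdom M i \<Longrightarrow>
        ((cmap M i \<circ> \<gamma>) has_vector_derivative D t) (at t within {c * a + d..c * b + d})"
    unfolding C1_curve_on_def by blast
  have img: "c * t + d \<in> {c * a + d..c * b + d}" if "t \<in> {a..b}" for t using that c by auto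
  show "\<exists>D. continuous_on {t \<in> {a..b}. \<eta> t \<in> cdom M i} D \<and>
      (\<forall>t\<in>{a..b}. \<eta> t \<in> cdom M i \<longrightarrow> ((cmap M i \<circ> \<eta>) has_vector_derivative D t) (at t within {a..b}))"
  proof (intro exI conjI ballI impI)
    show "continuous_on {t \<in> {a..b}. \<eta> t \<in> cdom M i} (\<lambda>t. c *\<^sub>R D (c * t + d))"
      by (intro continuous_intros continuous_on_compose2[OF cD]) (use img eq in auto)
    fix t assume t: "t \<in> {a..b}" "\<eta> t \<in> cdom M i"
    have "((\<lambda>t. c * t + d) has_vector_derivative c) (at t within {a..b})"
      by (auto intro!: derivative_eq_intros)
    moreover have "((cmap M i \<circ> \<gamma>) has_vector_derivative D (c * t + d)) (at (c * t + d) within (\<lambda>t. c * t + d) ` {a..b})"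
      by (rule has_vector_derivative_within_subset[OF D]) (use t img eq in auto)
    ultimately have "((cmap M i \<circ> \<gamma>) \<circ> (\<lambda>t. c * t + d) has_vector_derivative c *\<^sub>R D (c * t + d)) (at t within {a..b})"
      by (rule vector_diff_chain_within)
    then show "((cmap M i \<circ> \<eta>) has_vector_derivative c *\<^sub>R D (c * t + d)) (at t within {a..b})"
      by (rule has_vector_derivative_transform[OF t(1), rotated]) (simp add: eq)
  qed
qed

lemma partition_mono:
  fixes s :: "nat \<Rightarrow> real"
  assumes "\<And>i. i < k \<Longrightarrow> s i < s (Suc i)" "i \<le> j" "j \<le> k"
  shows "s i \<le> s j"
  using assms(2,3)
proof (induction rule: dec_induct)
  case (step m)
  then show ?case using assms(1)[of m] by simp
qed simp

definition curve_join :: "(real \<Rightarrow> 'a) \<Rightarrow> (real \<Rightarrow> 'a) \<Rightarrow> real \<Rightarrow> 'a" where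
  "curve_join \<gamma>\<^sub>1 \<gamma>\<^sub>2 = (\<lambda>t. if t \<le> 1/2 then \<gamma>\<^sub>1 (2 * t) else \<gamma>\<^sub>2 (2 * t - 1))"

lemma piecewise_C1_curve_join:
  assumes 1: "piecewise_C1_curve M \<gamma>\<^sub>1" and 2: "piecewise_C1_curve M \<gamma>\<^sub>2" and eq: "\<gamma>\<^sub>1 1 = \<gamma>\<^sub>2 0"
  shows "piecewise_C1_curve M (curve_join \<gamma>\<^sub>1 \<gamma>\<^sub>2)"
proof -
  obtain k\<^sub>1 s\<^sub>1 where s1: "s\<^sub>1 0 = 0" "s\<^sub>1 k\<^sub>1 = 1" "\<And>i. i < k\<^sub>1 \<Longrightarrow> s\<^sub>1 i < s\<^sub>1 (Suc i)"
      "\<And>i. i < k\<^sub>1 \<Longrightarrow> C1_curve_on M \<gamma>\<^sub>1 (s\<^sub>1 i) (s\<^sub>1 (Suc i))"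
    using 1 unfolding piecewise_C1_curve_def by blast
  obtain k\<^sub>2 s\<^sub>2 where s2: "s\<^sub>2 0 = 0" "s\<^sub>2 k\<^sub>2 = 1" "\<And>i. i < k\<^sub>2 \<Longrightarrow> s\<^sub>2 i < s\<^sub>2 (Suc i)"
      "\<And>i. i < k\<^sub>2 \<Longrightarrow> C1_curve_on M \<gamma>\<^sub>2 (s\<^sub>2 i) (s\<^sub>2 (Suc i))"
    using 2 unfolding piecewise_C1_curve_def by blast
  have b1: "s\<^sub>1 i \<le> 1" if "i \<le> k\<^sub>1" for i using partition_mono[of k\<^sub>1 s\<^sub>1 i k\<^sub>1, OF s1(3) that order_refl] s1(2) by simp
  have b2: "0 \<le> s\<^sub>2 i" if "i \<le> k\<^sub>2" for i using partition_mono[of k\<^sub>2 s\<^sub>2 0 i, OF s2(3) _ that] s2(1) by simp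
  have c1: "continuous_map (top_of_set {0..1}) (points M) \<gamma>\<^sub>1" and c2: "continuous_map (top_of_set {0..1}) (points M) \<gamma>\<^sub>2"
    using 1 2 unfolding piecewise_C1_curve_def by blast+
  have cont: "continuous_map (top_of_set {0..1}) (points M) (curve_join \<gamma>\<^sub>1 \<gamma>\<^sub>2)"
    unfolding curve_join_def
  proof (rule continuous_map_cases_le)
    show "continuous_map (top_of_set {0..1}) euclideanreal (\<lambda>t::real. t)" by simp
    show "continuous_map (top_of_set {0..1::real}) euclideanreal (\<lambda>t. 1/2)" by simp
    let ?X = "top_of_set {0..1::real}"
    have "continuous_map (subtopology ?X {t \<in> topspace ?X. t \<le> 1/2}) ?X (\<lambda>t. 2 * t)"
      by (auto simp: subtopology_subtopology continuous_map_in_subtopology intro!: continuous_intros)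
    from continuous_map_compose[OF this c1]
    show "continuous_map (subtopology ?X {t \<in> topspace ?X. t \<le> 1/2}) (points M) (\<lambda>t. \<gamma>\<^sub>1 (2 * t))" by (simp add: o_def)
    have "continuous_map (subtopology ?X {t \<in> topspace ?X. 1/2 \<le> t}) ?X (\<lambda>t. 2 * t - 1)"
      by (auto simp: subtopology_subtopology continuous_map_in_subtopology intro!: continuous_intros)
    from continuous_map_compose[OF this c2]
    show "continuous_map (subtopology ?X {t \<in> topspace ?X. 1/2 \<le> t}) (points M) (\<lambda>t. \<gamma>\<^sub>2 (2 * t - 1))" by (simp add: o_def)
    fix t :: real assume "t \<in> topspace ?X" "t = 1/2"
    then have "2 * t = 1" by simp
    then show "\<gamma>\<^sub>1 (2 * t) = \<gamma>\<^sub>2 (2 * t - 1)" using eq by (simp only:) simp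
  qed
  define s where "s i = (if i \<le> k\<^sub>1 then s\<^sub>1 i / 2 else 1/2 + s\<^sub>2 (i - k\<^sub>1) / 2)" for i
  have s': "s i = 1/2 + s\<^sub>2 (i - k\<^sub>1) / 2" if "k\<^sub>1 \<le> i" for i
    using that s1 s2 by (cases "i = k\<^sub>1") (auto simp: s_def)
  have "s i < s (Suc i) \<and> C1_curve_on M (curve_join \<gamma>\<^sub>1 \<gamma>\<^sub>2) (s i) (s (Suc i))" if i: "i < k\<^sub>1 + k\<^sub>2" for i
  proof (cases "i < k\<^sub>1")
    case True
    then have si: "s i = s\<^sub>1 i / 2" "s (Suc i) = s\<^sub>1 (Suc i) / 2" by (simp_all add: s_def)
    have "C1_curve_on M (curve_join \<gamma>\<^sub>1 \<gamma>\<^sub>2) (s\<^sub>1 i / 2) (s\<^sub>1 (Suc i) / 2)"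
    proof (rule C1_curve_on_affine[where c=2 and d=0])
      show "C1_curve_on M \<gamma>\<^sub>1 (2 * (s\<^sub>1 i / 2) + 0) (2 * (s\<^sub>1 (Suc i) / 2) + 0)" using s1(4)[OF True] by simp
      fix t assume "t \<in> {s\<^sub>1 i / 2..s\<^sub>1 (Suc i) / 2}"
      then show "(curve_join \<gamma>\<^sub>1 \<gamma>\<^sub>2) t = \<gamma>\<^sub>1 (2 * t + 0)" using b1[of "Suc i"] True by (simp add: curve_join_def)
    qed simp
    then show ?thesis using s1(3)[OF True] by (simp add: si)
  next
    case False
    let ?j = "i - k\<^sub>1"
    have j: "?j < k\<^sub>2" "Suc i - k\<^sub>1 = Suc ?j" using False i by auto
    have si: "s i = 1/2 + s\<^sub>2 ?j / 2" "s (Suc i) = 1/2 + s\<^sub>2 (Suc ?j) / 2" using s'[of i] s'[of "Suc i"] False j by auto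
    have "C1_curve_on M (curve_join \<gamma>\<^sub>1 \<gamma>\<^sub>2) (1/2 + s\<^sub>2 ?j / 2) (1/2 + s\<^sub>2 (Suc ?j) / 2)"
    proof (rule C1_curve_on_affine[where c=2 and d="-1"])
      show "C1_curve_on M \<gamma>\<^sub>2 (2 * (1/2 + s\<^sub>2 ?j / 2) + - 1) (2 * (1/2 + s\<^sub>2 (Suc ?j) / 2) + - 1)"
        using s2(4)[OF j(1)] by (simp add: algebra_simps)
      fix t assume t: "t \<in> {1/2 + s\<^sub>2 ?j / 2..1/2 + s\<^sub>2 (Suc ?j) / 2}"
      show "(curve_join \<gamma>\<^sub>1 \<gamma>\<^sub>2) t = \<gamma>\<^sub>2 (2 * t + - 1)"
      proof (cases "t = 1/2")
        case True
        then have "2 * t = 1" by simp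
        then show ?thesis using eq True by (simp only: curve_join_def) simp
      next
        case False
        then show ?thesis using t b2[of ?j] j by (simp add: curve_join_def)
      qed
    qed simp
    then show ?thesis using s2(3)[OF j(1)] by (simp add: si)
  qed
  moreover have "s 0 = 0" "s (k\<^sub>1 + k\<^sub>2) = 1" using s1 s2 s'[of "k\<^sub>1 + k\<^sub>2"] by (auto simp: s_def)
  ultimately show ?thesis unfolding piecewise_C1_curve_def using cont by blast
qed

text \<open>The finitely many exceptional times are the break points of the curve. Elsewhere the one-sided
  derivatives of \<open>C1_curve_on\<close> are two-sided, as required by \<open>speed\<close>.\<close>

lemma piecewise_C1_curve_differentiable:
  assumes "piecewise_C1_curve M \<gamma>"
  obtains S where "finite S" "\<And>t i. t \<in> {0..1} - S \<Longrightarrow> i \<in> charts M \<Longrightarrow> \<gamma> t \<in> cdom M i \<Longrightarrow>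
      \<exists>D. ((cmap M i \<circ> \<gamma>) has_vector_derivative D) (at t)"
proof -
  obtain k s where s: "s 0 = 0" "s k = 1" "\<And>i. i < k \<Longrightarrow> s i < s (Suc i)"
      "\<And>i. i < k \<Longrightarrow> C1_curve_on M \<gamma> (s i) (s (Suc i))"
    using assms unfolding piecewise_C1_curve_def by blast
  show ?thesis
  proof (rule that[of "s ` {..k}"])
    fix t i assume t: "t \<in> {0..1} - s ` {..k}" and i: "i \<in> charts M" and ti: "\<gamma> t \<in> cdom M i"
    have "\<exists>j<k. s j < t \<and> t < s (Suc j)"
    proof -
      define j where "j = (GREATEST j. j \<le> k \<and> s j \<le> t)"
      have ex: "0 \<le> k \<and> s 0 \<le> t" using s t by simp
      have j: "j \<le> k \<and> s j \<le> t"
        unfolding j_def by (rule GreatestI_nat[of "\<lambda>j. j \<le> k \<and> s j \<le> t" 0 k]) (use ex in auto)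
      then have "s j \<noteq> t" using t by auto
      then have lt: "s j < t" using j by simp
      have "j \<noteq> k" using lt s t by auto
      then have jk: "j < k" using j by simp
      have "\<not> s (Suc j) \<le> t"
      proof
        assume "s (Suc j) \<le> t"
        then have "Suc j \<le> j" unfolding j_def[symmetric] using Greatest_le_nat[of "\<lambda>j. j \<le> k \<and> s j \<le> t" "Suc j" k] jk
          by (auto simp: j_def)
        then show False by simp
      qed
      then show ?thesis using lt jk by (intro exI[of _ j]) simp
    qed
    then obtain j where j: "j < k" "s j < t" "t < s (Suc j)" by blast
    then obtain D where D: "((cmap M i \<circ> \<gamma>) has_vector_derivative D t) (at t within {s j..s (Suc j)})"
      using s(4)[OF j(1)] i ti unfolding C1_curve_on_def by (metis atLeastAtMost_iff less_imp_le)
    have "at t within {s j..s (Suc j)} = at t" using j by (intro at_within_interior) simp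
    then show "\<exists>D. ((cmap M i \<circ> \<gamma>) has_vector_derivative D) (at t)" using D by metis
  qed simp
qed

lemma inner_matrix_vector_transpose:
  fixes A :: "real^'n^'m"
  shows "(A *v x) \<bullet> y = x \<bullet> (transpose A *v y)"
proof -
  have "x \<bullet> (transpose A *v y) = (y v* A) \<bullet> x" by (simp add: inner_commute transpose_matrix_vector)
  also have "\<dots> = y \<bullet> (A *v x)" by (rule dot_lmul_matrix)
  finally show ?thesis by (simp add: inner_commute)
qed

context riem_mfd
begin

text \<open>Integrability of the speed belongs to the notion, so that lengths add under concatenation by the
  additivity of the integral; segments in charts have it because their speed is continuous away from the ends.\<close>

definition tame :: "(real \<Rightarrow> 'a) \<Rightarrow> bool" where
  "tame \<gamma> \<longleftrightarrow> piecewise_C1_curve M \<gamma> \<and> speed M g \<gamma> integrable_on {0..1}"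

lemma curve_in_space:
  assumes "piecewise_C1_curve M \<gamma>" "t \<in> {0..1}"
  shows "\<gamma> t \<in> topspace (points M)"
proof -
  have "continuous_map (top_of_set {0..1}) (points M) \<gamma>" using assms unfolding piecewise_C1_curve_def by blast
  then show ?thesis using assms(2) unfolding continuous_map_def by auto
qed

lemma speed_nonneg:
  assumes "\<gamma> t \<in> topspace (points M)" shows "0 \<le> speed M g \<gamma> t"
  unfolding speed_def Let_def using posdef_nonneg[OF metric_posdef[OF chart_at[OF assms]]] by simp

lemma curve_length_nonneg:
  assumes "piecewise_C1_curve M \<gamma>" shows "0 \<le> curve_length M g \<gamma>"
proof (cases "speed M g \<gamma> integrable_on {0..1}")
  case True
  then show ?thesis unfolding curve_length_def
    by (rule integral_nonneg) (auto intro!: speed_nonneg curve_in_space[OF assms])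
next
  case False
  then show ?thesis by (simp add: curve_length_def not_integrable_integral)
qed

text \<open>The speed at \<open>t\<close> only depends on the curve near \<open>t\<close>. The hypothesis is about a neighbourhood because it
  is applied to the two halves of a concatenation.\<close>

lemma speed_affine:
  assumes "\<forall>\<^sub>F r in nhds t. \<eta> r = \<gamma> (c * r + d)" "0 < c"
    and "\<gamma> (c * t + d) \<in> topspace (points M)"
    and D: "((cmap M (chart_at M (\<gamma> (c * t + d))) \<circ> \<gamma>) has_vector_derivative D) (at (c * t + d))"
  shows "speed M g \<eta> t = c * speed M g \<gamma> (c * t + d)"
proof -
  let ?i = "chart_at M (\<gamma> (c * t + d))"
  have eq: "\<eta> t = \<gamma> (c * t + d)" using assms(1) by (rule eventually_nhds_x_imp_x)
  have "((\<lambda>t. c * t + d) has_vector_derivative c) (at t)"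
    by (auto intro!: derivative_eq_intros)
  from vector_diff_chain_at[OF this D]
  have "((cmap M ?i \<circ> \<gamma>) \<circ> (\<lambda>t. c * t + d) has_vector_derivative c *\<^sub>R D) (at t)" .
  moreover obtain S where S: "open S" "t \<in> S" "\<And>r. r \<in> S \<Longrightarrow> \<eta> r = \<gamma> (c * r + d)"
    using assms(1) unfolding eventually_nhds by blast
  ultimately have "((cmap M ?i \<circ> \<eta>) has_vector_derivative c *\<^sub>R D) (at t)"
    using has_vector_derivative_transform_within_open[of "(cmap M ?i \<circ> \<gamma>) \<circ> (\<lambda>t. c * t + d)" "c *\<^sub>R D" t S "cmap M ?i \<circ> \<eta>"] by simp
  then have 1: "vector_derivative (cmap M ?i \<circ> \<eta>) (at t) = c *\<^sub>R D" by (rule vector_derivative_at)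
  have 2: "vector_derivative (cmap M ?i \<circ> \<gamma>) (at (c * t + d)) = D" using D by (rule vector_derivative_at)
  have "sqrt ((c *\<^sub>R D) \<bullet> (g ?i (\<gamma> (c * t + d)) *v (c *\<^sub>R D))) = sqrt (c\<^sup>2 * (D \<bullet> (g ?i (\<gamma> (c * t + d)) *v D)))"
    by (simp add: matrix_vector_mult_scaleR power2_eq_square mult.assoc)
  also have "\<dots> = c * sqrt (D \<bullet> (g ?i (\<gamma> (c * t + d)) *v D))" using assms(2) by (simp add: real_sqrt_mult)
  finally show ?thesis unfolding speed_def Let_def eq 1 2 .
qed

lemma has_integral_half_affine:
  fixes f :: "real \<Rightarrow> real"
  assumes "(f has_integral I) {0..1}" and d: "d \<in> {0, -1}"
  shows "((\<lambda>t. 2 * f (2 * t + d)) has_integral I) {- d / 2..(1 - d) / 2}"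
proof -
  have "((\<lambda>x. f (2 *\<^sub>R x + d)) has_integral (1 / \<bar>2\<bar> ^ DIM(real)) *\<^sub>R I) ((\<lambda>x. (1 / 2) *\<^sub>R x + - ((1 / 2) *\<^sub>R d)) ` cbox 0 1)"
    using assms(1) by (intro has_integral_affinity) auto
  moreover have "(\<lambda>x. (1 / 2) *\<^sub>R x + - ((1 / 2) *\<^sub>R d)) ` cbox 0 1 = {- d / 2..(1 - d) / 2}"
  proof
    show "{- d / 2..(1 - d) / 2} \<subseteq> (\<lambda>x. (1 / 2) *\<^sub>R x + - ((1 / 2) *\<^sub>R d)) ` cbox 0 1"
    proof
      fix y assume "y \<in> {- d / 2..(1 - d) / 2}"
      then show "y \<in> (\<lambda>x. (1 / 2) *\<^sub>R x + - ((1 / 2) *\<^sub>R d)) ` cbox 0 1"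
        by (intro image_eqI[where x="2 * y + d"]) (auto simp: add_divide_distrib)
    qed
  qed auto
  ultimately have "((\<lambda>x. f (2 * x + d)) has_integral I / 2) {- d / 2..(1 - d) / 2}" by simp
  from has_integral_mult_right[OF this, of 2] show ?thesis by simp
qed

text \<open>On each half the speed of the concatenation is twice the speed of the original curve at all but
  finitely many times, and finitely many values do not affect integrals.\<close>

lemma tame_join:
  assumes 1: "tame \<gamma>\<^sub>1" and 2: "tame \<gamma>\<^sub>2" and eq: "\<gamma>\<^sub>1 1 = \<gamma>\<^sub>2 0"
  shows "tame (curve_join \<gamma>\<^sub>1 \<gamma>\<^sub>2)" "curve_length M g (curve_join \<gamma>\<^sub>1 \<gamma>\<^sub>2) = curve_length M g \<gamma>\<^sub>1 + curve_length M g \<gamma>\<^sub>2"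
proof -
  let ?\<gamma> = "curve_join \<gamma>\<^sub>1 \<gamma>\<^sub>2"
  have p1: "piecewise_C1_curve M \<gamma>\<^sub>1" and p2: "piecewise_C1_curve M \<gamma>\<^sub>2" using 1 2 by (auto simp: tame_def)
  obtain S\<^sub>1 where S1: "finite S\<^sub>1" "\<And>t i. t \<in> {0..1} - S\<^sub>1 \<Longrightarrow> i \<in> charts M \<Longrightarrow> \<gamma>\<^sub>1 t \<in> cdom M i \<Longrightarrow>
      \<exists>D. ((cmap M i \<circ> \<gamma>\<^sub>1) has_vector_derivative D) (at t)" by (rule piecewise_C1_curve_differentiable[OF p1]) blast
  obtain S\<^sub>2 where S2: "finite S\<^sub>2" "\<And>t i. t \<in> {0..1} - S\<^sub>2 \<Longrightarrow> i \<in> charts M \<Longrightarrow> \<gamma>\<^sub>2 t \<in> cdom M i \<Longrightarrow>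
      \<exists>D. ((cmap M i \<circ> \<gamma>\<^sub>2) has_vector_derivative D) (at t)" by (rule piecewise_C1_curve_differentiable[OF p2]) blast
  have i1: "(speed M g \<gamma>\<^sub>1 has_integral curve_length M g \<gamma>\<^sub>1) {0..1}"
    and i2: "(speed M g \<gamma>\<^sub>2 has_integral curve_length M g \<gamma>\<^sub>2) {0..1}"
    using 1 2 by (auto simp: tame_def curve_length_def)
  \<comment> \<open>The excluded times are the ends of the half and the times at which the original curve may fail to be
    differentiable.\<close>
  have h1: "(speed M g ?\<gamma> has_integral curve_length M g \<gamma>\<^sub>1) {0..1/2}"
  proof (rule has_integral_spike_finite)
    show "finite ({0, 1/2} \<union> (\<lambda>s. s / 2) ` S\<^sub>1)" using S1 by simp
    show "((\<lambda>t. 2 * speed M g \<gamma>\<^sub>1 (2 * t + 0)) has_integral curve_length M g \<gamma>\<^sub>1) {0..1/2}"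
      using has_integral_half_affine[OF i1, of 0] by simp
    fix t :: real assume t: "t \<in> {0..1/2} - ({0, 1/2} \<union> (\<lambda>s. s / 2) ` S\<^sub>1)"
    have t2: "2 * t + 0 \<in> {0..1} - S\<^sub>1"
    proof -
      have "2 * t \<notin> S\<^sub>1"
      proof
        assume "2 * t \<in> S\<^sub>1"
        then have "t \<in> (\<lambda>s. s / 2) ` S\<^sub>1" by (intro image_eqI[of _ _ "2 * t"]) auto
        then show False using t by blast
      qed
      then show ?thesis using t by auto
    qed
    have sp: "\<gamma>\<^sub>1 (2 * t + 0) \<in> topspace (points M)" using curve_in_space[OF p1] t2 by blast
    obtain D where D: "((cmap M (chart_at M (\<gamma>\<^sub>1 (2 * t + 0))) \<circ> \<gamma>\<^sub>1) has_vector_derivative D) (at (2 * t + 0))"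
      using S1(2)[OF t2 chart_at[OF sp]] by blast
    have "\<forall>\<^sub>F r in nhds t. r < 1/2" using t by (intro order_tendstoD[OF tendsto_ident_at] eventually_nhds_in_open[of "{..<1/2}", simplified]) auto
    then have "\<forall>\<^sub>F r in nhds t. ?\<gamma> r = \<gamma>\<^sub>1 (2 * r + 0)" by eventually_elim (simp add: curve_join_def)
    from speed_affine[OF this _ sp D] show "speed M g ?\<gamma> t = 2 * speed M g \<gamma>\<^sub>1 (2 * t + 0)" by simp
  qed
  have h2: "(speed M g ?\<gamma> has_integral curve_length M g \<gamma>\<^sub>2) {1/2..1}"
  proof (rule has_integral_spike_finite)
    show "finite ({1, 1/2} \<union> (\<lambda>s. (s + 1) / 2) ` S\<^sub>2)" using S2 by simp
    show "((\<lambda>t. 2 * speed M g \<gamma>\<^sub>2 (2 * t + - 1)) has_integral curve_length M g \<gamma>\<^sub>2) {1/2..1}"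
      using has_integral_half_affine[OF i2, of "-1"] by simp
    fix t :: real assume t: "t \<in> {1/2..1} - ({1, 1/2} \<union> (\<lambda>s. (s + 1) / 2) ` S\<^sub>2)"
    have t2: "2 * t + - 1 \<in> {0..1} - S\<^sub>2"
    proof -
      have "2 * t + - 1 \<notin> S\<^sub>2"
      proof
        assume "2 * t + - 1 \<in> S\<^sub>2"
        then have "t \<in> (\<lambda>s. (s + 1) / 2) ` S\<^sub>2" by (intro image_eqI[of _ _ "2 * t + - 1"]) auto
        then show False using t by blast
      qed
      then show ?thesis using t by auto
    qed
    have sp: "\<gamma>\<^sub>2 (2 * t + - 1) \<in> topspace (points M)" using curve_in_space[OF p2] t2 by blast
    obtain D where D: "((cmap M (chart_at M (\<gamma>\<^sub>2 (2 * t + - 1))) \<circ> \<gamma>\<^sub>2) has_vector_derivative D) (at (2 * t + - 1))"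
      using S2(2)[OF t2 chart_at[OF sp]] by blast
    have "\<forall>\<^sub>F r in nhds t. 1/2 < r" using t by (intro order_tendstoD[OF tendsto_ident_at] eventually_nhds_in_open[of "{1/2<..}", simplified]) auto
    then have "\<forall>\<^sub>F r in nhds t. ?\<gamma> r = \<gamma>\<^sub>2 (2 * r + - 1)" by eventually_elim (simp add: curve_join_def)
    from speed_affine[OF this _ sp D] show "speed M g ?\<gamma> t = 2 * speed M g \<gamma>\<^sub>2 (2 * t + - 1)" by simp
  qed
  have "(speed M g ?\<gamma> has_integral curve_length M g \<gamma>\<^sub>1 + curve_length M g \<gamma>\<^sub>2) {0..1}"
    by (rule has_integral_combine[OF _ _ h1 h2]) auto
  then show "tame ?\<gamma>" "curve_length M g ?\<gamma> = curve_length M g \<gamma>\<^sub>1 + curve_length M g \<gamma>\<^sub>2"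
    using piecewise_C1_curve_join[OF p1 p2 eq] by (auto simp: tame_def curve_length_def has_integral_iff)
qed

definition chart_segment :: "'i \<Rightarrow> real^'n \<Rightarrow> real^'n \<Rightarrow> real \<Rightarrow> 'a" where
  "chart_segment i v w t = cinv M i (v + t *\<^sub>R (w - v))"

lemma segment_mem: "closed_segment v w \<subseteq> S \<Longrightarrow> t \<in> {0..1} \<Longrightarrow> v + t *\<^sub>R (w - v) \<in> S"
  for v w :: "real^'n"
  by (rule subsetD, assumption) (auto simp: in_segment algebra_simps intro!: exI[of _ t])

lemma
  assumes i: "i \<in> charts M" and seg: "closed_segment v w \<subseteq> cimg M i"
  shows tame_chart_segment: "tame (chart_segment i v w)"
    and curve_length_chart_segment: "curve_length M g (chart_segment i v w) =
      integral {0..1} (\<lambda>t. sqrt ((w - v) \<bullet> (g i (cinv M i (v + t *\<^sub>R (w - v))) *v (w - v))))"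
proof -
  let ?l = "\<lambda>t. v + t *\<^sub>R (w - v)" and ?\<gamma> = "chart_segment i v w" and ?d = "w - v"
  have l: "?l t \<in> cimg M i" if "t \<in> {0..1}" for t by (rule segment_mem[OF seg that])
  have gi: "?\<gamma> t \<in> cdom M i" "cmap M i (?\<gamma> t) = ?l t" if "t \<in> {0..1}" for t
    using l[OF that] by (auto simp: chart_segment_def cinv_in_cdom cmap_cinv)
  have l': "(?l has_vector_derivative ?d) (at t within S)" for t S
    by (auto intro!: derivative_eq_intros)
  have deriv: "((cmap M j \<circ> ?\<gamma>) has_vector_derivative (jacobian M i j (?\<gamma> t) *v ?d)) (at t)"
    if j: "j \<in> charts M" and t: "t \<in> {0..1}" "?\<gamma> t \<in> cdom M j" for j t
  proof -
    have "(transition M i j has_derivative (\<lambda>x. jacobian M i j (?\<gamma> t) *v x)) (at (?l t))"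
      using transition_has_derivative[OF i j, of "?\<gamma> t"] gi[OF t(1)] t by simp
    moreover have "(?l has_derivative (\<lambda>x. x *\<^sub>R ?d)) (at t)" using l'[of t UNIV] by (simp add: has_vector_derivative_def)
    ultimately have "(transition M i j \<circ> ?l has_derivative (\<lambda>x. jacobian M i j (?\<gamma> t) *v x) \<circ> (\<lambda>x. x *\<^sub>R ?d)) (at t)"
      by (intro diff_chain_at)
    moreover have "cmap M j \<circ> ?\<gamma> = transition M i j \<circ> ?l"
      by (simp add: fun_eq_iff transition_def chart_segment_def)
    ultimately show ?thesis by (simp add: has_vector_derivative_def o_def matrix_vector_mult_scaleR)
  qed
  have C1: "C1_curve_on M ?\<gamma> 0 1" unfolding C1_curve_on_def
  proof
    fix j assume j: "j \<in> charts M"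
    let ?T = "{t \<in> {0..1}. ?\<gamma> t \<in> cdom M j}"
    have cT: "?l ` ?T \<subseteq> cmap M i ` (cdom M i \<inter> cdom M j)"
    proof
      fix y assume "y \<in> ?l ` ?T"
      then obtain t where t: "t \<in> {0..1}" "?\<gamma> t \<in> cdom M j" "y = ?l t" by blast
      then show "y \<in> cmap M i ` (cdom M i \<inter> cdom M j)" using gi[OF t(1)] by (intro image_eqI[of _ _ "?\<gamma> t"]) auto
    qed
    have "Ck_on (Suc 0) (cmap M i ` (cdom M i \<inter> cdom M j)) (transition M i j)"
      using transition_smooth[OF i j] unfolding smooth_on_def by blast
    then have cf: "continuous_on (cmap M i ` (cdom M i \<inter> cdom M j)) (\<lambda>x. frechet_derivative (transition M i j) (at x) ?d)"
      by simp
    have cl: "continuous_on ?T ?l" by (intro continuous_intros)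
    have "continuous_on ?T (\<lambda>t. frechet_derivative (transition M i j) (at (?l t)) ?d)"
      by (rule continuous_on_compose2[OF cf cl cT])
    moreover have "frechet_derivative (transition M i j) (at (?l t)) ?d = jacobian M i j (?\<gamma> t) *v ?d" if "t \<in> ?T" for t
    proof -
      have "?\<gamma> t \<in> cdom M i \<inter> cdom M j" using that gi by auto
      from frechet_derivative_at[OF transition_has_derivative[OF i j this]]
      have "frechet_derivative (transition M i j) (at (cmap M i (?\<gamma> t))) = (\<lambda>v. jacobian M i j (?\<gamma> t) *v v)" by simp
      moreover have "cmap M i (?\<gamma> t) = ?l t" using gi(2)[of t] that by simp
      ultimately show ?thesis by simp
    qed
    ultimately have "continuous_on ?T (\<lambda>t. jacobian M i j (?\<gamma> t) *v ?d)"
      by (rule continuous_on_eq)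
    then show "\<exists>D. continuous_on ?T D \<and> (\<forall>t\<in>{0..1}. ?\<gamma> t \<in> cdom M j \<longrightarrow> ((cmap M j \<circ> ?\<gamma>) has_vector_derivative D t) (at t within {0..1}))"
      using deriv[OF j] has_vector_derivative_at_within by blast
  qed
  have cont: "continuous_map (top_of_set {0..1}) (points M) ?\<gamma>"
  proof -
    have "continuous_map (top_of_set {0..1}) (top_of_set (cimg M i)) ?l"
      using l by (auto simp: continuous_map_in_subtopology intro!: continuous_intros)
    from continuous_map_compose[OF this continuous_cinv[OF i]] show ?thesis by (simp add: o_def chart_segment_def[abs_def])
  qed
  have p: "piecewise_C1_curve M ?\<gamma>"
    unfolding piecewise_C1_curve_def using cont C1 by (intro conjI exI[of _ 1] exI[of _ real]) auto
  let ?F = "\<lambda>t. sqrt (?d \<bullet> (g i (cinv M i (?l t)) *v ?d))"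
  have cF: "continuous_on {0..1} ?F"
  proof -
    have "continuous_on {0..1} (\<lambda>t. g i (cinv M i (?l t)))"
      by (rule continuous_on_compose2[OF metric_continuous[OF i]]) (use l in \<open>auto intro!: continuous_intros\<close>)
    then show ?thesis unfolding quad_form_sum by (intro continuous_intros)
  qed
  have sp: "speed M g ?\<gamma> t = ?F t" if t: "t \<in> {0..1}" for t
  proof -
    have sp: "?\<gamma> t \<in> topspace (points M)" using curve_in_space[OF p t] .
    let ?j = "chart_at M (?\<gamma> t)" and ?J = "jacobian M i (chart_at M (?\<gamma> t)) (?\<gamma> t)"
    note j = chart_at[OF sp]
    have "vector_derivative (cmap M ?j \<circ> ?\<gamma>) (at t) = ?J *v ?d"
      by (rule vector_derivative_at[OF deriv[OF j(1) t j(2)]])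
    then have "speed M g ?\<gamma> t = sqrt ((?J *v ?d) \<bullet> (g ?j (?\<gamma> t) *v (?J *v ?d)))" by (simp add: speed_def Let_def)
    also have "(?J *v ?d) \<bullet> (g ?j (?\<gamma> t) *v (?J *v ?d)) = ?d \<bullet> ((transpose ?J ** g ?j (?\<gamma> t) ** ?J) *v ?d)"
      by (simp only: inner_matrix_vector_transpose matrix_vector_mul_assoc matrix_mul_assoc)
    also have "transpose ?J ** g ?j (?\<gamma> t) ** ?J = g i (?\<gamma> t)"
      using metric_change[OF i j(1), of "?\<gamma> t"] gi[OF t] j(2) by simp
    finally show ?thesis by (simp add: chart_segment_def[of i v w t])
  qed
  have "(speed M g ?\<gamma> has_integral integral {0..1} ?F) {0..1}"
    by (rule has_integral_eq[of _ ?F]) (use sp integrable_continuous_real[OF cF] in \<open>auto simp: has_integral_iff\<close>)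
  then show "tame ?\<gamma>" "curve_length M g ?\<gamma> = integral {0..1} ?F"
    using p by (auto simp: tame_def curve_length_def has_integral_iff)
qed

lemma chart_segment_ends[simp]: "chart_segment i v w 0 = cinv M i v" "chart_segment i v w 1 = cinv M i w"
  by (simp_all add: chart_segment_def)

lemma chart_ball:
  assumes "y \<in> topspace (points M)"
  obtains i e where "i \<in> charts M" "y \<in> cdom M i" "0 < e" "ball (cmap M i y) e \<subseteq> cimg M i"
proof -
  note c = chart_at[OF assms]
  obtain e where "0 < e" "ball (cmap M (chart_at M y) y) e \<subseteq> cimg M (chart_at M y)"
    using open_cimg[OF c(1)] cmap_in_cimg[OF c(2)] by (meson open_contains_ball)
  then show ?thesis using that c by blast
qed

text \<open>Points in a coordinate ball are joined by segments in both directions, so the set of points reachable from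
  \<open>x\<close> is open and closed.\<close>

lemma tame_connected:
  assumes conn: "connected_space (points M)" and x: "x \<in> topspace (points M)" and y: "y \<in> topspace (points M)"
  shows "\<exists>\<gamma>. tame \<gamma> \<and> \<gamma> 0 = x \<and> \<gamma> 1 = y"
proof -
  let ?R = "\<lambda>x y. \<exists>\<gamma>. tame \<gamma> \<and> \<gamma> 0 = x \<and> \<gamma> 1 = y"
  have trans: "?R a c" if ab: "?R a b" and bc: "?R b c" for a b c
  proof -
    from ab obtain \<gamma>\<^sub>1 where 1: "tame \<gamma>\<^sub>1" "\<gamma>\<^sub>1 0 = a" "\<gamma>\<^sub>1 1 = b" by blast
    from bc obtain \<gamma>\<^sub>2 where 2: "tame \<gamma>\<^sub>2" "\<gamma>\<^sub>2 0 = b" "\<gamma>\<^sub>2 1 = c" by blast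
    have "tame (curve_join \<gamma>\<^sub>1 \<gamma>\<^sub>2)" using tame_join(1)[OF 1(1) 2(1)] 1 2 by simp
    then show ?thesis using 1 2 by (intro exI[of _ "curve_join \<gamma>\<^sub>1 \<gamma>\<^sub>2"]) (simp add: curve_join_def)
  qed
  have near: "\<exists>U. openin (points M) U \<and> z \<in> U \<and> (\<forall>u\<in>U. ?R z u \<and> ?R u z)" if z: "z \<in> topspace (points M)" for z
  proof -
    obtain i e where i: "i \<in> charts M" "z \<in> cdom M i" "0 < e" "ball (cmap M i z) e \<subseteq> cimg M i"
      using chart_ball[OF z] by metis
    let ?B = "ball (cmap M i z) e"
    have seg: "?R (cinv M i v) (cinv M i w)" if "v \<in> ?B" "w \<in> ?B" for v w
    proof -
      have "closed_segment v w \<subseteq> cimg M i" using closed_segment_subset[OF that convex_ball] i(4) by blast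
      from tame_chart_segment[OF i(1) this] show ?thesis by (intro exI[of _ "chart_segment i v w"]) simp
    qed
    have zB: "cmap M i z \<in> ?B" using i by simp
    have zz: "cinv M i (cmap M i z) = z" by (rule cinv_cmap[OF i(1,2)])
    show ?thesis
    proof (rule exI[of _ "cinv M i ` ?B"], intro conjI ballI)
      show "openin (points M) (cinv M i ` ?B)" by (rule open_cinv_image[OF i(1) _ i(4)]) simp
      show "z \<in> cinv M i ` ?B" using zB zz by (metis image_eqI)
      fix u assume "u \<in> cinv M i ` ?B"
      then obtain v where v: "v \<in> ?B" "u = cinv M i v" by blast
      show "?R z u" using seg[OF zB v(1)] unfolding zz v(2) .
      show "?R u z" using seg[OF v(1) zB] unfolding zz v(2) .
    qed
  qed
  let ?T = "{y \<in> topspace (points M). ?R x y}"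
  have op: "openin (points M) ?T"
  proof (subst openin_subopen, rule ballI)
    fix z assume z: "z \<in> ?T"
    then obtain U where U: "openin (points M) U" "z \<in> U" "\<forall>u\<in>U. ?R z u \<and> ?R u z" using near[of z] by blast
    have "U \<subseteq> ?T" using U z trans openin_subset[OF U(1)] by blast
    then show "\<exists>T. openin (points M) T \<and> z \<in> T \<and> T \<subseteq> ?T" using U by blast
  qed
  have cl: "closedin (points M) ?T"
    unfolding closedin_def
  proof
    show "openin (points M) (topspace (points M) - ?T)"
    proof (subst openin_subopen, rule ballI)
      fix z assume z: "z \<in> topspace (points M) - ?T"
      then obtain U where U: "openin (points M) U" "z \<in> U" "\<forall>u\<in>U. ?R z u \<and> ?R u z" using near[of z] by blast
      have "U \<subseteq> topspace (points M) - ?T" using U z trans openin_subset[OF U(1)] by blast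
      then show "\<exists>T. openin (points M) T \<and> z \<in> T \<and> T \<subseteq> topspace (points M) - ?T" using U by blast
    qed
  qed blast
  have "?R x x" using near[OF x] by blast
  then have "?T \<noteq> {}" using x by blast
  then have "?T = topspace (points M)" using conn op cl unfolding connected_space_clopen_in by blast
  then show ?thesis using y by blast
qed

definition tame_dist :: "'a \<Rightarrow> 'a \<Rightarrow> real" where
  "tame_dist x y = Inf {curve_length M g \<gamma> | \<gamma>. tame \<gamma> \<and> \<gamma> 0 = x \<and> \<gamma> 1 = y}"

lemma tame_dist_le:
  assumes "tame \<gamma>" "\<gamma> 0 = x" "\<gamma> 1 = y" "curve_length M g \<gamma> \<le> L"
  shows "tame_dist x y \<le> L"
proof -
  have "tame_dist x y \<le> curve_length M g \<gamma>"
    unfolding tame_dist_def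
  proof (rule cInf_lower)
    show "bdd_below {curve_length M g \<gamma> |\<gamma>. tame \<gamma> \<and> \<gamma> 0 = x \<and> \<gamma> 1 = y}"
      by (rule bdd_belowI[of _ 0]) (auto simp: tame_def intro: curve_length_nonneg)
  qed (use assms in blast)
  then show ?thesis using assms by simp
qed

lemma tame_dist_approx:
  assumes "connected_space (points M)" "x \<in> topspace (points M)" "y \<in> topspace (points M)" "0 < e"
  obtains \<gamma> where "tame \<gamma>" "\<gamma> 0 = x" "\<gamma> 1 = y" "curve_length M g \<gamma> < tame_dist x y + e"
proof -
  let ?S = "{curve_length M g \<gamma> |\<gamma>. tame \<gamma> \<and> \<gamma> 0 = x \<and> \<gamma> 1 = y}"
  have "?S \<noteq> {}" using tame_connected[OF assms(1-3)] by blast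
  moreover have "Inf ?S < tame_dist x y + e" using assms(4) by (simp add: tame_dist_def)
  ultimately have "\<exists>L\<in>?S. L < tame_dist x y + e" by (rule cInf_lessD)
  then obtain \<gamma> where "tame \<gamma>" "\<gamma> 0 = x" "\<gamma> 1 = y" "curve_length M g \<gamma> < tame_dist x y + e" by auto
  then show ?thesis by (rule that)
qed

text \<open>An infimum over fewer curves is larger; there are such curves by connectedness.\<close>

lemma riemannian_dist_le_tame_dist:
  assumes "connected_space (points M)" "x \<in> topspace (points M)" "y \<in> topspace (points M)"
  shows "riemannian_dist M g x y \<le> tame_dist x y"
  unfolding riemannian_dist_def tame_dist_def
proof (rule cInf_superset_mono)
  show "{curve_length M g \<gamma> |\<gamma>. tame \<gamma> \<and> \<gamma> 0 = x \<and> \<gamma> 1 = y} \<noteq> {}" using tame_connected[OF assms] by blast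
  show "bdd_below {curve_length M g \<gamma> |\<gamma>. piecewise_C1_curve M \<gamma> \<and> \<gamma> 0 = x \<and> \<gamma> 1 = y}"
    by (rule bdd_belowI[of _ 0]) (auto intro: curve_length_nonneg)
qed (auto simp: tame_def)

lemma riemannian_dist_nonneg:
  assumes "connected_space (points M)" "x \<in> topspace (points M)" "y \<in> topspace (points M)"
  shows "0 \<le> riemannian_dist M g x y"
  unfolding riemannian_dist_def
proof (rule cInf_greatest)
  show "{curve_length M g \<gamma> |\<gamma>. piecewise_C1_curve M \<gamma> \<and> \<gamma> 0 = x \<and> \<gamma> 1 = y} \<noteq> {}"
    using tame_connected[OF assms] by (auto simp: tame_def)
qed (auto intro: curve_length_nonneg)

lemma tame_dist_nonneg:
  assumes "connected_space (points M)" "x \<in> topspace (points M)" "y \<in> topspace (points M)"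
  shows "0 \<le> tame_dist x y"
  using riemannian_dist_le_tame_dist[OF assms] riemannian_dist_nonneg[OF assms] by simp

lemma tame_dist_triangle:
  assumes c: "connected_space (points M)" 
    and x: "x \<in> topspace (points M)" and y: "y \<in> topspace (points M)" and z: "z \<in> topspace (points M)"
  shows "tame_dist x z \<le> tame_dist x y + tame_dist y z"
proof (rule field_le_epsilon)
  fix e :: real assume "0 < e"
  then have e: "0 < e / 2" by simp
  obtain \<gamma>\<^sub>1 where 1: "tame \<gamma>\<^sub>1" "\<gamma>\<^sub>1 0 = x" "\<gamma>\<^sub>1 1 = y" "curve_length M g \<gamma>\<^sub>1 < tame_dist x y + e / 2"
    by (rule tame_dist_approx[OF c x y e])
  obtain \<gamma>\<^sub>2 where 2: "tame \<gamma>\<^sub>2" "\<gamma>\<^sub>2 0 = y" "\<gamma>\<^sub>2 1 = z" "curve_length M g \<gamma>\<^sub>2 < tame_dist y z + e / 2"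
    by (rule tame_dist_approx[OF c y z e])
  have j: "\<gamma>\<^sub>1 1 = \<gamma>\<^sub>2 0" using 1 2 by simp
  show "tame_dist x z \<le> tame_dist x y + tame_dist y z + e"
    using tame_join[OF 1(1) 2(1) j] 1 2 by (intro tame_dist_le[of "curve_join \<gamma>\<^sub>1 \<gamma>\<^sub>2"]) (auto simp: curve_join_def)
qed

text \<open>The only way in which lengths of curves are estimated from above: a segment in a chart is a competitor.\<close>

lemma tame_dist_segment:
  assumes i: "i \<in> charts M" and seg: "closed_segment v w \<subseteq> cimg M i"
  shows "tame_dist (cinv M i v) (cinv M i w) \<le> integral {0..1} (\<lambda>t. sqrt ((w - v) \<bullet> (g i (cinv M i (v + t *\<^sub>R (w - v))) *v (w - v))))"
  by (rule tame_dist_le[OF tame_chart_segment[OF i seg]]) (simp_all add: curve_length_chart_segment[OF i seg])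

end

section \<open>Absorption in the Sobolev inequality\<close>

text \<open>Young's inequality with unequal exponents. Either \<open>b \<le> a^(q-\<gamma>+1)\<close>, and the product is at most \<open>a^q\<close>; or
  \<open>a\<close> is bounded by a power of \<open>b\<close>, and the product is at most \<open>b^(q/(q-\<gamma>+1))\<close>, which the hypothesis on
  \<open>p\<close> compares with \<open>b^p\<close>.\<close>

lemma young_type_bound:
  fixes a b :: real
  assumes a: "0 < a" and b: "0 < b" and \<gamma>: "1 \<le> \<gamma>" "\<gamma> < q + 1" and p: "q \<le> p * (q - \<gamma> + 1)" and q: "0 < q"
  shows "a powr (\<gamma> - 1) * b \<le> a powr q + 1 + b powr p"
proof (cases "b \<le> a powr (q - \<gamma> + 1)")
  case True
  then have "a powr (\<gamma> - 1) * b \<le> a powr (\<gamma> - 1) * a powr (q - \<gamma> + 1)" by (intro mult_left_mono) auto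
  also have "\<dots> = a powr q" by (simp add: powr_add[symmetric])
  also have "\<dots> \<le> a powr q + 1 + b powr p" by simp
  finally show ?thesis .
next
  case False
  let ?s = "q - \<gamma> + 1"
  have s: "0 < ?s" using \<gamma> by simp
  have "a = (a powr ?s) powr (1 / ?s)" using a s by (simp add: powr_powr)
  also have "\<dots> \<le> b powr (1 / ?s)" using False s by (intro powr_mono2) auto
  finally have "a \<le> b powr (1 / ?s)" .
  then have "a powr (\<gamma> - 1) \<le> (b powr (1 / ?s)) powr (\<gamma> - 1)" using a \<gamma> by (intro powr_mono2) auto
  then have "a powr (\<gamma> - 1) * b \<le> (b powr (1 / ?s)) powr (\<gamma> - 1) * b" using b by (intro mult_right_mono) auto
  also have "\<dots> = b powr ((\<gamma> - 1) / ?s) * b powr 1" using b by (simp add: powr_powr)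
  also have "\<dots> = b powr ((\<gamma> - 1) / ?s + 1)" by (rule powr_add[symmetric])
  also have "(\<gamma> - 1) / ?s + 1 = q / ?s" using s by (simp add: field_simps)
  also have "b powr (q / ?s) \<le> 1 + b powr p"
  proof (cases "b \<le> 1")
    case True
    have "b powr (q / ?s) \<le> 1 powr (q / ?s)" using True b q s by (intro powr_mono2) auto
    then show ?thesis by (simp add: add_increasing2)
  next
    case False
    have "q / ?s \<le> p" using p s by (simp add: pos_divide_le_eq)
    then have "b powr (q / ?s) \<le> b powr p" using False by (intro powr_mono) auto
    then show ?thesis by simp
  qed
  finally show ?thesis using powr_ge_zero[of a q] by linarith
qed

text \<open>Interpolation of \<open>u^\<gamma>\<close> between \<open>u\<close> and \<open>u^q\<close>, with a threshold \<open>l\<close> at our disposal: the first term wins for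
  \<open>u \<le> l\<close> and the second one for \<open>u \<ge> l\<close>.\<close>

lemma powr_interpolate:
  fixes u l :: real
  assumes "0 < u" "0 < l" "1 \<le> \<gamma>" "\<gamma> \<le> q"
  shows "u powr \<gamma> \<le> l powr (\<gamma> - 1) * u + l powr (\<gamma> - q) * u powr q"
proof (cases "u \<le> l")
  case True
  have "u powr \<gamma> = u powr (\<gamma> - 1) * u" using assms by (simp add: powr_mult_base mult.commute)
  also have "\<dots> \<le> l powr (\<gamma> - 1) * u" using True assms by (intro mult_right_mono powr_mono2) auto
  also have "\<dots> \<le> l powr (\<gamma> - 1) * u + l powr (\<gamma> - q) * u powr q" by simp
  finally show ?thesis .
next
  case False
  have "u powr \<gamma> = u powr (\<gamma> - q) * u powr q" by (simp add: powr_add[symmetric])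
  also have "\<dots> \<le> l powr (\<gamma> - q) * u powr q" using False assms by (intro mult_right_mono powr_mono2') auto
  also have "\<dots> \<le> l powr (\<gamma> - 1) * u + l powr (\<gamma> - q) * u powr q" using assms by simp
  finally show ?thesis .
qed

lemma (in finite_measure) integrable_bounded:
  fixes f :: "'a \<Rightarrow> real"
  assumes "f \<in> borel_measurable M" "\<And>x. x \<in> space M \<Longrightarrow> 0 \<le> f x \<and> f x \<le> C"
  shows "integrable M f"
  by (rule integrable_const_bound[where B=C]) (use assms in \<open>auto intro!: AE_I2\<close>)

lemma (in finite_measure) integral_pos_bounded:
  fixes f :: "'a \<Rightarrow> real"
  assumes f: "f \<in> borel_measurable M" "0 < c" "\<And>x. x \<in> space M \<Longrightarrow> c \<le> f x \<and> f x \<le> C"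
    and M: "0 < measure M (space M)"
  shows "0 < (\<integral>x. f x \<partial>M)"
proof -
  have "0 < c * measure M (space M)" using f M by simp
  also have "\<dots> = (\<integral>x. c \<partial>M)" by simp
  also have "\<dots> \<le> (\<integral>x. f x \<partial>M)"
    using f(2) by (intro integral_mono integrable_bounded[OF f(1), of C]) (use f in force)+
  finally show ?thesis .
qed

text \<open>Let \<open>D\<close> be the \<open>L^q\<close> norm of \<open>u\<close>. The Sobolev inequality says
  \<open>D^\<gamma> \<le> K' (\<integral> u^\<gamma> + \<integral> u^(\<gamma>-1) f)\<close>. The second integral is at most \<open>(2 + V) D^(\<gamma>-1) B\<close> by
  \<open>young_type_bound\<close>, applied to \<open>u / D\<close> and \<open>f / B\<close>. The first one is interpolated at the threshold \<open>\<tau> D\<close>: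
  it is at most \<open>\<tau>^(\<gamma>-1) D^(\<gamma>-1) \<integral> u + \<tau>^(\<gamma>-q) D^\<gamma>\<close>, and the last term is absorbed. Dividing by
  \<open>D^(\<gamma>-1)\<close> leaves \<open>D \<le> const * B\<close>. The bounds on \<open>u\<close> and \<open>f\<close> are there only to make all integrals finite
  and positive and do not occur in the conclusion.\<close>

lemma (in finite_measure) sobolev_absorb:
  fixes u f :: "'a \<Rightarrow> real"
  assumes u: "u \<in> borel_measurable M" "0 < cu" "\<And>x. x \<in> space M \<Longrightarrow> cu \<le> u x \<and> u x \<le> Cu"
    and f: "f \<in> borel_measurable M" "0 < cf" "\<And>x. x \<in> space M \<Longrightarrow> cf \<le> f x \<and> f x \<le> Cf"
    and M: "0 < measure M (space M)"
    and \<gamma>: "1 \<le> \<gamma>" and e: "1 < e" and q: "q = \<gamma> * e" and p: "1 \<le> p" "q \<le> p * (q - \<gamma> + 1)"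
    and K: "0 < K" and sob: "(\<integral>x. u x powr q \<partial>M) \<le> K * (\<integral>x. u x powr \<gamma> + u x powr (\<gamma> - 1) * f x \<partial>M) powr e"
    and B: "B = (\<integral>x. f x powr p \<partial>M) powr (1 / p)" and A: "(\<integral>x. u x \<partial>M) \<le> K\<^sub>2 * B"
  defines "K' \<equiv> K powr (1 / e)" and "V \<equiv> measure M (space M)"
  shows "(\<integral>x. u x powr q \<partial>M) powr (1 / q) \<le> 2 * K' * ((2 * K') powr ((\<gamma> - 1) / (q - \<gamma>)) * K\<^sub>2 + 2 + V) * B"
proof -
  have q\<gamma>: "\<gamma> < q" using \<gamma> e unfolding q by (simp add: mult_less_cancel_left1)
  have q0: "0 < q" using q\<gamma> \<gamma> by simp
  have upos: "0 < u x" if "x \<in> space M" for x using u(2) u(3)[OF that] by simp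
  have fpos: "0 < f x" if "x \<in> space M" for x using f(2) f(3)[OF that] by simp
  have pw: "cu powr r \<le> u x powr r \<and> u x powr r \<le> Cu powr r" if "x \<in> space M" "0 \<le> r" for x r
    using u(2) u(3)[OF that(1)] that(2) by (auto intro!: powr_mono2)
  have pf: "cf powr r \<le> f x powr r \<and> f x powr r \<le> Cf powr r" if "x \<in> space M" "0 \<le> r" for x r
    using f(2) f(3)[OF that(1)] that(2) by (auto intro!: powr_mono2)
  have iu: "integrable M (\<lambda>x. u x powr r)" if "0 \<le> r" for r
    using u(1) pw[OF _ that] by (intro integrable_bounded[where C="Cu powr r"]) auto
  have if': "integrable M (\<lambda>x. f x powr r)" if "0 \<le> r" for r
    using f(1) pf[OF _ that] by (intro integrable_bounded[where C="Cf powr r"]) auto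
  have iu1: "integrable M u" using u upos by (intro integrable_bounded[where C=Cu]) (auto simp: less_imp_le)
  have iuf: "integrable M (\<lambda>x. u x powr (\<gamma> - 1) * f x)"
  proof (rule integrable_bounded[where C="Cu powr (\<gamma> - 1) * Cf"])
    show "(\<lambda>x. u x powr (\<gamma> - 1) * f x) \<in> borel_measurable M" using u f by measurable
    show "0 \<le> u x powr (\<gamma> - 1) * f x \<and> u x powr (\<gamma> - 1) * f x \<le> Cu powr (\<gamma> - 1) * Cf" if "x \<in> space M" for x
      using pw[OF that, of "\<gamma> - 1"] f(3)[OF that] fpos[OF that] \<gamma> by (auto intro!: mult_mono)
  qed
  define Iq where "Iq = (\<integral>x. u x powr q \<partial>M)"
  have Iq: "0 < Iq" unfolding Iq_def
    using u(1,2) pw q0 by (intro integral_pos_bounded[where c="cu powr q" and C="Cu powr q"] M) auto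
  define D where "D = Iq powr (1 / q)"
  have D: "0 < D" using Iq by (simp add: D_def)
  have Dq: "D powr q = Iq" using Iq q0 by (simp add: D_def powr_powr)
  define Jp where "Jp = (\<integral>x. f x powr p \<partial>M)"
  have Jp: "0 < Jp" unfolding Jp_def
    using f(1,2) pf p by (intro integral_pos_bounded[where c="cf powr p" and C="Cf powr p"] M) auto
  have B0: "0 < B" and Bp: "B powr p = Jp" using Jp p unfolding B Jp_def[symmetric] by (simp_all add: powr_powr)
  have K': "0 < K'" using K by (simp add: K'_def)
  \<comment> \<open>This threshold gives the term to be absorbed the coefficient \<open>1/2\<close>.\<close>
  define \<tau> where "\<tau> = (2 * K') powr (1 / (q - \<gamma>))"
  have \<tau>: "0 < \<tau>" using K' by (simp add: \<tau>_def)
  have \<tau>1: "\<tau> powr (\<gamma> - 1) = (2 * K') powr ((\<gamma> - 1) / (q - \<gamma>))" by (simp add: \<tau>_def powr_powr)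
  have \<tau>2: "K' * \<tau> powr (\<gamma> - q) = 1 / 2"
  proof -
    have "\<tau> powr (\<gamma> - q) = (2 * K') powr (- 1)"
      unfolding \<tau>_def powr_powr using q\<gamma> by (intro arg_cong2[where f="(powr)"]) (auto simp: field_simps)
    then show ?thesis using K' by (simp add: powr_minus_divide)
  qed
  have I1: "(\<integral>x. u x powr \<gamma> \<partial>M) \<le> \<tau> powr (\<gamma> - 1) * D powr (\<gamma> - 1) * (K\<^sub>2 * B) + \<tau> powr (\<gamma> - q) * D powr \<gamma>"
  proof -
    have "(\<integral>x. u x powr \<gamma> \<partial>M) \<le> (\<integral>x. (\<tau> * D) powr (\<gamma> - 1) * u x + (\<tau> * D) powr (\<gamma> - q) * u x powr q \<partial>M)"
    proof (rule integral_mono)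
      show "integrable M (\<lambda>x. u x powr \<gamma>)" using \<gamma> by (intro iu) simp
      show "integrable M (\<lambda>x. (\<tau> * D) powr (\<gamma> - 1) * u x + (\<tau> * D) powr (\<gamma> - q) * u x powr q)"
        using iu1 iu[of q] q0 by simp
      show "u x powr \<gamma> \<le> (\<tau> * D) powr (\<gamma> - 1) * u x + (\<tau> * D) powr (\<gamma> - q) * u x powr q" if "x \<in> space M" for x
        using \<gamma> q\<gamma> \<tau> D upos[OF that] by (intro powr_interpolate) auto
    qed
    also have "\<dots> = (\<tau> * D) powr (\<gamma> - 1) * (\<integral>x. u x \<partial>M) + (\<tau> * D) powr (\<gamma> - q) * D powr q"
      using iu1 iu[of q] q0 by (simp add: Dq Iq_def)
    also have "\<dots> \<le> (\<tau> * D) powr (\<gamma> - 1) * (K\<^sub>2 * B) + (\<tau> * D) powr (\<gamma> - q) * D powr q"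
      using A by (intro add_right_mono mult_left_mono) auto
    also have "(\<tau> * D) powr (\<gamma> - q) * D powr q = \<tau> powr (\<gamma> - q) * D powr \<gamma>"
      using \<tau> D by (simp add: powr_mult mult.assoc powr_add[symmetric])
    also have "(\<tau> * D) powr (\<gamma> - 1) = \<tau> powr (\<gamma> - 1) * D powr (\<gamma> - 1)" using \<tau> D by (simp add: powr_mult)
    finally show ?thesis .
  qed
  have I2: "(\<integral>x. u x powr (\<gamma> - 1) * f x \<partial>M) \<le> D powr (\<gamma> - 1) * B * (2 + V)"
  proof -
    have "(\<integral>x. u x powr (\<gamma> - 1) * f x \<partial>M) \<le> (\<integral>x. D powr (\<gamma> - 1) * B * (u x powr q / Iq + 1 + f x powr p / Jp) \<partial>M)"
    proof (rule integral_mono[OF iuf])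
      show "integrable M (\<lambda>x. D powr (\<gamma> - 1) * B * (u x powr q / Iq + 1 + f x powr p / Jp))"
        using iu[of q] if'[of p] q0 p by simp
      fix x assume x: "x \<in> space M"
      have "(u x / D) powr (\<gamma> - 1) * (f x / B) \<le> (u x / D) powr q + 1 + (f x / B) powr p"
        using upos[OF x] fpos[OF x] D B0 \<gamma> q\<gamma> p q0 by (intro young_type_bound) auto
      also have "\<dots> = u x powr q / Iq + 1 + f x powr p / Jp"
        using upos[OF x] fpos[OF x] D B0 by (simp add: powr_divide Dq Bp)
      finally have "D powr (\<gamma> - 1) * B * ((u x / D) powr (\<gamma> - 1) * (f x / B)) \<le> D powr (\<gamma> - 1) * B * (u x powr q / Iq + 1 + f x powr p / Jp)"
        using D B0 by (intro mult_left_mono) auto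
      moreover have "D powr (\<gamma> - 1) * B * ((u x / D) powr (\<gamma> - 1) * (f x / B)) = u x powr (\<gamma> - 1) * f x"
        using upos[OF x] D B0 by (simp add: powr_divide)
      ultimately show "u x powr (\<gamma> - 1) * f x \<le> D powr (\<gamma> - 1) * B * (u x powr q / Iq + 1 + f x powr p / Jp)" by simp
    qed
    also have "\<dots> = D powr (\<gamma> - 1) * B * ((\<integral>x. u x powr q \<partial>M) / Iq + V + (\<integral>x. f x powr p \<partial>M) / Jp)"
      using iu[of q] if'[of p] q0 p by (simp add: V_def)
    also have "\<dots> = D powr (\<gamma> - 1) * B * (2 + V)"
      using Iq Jp by (simp add: Iq_def[symmetric] Jp_def[symmetric])
    finally show ?thesis .
  qed
  let ?I = "\<integral>x. u x powr \<gamma> + u x powr (\<gamma> - 1) * f x \<partial>M"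
  have I0: "0 \<le> ?I" using fpos by (intro Bochner_Integration.integral_nonneg) (auto simp: less_imp_le)
  have Isum: "?I = (\<integral>x. u x powr \<gamma> \<partial>M) + (\<integral>x. u x powr (\<gamma> - 1) * f x \<partial>M)"
    using iu[of \<gamma>] iuf \<gamma> by simp
  define X where "X = \<tau> powr (\<gamma> - 1) * K\<^sub>2 + 2 + V"
  have "D powr \<gamma> = Iq powr (1 / e)" using Iq q e \<gamma> by (simp add: D_def powr_powr)
  also have "\<dots> \<le> (K * ?I powr e) powr (1 / e)" using sob Iq e unfolding Iq_def by (intro powr_mono2) auto
  also have "\<dots> = K' * ?I" using K I0 e by (simp add: powr_mult powr_powr K'_def)
  also have "\<dots> \<le> K' * (\<tau> powr (\<gamma> - 1) * D powr (\<gamma> - 1) * (K\<^sub>2 * B) + \<tau> powr (\<gamma> - q) * D powr \<gamma> + D powr (\<gamma> - 1) * B * (2 + V))"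
    unfolding Isum using I1 I2 K' by (intro mult_left_mono) auto
  also have "\<dots> = K' * D powr (\<gamma> - 1) * X * B + (K' * \<tau> powr (\<gamma> - q)) * D powr \<gamma>"
    unfolding X_def by (simp add: algebra_simps)
  finally have "D powr \<gamma> \<le> 2 * K' * D powr (\<gamma> - 1) * X * B"
    unfolding \<tau>2 by simp
  moreover have "D powr \<gamma> = D powr (\<gamma> - 1) * D" using D by (simp add: powr_mult_base mult.commute)
  ultimately have "D powr (\<gamma> - 1) * D \<le> D powr (\<gamma> - 1) * (2 * K' * X * B)"
    by (simp add: mult_ac)
  then have "D \<le> 2 * K' * X * B"
    by (rule mult_left_le_imp_le) (use D in simp)
  then show ?thesis by (simp add: D_def Iq_def \<tau>1 X_def)
qed

section \<open>The tensor norm and the symmetrised distance\<close>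

lemma continuous_on_matrix_inv_entry:
  fixes A :: "'x::topological_space \<Rightarrow> real^'n^'n"
  assumes A: "continuous_on S A" and inv: "\<And>x. x \<in> S \<Longrightarrow> invertible (A x)"
  shows "continuous_on S (\<lambda>x. matrix_inv (A x) $ a $ b)"
proof -
  have eq: "matrix_inv (A x) $ a $ b = det (\<chi> i j. if j = a then axis b 1 $ i else A x $ i $ j) / det (A x)" if "x \<in> S" for x
  proof -
    have d: "det (A x) \<noteq> 0" using inv[OF that] by (simp add: invertible_det_nz)
    have "A x *v (matrix_inv (A x) *v axis b 1) = axis b 1"
      by (simp add: matrix_vector_mul_assoc matrix_inv_mult[OF inv[OF that]])
    then have "matrix_inv (A x) *v axis b 1 = (\<chi> k. det (\<chi> i j. if j = k then axis b 1 $ i else A x $ i $ j) / det (A x))"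
      using cramer[OF d, of "matrix_inv (A x) *v axis b 1" "axis b 1"] by simp
    moreover have "(matrix_inv (A x) *v axis b 1) $ a = matrix_inv (A x) $ a $ b"
      by (simp add: matrix_vector_mult_basis column_def)
    ultimately show ?thesis by simp
  qed
  have comp: "continuous_on S (\<lambda>x. A x $ i $ j)" for i j by (intro continuous_intros A)
  have comp': "continuous_on S (\<lambda>x. if P then c else A x $ i $ j)" for P i j and c :: real
    by (cases P) (auto intro: comp)
  have "continuous_on S (\<lambda>x. det (\<chi> i j. if j = a then axis b 1 $ i else A x $ i $ j) / det (A x))"
  proof (intro continuous_on_divide)
    show "continuous_on S (\<lambda>x. det (\<chi> i j. if j = a then axis b 1 $ i else A x $ i $ j))"
      unfolding det_def vec_lambda_beta
      by (intro continuous_on_sum continuous_on_mult continuous_on_prod continuous_on_const comp')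
    show "continuous_on S (\<lambda>x. det (A x))"
      unfolding det_def by (intro continuous_on_sum continuous_on_mult continuous_on_prod continuous_on_const comp)
    show "\<forall>x\<in>S. det (A x) \<noteq> 0" using inv by (simp add: invertible_det_nz)
  qed
  then show ?thesis by (rule continuous_on_eq) (simp add: eq)
qed

lemma quad_form_bound:
  fixes A :: "real^'n^'n"
  shows "\<bar>d \<bullet> (A *v d)\<bar> \<le> real (CARD('n) * CARD('n)) * norm A * (norm d)\<^sup>2"
proof -
  have "\<bar>d \<bullet> (A *v d)\<bar> \<le> (\<Sum>i\<in>UNIV. \<Sum>j\<in>UNIV. \<bar>d$i * A$i$j * d$j\<bar>)"
    unfolding quad_form_sum by (intro order_trans[OF sum_abs] sum_mono sum_abs)
  also have "\<dots> \<le> (\<Sum>i\<in>(UNIV::'n set). \<Sum>j\<in>(UNIV::'n set). norm d * norm A * norm d)"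
  proof (intro sum_mono)
    fix i j
    have "\<bar>A$i$j\<bar> \<le> norm A" using component_le_norm_cart[of "A$i" j] Finite_Cartesian_Product.norm_nth_le[of A i] by linarith
    then show "\<bar>d$i * A$i$j * d$j\<bar> \<le> norm d * norm A * norm d"
      unfolding abs_mult by (intro mult_mono component_le_norm_cart) auto
  qed
  also have "\<dots> = real (CARD('n) * CARD('n)) * norm A * (norm d)\<^sup>2" by (simp add: power2_eq_square)
  finally show ?thesis .
qed

context smooth_mfd
begin

text \<open>Continuity on the manifold is checked in coordinates.\<close>

lemma continuous_map_chartI:
  fixes \<phi> :: "'a \<Rightarrow> 'b::topological_space"
  assumes "\<And>i. i \<in> charts M \<Longrightarrow> continuous_on (cimg M i) (\<lambda>v. \<phi> (cinv M i v))"
  shows "continuous_map (points M) euclidean \<phi>"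
proof (rule pasting_lemma[where I="charts M" and T="cdom M" and f="\<lambda>_. \<phi>"])
  fix i assume i: "i \<in> charts M"
  show "openin (points M) (cdom M i)" by (rule open_cdom[OF i])
  have "continuous_map (subtopology (points M) (cdom M i)) (top_of_set (cimg M i)) (cmap M i)"
    using homeo_cmap[OF i] by (rule homeomorphic_imp_continuous_map)
  moreover have "continuous_map (top_of_set (cimg M i)) euclidean (\<lambda>v. \<phi> (cinv M i v))"
    using assms[OF i] by simp
  ultimately have "continuous_map (subtopology (points M) (cdom M i)) euclidean ((\<lambda>v. \<phi> (cinv M i v)) \<circ> cmap M i)"
    by (rule continuous_map_compose)
  then show "continuous_map (subtopology (points M) (cdom M i)) euclidean \<phi>"
  proof (rule continuous_map_eq)
    fix x assume "x \<in> topspace (subtopology (points M) (cdom M i))"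
    then have "x \<in> cdom M i" by simp
    then show "((\<lambda>v. \<phi> (cinv M i v)) \<circ> cmap M i) x = \<phi> x" using cinv_cmap[OF i] by simp
  qed
next
  fix x assume "x \<in> topspace (points M)"
  then show "\<exists>i. i \<in> charts M \<and> x \<in> cdom M i \<and> \<phi> x = \<phi> x" using chart_at by blast
qed simp

end

context riem_mfd
begin

lemma jacobian_invertible:
  assumes "i \<in> charts M" "j \<in> charts M" "x \<in> cdom M i \<inter> cdom M j"
  shows "invertible (jacobian M i j x)"
proof -
  have "posdef (g i x)" using assms by (intro metric_posdef) auto
  then have "det (g i x) \<noteq> 0" using posdef_det_pos by force
  then have "det (jacobian M i j x) \<noteq> 0" unfolding metric_change[OF assms] by (simp add: det_mul)
  then show ?thesis by (simp add: invertible_det_nz)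
qed

lemma tensor_norm_chart:
  assumes h: "riemannian_metric M h" and i: "i \<in> charts M" "x \<in> cdom M i"
  shows "tensor_norm M g h x = sqrt (contraction2 (matrix_inv (g i x)) (h i x))"
proof -
  interpret h: riem_mfd M h by unfold_locales (rule h)
  have x: "x \<in> topspace (points M)" using cdom_subset[OF i(1)] i(2) by blast
  let ?c = "chart_at M x"
  note c = chart_at[OF x]
  have ov: "x \<in> cdom M i \<inter> cdom M ?c" using i c by simp
  have ginv: "invertible (g ?c x)" by (rule posdef_invertible[OF metric_posdef[OF c]])
  have "tensor_norm M g h x = sqrt (contraction2 (matrix_inv (g ?c x)) (h ?c x))"
    by (simp add: tensor_norm_def Let_def contraction2_def)
  also have "contraction2 (matrix_inv (g ?c x)) (h ?c x) = contraction2 (matrix_inv (g i x)) (h i x)"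
    unfolding metric_change[OF i(1) c(1) ov] h.metric_change[OF i(1) c(1) ov]
    by (rule contraction2_invariant[OF jacobian_invertible[OF i(1) c(1) ov] ginv, symmetric])
  finally show ?thesis .
qed

lemma quad_form_le_tensor_norm:
  assumes h: "riemannian_metric M h" and i: "i \<in> charts M" "x \<in> cdom M i"
  shows "d \<bullet> (h i x *v d) \<le> tensor_norm M g h x * (d \<bullet> (g i x *v d))"
  unfolding tensor_norm_chart[OF assms] by (rule quad_form_le_contraction2[OF metric_posdef[OF i]])

text \<open>Positivity comes from \<open>quad_form_le_tensor_norm\<close>: \<open>h\<close> is positive on some vector.\<close>

lemma tensor_norm_pos:
  assumes h: "riemannian_metric M h" and x: "x \<in> topspace (points M)"
  shows "0 < tensor_norm M g h x"
proof -
  interpret h: riem_mfd M h by unfold_locales (rule h)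
  note c = chart_at[OF x]
  define d where "d = (axis undefined 1 :: real^'n)"
  have d: "d \<noteq> 0" by (simp add: d_def axis_eq_0_iff)
  have "0 < d \<bullet> (h (chart_at M x) x *v d)" using h.metric_posdef[OF c] d by (simp add: posdef_def)
  also have "\<dots> \<le> tensor_norm M g h x * (d \<bullet> (g (chart_at M x) x *v d))" by (rule quad_form_le_tensor_norm[OF h c])
  finally show ?thesis using metric_posdef[OF c] d by (simp add: posdef_def zero_less_mult_iff) (meson less_asym)
qed

lemma tensor_norm_continuous:
  assumes h: "riemannian_metric M h"
  shows "continuous_map (points M) euclideanreal (tensor_norm M g h)"
proof (rule continuous_map_chartI)
  interpret h: riem_mfd M h by unfold_locales (rule h)
  fix i assume i: "i \<in> charts M"
  have cg: "continuous_on (cimg M i) (\<lambda>v. matrix_inv (g i (cinv M i v)) $ a $ b)" for a b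
    by (rule continuous_on_matrix_inv_entry[OF metric_continuous[OF i]])
       (rule posdef_invertible[OF metric_posdef[OF i cinv_in_cdom]])
  have ch: "continuous_on (cimg M i) (\<lambda>v. h i (cinv M i v) $ a $ b)" for a b
    by (intro continuous_intros h.metric_continuous[OF i])
  have "continuous_on (cimg M i) (\<lambda>v. sqrt (contraction2 (matrix_inv (g i (cinv M i v))) (h i (cinv M i v))))"
    unfolding contraction2_def by (intro continuous_on_real_sqrt continuous_on_sum continuous_on_mult cg ch)
  then show "continuous_on (cimg M i) (\<lambda>v. tensor_norm M g h (cinv M i v))"
    by (rule continuous_on_eq) (simp add: tensor_norm_chart[OF h i cinv_in_cdom])
qed

text \<open>Symmetrisation makes symmetry immediate, without any discussion of reversed curves, and costs only a factor.\<close>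

definition sym_dist :: "'a \<Rightarrow> 'a \<Rightarrow> real" where
  "sym_dist x y = tame_dist x y + tame_dist y x"

lemma sym_dist_commute: "sym_dist x y = sym_dist y x"
  by (simp add: sym_dist_def)

text \<open>The segment lemma with a constant bound \<open>L\<close> on the speed; both directions together give the factor 2.\<close>

lemma sym_dist_segment_bound:
  assumes i: "i \<in> charts M" and K: "convex K" "K \<subseteq> cimg M i" and vw: "v \<in> K" "w \<in> K"
    and L: "\<And>z. z \<in> K \<Longrightarrow> (w - v) \<bullet> (g i (cinv M i z) *v (w - v)) \<le> L\<^sup>2" "0 \<le> L"
  shows "sym_dist (cinv M i v) (cinv M i w) \<le> 2 * L"
proof -
  have *: "tame_dist (cinv M i v) (cinv M i w) \<le> L" if vw: "v \<in> K" "w \<in> K"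
    and b: "\<And>z. z \<in> K \<Longrightarrow> (w - v) \<bullet> (g i (cinv M i z) *v (w - v)) \<le> L\<^sup>2" for v w
  proof -
    have sK: "closed_segment v w \<subseteq> K" using vw by (intro closed_segment_subset K)
    then have seg: "closed_segment v w \<subseteq> cimg M i" using K by blast
    let ?F = "\<lambda>t. sqrt ((w - v) \<bullet> (g i (cinv M i (v + t *\<^sub>R (w - v))) *v (w - v)))"
    have "integral {0..1} ?F \<le> integral {0..1} (\<lambda>t::real. L)"
    proof (rule integral_le)
      have "continuous_on {0..1} (\<lambda>t. g i (cinv M i (v + t *\<^sub>R (w - v))))"
        by (rule continuous_on_compose2[OF metric_continuous[OF i]])
           (use segment_mem[OF seg] in \<open>auto intro!: continuous_intros\<close>)
      then have "continuous_on {0..1} ?F" unfolding quad_form_sum by (intro continuous_intros)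
      then show "?F integrable_on {0..1}" by (rule integrable_continuous_real)
      show "?F t \<le> L" if "t \<in> {0..1}" for t
        using b[OF segment_mem[OF sK that]] L(2) by (intro real_le_lsqrt) auto
    qed (rule integrable_const_ivl)
    then show ?thesis using tame_dist_segment[OF i seg] by simp
  qed
  have "(v - w) \<bullet> (g i (cinv M i z) *v (v - w)) = (w - v) \<bullet> (g i (cinv M i z) *v (w - v))" for z
    unfolding quad_form_sum by (intro sum.cong refl) (simp add: algebra_simps)
  then show ?thesis using *[OF vw L(1)] *[of w v] vw L(1) by (simp add: sym_dist_def)
qed

end

locale connected_riem_mfd = riem_mfd M g for M :: "('a, 'i, 'n::finite) mfd" and g +
  assumes connected: "connected_space (points M)"
begin

lemma sym_dist_nonneg: "x \<in> topspace (points M) \<Longrightarrow> y \<in> topspace (points M) \<Longrightarrow> 0 \<le> sym_dist x y"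
  using tame_dist_nonneg[OF connected] by (simp add: sym_dist_def)

lemma sym_dist_triangle:
  "x \<in> topspace (points M) \<Longrightarrow> y \<in> topspace (points M) \<Longrightarrow> z \<in> topspace (points M) \<Longrightarrow>
     sym_dist x z \<le> sym_dist x y + sym_dist y z"
  using tame_dist_triangle[OF connected, of x y z] tame_dist_triangle[OF connected, of z y x] by (simp add: sym_dist_def)

lemma riemannian_dist_le_sym_dist:
  "x \<in> topspace (points M) \<Longrightarrow> y \<in> topspace (points M) \<Longrightarrow> riemannian_dist M g x y \<le> sym_dist x y"
  using riemannian_dist_le_tame_dist[OF connected, of x y] tame_dist_nonneg[OF connected, of y x] by (simp add: sym_dist_def)

text \<open>Near \<open>x\<close> the metric is bounded in coordinates, so short segments have small length.\<close>

lemma sym_dist_small: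
  assumes x: "x \<in> topspace (points M)" and e: "0 < e"
  obtains U where "openin (points M) U" "x \<in> U" "\<And>y. y \<in> U \<Longrightarrow> sym_dist x y < e"
proof -
  obtain i r where i: "i \<in> charts M" "x \<in> cdom M i" "0 < r" "ball (cmap M i x) r \<subseteq> cimg M i"
    using chart_ball[OF x] by metis
  let ?c = "cmap M i x" and ?K = "cball (cmap M i x) (r / 2)"
  have "?K \<subseteq> ball ?c r" using i(3) by auto
  then have K: "?K \<subseteq> cimg M i" using i(4) by blast
  have "compact ((\<lambda>v. g i (cinv M i v)) ` ?K)"
    by (rule compact_continuous_image[OF continuous_on_subset[OF metric_continuous[OF i(1)] K] compact_cball])
  then have "bounded ((\<lambda>v. g i (cinv M i v)) ` ?K)" by (rule compact_imp_bounded)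
  then obtain B where "\<forall>A\<in>(\<lambda>v. g i (cinv M i v)) ` ?K. norm A \<le> B" unfolding bounded_iff by blast
  then have B: "norm (g i (cinv M i v)) \<le> B" if "v \<in> ?K" for v using that by blast
  have "norm (g i (cinv M i ?c)) \<le> B" using i(3) by (intro B) simp
  then have B0: "0 \<le> B" using norm_ge_zero order_trans by blast
  define m where "m = real (CARD('n) * CARD('n)) * B + 1"
  have m: "0 < m" using B0 by (simp add: m_def add_nonneg_pos)
  have close: "sym_dist x (cinv M i w) \<le> 2 * (sqrt m * norm (w - ?c))" if w: "w \<in> ?K" for w
  proof -
    have "sym_dist (cinv M i ?c) (cinv M i w) \<le> 2 * (sqrt m * norm (w - ?c))"
    proof (rule sym_dist_segment_bound[OF i(1) convex_cball K _ w])
      show "?c \<in> ?K" using i(3) by simp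
      fix z assume z: "z \<in> ?K"
      have "(w - ?c) \<bullet> (g i (cinv M i z) *v (w - ?c)) \<le> real (CARD('n) * CARD('n)) * norm (g i (cinv M i z)) * (norm (w - ?c))\<^sup>2"
        using quad_form_bound[of "w - ?c" "g i (cinv M i z)"] by linarith
      also have "\<dots> \<le> m * (norm (w - ?c))\<^sup>2"
        using B[OF z] by (intro mult_right_mono) (auto simp: m_def intro!: add_increasing2 mult_left_mono)
      also have "\<dots> = (sqrt m * norm (w - ?c))\<^sup>2" using m by (simp add: power_mult_distrib)
      finally show "(w - ?c) \<bullet> (g i (cinv M i z) *v (w - ?c)) \<le> (sqrt m * norm (w - ?c))\<^sup>2" .
    qed (use m in simp)
    then show ?thesis by (simp add: cinv_cmap[OF i(1,2)])
  qed
  define s where "s = min (r / 2) (e / (4 * sqrt m))"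
  have s: "0 < s" "s \<le> r / 2" "2 * (sqrt m * s) < e"
  proof -
    show "0 < s" "s \<le> r / 2" using i(3) e m by (auto simp: s_def)
    have "2 * (sqrt m * s) \<le> 2 * (sqrt m * (e / (4 * sqrt m)))" using m by (intro mult_left_mono) (auto simp: s_def)
    also have "\<dots> = e / 2" using m by simp
    also have "\<dots> < e" using e by simp
    finally show "2 * (sqrt m * s) < e" .
  qed
  have sub: "ball ?c s \<subseteq> ?K" using s by (auto simp: dist_norm)
  show ?thesis
  proof (rule that)
    show "openin (points M) (cinv M i ` ball ?c s)" using sub K by (intro open_cinv_image i(1)) auto
    have "cinv M i ?c \<in> cinv M i ` ball ?c s" using s by (intro imageI) simp
    then show "x \<in> cinv M i ` ball ?c s" by (simp only: cinv_cmap[OF i(1,2)])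
    fix y assume "y \<in> cinv M i ` ball ?c s"
    then obtain w where w: "w \<in> ball ?c s" "y = cinv M i w" by blast
    have "norm (w - ?c) < s" using w by (simp add: dist_norm norm_minus_commute)
    then have "2 * (sqrt m * norm (w - ?c)) \<le> 2 * (sqrt m * s)" using m by (intro mult_left_mono) auto
    then show "sym_dist x y < e" using close[of w] sub w s(3) by auto
  qed
qed

lemma sym_dist_refl:
  assumes "x \<in> topspace (points M)" shows "sym_dist x x = 0"
proof (rule antisym)
  show "sym_dist x x \<le> 0"
  proof (rule field_le_epsilon)
    fix e :: real assume "0 < e"
    then obtain U where "x \<in> U" "\<And>y. y \<in> U \<Longrightarrow> sym_dist x y < e" using sym_dist_small[OF assms] by metis
    then show "sym_dist x x \<le> 0 + e" by (simp add: less_imp_le)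
  qed
qed (rule sym_dist_nonneg[OF assms assms])

text \<open>By the triangle inequality, smallness near the diagonal is enough.\<close>

lemma sym_dist_continuous:
  "continuous_map (prod_topology (points M) (points M)) euclideanreal (\<lambda>(x, y). sym_dist x y)"
proof -
  let ?X = "points M" and ?P = "prod_topology (points M) (points M)"
  have "\<exists>W. openin ?P W \<and> p \<in> W \<and> (\<forall>q\<in>W. \<bar>case_prod sym_dist q - case_prod sym_dist p\<bar> < e)"
    if p: "p \<in> topspace ?P" and e: "0 < e" for p e
  proof -
    obtain x y where xy: "p = (x, y)" "x \<in> topspace ?X" "y \<in> topspace ?X" using p by auto
    obtain U where U: "openin ?X U" "x \<in> U" "\<And>z. z \<in> U \<Longrightarrow> sym_dist x z < e / 2"
      using sym_dist_small[OF xy(2), of "e / 2"] e by auto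
    obtain V where V: "openin ?X V" "y \<in> V" "\<And>z. z \<in> V \<Longrightarrow> sym_dist y z < e / 2"
      using sym_dist_small[OF xy(3), of "e / 2"] e by auto
    have "\<bar>sym_dist a b - sym_dist x y\<bar> < e" if "a \<in> U" "b \<in> V" for a b
    proof -
      have a: "a \<in> topspace ?X" and b: "b \<in> topspace ?X" using that U(1) V(1) openin_subset by blast+
      have "sym_dist a b \<le> sym_dist a x + (sym_dist x y + sym_dist y b)"
        using sym_dist_triangle[OF a xy(2) b] sym_dist_triangle[OF xy(2,3) b] by linarith
      moreover have "sym_dist x y \<le> sym_dist x a + (sym_dist a b + sym_dist b y)"
        using sym_dist_triangle[OF xy(2) a xy(3)] sym_dist_triangle[OF a b xy(3)] by linarith
      ultimately show ?thesis
        using U(3)[OF that(1)] V(3)[OF that(2)] sym_dist_commute[of a x] sym_dist_commute[of b y] by linarith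
    qed
    then show ?thesis using U V xy by (intro exI[of _ "U \<times> V"]) (auto simp: openin_prod_Times_iff)
  qed
  note key = this
  show ?thesis
    unfolding continuous_map_def
  proof (intro conjI allI impI)
    fix S :: "real set" assume "openin euclideanreal S"
    then have S: "open S" by simp
    show "openin ?P {p \<in> topspace ?P. (case p of (x, y) \<Rightarrow> sym_dist x y) \<in> S}"
    proof (subst openin_subopen, rule ballI)
      fix p assume p: "p \<in> {p \<in> topspace ?P. (case p of (x, y) \<Rightarrow> sym_dist x y) \<in> S}"
      then obtain e where e: "0 < e" "\<And>r. \<bar>r - case_prod sym_dist p\<bar> < e \<Longrightarrow> r \<in> S"
        using S unfolding open_dist by (auto simp: dist_real_def)
      obtain W where W: "openin ?P W" "p \<in> W" "\<forall>q\<in>W. \<bar>case_prod sym_dist q - case_prod sym_dist p\<bar> < e"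
        using key[of p e] p e(1) by auto
      have "W \<subseteq> {p \<in> topspace ?P. (case p of (x, y) \<Rightarrow> sym_dist x y) \<in> S}"
        using W e(2) openin_subset[OF W(1)] by blast
      then show "\<exists>T. openin ?P T \<and> p \<in> T \<and> T \<subseteq> {p \<in> topspace ?P. (case p of (x, y) \<Rightarrow> sym_dist x y) \<in> S}"
        using W by blast
    qed
  qed auto
qed

lemma sym_dist_continuous_right:
  assumes "x \<in> topspace (points M)"
  shows "continuous_map (points M) euclideanreal (sym_dist x)"
proof -
  have "continuous_map (points M) (prod_topology (points M) (points M)) (\<lambda>y. (x, y))"
    using assms by (simp add: continuous_map_paired)
  from continuous_map_compose[OF this sym_dist_continuous] show ?thesis by (simp add: o_def)
qed

end

section \<open>Cubical charts\<close>

lemma has_integral_unit_param: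
  fixes F :: "real \<Rightarrow> real"
  assumes F: "(F has_integral I) {s..t}" and st: "s < t"
  shows "((\<lambda>r. F (s + r * (t - s))) has_integral I / (t - s)) {0..1}"
    and "((\<lambda>r. F (t + r * (s - t))) has_integral I / (t - s)) {0..1}"
proof -
  have F': "(F has_integral I) (cbox s t)" using F by simp
  have "(\<lambda>x. (1 / (t - s)) *\<^sub>R x + - ((1 / (t - s)) *\<^sub>R s)) ` cbox s t = {0..1}"
  proof (intro equalityI subsetI)
    fix r assume r: "r \<in> {0..1::real}"
    have "0 \<le> r * (t - s)" "r * (t - s) \<le> 1 * (t - s)" using r st by (auto intro!: mult_right_mono)
    moreover have "r * (s - t) = - (r * (t - s))" by (simp add: algebra_simps)
    ultimately have mem: "s + r * (t - s) \<in> cbox s t" by auto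
    have "r = (1 / (t - s)) *\<^sub>R (s + r * (t - s)) + - ((1 / (t - s)) *\<^sub>R s)"
      using st by (simp add: add_divide_distrib)
    then show "r \<in> (\<lambda>x. (1 / (t - s)) *\<^sub>R x + - ((1 / (t - s)) *\<^sub>R s)) ` cbox s t"
      using mem by (rule image_eqI)
  next
    fix y assume "y \<in> (\<lambda>x. (1 / (t - s)) *\<^sub>R x + - ((1 / (t - s)) *\<^sub>R s)) ` cbox s t"
    then obtain x where x: "s \<le> x" "x \<le> t" "y = (x - s) / (t - s)" by (auto simp: diff_divide_distrib)
    then show "y \<in> {0..1}" using st by (simp add: zero_le_divide_iff divide_le_eq_1)
  qed
  then show "((\<lambda>r. F (s + r * (t - s))) has_integral I / (t - s)) {0..1}"
    using has_integral_affinity[OF F', of "t - s" s] st by (simp add: algebra_simps)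
  have "(\<lambda>x. (1 / (s - t)) *\<^sub>R x + - ((1 / (s - t)) *\<^sub>R t)) ` cbox s t = {0..1}"
  proof (intro equalityI subsetI)
    fix r assume r: "r \<in> {0..1::real}"
    have "0 \<le> r * (t - s)" "r * (t - s) \<le> 1 * (t - s)" using r st by (auto intro!: mult_right_mono)
    moreover have "r * (s - t) = - (r * (t - s))" by (simp add: algebra_simps)
    ultimately have mem: "t + r * (s - t) \<in> cbox s t" by auto
    have "r = (1 / (s - t)) *\<^sub>R (t + r * (s - t)) + - ((1 / (s - t)) *\<^sub>R t)"
      using st by (simp add: add_divide_distrib)
    then show "r \<in> (\<lambda>x. (1 / (s - t)) *\<^sub>R x + - ((1 / (s - t)) *\<^sub>R t)) ` cbox s t"
      using mem by (rule image_eqI)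
  next
    fix y assume "y \<in> (\<lambda>x. (1 / (s - t)) *\<^sub>R x + - ((1 / (s - t)) *\<^sub>R t)) ` cbox s t"
    then obtain x where x: "s \<le> x" "x \<le> t" "y = (x - t) / (s - t)" by (auto simp: diff_divide_distrib)
    then show "y \<in> {0..1}" using st by (simp add: zero_le_divide_iff divide_le_eq_1)
  qed
  then show "((\<lambda>r. F (t + r * (s - t))) has_integral I / (t - s)) {0..1}"
    using has_integral_affinity[OF F', of "s - t" t] st by (simp add: algebra_simps)
qed

context closed_riem_mfd
begin

text \<open>The density of the volume in a chart, extended from sets to functions.\<close>

lemma nn_integral_chart:
  assumes i: "i \<in> charts M" and \<phi>: "\<phi> \<in> borel_measurable vol"
  shows "(\<integral>\<^sup>+x. \<phi> x * indicator (cdom M i) x \<partial>vol) =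
    (\<integral>\<^sup>+v. \<phi> (cinv M i v) * ennreal (vol_density i v) * indicator (cimg M i) v \<partial>lborel)"
proof -
  let ?R = "restrict_space lborel (cimg M i)" and ?w = "\<lambda>v. ennreal (vol_density i v)"
  let ?B = "borelt (points M)"
  have ci: "cimg M i \<in> sets borel" using open_cimg[OF i] by simp
  have cd: "cdom M i \<in> sets vol" using open_cdom[OF i] by (simp add: sets_vol openin_sets_borelt)
  have setsR: "sets ?R = sets (restrict_space borel (cimg M i))" by (intro sets_restrict_space_cong) simp
  have wm: "?w \<in> borel_measurable ?R"
  proof -
    have "vol_density i \<in> borel_measurable (restrict_space borel (cimg M i))"
      by (rule borel_measurable_continuous_on_restrict[OF vol_density_continuous[OF i]])
    then have "vol_density i \<in> borel_measurable ?R" using measurable_cong_sets[OF setsR refl] by blast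
    then show ?thesis by measurable
  qed
  have cm: "cinv M i \<in> measurable ?R ?B"
    using cinv_measurable[OF i] measurable_cong_sets[OF setsR refl] by blast
  have cm': "cinv M i \<in> measurable (density ?R ?w) ?B" using cm by simp
  let ?N = "distr (density ?R ?w) ?B (cinv M i)"
  have eq: "density vol (indicator (cdom M i)) = ?N"
  proof (rule measure_eqI)
    show "sets (density vol (indicator (cdom M i))) = sets ?N" by (simp add: sets_vol)
    fix A assume "A \<in> sets (density vol (indicator (cdom M i)))"
    then have A: "A \<in> sets vol" by simp
    have A': "A \<in> sets ?B" using A sets_vol by simp
    have Ac: "A \<inter> cdom M i \<in> sets vol" using A cd by blast
    have "emeasure (density vol (indicator (cdom M i))) A = emeasure vol (A \<inter> cdom M i)"
    proof -
      have "emeasure (density vol (indicator (cdom M i))) A = (\<integral>\<^sup>+x. indicator (cdom M i) x * indicator A x \<partial>vol)"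
        by (rule emeasure_density) (use cd A in auto)
      also have "\<dots> = (\<integral>\<^sup>+x. indicator (A \<inter> cdom M i) x \<partial>vol)"
        by (intro nn_integral_cong) (simp split: split_indicator)
      finally show ?thesis using Ac by simp
    qed
    also have "\<dots> = chart_vol i (A \<inter> cdom M i)" by (rule emeasure_vol_chart[OF i Ac]) simp
    also have "\<dots> = (\<integral>\<^sup>+v. ?w v * indicator (cinv M i -` A \<inter> cimg M i) v \<partial>lborel)"
    proof -
      have "cmap M i ` (A \<inter> cdom M i) = cinv M i -` A \<inter> cimg M i"
        using cmap_image_eq[OF i, of "A \<inter> cdom M i"] cinv_in_cdom by auto
      then show ?thesis by (simp add: chart_vol_def)
    qed
    also have "\<dots> = (\<integral>\<^sup>+v. (?w v * indicator (cinv M i -` A \<inter> cimg M i) v) * indicator (cimg M i) v \<partial>lborel)"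
      by (intro nn_integral_cong) (simp split: split_indicator)
    also have "\<dots> = (\<integral>\<^sup>+v. ?w v * indicator (cinv M i -` A \<inter> cimg M i) v \<partial>?R)"
      using ci by (subst nn_integral_restrict_space) auto
    also have "\<dots> = emeasure (density ?R ?w) (cinv M i -` A \<inter> space (density ?R ?w))"
      using measurable_sets[OF cm A'] by (subst emeasure_density[OF wm]) (auto simp: space_restrict_space Int_commute)
    also have "\<dots> = emeasure ?N A" by (rule emeasure_distr[OF cm' A', symmetric])
    finally show "emeasure (density vol (indicator (cdom M i))) A = emeasure ?N A" .
  qed
  have \<phi>': "\<phi> \<in> borel_measurable ?B" using \<phi> measurable_cong_sets[OF sets_vol refl] by blast
  have "(\<integral>\<^sup>+x. \<phi> x * indicator (cdom M i) x \<partial>vol) = (\<integral>\<^sup>+x. \<phi> x \<partial>density vol (indicator (cdom M i)))"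
    using \<phi> cd by (subst nn_integral_density) (auto simp: mult.commute)
  also have "\<dots> = (\<integral>\<^sup>+v. \<phi> (cinv M i v) \<partial>density ?R ?w)"
    unfolding eq by (rule nn_integral_distr[OF cm']) (simp add: \<phi>')
  also have "\<dots> = (\<integral>\<^sup>+v. ?w v * \<phi> (cinv M i v) \<partial>?R)"
    by (rule nn_integral_density[OF wm measurable_compose[OF cm \<phi>']])
  also have "\<dots> = (\<integral>\<^sup>+v. ?w v * \<phi> (cinv M i v) * indicator (cimg M i) v \<partial>lborel)"
    using ci by (subst nn_integral_restrict_space) auto
  finally show ?thesis by (simp add: mult_ac)
qed

text \<open>A parametrisation of a subset of \<open>M\<close> by the unit cube that covers the open set \<open>U\<close>. Integrals over the cube and
  over the manifold are comparable with the constant \<open>C\<close>, and along coordinate lines the distance of every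
  metric \<open>h\<close> is bounded by the integral of \<open>|h|_g^(1/2)\<close>. These are all the facts about charts that the Poincare
  and Sobolev inequalities use; the one constant \<open>C\<close> works for all \<open>h\<close>.\<close>

definition cube_chart :: "(('n \<Rightarrow> real) \<Rightarrow> 'a) \<Rightarrow> 'a set \<Rightarrow> real \<Rightarrow> bool" where
  "cube_chart \<Phi> U C \<longleftrightarrow> 0 < C \<and> openin (points M) U \<and> (\<forall>y\<in>space cube. \<Phi> y \<in> topspace (points M)) \<and>
     \<Phi> \<in> measurable cube vol \<and>
     (\<forall>\<phi>\<in>borel_measurable vol. (\<integral>\<^sup>+y. \<phi> (\<Phi> y) \<partial>cube) \<le> ennreal C * (\<integral>\<^sup>+x. \<phi> x \<partial>vol)) \<and>
     (\<forall>\<phi>\<in>borel_measurable vol. (\<integral>\<^sup>+x. \<phi> x * indicator U x \<partial>vol) \<le> ennreal C * (\<integral>\<^sup>+y. \<phi> (\<Phi> y) \<partial>cube)) \<and>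
     (\<forall>y\<in>space cube. \<forall>k. continuous_map (top_of_set {0..1}) (points M) (\<lambda>r. \<Phi> (y(k := r)))) \<and>
     (\<forall>h. riemannian_metric M h \<longrightarrow> (\<forall>y\<in>space cube. \<forall>k s t. 0 \<le> s \<and> s \<le> t \<and> t \<le> 1 \<longrightarrow>
        riem_mfd.sym_dist M h (\<Phi> (y(k := s))) (\<Phi> (y(k := t)))
          \<le> C * integral {s..t} (\<lambda>r. sqrt (tensor_norm M g h (\<Phi> (y(k := r)))))))"

text \<open>A small closed coordinate cube around \<open>x\<close>. On this compact set the volume density is bounded above and below,
  and \<open>g\<close> is bounded by a multiple of the Euclidean metric, so that \<open>quad_form_le_tensor_norm\<close> bounds the \<open>h\<close>-speed
  of a coordinate segment by a multiple of \<open>|h|_g^(1/2)\<close>.\<close>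

lemma cube_chart_exists:
  assumes x: "x \<in> topspace (points M)"
  obtains \<Phi> U C where "cube_chart \<Phi> U C" "x \<in> U"
proof -
  let ?X = "points M" and ?n = "real CARD('n)"
  obtain i r where i: "i \<in> charts M" "x \<in> cdom M i" "0 < r" "ball (cmap M i x) r \<subseteq> cimg M i"
    using chart_ball[OF x] by metis
  define c where "c = cmap M i x"
  \<comment> \<open>A cube of side \<open>r / n\<close> has its corners at distance less than \<open>r\<close> from the centre.\<close>
  define l where "l = r / ?n"
  have n: "0 < ?n" by simp
  have l: "0 < l" using i(3) by (simp add: l_def)
  define a where "a = c - (l / 2) *\<^sub>R (\<chi> k. 1)"
  define L where "L = cbox a (a + l *\<^sub>R (\<chi> k. 1))"
  have memL: "v \<in> L \<longleftrightarrow> (\<forall>k. a $ k \<le> v $ k \<and> v $ k \<le> a $ k + l)" for v by (simp add: L_def mem_box_cart)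
  have Lb: "L \<subseteq> ball c r"
  proof
    fix v assume v: "v \<in> L"
    have "norm (v - c) \<le> (\<Sum>k\<in>UNIV. \<bar>(v - c) $ k\<bar>)" by (rule norm_le_l1_cart)
    also have "\<dots> \<le> (\<Sum>k\<in>(UNIV::'n set). l / 2)"
    proof (rule sum_mono)
      fix k
      have "a $ k \<le> v $ k \<and> v $ k \<le> a $ k + l" using v memL by blast
      moreover have "a $ k = c $ k - l / 2" by (simp add: a_def)
      ultimately show "\<bar>(v - c) $ k\<bar> \<le> l / 2" unfolding vector_minus_component abs_le_iff by linarith
    qed
    also have "\<dots> = r / 2" using n by (simp add: l_def)
    also have "\<dots> < r" using i(3) by simp
    finally show "v \<in> ball c r" by (simp add: dist_norm norm_minus_commute)
  qed
  then have Lc: "L \<subseteq> cimg M i" using i(4) by (auto simp: c_def)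
  have Lcomp: "compact L" by (simp add: L_def)
  have Lborel: "L \<in> sets borel" by (simp add: L_def)
  have Lconv: "convex L" by (simp add: L_def)
  have cL: "c \<in> box a (a + l *\<^sub>R (\<chi> k. 1))" using l by (simp add: mem_box_cart a_def)
  have boxL: "box a (a + l *\<^sub>R (\<chi> k. 1)) \<subseteq> L" unfolding L_def by (rule box_subset_cbox)
  then have Lne: "L \<noteq> {}" using cL by blast
  define U where "U = cinv M i ` box a (a + l *\<^sub>R (\<chi> k. 1))"
  have Uo: "openin ?X U" unfolding U_def using boxL Lc by (intro open_cinv_image[OF i(1)]) auto
  have xU: "x \<in> U" using cL cinv_cmap[OF i(1,2)] unfolding U_def c_def by (metis image_eqI)
  define P where "P y = a + l *\<^sub>R (\<chi> k. y k)" for y :: "'n \<Rightarrow> real"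
  have PL: "P y \<in> L" if "y \<in> space cube" for y
    using that l by (auto simp: P_def memL space_cube mult_left_le)
  define \<Phi> where "\<Phi> y = cinv M i (P y)" for y
  have \<Phi>t: "\<Phi> y \<in> topspace ?X" if "y \<in> space cube" for y
    using PL[OF that] Lc cinv_in_cdom cdom_subset[OF i(1)] unfolding \<Phi>_def by blast
  let ?w = "vol_density i"
  have wc: "continuous_on L ?w" by (rule continuous_on_subset[OF vol_density_continuous[OF i(1)] Lc])
  obtain v1 where v1: "v1 \<in> L" "\<And>v. v \<in> L \<Longrightarrow> ?w v1 \<le> ?w v" using continuous_attains_inf[OF Lcomp Lne wc] by blast
  obtain v2 where v2: "v2 \<in> L" "\<And>v. v \<in> L \<Longrightarrow> ?w v \<le> ?w v2" using continuous_attains_sup[OF Lcomp Lne wc] by blast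
  have w1: "0 < ?w v1" using vol_density_pos[OF i(1)] v1 Lc by blast
  have w2: "0 < ?w v2" using vol_density_pos[OF i(1)] v2 Lc by blast
  have "bounded ((\<lambda>v. g i (cinv M i v)) ` L)"
    by (rule compact_imp_bounded[OF compact_continuous_image[OF continuous_on_subset[OF metric_continuous[OF i(1)] Lc] Lcomp]])
  then obtain B where "\<forall>A\<in>(\<lambda>v. g i (cinv M i v)) ` L. norm A \<le> B" unfolding bounded_iff by blast
  then have B: "norm (g i (cinv M i v)) \<le> B" if "v \<in> L" for v using that by blast
  have B0: "0 \<le> B" using B[OF v1(1)] norm_ge_zero order_trans by blast
  define \<Lambda> where "\<Lambda> = sqrt (?n * ?n * B)"
  have \<Lambda>0: "0 \<le> \<Lambda>" using B0 by (simp add: \<Lambda>_def)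
  have gb: "d \<bullet> (g i (cinv M i v) *v d) \<le> (\<Lambda> * norm d)\<^sup>2" if "v \<in> L" for v d
  proof -
    have "d \<bullet> (g i (cinv M i v) *v d) \<le> real (CARD('n) * CARD('n)) * norm (g i (cinv M i v)) * (norm d)\<^sup>2"
      using quad_form_bound[of d "g i (cinv M i v)"] by linarith
    also have "\<dots> \<le> ?n * ?n * B * (norm d)\<^sup>2" using B[OF that] by (intro mult_right_mono mult_left_mono) auto
    also have "\<dots> = (\<Lambda> * norm d)\<^sup>2" using B0 by (simp add: \<Lambda>_def power_mult_distrib)
    finally show ?thesis .
  qed
  \<comment> \<open>The three summands are the constants for the two comparisons of integrals and for the length of segments.\<close>
  define C where "C = 1 / (l ^ CARD('n) * ?w v1) + ?w v2 * l ^ CARD('n) + 2 * (l * \<Lambda>)"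
  have C1: "1 / (l ^ CARD('n) * ?w v1) \<le> C" and C2: "?w v2 * l ^ CARD('n) \<le> C" and C3: "2 * (l * \<Lambda>) \<le> C" and C0: "0 < C"
  proof -
    have "0 < 1 / (l ^ CARD('n) * ?w v1)" "0 < ?w v2 * l ^ CARD('n)" "0 \<le> 2 * (l * \<Lambda>)"
      using l w1 w2 \<Lambda>0 by simp_all
    then show "1 / (l ^ CARD('n) * ?w v1) \<le> C" "?w v2 * l ^ CARD('n) \<le> C" "2 * (l * \<Lambda>) \<le> C" "0 < C"
      unfolding C_def by linarith+
  qed
  have Pm: "P \<in> borel_measurable cube"
  proof (subst borel_measurable_euclidean_space, rule ballI)
    fix b :: "real^'n" assume "b \<in> Basis"
    then obtain k where b: "b = axis k 1" by (auto simp: Basis_vec_def)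
    have "(\<lambda>x. x k) \<in> measurable cube unit_interval" unfolding cube_def by measurable
    moreover have "(\<lambda>t. a $ k + l * t) \<in> measurable unit_interval borel"
      unfolding unit_interval_def by (intro measurable_restrict_space1) simp
    ultimately have "(\<lambda>x::'n \<Rightarrow> real. a $ k + l * x k) \<in> borel_measurable cube" by (rule measurable_compose)
    then show "(\<lambda>x. P x \<bullet> b) \<in> borel_measurable cube" by (simp add: b inner_axis P_def)
  qed
  have \<Phi>m: "\<Phi> \<in> measurable cube vol"
  proof -
    have "P \<in> measurable cube (restrict_space borel (cimg M i))"
      using PL Lc by (intro measurable_restrict_space2 Pm) auto
    from measurable_compose[OF this cinv_measurable[OF i(1)]]
    have "\<Phi> \<in> measurable cube (borelt ?X)" by (simp add: \<Phi>_def[abs_def])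
    then show ?thesis using measurable_cong_sets[OF refl sets_vol] by blast
  qed
  have aff: "(\<integral>\<^sup>+y. \<phi> (\<Phi> y) \<partial>cube) = ennreal (1 / l ^ CARD('n)) * (\<integral>\<^sup>+v. \<phi> (cinv M i v) * indicator L v \<partial>lborel)"
    if \<phi>: "\<phi> \<in> borel_measurable vol" for \<phi>
  proof -
    let ?\<psi> = "\<lambda>v. \<phi> (cinv M i v) * indicator L v"
    have "\<phi> \<in> borel_measurable (borelt ?X)" using \<phi> measurable_cong_sets[OF sets_vol refl] by blast
    then have "(\<lambda>v. \<phi> (cinv M i v)) \<in> borel_measurable (restrict_space borel (cimg M i))"
      by (rule measurable_compose[OF cinv_measurable[OF i(1)]])
    then have "(\<lambda>v. \<phi> (cinv M i v)) \<in> borel_measurable (restrict_space borel L)"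
      using Lc by (metis measurable_restrict_mono)
    then have \<psi>: "?\<psi> \<in> borel_measurable borel"
      using Lborel by (subst (asm) borel_measurable_restrict_space_iff_ennreal) auto
    have "(\<integral>\<^sup>+y. \<phi> (\<Phi> y) \<partial>cube) = (\<integral>\<^sup>+y. ?\<psi> (a + l *\<^sub>R (\<chi> k. y k)) \<partial>cube)"
      using PL by (intro nn_integral_cong) (simp add: \<Phi>_def P_def)
    also have "\<dots> = ennreal (1 / l ^ CARD('n)) * (\<integral>\<^sup>+v. ?\<psi> v * indicator L v \<partial>lborel)"
      using nn_integral_cube_affine[OF \<psi> l, of a] by (simp only: L_def)
    also have "(\<integral>\<^sup>+v. ?\<psi> v * indicator L v \<partial>lborel) = (\<integral>\<^sup>+v. ?\<psi> v \<partial>lborel)"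
      by (intro nn_integral_cong) (simp split: split_indicator)
    finally show ?thesis .
  qed
  have meas1: "(\<integral>\<^sup>+y. \<phi> (\<Phi> y) \<partial>cube) \<le> ennreal C * (\<integral>\<^sup>+x. \<phi> x \<partial>vol)" if \<phi>: "\<phi> \<in> borel_measurable vol" for \<phi>
  proof -
    have m: "(\<lambda>v. \<phi> (cinv M i v) * ennreal (?w v) * indicator (cimg M i) v) \<in> borel_measurable lborel"
    proof -
      have "\<phi> \<in> borel_measurable (borelt ?X)" using \<phi> measurable_cong_sets[OF sets_vol refl] by blast
      then have 1: "(\<lambda>v. \<phi> (cinv M i v)) \<in> borel_measurable (restrict_space borel (cimg M i))"
        by (rule measurable_compose[OF cinv_measurable[OF i(1)]])
      have 2: "?w \<in> borel_measurable (restrict_space borel (cimg M i))"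
        by (rule borel_measurable_continuous_on_restrict[OF vol_density_continuous[OF i(1)]])
      have "(\<lambda>v. \<phi> (cinv M i v) * ennreal (?w v)) \<in> borel_measurable (restrict_space borel (cimg M i))"
        using 1 2 by measurable
      then show ?thesis using open_cimg[OF i(1)] by (subst (asm) borel_measurable_restrict_space_iff_ennreal) auto
    qed
    have "(\<integral>\<^sup>+v. \<phi> (cinv M i v) * indicator L v \<partial>lborel)
       \<le> (\<integral>\<^sup>+v. ennreal (1 / ?w v1) * (\<phi> (cinv M i v) * ennreal (?w v) * indicator (cimg M i) v) \<partial>lborel)"
    proof (rule nn_integral_mono)
      fix v
      show "\<phi> (cinv M i v) * indicator L v \<le> ennreal (1 / ?w v1) * (\<phi> (cinv M i v) * ennreal (?w v) * indicator (cimg M i) v)"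
      proof (cases "v \<in> L")
        case True
        have "1 \<le> ennreal (1 / ?w v1) * ennreal (?w v)"
          using v1(2)[OF True] w1 by (simp add: ennreal_mult[symmetric] flip: ennreal_1 del: ennreal_1)
        then have "\<phi> (cinv M i v) * 1 \<le> \<phi> (cinv M i v) * (ennreal (1 / ?w v1) * ennreal (?w v))" by (intro mult_left_mono) auto
        then show ?thesis using True Lc by (auto simp: mult_ac)
      qed simp
    qed
    also have "\<dots> = ennreal (1 / ?w v1) * (\<integral>\<^sup>+x. \<phi> x * indicator (cdom M i) x \<partial>vol)"
      unfolding nn_integral_chart[OF i(1) \<phi>] by (rule nn_integral_cmult[OF m])
    also have "\<dots> \<le> ennreal (1 / ?w v1) * (\<integral>\<^sup>+x. \<phi> x \<partial>vol)"
      by (intro mult_left_mono nn_integral_mono) (auto split: split_indicator)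
    finally have "(\<integral>\<^sup>+y. \<phi> (\<Phi> y) \<partial>cube) \<le> ennreal (1 / l ^ CARD('n)) * (ennreal (1 / ?w v1) * (\<integral>\<^sup>+x. \<phi> x \<partial>vol))"
      unfolding aff[OF \<phi>] by (intro mult_left_mono) auto
    also have "\<dots> = ennreal (1 / (l ^ CARD('n) * ?w v1)) * (\<integral>\<^sup>+x. \<phi> x \<partial>vol)"
      using l w1 by (simp add: mult.assoc[symmetric] ennreal_mult[symmetric])
    also have "\<dots> \<le> ennreal C * (\<integral>\<^sup>+x. \<phi> x \<partial>vol)" using C1 by (intro mult_right_mono ennreal_leI) auto
    finally show ?thesis .
  qed
  have meas2: "(\<integral>\<^sup>+x. \<phi> x * indicator U x \<partial>vol) \<le> ennreal C * (\<integral>\<^sup>+y. \<phi> (\<Phi> y) \<partial>cube)" if \<phi>: "\<phi> \<in> borel_measurable vol" for \<phi>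
  proof -
    have Um: "U \<in> sets vol" using Uo by (simp add: sets_vol openin_sets_borelt)
    have Uc: "U \<subseteq> cdom M i" unfolding U_def using boxL Lc cinv_in_cdom by blast
    have "(\<integral>\<^sup>+x. \<phi> x * indicator U x \<partial>vol) = (\<integral>\<^sup>+x. (\<phi> x * indicator U x) * indicator (cdom M i) x \<partial>vol)"
      using Uc by (intro nn_integral_cong) (auto split: split_indicator)
    also have "\<dots> = (\<integral>\<^sup>+v. (\<phi> (cinv M i v) * indicator U (cinv M i v)) * ennreal (?w v) * indicator (cimg M i) v \<partial>lborel)"
      using \<phi> Um by (intro nn_integral_chart[OF i(1)]) auto
    also have "\<dots> \<le> (\<integral>\<^sup>+v. ennreal (?w v2) * (\<phi> (cinv M i v) * indicator L v) \<partial>lborel)"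
    proof (rule nn_integral_mono)
      fix v
      show "(\<phi> (cinv M i v) * indicator U (cinv M i v)) * ennreal (?w v) * indicator (cimg M i) v \<le> ennreal (?w v2) * (\<phi> (cinv M i v) * indicator L v)"
      proof (cases "v \<in> cimg M i \<and> cinv M i v \<in> U")
        case True
        then obtain v' where v': "v' \<in> box a (a + l *\<^sub>R (\<chi> k. 1))" "cinv M i v = cinv M i v'" unfolding U_def by blast
        have "v = v'" using True v' boxL Lc cmap_cinv by (metis subsetD)
        then have vL: "v \<in> L" using v' boxL by blast
        have "\<phi> (cinv M i v) * ennreal (?w v) \<le> \<phi> (cinv M i v) * ennreal (?w v2)"
          using v2(2)[OF vL] by (intro mult_left_mono ennreal_leI) auto
        then show ?thesis using True vL by (simp add: mult_ac)
      next
        case False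
        then show ?thesis by (auto split: split_indicator)
      qed
    qed
    also have "\<dots> = ennreal (?w v2) * (\<integral>\<^sup>+v. \<phi> (cinv M i v) * indicator L v \<partial>lborel)"
    proof (rule nn_integral_cmult)
      have "\<phi> \<in> borel_measurable (borelt ?X)" using \<phi> measurable_cong_sets[OF sets_vol refl] by blast
      then have "(\<lambda>v. \<phi> (cinv M i v)) \<in> borel_measurable (restrict_space borel (cimg M i))"
        by (rule measurable_compose[OF cinv_measurable[OF i(1)]])
      then have "(\<lambda>v. \<phi> (cinv M i v)) \<in> borel_measurable (restrict_space borel L)"
        using Lc by (metis measurable_restrict_mono)
      then show "(\<lambda>v. \<phi> (cinv M i v) * indicator L v) \<in> borel_measurable lborel"
        using Lborel by (subst (asm) borel_measurable_restrict_space_iff_ennreal) auto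
    qed
    also have "\<dots> = ennreal (?w v2 * l ^ CARD('n)) * (\<integral>\<^sup>+y. \<phi> (\<Phi> y) \<partial>cube)"
    proof -
      have "ennreal (?w v2 * l ^ CARD('n)) * (ennreal (1 / l ^ CARD('n)) * Z) = ennreal (?w v2) * Z" for Z
      proof -
        have "ennreal (?w v2 * l ^ CARD('n)) * ennreal (1 / l ^ CARD('n)) = ennreal (?w v2)"
          using l w2 by (simp add: ennreal_mult[symmetric])
        then show ?thesis by (simp add: mult.assoc[symmetric])
      qed
      then show ?thesis by (simp add: aff[OF \<phi>])
    qed
    also have "\<dots> \<le> ennreal C * (\<integral>\<^sup>+y. \<phi> (\<Phi> y) \<partial>cube)" using C2 by (intro mult_right_mono ennreal_leI) auto
    finally show ?thesis .
  qed
  have line: "continuous_map (top_of_set {0..1}) ?X (\<lambda>r. \<Phi> (y(k := r)))" if y: "y \<in> space cube" for y k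
  proof -
    have cc: "continuous_on {0..1} (\<lambda>r. (y(k := r)) j)" for j by (cases "j = k") (auto intro!: continuous_intros)
    have "continuous_on {0..1} (\<lambda>r. P (y(k := r)))"
      unfolding P_def by (intro continuous_on_add continuous_on_scaleR continuous_on_const continuous_on_vec_lambda cc)
    moreover have "P (y(k := r)) \<in> cimg M i" if "r \<in> {0..1}" for r
      using PL[OF fun_upd_space_cube[OF y that]] Lc by blast
    ultimately have "continuous_map (top_of_set {0..1}) (top_of_set (cimg M i)) (\<lambda>r. P (y(k := r)))"
      by (auto simp: continuous_map_in_subtopology)
    from continuous_map_compose[OF this continuous_cinv[OF i(1)]] show ?thesis by (simp add: o_def \<Phi>_def)
  qed
  have seg: "riem_mfd.sym_dist M h (\<Phi> (y(k := s))) (\<Phi> (y(k := t)))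
          \<le> C * integral {s..t} (\<lambda>r. sqrt (tensor_norm M g h (\<Phi> (y(k := r)))))"
    if h: "riemannian_metric M h" and y: "y \<in> space cube" and st: "0 \<le> s" "s \<le> t" "t \<le> 1" for h y k s t
  proof -
    interpret h: riem_mfd M h by unfold_locales (rule h)
    define F where "F r = sqrt (tensor_norm M g h (\<Phi> (y(k := r))))" for r
    have F0: "0 \<le> F r" if "r \<in> {0..1}" for r
    proof -
      have "0 < tensor_norm M g h (\<Phi> (y(k := r)))" by (rule tensor_norm_pos[OF h \<Phi>t[OF fun_upd_space_cube[OF y that]]])
      then show ?thesis by (simp add: F_def)
    qed
    have cF: "continuous_on {0..1} F"
    proof -
      have "continuous_map (top_of_set {0..1}) euclideanreal (tensor_norm M g h \<circ> (\<lambda>r. \<Phi> (y(k := r))))"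
        by (rule continuous_map_compose[OF line[OF y] tensor_norm_continuous[OF h]])
      then have "continuous_on {0..1} (\<lambda>r. tensor_norm M g h (\<Phi> (y(k := r))))" by (simp add: o_def)
      then show ?thesis unfolding F_def by (intro continuous_intros)
    qed
    have diff: "P (y(k := t)) - P (y(k := s)) = (l * (t - s)) *\<^sub>R axis k 1" for s t
      by (simp add: P_def vec_eq_iff axis_def algebra_simps)
    have pt: "P (y(k := s)) + \<tau> *\<^sub>R (P (y(k := t)) - P (y(k := s))) = P (y(k := s + \<tau> * (t - s)))" for s t \<tau>
      unfolding diff by (simp add: P_def vec_eq_iff axis_def algebra_simps)
    have td: "h.tame_dist (\<Phi> (y(k := s))) (\<Phi> (y(k := t))) \<le> l * \<Lambda> * (\<bar>t - s\<bar> * integral {0..1} (\<lambda>\<tau>. F (s + \<tau> * (t - s))))"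
      if s: "s \<in> {0..1}" and t: "t \<in> {0..1}" for s t
    proof -
      let ?v = "P (y(k := s))" and ?w = "P (y(k := t))"
      have in01: "s + \<tau> * (t - s) \<in> {0..1}" if "\<tau> \<in> {0..1}" for \<tau>
      proof -
        have "s + \<tau> * (t - s) = (1 - \<tau>) * s + \<tau> * t" by (simp add: algebra_simps)
        moreover have "(1 - \<tau>) * s + \<tau> * t \<le> (1 - \<tau>) * 1 + \<tau> * 1"
          using s t that by (intro add_mono mult_left_mono) auto
        moreover have "0 \<le> (1 - \<tau>) * s + \<tau> * t" using s t that by simp
        ultimately show ?thesis by simp
      qed
      have vw: "?v \<in> L" "?w \<in> L" using PL fun_upd_space_cube[OF y] s t by auto
      have sL: "closed_segment ?v ?w \<subseteq> L" by (rule closed_segment_subset[OF vw Lconv])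
      have sg: "closed_segment ?v ?w \<subseteq> cimg M i" using sL Lc by blast
      let ?d = "?w - ?v" and ?z = "\<lambda>\<tau>. cinv M i (?v + \<tau> *\<^sub>R (?w - ?v))"
      have nd: "norm ?d = l * \<bar>t - s\<bar>" unfolding diff using l by (simp add: abs_mult)
      have cFl: "continuous_on {0..1} (\<lambda>\<tau>. F (s + \<tau> * (t - s)))"
        by (rule continuous_on_compose2[OF cF]) (use in01 in \<open>auto intro!: continuous_intros\<close>)
      have "h.tame_dist (\<Phi> (y(k := s))) (\<Phi> (y(k := t))) \<le> integral {0..1} (\<lambda>\<tau>. sqrt (?d \<bullet> (h i (?z \<tau>) *v ?d)))"
        unfolding \<Phi>_def by (rule h.tame_dist_segment[OF i(1) sg])
      also have "\<dots> \<le> integral {0..1} (\<lambda>\<tau>. l * \<Lambda> * \<bar>t - s\<bar> * F (s + \<tau> * (t - s)))"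
      proof (rule integral_le)
        have "continuous_on {0..1} (\<lambda>\<tau>. h i (?z \<tau>))"
          by (rule continuous_on_compose2[OF h.metric_continuous[OF i(1)]])
             (use h.segment_mem[OF sg] in \<open>auto intro!: continuous_intros\<close>)
        then have "continuous_on {0..1} (\<lambda>\<tau>. sqrt (?d \<bullet> (h i (?z \<tau>) *v ?d)))" unfolding quad_form_sum by (intro continuous_intros)
        then show "(\<lambda>\<tau>. sqrt (?d \<bullet> (h i (?z \<tau>) *v ?d))) integrable_on {0..1}" by (rule integrable_continuous_real)
        show "(\<lambda>\<tau>. l * \<Lambda> * \<bar>t - s\<bar> * F (s + \<tau> * (t - s))) integrable_on {0..1}"
          by (intro integrable_continuous_real continuous_intros cFl)
        fix \<tau> :: real assume \<tau>: "\<tau> \<in> {0..1}"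
        have zL: "?v + \<tau> *\<^sub>R (?w - ?v) \<in> L" by (rule h.segment_mem[OF sL \<tau>])
        then have zc: "?z \<tau> \<in> cdom M i" using Lc cinv_in_cdom by blast
        then have zt: "?z \<tau> \<in> topspace ?X" using cdom_subset[OF i(1)] by blast
        have N0: "0 \<le> tensor_norm M g h (?z \<tau>)" using tensor_norm_pos[OF h zt] by simp
        have "?d \<bullet> (h i (?z \<tau>) *v ?d) \<le> tensor_norm M g h (?z \<tau>) * (?d \<bullet> (g i (?z \<tau>) *v ?d))"
          by (rule quad_form_le_tensor_norm[OF h i(1) zc])
        also have "\<dots> \<le> tensor_norm M g h (?z \<tau>) * (\<Lambda> * norm ?d)\<^sup>2"
          using gb[OF zL] N0 by (intro mult_left_mono)
        finally have "sqrt (?d \<bullet> (h i (?z \<tau>) *v ?d)) \<le> sqrt (tensor_norm M g h (?z \<tau>) * (\<Lambda> * norm ?d)\<^sup>2)" by simp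
        also have "\<dots> = sqrt (tensor_norm M g h (?z \<tau>)) * (\<Lambda> * norm ?d)" using \<Lambda>0 by (simp add: real_sqrt_mult)
        also have "\<dots> = l * \<Lambda> * \<bar>t - s\<bar> * F (s + \<tau> * (t - s))" unfolding nd F_def \<Phi>_def pt by simp
        finally show "sqrt (?d \<bullet> (h i (?z \<tau>) *v ?d)) \<le> l * \<Lambda> * \<bar>t - s\<bar> * F (s + \<tau> * (t - s))" .
      qed
      finally show ?thesis by (simp add: mult.assoc)
    qed
    show ?thesis
    proof (cases "s = t")
      case True
      then show ?thesis using td[of s s] st by (simp add: h.sym_dist_def)
    next
      case False
      then have lt: "s < t" using st by simp
      have sub: "{s..t} \<subseteq> {0..1}" using st by auto
      have iF: "(F has_integral integral {s..t} F) {s..t}"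
        by (intro integrable_integral integrable_continuous_real continuous_on_subset[OF cF sub])
      have e1: "\<bar>t - s\<bar> * integral {0..1} (\<lambda>\<tau>. F (s + \<tau> * (t - s))) = integral {s..t} F"
        and e2: "\<bar>s - t\<bar> * integral {0..1} (\<lambda>\<tau>. F (t + \<tau> * (s - t))) = integral {s..t} F"
        using integral_unique[OF has_integral_unit_param(1)[OF iF lt]] integral_unique[OF has_integral_unit_param(2)[OF iF lt]] lt by auto
      have I0: "0 \<le> integral {s..t} F"
        using F0 sub by (intro integral_nonneg integrable_continuous_real continuous_on_subset[OF cF sub]) auto
      have "h.sym_dist (\<Phi> (y(k := s))) (\<Phi> (y(k := t))) \<le> 2 * (l * \<Lambda>) * integral {s..t} F"
        using td[of s t] td[of t s] st unfolding e1 e2 h.sym_dist_def by auto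
      also have "\<dots> \<le> C * integral {s..t} F" using C3 I0 by (rule mult_right_mono)
      finally show ?thesis by (simp add: F_def[abs_def])
    qed
  qed
  have "cube_chart \<Phi> U C"
    unfolding cube_chart_def using C0 Uo \<Phi>t \<Phi>m meas1 meas2 line seg by blast
  then show ?thesis using that xU by blast
qed

end

section \<open>Finiteness of the volume and the volume of the product\<close>

lemma continuous_map_measurable_borelt_borelt:
  assumes f: "continuous_map X Y f"
  shows "f \<in> measurable (borelt X) (borelt Y)"
  unfolding borelt_def[of Y]
proof (rule measurable_measure_of)
  show "f \<in> space (borelt X) \<rightarrow> topspace Y" using f by (auto simp: continuous_map_def)
  fix U assume "U \<in> {U. openin Y U}"
  then have "openin X {x \<in> topspace X. f x \<in> U}" using f by (auto simp: continuous_map_def)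
  moreover have "f -` U \<inter> space (borelt X) = {x \<in> topspace X. f x \<in> U}" by auto
  ultimately show "f -` U \<inter> space (borelt X) \<in> sets (borelt X)" by (metis openin_sets_borelt)
qed (auto dest: openin_subset)

text \<open>With countable bases, every open set of the product is a countable union of open rectangles.\<close>

lemma sets_borelt_prod:
  assumes X: "second_countable X" and Y: "second_countable Y"
  shows "sets (borelt (prod_topology X Y)) = sets (borelt X \<Otimes>\<^sub>M borelt Y)"
proof
  let ?P = "prod_topology X Y"
  have "(\<lambda>p. (fst p, snd p)) \<in> measurable (borelt ?P) (borelt X \<Otimes>\<^sub>M borelt Y)"
    by (intro measurable_Pair continuous_map_measurable_borelt_borelt continuous_map_fst continuous_map_snd)
  then have id: "(\<lambda>p. p) \<in> measurable (borelt ?P) (borelt X \<Otimes>\<^sub>M borelt Y)" by simp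
  show "sets (borelt X \<Otimes>\<^sub>M borelt Y) \<subseteq> sets (borelt ?P)"
  proof
    fix A assume A: "A \<in> sets (borelt X \<Otimes>\<^sub>M borelt Y)"
    then have "A \<subseteq> topspace ?P" using sets.sets_into_space[OF A] by (simp add: space_pair_measure)
    then show "A \<in> sets (borelt ?P)" using measurable_sets[OF id A] by (simp add: Int_absorb2)
  qed
  obtain BX where BX': "countable BX" "\<forall>V\<in>BX. openin X V" "\<forall>U x. openin X U \<and> x \<in> U \<longrightarrow> (\<exists>V\<in>BX. x \<in> V \<and> V \<subseteq> U)"
    using X[unfolded second_countable_def] by (elim exE conjE)
  note BX = BX'(1) BX'(2)[THEN bspec] BX'(3)[THEN spec, THEN spec, THEN mp, OF conjI]
  obtain BY where BY': "countable BY" "\<forall>V\<in>BY. openin Y V" "\<forall>U x. openin Y U \<and> x \<in> U \<longrightarrow> (\<exists>V\<in>BY. x \<in> V \<and> V \<subseteq> U)"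
    using Y[unfolded second_countable_def] by (elim exE conjE)
  note BY = BY'(1) BY'(2)[THEN bspec] BY'(3)[THEN spec, THEN spec, THEN mp, OF conjI]
  have "W \<in> sets (borelt X \<Otimes>\<^sub>M borelt Y)" if W: "openin ?P W" for W
  proof -
    define R where "R = {p \<in> BX \<times> BY. fst p \<times> snd p \<subseteq> W}"
    have "countable (BX \<times> BY)" using BX(1) BY(1) by (rule countable_SIGMA)
    moreover have "R \<subseteq> BX \<times> BY" by (simp add: R_def)
    ultimately have cR: "countable R" using countable_subset by blast
    have "W = (\<Union>p\<in>R. fst p \<times> snd p)"
    proof (intro equalityI subsetI)
      fix z assume z: "z \<in> W"
      obtain x y where xy: "z = (x, y)" by (cases z)
      obtain U V where UV: "openin X U" "openin Y V" "x \<in> U" "y \<in> V" "U \<times> V \<subseteq> W"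
        using openin_prod_topology_alt[THEN iffD1, OF W, THEN spec, THEN spec, THEN mp, OF z[unfolded xy]] by (elim exE conjE)
      obtain U' where U': "U' \<in> BX" "x \<in> U'" "U' \<subseteq> U" using BX(3)[OF UV(1,3)] by blast
      obtain V' where V': "V' \<in> BY" "y \<in> V'" "V' \<subseteq> V" using BY(3)[OF UV(2,4)] by blast
      have "U' \<times> V' \<subseteq> W" using Sigma_mono[OF U'(3), of "\<lambda>_. V'" "\<lambda>_. V"] V'(3) UV(5) by (meson order_trans)
      then have "(U', V') \<in> R" using U'(1) V'(1) by (simp add: R_def)
      moreover have "z \<in> fst (U', V') \<times> snd (U', V')" using U'(2) V'(2) xy by simp
      ultimately show "z \<in> (\<Union>p\<in>R. fst p \<times> snd p)" by (rule UN_I)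
    qed (auto simp: R_def)
    also have "\<dots> \<in> sets (borelt X \<Otimes>\<^sub>M borelt Y)"
    proof (rule sets.countable_UN''[OF cR])
      fix p assume "p \<in> R"
      then have "fst p \<in> BX" "snd p \<in> BY" by (auto simp: R_def)
      then show "fst p \<times> snd p \<in> sets (borelt X \<Otimes>\<^sub>M borelt Y)"
        by (intro pair_measureI openin_sets_borelt BX(2) BY(2))
    qed
    finally show ?thesis .
  qed
  then have "sigma_sets (topspace ?P) {W. openin ?P W} \<subseteq> sets (borelt X \<Otimes>\<^sub>M borelt Y)"
    using sets.sigma_sets_subset[of "{W. openin ?P W}" "borelt X \<Otimes>\<^sub>M borelt Y"] by (auto simp: space_pair_measure)
  then show "sets (borelt ?P) \<subseteq> sets (borelt X \<Otimes>\<^sub>M borelt Y)" by (simp add: sets_borelt)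
qed

text \<open>The coordinates of the product chart.\<close>

definition pair_vec :: "real^'n \<Rightarrow> real^'k \<Rightarrow> real^('n + 'k)" where
  "pair_vec v w = (\<chi> k. case k of Inl a \<Rightarrow> v $ a | Inr b \<Rightarrow> w $ b)"

lemma reindex_pair_vec[simp]: "reindex Inl (pair_vec v w) = v" "reindex Inr (pair_vec v w) = w"
  by (simp_all add: reindex_def pair_vec_def vec_eq_iff)

lemma pair_vec_reindex[simp]: "pair_vec (reindex Inl z) (reindex Inr z) = z"
  by (simp add: reindex_def pair_vec_def vec_eq_iff split: sum.split)

lemma measurable_pair_vec: "(\<lambda>(v, w). pair_vec v w) \<in> borel_measurable (borel :: ((real^'n::finite) \<times> (real^'k::finite)) measure)"
proof (rule borel_measurable_continuous_onI)
  have "continuous_on UNIV (\<lambda>p :: (real^'n) \<times> (real^'k). case k of Inl a \<Rightarrow> fst p $ a | Inr b \<Rightarrow> snd p $ b)" for k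
    by (cases k) (auto intro!: continuous_intros)
  then have "continuous_on UNIV (\<lambda>p :: (real^'n) \<times> (real^'k). pair_vec (fst p) (snd p))"
    unfolding pair_vec_def by (intro continuous_on_vec_lambda)
  then show "continuous_on UNIV (\<lambda>(v :: real^'n, w :: real^'k). pair_vec v w)" by (simp add: case_prod_unfold)
qed

lemma prod_sum_type:
  fixes f :: "'n::finite + 'k::finite \<Rightarrow> 'c::comm_monoid_mult"
  shows "(\<Prod>k\<in>UNIV. f k) = (\<Prod>a\<in>UNIV. f (Inl a)) * (\<Prod>b\<in>UNIV. f (Inr b))"
  unfolding UNIV_Plus_UNIV[symmetric] by (subst prod.Plus) (simp_all add: o_def)

lemma sum_sum_type:
  fixes f :: "'n::finite + 'k::finite \<Rightarrow> 'c::comm_monoid_add"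
  shows "(\<Sum>k\<in>UNIV. f k) = (\<Sum>a\<in>UNIV. f (Inl a)) + (\<Sum>b\<in>UNIV. f (Inr b))"
  unfolding UNIV_Plus_UNIV[symmetric] by (subst sum.Plus) (simp_all add: o_def)

lemma lborel_sum_type:
  "(lborel :: (real^('n::finite + 'k::finite)) measure) = distr (lborel \<Otimes>\<^sub>M lborel) borel (\<lambda>(v, w). pair_vec v w)"
proof (rule lborel_vec_eqI)
  fix l u :: "real^('n + 'k)" assume le: "\<And>i. l $ i \<le> u $ i"
  have "(\<lambda>(v :: real^'n, w :: real^'k). pair_vec v w) -` box l u = box (reindex Inl l) (reindex Inl u) \<times> box (reindex Inr l) (reindex Inr u)"
  proof -
    have all: "(\<forall>k :: 'n + 'k. Q k) \<longleftrightarrow> (\<forall>a. Q (Inl a)) \<and> (\<forall>b. Q (Inr b))" for Q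
      by (metis sum.exhaust)
    show ?thesis by (auto simp: mem_box_cart all pair_vec_def reindex_def)
  qed
  then have "emeasure (distr (lborel \<Otimes>\<^sub>M lborel) borel (\<lambda>(v :: real^'n, w :: real^'k). pair_vec v w)) (box l u)
     = emeasure (lborel \<Otimes>\<^sub>M lborel) (box (reindex Inl l) (reindex Inl u) \<times> box (reindex Inr l) (reindex Inr u))"
    using measurable_pair_vec[where 'n='n and 'k='k] by (subst emeasure_distr) (auto simp: lborel_prod space_pair_measure)
  also have "\<dots> = emeasure lborel (box (reindex Inl l) (reindex Inl u)) * emeasure lborel (box (reindex Inr l) (reindex Inr u))"
    by (rule lborel.emeasure_pair_measure_Times) auto
  also have "\<dots> = (\<Prod>i\<in>UNIV. ennreal (u $ i - l $ i))"
    using le by (simp add: emeasure_lborel_box_vec prod_sum_type reindex_def)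
  finally show "emeasure (distr (lborel \<Otimes>\<^sub>M lborel) borel (\<lambda>(v :: real^'n, w :: real^'k). pair_vec v w)) (box l u) = (\<Prod>i\<in>UNIV. ennreal (u $ i - l $ i))" .
qed simp

text \<open>The block matrix is the product of the two padded blocks.\<close>

lemma det_block:
  fixes A :: "real^'n::finite^'n" and B :: "real^'k::finite^'k"
  shows "det (\<chi> k l. case (k, l) of (Inl a, Inl b) \<Rightarrow> A $ a $ b | (Inr a, Inr b) \<Rightarrow> B $ a $ b | _ \<Rightarrow> 0) = det A * det B"
proof -
  let ?I = "Inl :: 'n \<Rightarrow> 'n + 'k" and ?J = "Inr :: 'k \<Rightarrow> 'n + 'k"
  have ij: "inj ?I" "inj ?J" by (simp_all add: inj_def)
  have invs: "inv ?I (Inl a) = a" "inv ?J (Inr b) = b" for a b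
    using ij by (simp_all add: inv_f_f)
  have P: "pad_matrix ?I A $ Inl a $ Inl b = A $ a $ b" "pad_matrix ?I A $ Inl a $ Inr d = 0"
      "pad_matrix ?I A $ Inr c $ Inl b = 0" "pad_matrix ?I A $ Inr c $ Inr d = (if c = d then 1 else 0)" for a b c d
    by (auto simp: pad_matrix_def invs)
  have Q: "pad_matrix ?J B $ Inl a $ Inl b = (if a = b then 1 else 0)" "pad_matrix ?J B $ Inl a $ Inr d = 0"
      "pad_matrix ?J B $ Inr c $ Inl b = 0" "pad_matrix ?J B $ Inr c $ Inr d = B $ c $ d" for a b c d
    by (auto simp: pad_matrix_def invs)
  have mult: "(pad_matrix ?I A ** pad_matrix ?J B) $ k $ l = (\<Sum>a\<in>UNIV. pad_matrix ?I A $ k $ Inl a * pad_matrix ?J B $ Inl a $ l)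
      + (\<Sum>b\<in>UNIV. pad_matrix ?I A $ k $ Inr b * pad_matrix ?J B $ Inr b $ l)" for k l
    by (simp add: matrix_matrix_mult_def sum_sum_type)
  have d1: "(\<Sum>a\<in>UNIV. f a * (if a = x then 1 else 0)) = f x" for f :: "'n \<Rightarrow> real" and x
  proof -
    have "(\<Sum>a\<in>UNIV. f a * (if a = x then 1 else 0)) = (\<Sum>a\<in>UNIV. if a = x then f a else 0)" by (intro sum.cong) auto
    then show ?thesis by simp
  qed
  have d2: "(\<Sum>b\<in>UNIV. (if x = b then 1 else 0) * f b) = f x" for f :: "'k \<Rightarrow> real" and x
  proof -
    have "(\<Sum>b\<in>UNIV. (if x = b then 1 else 0) * f b) = (\<Sum>b\<in>UNIV. if x = b then f b else 0)" by (intro sum.cong) auto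
    then show ?thesis by simp
  qed
  have "(pad_matrix ?I A ** pad_matrix ?J B) $ k $ l = (case (k, l) of (Inl a, Inl b) \<Rightarrow> A $ a $ b | (Inr a, Inr b) \<Rightarrow> B $ a $ b | _ \<Rightarrow> 0)" for k l
    by (cases k; cases l) (simp_all only: mult P Q d1 d2 prod.case sum.case mult_zero_left mult_zero_right sum.neutral_const add_0_left add_0_right)
  then have "(\<chi> k l. case (k, l) of (Inl a, Inl b) \<Rightarrow> A $ a $ b | (Inr a, Inr b) \<Rightarrow> B $ a $ b | _ \<Rightarrow> 0) = pad_matrix ?I A ** pad_matrix ?J B"
    by (simp add: vec_eq_iff)
  then show ?thesis by (simp add: det_mul det_pad_matrix[OF ij(1)] det_pad_matrix[OF ij(2)])
qed

context closed_riem_mfd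
begin

lemma cinv_prod_chart:
  assumes i: "i \<in> charts M" and j: "j \<in> charts M" and x: "x \<in> cdom M i" and y: "y \<in> cdom M j"
  shows "cmap (prod_mfd M M) (i, j) (x, y) = pair_vec (cmap M i x) (cmap M j y)"
    and "cinv (prod_mfd M M) (i, j) (pair_vec (cmap M i x) (cmap M j y)) = (x, y)"
proof -
  have cm: "cmap (prod_mfd M M) (i, j) (x, y) = pair_vec (cmap M i x) (cmap M j y)" for x y
    by (simp add: prod_mfd_def pair_vec_def)
  then show "cmap (prod_mfd M M) (i, j) (x, y) = pair_vec (cmap M i x) (cmap M j y)" .
  have dom: "cdom (prod_mfd M M) (i, j) = cdom M i \<times> cdom M j" by (simp add: prod_mfd_def)
  have "inj_on (cmap (prod_mfd M M) (i, j)) (cdom (prod_mfd M M) (i, j))"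
  proof (rule inj_onI)
    fix p q assume p: "p \<in> cdom (prod_mfd M M) (i, j)" and q: "q \<in> cdom (prod_mfd M M) (i, j)"
      and eq: "cmap (prod_mfd M M) (i, j) p = cmap (prod_mfd M M) (i, j) q"
    obtain a b c d where pq: "p = (a, b)" "q = (c, d)" by (cases p; cases q)
    have "pair_vec (cmap M i a) (cmap M j b) = pair_vec (cmap M i c) (cmap M j d)" using eq by (simp add: pq cm)
    then have "cmap M i a = cmap M i c" "cmap M j b = cmap M j d" by (metis reindex_pair_vec)+
    then show "p = q" using p q inj_onD[OF inj_cmap[OF i]] inj_onD[OF inj_cmap[OF j]] unfolding pq dom by blast
  qed
  from inv_into_f_f[OF this, of "(x, y)"] show "cinv (prod_mfd M M) (i, j) (pair_vec (cmap M i x) (cmap M j y)) = (x, y)"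
    using x y by (simp add: cinv_def dom cm)
qed

lemma chart_weight_measurable:
  assumes i: "i \<in> charts M" and \<phi>: "\<phi> \<in> borel_measurable vol"
  shows "(\<lambda>v. \<phi> (cinv M i v) * ennreal (vol_density i v) * indicator (cimg M i) v) \<in> borel_measurable borel"
proof -
  have "\<phi> \<in> borel_measurable (borelt (points M))" using \<phi> measurable_cong_sets[OF sets_vol refl] by blast
  then have 1: "(\<lambda>v. \<phi> (cinv M i v)) \<in> borel_measurable (restrict_space borel (cimg M i))"
    by (rule measurable_compose[OF cinv_measurable[OF i]])
  have 2: "vol_density i \<in> borel_measurable (restrict_space borel (cimg M i))"
    by (rule borel_measurable_continuous_on_restrict[OF vol_density_continuous[OF i]])
  have "(\<lambda>v. \<phi> (cinv M i v) * ennreal (vol_density i v)) \<in> borel_measurable (restrict_space borel (cimg M i))"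
    using 1 2 by measurable
  then show ?thesis using open_cimg[OF i] by (subst (asm) borel_measurable_restrict_space_iff_ennreal) auto
qed

lemma finite_subcover:
  assumes "\<And>x. x \<in> topspace (points M) \<Longrightarrow> openin (points M) (U x) \<and> x \<in> U x"
  obtains F where "finite F" "F \<subseteq> topspace (points M)" "topspace (points M) \<subseteq> (\<Union>x\<in>F. U x)"
proof -
  let ?X = "topspace (points M)"
  have op: "openin (points M) W" if "W \<in> U ` ?X" for W using that assms by blast
  have sub: "?X \<subseteq> \<Union>(U ` ?X)" using assms by blast
  have cp: "compactin (points M) ?X" using compact unfolding compact_space_def .
  from compactinD[OF cp op sub] obtain \<F> where F: "finite \<F>" "\<F> \<subseteq> U ` ?X" "?X \<subseteq> \<Union>\<F>" by blast
  from finite_subset_image[OF F(1,2)] obtain F where "F \<subseteq> ?X" "finite F" "\<F> = U ` F" by blast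
  then show ?thesis using that[of F] F(3) by simp
qed

lemma cube_chart_measure:
  assumes "cube_chart \<Phi> U C" shows "U \<in> sets vol" "emeasure vol U \<le> ennreal C"
proof -
  have o: "openin (points M) U" using assms unfolding cube_chart_def by blast
  then show s: "U \<in> sets vol" by (simp add: sets_vol openin_sets_borelt)
  have "(\<integral>\<^sup>+x. 1 * indicator U x \<partial>vol) \<le> ennreal C * (\<integral>\<^sup>+y. (\<lambda>_. 1) (\<Phi> y) \<partial>cube)"
    using assms unfolding cube_chart_def by (elim conjE) (erule bspec, simp)
  then show "emeasure vol U \<le> ennreal C" using s by (simp add: cubeM.emeasure_space_1)
qed

text \<open>Finitely many cubical charts cover \<open>M\<close>, each of finite volume.\<close>

lemma finite_vol: "finite_measure vol"
proof (rule finite_measureI)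
  have "\<forall>x\<in>topspace (points M). \<exists>U. (\<exists>\<Phi> C. cube_chart \<Phi> U C) \<and> x \<in> U"
    using cube_chart_exists by metis
  then obtain U where U: "\<And>x. x \<in> topspace (points M) \<Longrightarrow> \<exists>\<Phi> C. cube_chart \<Phi> (U x) C" "\<And>x. x \<in> topspace (points M) \<Longrightarrow> x \<in> U x"
    by metis
  have "openin (points M) (U x) \<and> x \<in> U x" if "x \<in> topspace (points M)" for x
    using U[OF that] unfolding cube_chart_def by blast
  then obtain F where F: "finite F" "F \<subseteq> topspace (points M)" "topspace (points M) \<subseteq> (\<Union>x\<in>F. U x)" by (rule finite_subcover)
  have fin: "U x \<in> sets vol \<and> emeasure vol (U x) < \<infinity>" if xF: "x \<in> F" for x
  proof -
    have "\<exists>\<Phi> C. cube_chart \<Phi> (U x) C" using U(1) F(2) xF by blast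
    then obtain \<Phi> C where "cube_chart \<Phi> (U x) C" by blast
    from cube_chart_measure[OF this] show ?thesis by (auto intro: le_less_trans)
  qed
  have "emeasure vol (space vol) \<le> emeasure vol (\<Union>x\<in>F. U x)"
    using F fin by (intro emeasure_mono) (auto simp: space_vol)
  also have "\<dots> \<le> (\<Sum>x\<in>F. emeasure vol (U x))" using F fin by (intro emeasure_subadditive_finite) auto
  also have "\<dots> < \<infinity>" using F(1) fin by (simp add: sum_Pinfty less_top)
  finally show "emeasure vol (space vol) \<noteq> \<infinity>" by simp
qed

sublocale vol: finite_measure vol by (rule finite_vol)

lemma second_countable_points: "second_countable (points M)"
  using smooth unfolding smooth_manifold_def by blast

lemma sets_vol_prod: "sets (vol \<Otimes>\<^sub>M vol) = sets (borelt (prod_topology (points M) (points M)))"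
  unfolding sets_borelt_prod[OF second_countable_points second_countable_points]
  by (intro sets_pair_measure_cong sets_vol)

lemma continuous_measurable_vol_prod:
  fixes f :: "'a \<times> 'a \<Rightarrow> 'b::topological_space"
  assumes "continuous_map (prod_topology (points M) (points M)) euclidean f"
  shows "f \<in> borel_measurable (vol \<Otimes>\<^sub>M vol)"
  using continuous_map_measurable_borelt[OF assms] measurable_cong_sets[OF sets_vol_prod refl] by blast

lemma continuous_measurable_vol:
  fixes f :: "'a \<Rightarrow> 'b::topological_space"
  assumes "continuous_map (points M) euclidean f"
  shows "f \<in> borel_measurable vol"
  using continuous_map_measurable_borelt[OF assms] measurable_cong_sets[OF sets_vol refl] by blast

text \<open>The matrix of \<open>g \<oplus> g\<close> is block diagonal, so the densities multiply.\<close>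

lemma prod_density:
  assumes i: "i \<in> charts M" and j: "j \<in> charts M" and x: "x \<in> cdom M i" and y: "y \<in> cdom M j"
  shows "sqrt (det (prod_riemannian_metric g g (i, j) (x, y))) = vol_density i (cmap M i x) * vol_density j (cmap M j y)"
proof -
  have "prod_riemannian_metric g g (i, j) (x, y) = 
     (\<chi> k l. case (k, l) of (Inl a, Inl b) \<Rightarrow> g i x $ a $ b | (Inr a, Inr b) \<Rightarrow> g j y $ a $ b | _ \<Rightarrow> 0)"
    by (simp add: prod_riemannian_metric_def)
  then show ?thesis
    unfolding vol_density_def using cinv_cmap[OF i x] cinv_cmap[OF j y]
    by (simp only: det_block real_sqrt_mult)
qed

text \<open>Tonelli's theorem in coordinates.\<close>

lemma emeasure_vol_prod_chart:
  assumes i: "i \<in> charts M" and j: "j \<in> charts M" and B: "B \<in> sets (vol \<Otimes>\<^sub>M vol)" and Bs: "B \<subseteq> cdom M i \<times> cdom M j"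
  shows "emeasure (vol \<Otimes>\<^sub>M vol) B =
    (\<integral>\<^sup>+ z. ennreal (sqrt (det (prod_riemannian_metric g g (i, j) (cinv (prod_mfd M M) (i, j) z)))) * indicator (cmap (prod_mfd M M) (i, j) ` B) z \<partial>lborel)"
proof -
  let ?w = "\<lambda>i v. ennreal (vol_density i v)" and ?c = "cinv M" and ?I = "\<lambda>i. indicator (cimg M i) :: real^'n \<Rightarrow> ennreal"
  define F where "F z = ennreal (sqrt (det (prod_riemannian_metric g g (i, j) (cinv (prod_mfd M M) (i, j) z)))) * indicator (cmap (prod_mfd M M) (i, j) ` B) z" for z
  define G where "G v w = indicator B (?c i v, ?c j w) * ?w j w * ?I j w * ?w i v * ?I i v" for v w
  have FG: "F (pair_vec v w) = G v w" for v w
  proof (cases "v \<in> cimg M i \<and> w \<in> cimg M j \<and> (?c i v, ?c j w) \<in> B")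
    case True
    let ?x = "?c i v" and ?y = "?c j w"
    have x: "?x \<in> cdom M i" "cmap M i ?x = v" and y: "?y \<in> cdom M j" "cmap M j ?y = w"
      using True by (auto simp: cinv_in_cdom cmap_cinv)
    note cp = cinv_prod_chart[OF i j x(1) y(1), unfolded x(2) y(2)]
    have "pair_vec v w \<in> cmap (prod_mfd M M) (i, j) ` B" using True cp(1) by (metis image_eqI)
    then have "F (pair_vec v w) = ennreal (vol_density i v * vol_density j w)"
      unfolding F_def cp(2) prod_density[OF i j x(1) y(1)] x(2) y(2) by simp
    also have "\<dots> = ?w i v * ?w j w"
      using vol_density_pos[OF i, of v] vol_density_pos[OF j, of w] True by (intro ennreal_mult) auto
    finally show ?thesis using True by (simp add: G_def mult.commute)
  next
    case False
    have "pair_vec v w \<notin> cmap (prod_mfd M M) (i, j) ` B"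
    proof
      assume "pair_vec v w \<in> cmap (prod_mfd M M) (i, j) ` B"
      then obtain x y where xy: "(x, y) \<in> B" "pair_vec v w = cmap (prod_mfd M M) (i, j) (x, y)" by auto
      have d: "x \<in> cdom M i" "y \<in> cdom M j" using xy(1) Bs by auto
      have "v = cmap M i x" "w = cmap M j y"
        using xy(2) unfolding cinv_prod_chart(1)[OF i j d] by (metis reindex_pair_vec)+
      then show False using False xy(1) d cinv_cmap[OF i d(1)] cinv_cmap[OF j d(2)] cmap_in_cimg by metis
    qed
    then have "F (pair_vec v w) = 0" by (simp add: F_def)
    moreover have "G v w = 0" using False by (auto simp: G_def split: split_indicator)
    ultimately show ?thesis by simp
  qed
  have Gm: "(\<lambda>(v, w). G v w) \<in> borel_measurable (lborel \<Otimes>\<^sub>M lborel)"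
  proof -
    let ?R = "restrict_space borel (cimg M i) \<Otimes>\<^sub>M restrict_space borel (cimg M j)"
    have ci: "?c i \<in> measurable (restrict_space borel (cimg M i)) vol" if "i \<in> charts M" for i
      using cinv_measurable[OF that] measurable_cong_sets[OF refl sets_vol] by blast
    have wm: "vol_density i \<in> borel_measurable (restrict_space borel (cimg M i))" if "i \<in> charts M" for i
      by (rule borel_measurable_continuous_on_restrict[OF vol_density_continuous[OF that]])
    have "(\<lambda>p. (?c i (fst p), ?c j (snd p))) \<in> measurable ?R (vol \<Otimes>\<^sub>M vol)"
      by (intro measurable_Pair measurable_compose[OF measurable_fst ci[OF i]] measurable_compose[OF measurable_snd ci[OF j]])
    from measurable_compose[OF this borel_measurable_indicator[OF B]]
    have m1: "(\<lambda>p. indicator B (?c i (fst p), ?c j (snd p)) :: ennreal) \<in> borel_measurable ?R" .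
    have m2: "(\<lambda>p. ?w i (fst p)) \<in> borel_measurable ?R" "(\<lambda>p. ?w j (snd p)) \<in> borel_measurable ?R"
      using measurable_compose[OF measurable_fst wm[OF i]] measurable_compose[OF measurable_snd wm[OF j]] by measurable
    have m3: "(\<lambda>p. indicator B (?c i (fst p), ?c j (snd p)) * ?w j (snd p) * ?w i (fst p)) \<in> borel_measurable ?R"
      using m1 m2 by measurable
    have S: "cimg M i \<times> cimg M j \<in> sets (borel :: ((real^'n) \<times> (real^'n)) measure)"
      using open_cimg[OF i] open_cimg[OF j] by (simp add: open_Times)
    have "(\<lambda>p. (fst p, snd p)) \<in> measurable (restrict_space borel (cimg M i \<times> cimg M j)) ?R"
      by (intro measurable_Pair measurable_restrict_space3 borel_measurable_continuous_onI continuous_intros) auto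
    from measurable_compose[OF this m3]
    have "(\<lambda>p. indicator B (?c i (fst p), ?c j (snd p)) * ?w j (snd p) * ?w i (fst p)) \<in> borel_measurable (restrict_space borel (cimg M i \<times> cimg M j))"
      by simp
    then have "(\<lambda>p. indicator B (?c i (fst p), ?c j (snd p)) * ?w j (snd p) * ?w i (fst p) * indicator (cimg M i \<times> cimg M j) p) \<in> borel_measurable borel"
      using S by (subst (asm) borel_measurable_restrict_space_iff_ennreal) auto
    moreover have "(\<lambda>p. indicator B (?c i (fst p), ?c j (snd p)) * ?w j (snd p) * ?w i (fst p) * indicator (cimg M i \<times> cimg M j) p) = (\<lambda>(v, w). G v w)"
      by (auto simp: fun_eq_iff G_def split: split_indicator)
    ultimately show ?thesis by (simp add: lborel_prod)
  qed
  have Fm: "F \<in> borel_measurable borel"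
  proof -
    have "(\<lambda>z. (\<lambda>(v, w). G v w) (reindex Inl z, reindex Inr z)) \<in> borel_measurable borel"
      by (rule measurable_compose[OF _ Gm]) (intro measurable_Pair; simp)
    moreover have "(\<lambda>(v, w). G v w) (reindex Inl z, reindex Inr z) = F z" for z
      using FG[of "reindex Inl z" "reindex Inr z"] by simp
    ultimately show ?thesis by simp
  qed
  have Bm: "(\<lambda>y. indicator B (x, y)) \<in> borel_measurable vol" if "x \<in> space vol" for x
    using measurable_Pair2[OF borel_measurable_indicator[OF B] that] by simp
  define H where "H x = (\<integral>\<^sup>+y. indicator B (x, y) \<partial>vol)" for x
  have Hm: "H \<in> borel_measurable vol"
  proof -
    have "(\<lambda>(x, y). indicator B (x, y) :: ennreal) = indicator B" by (simp add: fun_eq_iff)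
    then have "(\<lambda>(x, y). indicator B (x, y) :: ennreal) \<in> borel_measurable (vol \<Otimes>\<^sub>M vol)"
      using borel_measurable_indicator[OF B] by (simp only:)
    then show ?thesis unfolding H_def by (rule vol.borel_measurable_nn_integral)
  qed
  have Hx: "H x = (\<integral>\<^sup>+w. indicator B (x, ?c j w) * ?w j w * ?I j w \<partial>lborel)" if "x \<in> space vol" for x
  proof -
    have "H x = (\<integral>\<^sup>+y. indicator B (x, y) * indicator (cdom M j) y \<partial>vol)"
      unfolding H_def using Bs by (intro nn_integral_cong) (auto split: split_indicator)
    then show ?thesis using nn_integral_chart[OF j Bm[OF that]] by simp
  qed
  have "emeasure (vol \<Otimes>\<^sub>M vol) B = (\<integral>\<^sup>+x. H x \<partial>vol)"
    unfolding H_def by (rule vol.emeasure_pair_measure[OF B])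
  also have "\<dots> = (\<integral>\<^sup>+x. H x * indicator (cdom M i) x \<partial>vol)"
  proof (rule nn_integral_cong)
    fix x
    have "x \<notin> cdom M i \<Longrightarrow> H x = 0" unfolding H_def using Bs by (subst nn_integral_cong[where v="\<lambda>_. 0"]) (auto split: split_indicator)
    then show "H x = H x * indicator (cdom M i) x" by (auto split: split_indicator)
  qed
  also have "\<dots> = (\<integral>\<^sup>+v. H (?c i v) * ?w i v * ?I i v \<partial>lborel)" by (rule nn_integral_chart[OF i Hm])
  also have "\<dots> = (\<integral>\<^sup>+v. (\<integral>\<^sup>+w. G v w \<partial>lborel) \<partial>lborel)"
  proof (rule nn_integral_cong)
    fix v
    show "H (?c i v) * ?w i v * ?I i v = (\<integral>\<^sup>+w. G v w \<partial>lborel)"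
    proof (cases "v \<in> cimg M i")
      case True
      then have sp: "?c i v \<in> space vol" using cinv_in_cdom cdom_subset[OF i] by (auto simp: space_vol)
      have m: "(\<lambda>w. indicator B (?c i v, ?c j w) * ?w j w * ?I j w) \<in> borel_measurable borel"
        using chart_weight_measurable[OF j Bm[OF sp]] .
      have "(\<integral>\<^sup>+w. G v w \<partial>lborel) = (\<integral>\<^sup>+w. (indicator B (?c i v, ?c j w) * ?w j w * ?I j w) * ?w i v \<partial>lborel)"
        using True by (simp add: G_def)
      also have "\<dots> = (\<integral>\<^sup>+w. indicator B (?c i v, ?c j w) * ?w j w * ?I j w \<partial>lborel) * ?w i v"
        using m by (intro nn_integral_multc) simp
      finally show ?thesis using True Hx[OF sp] by simp
    next
      case False
      then show ?thesis by (simp add: G_def)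
    qed
  qed
  also have "\<dots> = (\<integral>\<^sup>+p. (\<lambda>(v, w). G v w) p \<partial>(lborel \<Otimes>\<^sub>M lborel))"
    using lborel.nn_integral_fst[OF Gm] by simp
  also have "\<dots> = (\<integral>\<^sup>+p. F ((\<lambda>(v, w). pair_vec v w) p) \<partial>(lborel \<Otimes>\<^sub>M lborel))"
    by (intro nn_integral_cong) (auto simp: FG)
  also have "\<dots> = (\<integral>\<^sup>+z. F z \<partial>distr (lborel \<Otimes>\<^sub>M lborel) borel (\<lambda>(v, w). pair_vec v w))"
    using measurable_pair_vec[where 'n='n and 'k='n] Fm by (subst nn_integral_distr) (auto simp: lborel_prod)
  also have "\<dots> = (\<integral>\<^sup>+z. F z \<partial>lborel)" by (simp only: lborel_sum_type[symmetric])
  finally show ?thesis by (simp only: F_def)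
qed

text \<open>The product measure has the defining property of the volume of \<open>g \<oplus> g\<close>; uniqueness does the rest.\<close>

lemma riemannian_volume_prod:
  "riemannian_volume (prod_mfd M M) (prod_riemannian_metric g g) = vol \<Otimes>\<^sub>M vol"
  unfolding riemannian_volume_def[of "prod_mfd M M"]
proof (rule the_equality)
  let ?P = "prod_mfd M M"
  have pts: "points ?P = prod_topology (points M) (points M)" and chs: "charts ?P = charts M \<times> charts M"
    by (simp_all add: prod_mfd_def)
  have dom: "cdom ?P (i, j) = cdom M i \<times> cdom M j" for i j by (simp add: prod_mfd_def)
  show is_vol: "is_riemannian_volume ?P (prod_riemannian_metric g g) (vol \<Otimes>\<^sub>M vol)"
    unfolding is_riemannian_volume_def
  proof (intro conjI ballI impI)
    show "space (vol \<Otimes>\<^sub>M vol) = topspace (points ?P)" by (simp add: pts space_pair_measure space_vol)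
    show "sets (vol \<Otimes>\<^sub>M vol) = sigma_sets (topspace (points ?P)) {U. openin (points ?P) U}"
      unfolding sets_vol_prod sets_borelt pts ..
    fix p B assume p: "p \<in> charts ?P" and B: "B \<in> sets (vol \<Otimes>\<^sub>M vol)" "B \<subseteq> cdom ?P p"
    obtain i j where ij: "p = (i, j)" by (cases p)
    have ij': "i \<in> charts M" "j \<in> charts M" using p unfolding ij chs by auto
    have Bs: "B \<subseteq> cdom M i \<times> cdom M j" using B(2) unfolding ij dom .
    show "emeasure (vol \<Otimes>\<^sub>M vol) B = (\<integral>\<^sup>+ v. ennreal (sqrt (det (prod_riemannian_metric g g p (cinv ?P p v)))) * indicator (cmap ?P p ` B) v \<partial>lborel)"
      unfolding ij by (rule emeasure_vol_prod_chart[OF ij' B(1) Bs])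
  qed
  obtain I where I: "set I \<subseteq> charts M" "(\<Union>i\<in>set I. cdom M i) = topspace (points M)" by (rule finite_chart_cover)
  show "\<mu> = vol \<Otimes>\<^sub>M vol" if "is_riemannian_volume ?P (prod_riemannian_metric g g) \<mu>" for \<mu>
  proof (rule riemannian_volume_unique[OF that is_vol, where I="List.product I I"])
    show "openin (points ?P) (cdom ?P p)" if p: "p \<in> charts ?P" for p
    proof -
      obtain i j where ij: "p = (i, j)" by (cases p)
      have "i \<in> charts M" "j \<in> charts M" using p unfolding ij chs by auto
      then show ?thesis unfolding ij dom pts by (simp add: openin_prod_Times_iff open_cdom)
    qed
    show "set (List.product I I) \<subseteq> charts ?P" using I(1) by (auto simp: chs)
    show "topspace (points ?P) \<subseteq> (\<Union>p\<in>set (List.product I I). cdom ?P p)"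
    proof
      fix z assume "z \<in> topspace (points ?P)"
      then obtain x y where z: "z = (x, y)" "x \<in> topspace (points M)" "y \<in> topspace (points M)" by (auto simp: pts)
      then obtain i j where "i \<in> set I" "x \<in> cdom M i" "j \<in> set I" "y \<in> cdom M j" unfolding I(2)[symmetric] by blast
      then show "z \<in> (\<Union>p\<in>set (List.product I I). cdom ?P p)" unfolding z(1)
        by (intro UN_I[of "(i, j)"]) (auto simp: dom)
    qed
  qed
qed

end

section \<open>The Poincare inequality on the manifold\<close>

lemma unit_interval_continuous:
  fixes F :: "real \<Rightarrow> real"
  assumes c: "continuous_on {0..1} F"
  shows "integrable unit_interval F" "(\<integral>t. F t \<partial>unit_interval) = integral {0..1} F"
    "(\<And>t. t \<in> {0..1} \<Longrightarrow> 0 \<le> F t) \<Longrightarrow> (\<integral>\<^sup>+t. ennreal (F t) \<partial>unit_interval) = ennreal (integral {0..1} F)"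
proof -
  have s: "set_integrable lborel {0..1} F" by (rule borel_integrable_atLeastAtMost') (rule c)
  show i: "integrable unit_interval F"
    using s by (simp add: unit_interval_def integrable_restrict_space set_integrable_def)
  show e: "(\<integral>t. F t \<partial>unit_interval) = integral {0..1} F"
    using set_borel_integral_eq_integral(2)[OF s]
    by (simp add: unit_interval_def integral_restrict_space set_lebesgue_integral_def)
  show "(\<And>t. t \<in> {0..1} \<Longrightarrow> 0 \<le> F t) \<Longrightarrow> (\<integral>\<^sup>+t. ennreal (F t) \<partial>unit_interval) = ennreal (integral {0..1} F)"
    unfolding e[symmetric] by (rule nn_integral_eq_integral[OF i]) (auto intro: AE_I2)
qed

locale closed_connected_riem_mfd = closed_riem_mfd M g for M :: "('a, 'i, 'n::finite) mfd" and g +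
  assumes connected: "connected_space (points M)"
begin

text \<open>\<open>\<sigma> h\<close> is the symmetrised distance of the variable metric \<open>h\<close>, while \<open>vol\<close> belongs to the fixed metric \<open>g\<close>.\<close>

abbreviation "X \<equiv> topspace (points M)"
abbreviation "\<sigma> \<equiv> riem_mfd.sym_dist M"

text \<open>\<open>|h|_g^(1/2)\<close>, the upper gradient common to all functions that are 1-Lipschitz for \<open>h\<close>.\<close>

definition speed_bound :: "('a, 'i, 'n) tensor2 \<Rightarrow> 'a \<Rightarrow> real" where
  "speed_bound h x = sqrt (tensor_norm M g h x)"

lemma connected_riem_mfd: "riemannian_metric M h \<Longrightarrow> connected_riem_mfd M h"
  by unfold_locales (auto intro: connected)

lemma speed_bound_pos: "riemannian_metric M h \<Longrightarrow> x \<in> X \<Longrightarrow> 0 < speed_bound h x"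
  using tensor_norm_pos by (simp add: speed_bound_def)

lemma speed_bound_continuous: "riemannian_metric M h \<Longrightarrow> continuous_map (points M) euclideanreal (speed_bound h)"
  unfolding speed_bound_def using continuous_map_compose[OF tensor_norm_continuous, of h euclideanreal sqrt]
  by (simp add: o_def continuous_on_real_sqrt)

lemma speed_bound_measurable: "riemannian_metric M h \<Longrightarrow> speed_bound h \<in> borel_measurable vol"
  by (rule continuous_measurable_vol[OF speed_bound_continuous])

lemma
  assumes h: "riemannian_metric M h"
  shows \<sigma>_measurable: "(\<lambda>p. \<sigma> h (fst p) (snd p)) \<in> borel_measurable (vol \<Otimes>\<^sub>M vol)"
    and \<sigma>_measurable_right: "x \<in> X \<Longrightarrow> \<sigma> h x \<in> borel_measurable vol"
proof -
  interpret h: connected_riem_mfd M h by (rule connected_riem_mfd[OF h])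
  show "(\<lambda>p. \<sigma> h (fst p) (snd p)) \<in> borel_measurable (vol \<Otimes>\<^sub>M vol)"
    using continuous_measurable_vol_prod[OF h.sym_dist_continuous] by (simp add: case_prod_unfold)
  show "x \<in> X \<Longrightarrow> \<sigma> h x \<in> borel_measurable vol"
    by (rule continuous_measurable_vol[OF h.sym_dist_continuous_right])
qed

text \<open>A Poincare inequality between two open sets. The constant is chosen before the metric \<open>h\<close>.\<close>

definition good_pair :: "'a set \<Rightarrow> 'a set \<Rightarrow> bool" where
  "good_pair U V \<longleftrightarrow> openin (points M) U \<and> openin (points M) V \<and>
     (\<exists>C::real\<ge>0. \<forall>h. riemannian_metric M h \<longrightarrow>
        (\<integral>\<^sup>+x. (\<integral>\<^sup>+y. ennreal (\<sigma> h x y) * indicator V y \<partial>vol) * indicator U x \<partial>vol)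
          \<le> ennreal C * (\<integral>\<^sup>+x. ennreal (speed_bound h x) \<partial>vol))"

lemma open_sets_vol: "openin (points M) U \<Longrightarrow> U \<in> sets vol"
  by (simp add: sets_vol openin_sets_borelt)

lemma section_measurable:
  assumes h: "riemannian_metric M h" and V: "V \<in> sets vol"
  shows "(\<lambda>x. \<integral>\<^sup>+y. ennreal (\<sigma> h x y) * indicator V y \<partial>vol) \<in> borel_measurable vol"
proof -
  have "(\<lambda>p. ennreal (\<sigma> h (fst p) (snd p)) * indicator V (snd p)) \<in> borel_measurable (vol \<Otimes>\<^sub>M vol)"
    using \<sigma>_measurable[OF h] V by measurable
  then show ?thesis using vol.borel_measurable_nn_integral[of "\<lambda>x y. ennreal (\<sigma> h x y) * indicator V y" vol]
    by (simp add: case_prod_unfold)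
qed

lemma cube_chart_line:
  assumes cc: "cube_chart \<Phi> U C" and h: "riemannian_metric M h" and y: "y \<in> space cube"
  shows "continuous_on {0..1} (\<lambda>r. speed_bound h (\<Phi> (y(k := r))))"
    and "0 \<le> s \<Longrightarrow> s \<le> t \<Longrightarrow> t \<le> 1 \<Longrightarrow>
      \<sigma> h (\<Phi> (y(k := s))) (\<Phi> (y(k := t))) \<le> integral {s..t} (\<lambda>r. C * speed_bound h (\<Phi> (y(k := r))))"
proof -
  have line: "continuous_map (top_of_set {0..1}) (points M) (\<lambda>r. \<Phi> (y(k := r)))"
    using cc y unfolding cube_chart_def by blast
  show "continuous_on {0..1} (\<lambda>r. speed_bound h (\<Phi> (y(k := r))))"
    using continuous_map_compose[OF line speed_bound_continuous[OF h]] by (simp add: o_def)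
  have "\<forall>h. riemannian_metric M h \<longrightarrow> (\<forall>y\<in>space cube. \<forall>k s t. 0 \<le> s \<and> s \<le> t \<and> t \<le> 1 \<longrightarrow>
      \<sigma> h (\<Phi> (y(k := s))) (\<Phi> (y(k := t))) \<le> C * integral {s..t} (\<lambda>r. sqrt (tensor_norm M g h (\<Phi> (y(k := r))))))"
    using cc unfolding cube_chart_def by (elim conjE)
  then show "0 \<le> s \<Longrightarrow> s \<le> t \<Longrightarrow> t \<le> 1 \<Longrightarrow>
      \<sigma> h (\<Phi> (y(k := s))) (\<Phi> (y(k := t))) \<le> integral {s..t} (\<lambda>r. C * speed_bound h (\<Phi> (y(k := r))))"
    using h y unfolding speed_bound_def integral_mult_right by blast
qed

lemma cube_chart_segment:
  assumes cc: "cube_chart \<Phi> U C" and h: "riemannian_metric M h" and y: "y \<in> space cube" and st: "s \<in> {0..1}" "t \<in> {0..1}"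
  shows "\<sigma> h (\<Phi> (y(k := s))) (\<Phi> (y(k := t))) \<le> integral {0..1} (\<lambda>r. C * speed_bound h (\<Phi> (y(k := r))))"
proof -
  interpret h: connected_riem_mfd M h by (rule connected_riem_mfd[OF h])
  let ?F = "\<lambda>r. C * speed_bound h (\<Phi> (y(k := r)))"
  have C: "0 < C" and pt: "\<And>y. y \<in> space cube \<Longrightarrow> \<Phi> y \<in> X" using cc unfolding cube_chart_def by blast+
  have c: "continuous_on {0..1} ?F" by (intro continuous_intros cube_chart_line(1)[OF cc h y])
  have F0: "0 \<le> ?F r" if "r \<in> {0..1}" for r
    using speed_bound_pos[OF h pt[OF fun_upd_space_cube[OF y that, of k]]] C by simp
  have seg: "\<sigma> h (\<Phi> (y(k := s))) (\<Phi> (y(k := t))) \<le> integral {0..1} ?F" if st: "0 \<le> s" "s \<le> t" "t \<le> 1" for s t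
  proof -
    have "\<sigma> h (\<Phi> (y(k := s))) (\<Phi> (y(k := t))) \<le> integral {s..t} ?F" by (rule cube_chart_line(2)[OF cc h y st])
    also have "\<dots> \<le> integral {0..1} ?F"
    proof (rule integral_subset_le)
      show s: "{s..t} \<subseteq> {0..1}" using st by auto
      show "?F integrable_on {s..t}" by (rule integrable_continuous_real[OF continuous_on_subset[OF c s]])
      show "?F integrable_on {0..1}" by (rule integrable_continuous_real[OF c])
    qed (use F0 in auto)
    finally show ?thesis .
  qed
  show ?thesis
  proof (cases "s \<le> t")
    case True
    then show ?thesis using st by (intro seg) auto
  next
    case False
    then show ?thesis using st by (subst h.sym_dist_commute) (intro seg; auto)
  qed
qed

text \<open>\<open>poincare_cube\<close> transported to the manifold, where \<open>\<rho>\<close> is the distance between the images of two points.\<close>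

lemma cube_chart_good:
  assumes cc: "cube_chart \<Phi> U C"
  shows "good_pair U U"
proof -
  have C: "0 < C" and Uo: "openin (points M) U" and pt: "\<And>y. y \<in> space cube \<Longrightarrow> \<Phi> y \<in> X"
    and \<Phi>m: "\<Phi> \<in> measurable cube vol"
    using cc unfolding cube_chart_def by blast+
  have m1: "(\<integral>\<^sup>+y. \<phi> (\<Phi> y) \<partial>cube) \<le> ennreal C * (\<integral>\<^sup>+x. \<phi> x \<partial>vol)" if "\<phi> \<in> borel_measurable vol" for \<phi>
    using cc that unfolding cube_chart_def by blast
  have m2: "(\<integral>\<^sup>+x. \<phi> x * indicator U x \<partial>vol) \<le> ennreal C * (\<integral>\<^sup>+y. \<phi> (\<Phi> y) \<partial>cube)" if "\<phi> \<in> borel_measurable vol" for \<phi>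
    using cc that unfolding cube_chart_def by blast
  have "(\<integral>\<^sup>+x. (\<integral>\<^sup>+y. ennreal (\<sigma> h x y) * indicator U y \<partial>vol) * indicator U x \<partial>vol)
          \<le> ennreal (C * (C * (real CARD('n) * (C * C)))) * (\<integral>\<^sup>+x. ennreal (speed_bound h x) \<partial>vol)" (is "?L \<le> _")
    if h: "riemannian_metric M h" for h
  proof -
    interpret h: connected_riem_mfd M h by (rule connected_riem_mfd[OF h])
    define \<rho> where "\<rho> y z = ennreal (\<sigma> h (\<Phi> y) (\<Phi> z))" for y z
    define F where "F y = ennreal (C * speed_bound h (\<Phi> y))" for y
    have fm: "(\<lambda>x. ennreal (speed_bound h x)) \<in> borel_measurable vol" using speed_bound_measurable[OF h] by measurable
    have \<rho>m: "(\<lambda>(y, z). \<rho> y z) \<in> borel_measurable (cube \<Otimes>\<^sub>M cube)"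
    proof -
      have "(\<lambda>p. (\<Phi> (fst p), \<Phi> (snd p))) \<in> measurable (cube \<Otimes>\<^sub>M cube) (vol \<Otimes>\<^sub>M vol)"
        by (intro measurable_Pair measurable_compose[OF measurable_fst \<Phi>m] measurable_compose[OF measurable_snd \<Phi>m])
      from measurable_compose[OF this \<sigma>_measurable[OF h]]
      have "(\<lambda>p. \<sigma> h (\<Phi> (fst p)) (\<Phi> (snd p))) \<in> borel_measurable (cube \<Otimes>\<^sub>M cube)" by simp
      then show ?thesis unfolding \<rho>_def case_prod_unfold by measurable
    qed
    have Fm: "F \<in> borel_measurable cube"
      unfolding F_def using measurable_compose[OF \<Phi>m speed_bound_measurable[OF h]] by measurable
    have poinc: "(\<integral>\<^sup>+y. (\<integral>\<^sup>+z. \<rho> y z \<partial>cube) \<partial>cube) \<le> of_nat CARD('n) * (\<integral>\<^sup>+y. F y \<partial>cube)"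
    proof (rule poincare_cube[OF \<rho>m Fm])
      show "\<rho> y y = 0" if "y \<in> space cube" for y using h.sym_dist_refl[OF pt[OF that]] by (simp add: \<rho>_def)
      show "\<rho> x z \<le> \<rho> x y + \<rho> y z" if "x \<in> space cube" "y \<in> space cube" "z \<in> space cube" for x y z
        using h.sym_dist_triangle[OF pt[OF that(1)] pt[OF that(2)] pt[OF that(3)]]
          h.sym_dist_nonneg[OF pt[OF that(1)] pt[OF that(2)]] h.sym_dist_nonneg[OF pt[OF that(2)] pt[OF that(3)]]
        unfolding \<rho>_def by (simp add: ennreal_plus[symmetric] ennreal_leI del: ennreal_plus)
      fix y :: "'n \<Rightarrow> real" and k and t :: real assume y: "y \<in> space cube" and t: "t \<in> {0..1}"
      have yk: "y k \<in> {0..1}" using y by (simp add: space_cube)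
      let ?F = "\<lambda>r. speed_bound h (\<Phi> (y(k := r)))"
      note s = cube_chart_segment[OF cc h y yk t, of k]
      have F0: "0 \<le> C * ?F r" if "r \<in> {0..1}" for r
        using speed_bound_pos[OF h pt[OF fun_upd_space_cube[OF y that, of k]]] C by simp
      have "\<rho> y (y(k := t)) \<le> ennreal (integral {0..1} (\<lambda>r. C * ?F r))" using s unfolding \<rho>_def by (intro ennreal_leI) simp
      also have "\<dots> = (\<integral>\<^sup>+r. ennreal (C * ?F r) \<partial>unit_interval)"
        by (rule unit_interval_continuous(3)[symmetric]) (intro continuous_intros cube_chart_line(1)[OF cc h y], rule F0)
      finally show "\<rho> y (y(k := t)) \<le> (\<integral>\<^sup>+r. F (y(k := r)) \<partial>unit_interval)" unfolding F_def .
    qed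
    have "(\<integral>\<^sup>+y. F y \<partial>cube) = ennreal C * (\<integral>\<^sup>+y. ennreal (speed_bound h (\<Phi> y)) \<partial>cube)"
      unfolding F_def using measurable_compose[OF \<Phi>m fm] C by (simp add: ennreal_mult' nn_integral_cmult)
    also have "\<dots> \<le> ennreal C * (ennreal C * (\<integral>\<^sup>+x. ennreal (speed_bound h x) \<partial>vol))"
      using m1[OF fm] by (intro mult_left_mono) auto
    finally have P: "(\<integral>\<^sup>+y. (\<integral>\<^sup>+z. \<rho> y z \<partial>cube) \<partial>cube) \<le> of_nat CARD('n) * (ennreal C * (ennreal C * (\<integral>\<^sup>+x. ennreal (speed_bound h x) \<partial>vol)))"
      by (rule order_trans[OF poinc mult_left_mono]) simp
    define Z where "Z x = (\<integral>\<^sup>+z. ennreal (\<sigma> h x (\<Phi> z)) \<partial>cube)" for x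
    have Zm: "Z \<in> borel_measurable vol"
    proof -
      have "(\<lambda>p. (fst p, \<Phi> (snd p))) \<in> measurable (vol \<Otimes>\<^sub>M cube) (vol \<Otimes>\<^sub>M vol)"
        by (intro measurable_Pair measurable_fst measurable_compose[OF measurable_snd \<Phi>m])
      from measurable_compose[OF this \<sigma>_measurable[OF h]]
      have "(\<lambda>p. \<sigma> h (fst p) (\<Phi> (snd p))) \<in> borel_measurable (vol \<Otimes>\<^sub>M cube)" by simp
      then have "(\<lambda>p. ennreal (\<sigma> h (fst p) (\<Phi> (snd p)))) \<in> borel_measurable (vol \<Otimes>\<^sub>M cube)" by measurable
      then show ?thesis unfolding Z_def
        using cubeM.borel_measurable_nn_integral[of "\<lambda>x z. ennreal (\<sigma> h x (\<Phi> z))" vol] by (simp add: case_prod_unfold)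
    qed
    have "?L \<le> (\<integral>\<^sup>+x. (ennreal C * Z x) * indicator U x \<partial>vol)"
    proof (rule nn_integral_mono)
      fix x assume "x \<in> space vol"
      then have x: "x \<in> X" by (simp add: space_vol)
      have "(\<lambda>y. ennreal (\<sigma> h x y)) \<in> borel_measurable vol" using \<sigma>_measurable_right[OF h x] by measurable
      from m2[OF this] show "(\<integral>\<^sup>+y. ennreal (\<sigma> h x y) * indicator U y \<partial>vol) * indicator U x \<le> (ennreal C * Z x) * indicator U x"
        unfolding Z_def by (intro mult_right_mono) auto
    qed
    also have "\<dots> \<le> ennreal C * (\<integral>\<^sup>+y. ennreal C * Z (\<Phi> y) \<partial>cube)"
      using Zm by (intro m2) measurable
    also have "(\<integral>\<^sup>+y. ennreal C * Z (\<Phi> y) \<partial>cube) = ennreal C * (\<integral>\<^sup>+y. Z (\<Phi> y) \<partial>cube)"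
      using measurable_compose[OF \<Phi>m Zm] by (rule nn_integral_cmult)
    also have "(\<integral>\<^sup>+y. Z (\<Phi> y) \<partial>cube) = (\<integral>\<^sup>+y. (\<integral>\<^sup>+z. \<rho> y z \<partial>cube) \<partial>cube)" by (simp add: Z_def \<rho>_def)
    finally have "?L \<le> ennreal C * (ennreal C * (of_nat CARD('n) * (ennreal C * (ennreal C * (\<integral>\<^sup>+x. ennreal (speed_bound h x) \<partial>vol)))))"
      using P by (meson mult_left_mono order_trans zero_le)
    also have "\<dots> = ennreal (C * (C * (real CARD('n) * (C * C)))) * (\<integral>\<^sup>+x. ennreal (speed_bound h x) \<partial>vol)"
      using C by (simp add: ennreal_mult mult.assoc ennreal_of_nat_eq_real_of_nat)
    finally show ?thesis .
  qed
  then show ?thesis unfolding good_pair_def using Uo C by (intro conjI exI[of _ "C * (C * (real CARD('n) * (C * C)))"]) auto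
qed

text \<open>In a chart, a nonempty open set has positive Lebesgue measure and the density is positive.\<close>

lemma emeasure_open_pos:
  assumes U: "openin (points M) U" and ne: "U \<noteq> {}"
  shows "0 < emeasure vol U"
proof (rule ccontr)
  assume "\<not> 0 < emeasure vol U"
  then have z: "emeasure vol U = 0" by simp
  obtain x where x: "x \<in> U" using ne by blast
  then have "x \<in> X" using openin_subset[OF U] by blast
  note i = chart_at[OF this]
  let ?i = "chart_at M x" and ?B = "U \<inter> cdom M (chart_at M x)"
  have Bo: "openin (points M) ?B" by (intro openin_Int U open_cdom i)
  have B0: "emeasure vol ?B = 0"
    using z emeasure_mono[of ?B U vol] open_sets_vol[OF U] by simp
  let ?V = "cmap M ?i ` ?B"
  have Vo: "open ?V" by (rule open_cmap_image[OF i(1) Bo]) simp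
  have Vc: "?V \<subseteq> cimg M ?i" by (auto simp: cimg_def)
  have "chart_vol ?i ?B = 0" using emeasure_vol_chart[OF i(1) open_sets_vol[OF Bo]] B0 by simp
  then have "(\<integral>\<^sup>+ v. ennreal (vol_density ?i v * indicator ?V v) \<partial>lborel) = 0" by (simp add: chart_vol_alt)
  moreover have "(\<lambda>v. ennreal (vol_density ?i v * indicator ?V v)) \<in> borel_measurable lborel"
    using vol_density_measurable[OF i(1) _ Vc] Vo by measurable
  ultimately have "AE v in lborel. ennreal (vol_density ?i v * indicator ?V v) = 0"
    by (simp add: nn_integral_0_iff_AE)
  then have "AE v in lborel. v \<notin> ?V"
  proof (eventually_elim)
    case (elim v)
    show "v \<notin> ?V"
    proof
      assume v: "v \<in> ?V"
      then have "0 < vol_density ?i v" using vol_density_pos[OF i(1)] Vc by blast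
      then show False using elim v by simp
    qed
  qed
  then have "?V \<in> null_sets lborel" using Vo by (subst (asm) AE_iff_null_sets[symmetric]) auto
  then have "negligible ?V" by (simp add: negligible_iff_null_sets null_sets_completionI)
  then show False using open_not_negligible[OF Vo] x i by blast
qed

text \<open>Averaging \<open>\<sigma> h x y \<le> \<sigma> h x b + \<sigma> h b y\<close> over \<open>b\<close> in the overlap of \<open>V\<close> and \<open>V'\<close>, which has positive
  measure, bounds distances between \<open>U\<close> and \<open>W\<close>.\<close>

lemma good_pair_trans:
  assumes UV: "good_pair U V" and WV: "good_pair W V'" and ne: "V \<inter> V' \<noteq> {}"
  shows "good_pair U W"
proof -
  let ?I = "\<lambda>h. \<integral>\<^sup>+x. ennreal (speed_bound h x) \<partial>vol"
  have op: "openin (points M) U" "openin (points M) V" "openin (points M) W" "openin (points M) V'"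
    using UV WV unfolding good_pair_def by blast+
  note ms = open_sets_vol[OF op(1)] open_sets_vol[OF op(2)] open_sets_vol[OF op(3)] open_sets_vol[OF op(4)]
  obtain C\<^sub>1 where C1: "0 \<le> C\<^sub>1" "\<And>h. riemannian_metric M h \<Longrightarrow> (\<integral>\<^sup>+x. (\<integral>\<^sup>+y. ennreal (\<sigma> h x y) * indicator V y \<partial>vol) * indicator U x \<partial>vol) \<le> ennreal C\<^sub>1 * ?I h"
    using UV unfolding good_pair_def by blast
  obtain C\<^sub>2 where C2: "0 \<le> C\<^sub>2" "\<And>h. riemannian_metric M h \<Longrightarrow> (\<integral>\<^sup>+x. (\<integral>\<^sup>+y. ennreal (\<sigma> h x y) * indicator V' y \<partial>vol) * indicator W x \<partial>vol) \<le> ennreal C\<^sub>2 * ?I h"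
    using WV unfolding good_pair_def by blast
  let ?O = "V \<inter> V'"
  have Oo: "openin (points M) ?O" using op by (intro openin_Int)
  have Om: "?O \<in> sets vol" by (rule open_sets_vol[OF Oo])
  define m where "m = measure vol ?O"
  have em: "emeasure vol ?O = ennreal m" by (simp add: m_def vol.emeasure_eq_measure)
  have m: "0 < m" using emeasure_open_pos[OF Oo ne] unfolding em by simp
  let ?u = "measure vol U" and ?w = "measure vol W"
  define C where "C = (?w * C\<^sub>1 + ?u * C\<^sub>2) / m"
  have C0: "0 \<le> C" using C1 C2 m by (simp add: C_def)
  have "(\<integral>\<^sup>+x. (\<integral>\<^sup>+y. ennreal (\<sigma> h x y) * indicator W y \<partial>vol) * indicator U x \<partial>vol) \<le> ennreal C * ?I h" (is "?L \<le> _")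
    if h: "riemannian_metric M h" for h
  proof -
    interpret h: connected_riem_mfd M h by (rule connected_riem_mfd[OF h])
    define A where "A x = (\<integral>\<^sup>+b. ennreal (\<sigma> h x b) * indicator ?O b \<partial>vol)" for x
    have Am: "A \<in> borel_measurable vol" unfolding A_def by (rule section_measurable[OF h Om])
    have sm: "(\<lambda>b. ennreal (\<sigma> h x b)) \<in> borel_measurable vol" if "x \<in> X" for x
      using \<sigma>_measurable_right[OF h that] by measurable
    have tri: "ennreal m * ennreal (\<sigma> h x y) \<le> A x + A y" if x: "x \<in> X" and y: "y \<in> X" for x y
    proof -
      have "ennreal m * ennreal (\<sigma> h x y) = (\<integral>\<^sup>+b. ennreal (\<sigma> h x y) * indicator ?O b \<partial>vol)"
        unfolding em[symmetric] by (subst nn_integral_cmult_indicator) (rule Om, rule mult.commute)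
      also have "\<dots> \<le> (\<integral>\<^sup>+b. ennreal (\<sigma> h x b) * indicator ?O b + ennreal (\<sigma> h y b) * indicator ?O b \<partial>vol)"
      proof (rule nn_integral_mono)
        fix b assume "b \<in> space vol"
        then have b: "b \<in> X" by (simp add: space_vol)
        have "\<sigma> h x y \<le> \<sigma> h x b + \<sigma> h y b" using h.sym_dist_triangle[OF x b y] h.sym_dist_commute[of b y] by simp
        then have "ennreal (\<sigma> h x y) \<le> ennreal (\<sigma> h x b) + ennreal (\<sigma> h y b)"
          using h.sym_dist_nonneg[OF x b] h.sym_dist_nonneg[OF y b] by (simp add: ennreal_plus[symmetric] ennreal_leI del: ennreal_plus)
        then show "ennreal (\<sigma> h x y) * indicator ?O b \<le> ennreal (\<sigma> h x b) * indicator ?O b + ennreal (\<sigma> h y b) * indicator ?O b"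
          by (auto split: split_indicator)
      qed
      also have "\<dots> = A x + A y"
        unfolding A_def by (intro nn_integral_add borel_measurable_times_ennreal sm[OF x] sm[OF y] borel_measurable_indicator Om)
      finally show ?thesis .
    qed
    have inner: "ennreal m * (\<integral>\<^sup>+y. ennreal (\<sigma> h x y) * indicator W y \<partial>vol) \<le> ennreal ?w * A x + (\<integral>\<^sup>+y. A y * indicator W y \<partial>vol)" if x: "x \<in> X" for x
    proof -
      have "ennreal m * (\<integral>\<^sup>+y. ennreal (\<sigma> h x y) * indicator W y \<partial>vol) = (\<integral>\<^sup>+y. ennreal m * (ennreal (\<sigma> h x y) * indicator W y) \<partial>vol)"
        by (intro nn_integral_cmult[symmetric] borel_measurable_times_ennreal sm[OF x] borel_measurable_indicator ms(3))
      also have "\<dots> \<le> (\<integral>\<^sup>+y. A x * indicator W y + A y * indicator W y \<partial>vol)"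
      proof (rule nn_integral_mono)
        fix y assume "y \<in> space vol"
        then have "y \<in> X" by (simp add: space_vol)
        from tri[OF x this] show "ennreal m * (ennreal (\<sigma> h x y) * indicator W y) \<le> A x * indicator W y + A y * indicator W y"
          by (auto split: split_indicator)
      qed
      also have "\<dots> = A x * emeasure vol W + (\<integral>\<^sup>+y. A y * indicator W y \<partial>vol)"
        using Am ms(3) by (subst nn_integral_add) (auto simp: nn_integral_cmult)
      finally show ?thesis by (simp add: vol.emeasure_eq_measure mult.commute)
    qed
    have A1: "(\<integral>\<^sup>+x. A x * indicator U x \<partial>vol) \<le> ennreal C\<^sub>1 * ?I h"
      by (rule order_trans[OF nn_integral_mono C1(2)[OF h]])
         (auto simp: A_def intro!: mult_right_mono nn_integral_mono split: split_indicator)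
    have A2: "(\<integral>\<^sup>+y. A y * indicator W y \<partial>vol) \<le> ennreal C\<^sub>2 * ?I h"
      by (rule order_trans[OF nn_integral_mono C2(2)[OF h]])
         (auto simp: A_def intro!: mult_right_mono nn_integral_mono split: split_indicator)
    let ?S = "\<integral>\<^sup>+y. A y * indicator W y \<partial>vol"
    have "ennreal m * ?L = (\<integral>\<^sup>+x. ennreal m * ((\<integral>\<^sup>+y. ennreal (\<sigma> h x y) * indicator W y \<partial>vol) * indicator U x) \<partial>vol)"
      by (intro nn_integral_cmult[symmetric] borel_measurable_times_ennreal section_measurable[OF h ms(3)] borel_measurable_indicator ms(1))
    also have "\<dots> \<le> (\<integral>\<^sup>+x. ennreal ?w * (A x * indicator U x) + ?S * indicator U x \<partial>vol)"
    proof (rule nn_integral_mono)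
      fix x assume "x \<in> space vol"
      then have "x \<in> X" by (simp add: space_vol)
      from inner[OF this] show "ennreal m * ((\<integral>\<^sup>+y. ennreal (\<sigma> h x y) * indicator W y \<partial>vol) * indicator U x) \<le> ennreal ?w * (A x * indicator U x) + ?S * indicator U x"
        by (auto split: split_indicator)
    qed
    also have "\<dots> = ennreal ?w * (\<integral>\<^sup>+x. A x * indicator U x \<partial>vol) + ?S * emeasure vol U"
      using Am ms(1) by (subst nn_integral_add) (auto simp: nn_integral_cmult)
    also have "\<dots> \<le> ennreal ?w * (ennreal C\<^sub>1 * ?I h) + (ennreal C\<^sub>2 * ?I h) * ennreal ?u"
      unfolding vol.emeasure_eq_measure using A1 A2 by (intro add_mono mult_left_mono mult_right_mono) auto
    also have "\<dots> = ennreal (m * C) * ?I h"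
    proof -
      have "m * C = ?w * C\<^sub>1 + ?u * C\<^sub>2" using m by (simp add: C_def)
      then have "ennreal (m * C) = ennreal ?w * ennreal C\<^sub>1 + ennreal ?u * ennreal C\<^sub>2"
        using C1(1) C2(1) by (simp add: ennreal_mult)
      then show ?thesis by (simp only: distrib_right mult.assoc mult.commute[of _ "ennreal ?u"])
    qed
    finally have "ennreal m * ?L \<le> ennreal m * (ennreal C * ?I h)" using m C0 by (simp add: ennreal_mult mult.assoc)
    then have "ennreal (1/m) * (ennreal m * ?L) \<le> ennreal (1/m) * (ennreal m * (ennreal C * ?I h))" by (rule mult_left_mono) simp
    moreover have "ennreal (1/m) * (ennreal m * Z) = Z" for Z using m by (simp add: mult.assoc[symmetric] ennreal_mult[symmetric])
    ultimately show ?thesis by (simp only:)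
  qed
  then show ?thesis unfolding good_pair_def using op C0 by blast
qed

lemma continuous_positive_bounds:
  assumes f: "continuous_map (points M) euclideanreal f" and pos: "\<And>x. x \<in> X \<Longrightarrow> 0 < f x"
  shows "\<exists>c C. 0 < c \<and> (\<forall>x\<in>X. c \<le> f x \<and> f x \<le> C)"
proof (cases "X = {}")
  case True
  then show ?thesis by (intro exI[of _ 1]) auto
next
  case False
  have "compactin (points M) X" using compact unfolding compact_space_def .
  from image_compactin[OF this f] have cp: "compact (f ` X)" by simp
  obtain a where a: "a \<in> X" "\<And>x. x \<in> X \<Longrightarrow> f a \<le> f x" using compact_attains_inf[OF cp] False by auto
  obtain b where b: "b \<in> X" "\<And>x. x \<in> X \<Longrightarrow> f x \<le> f b" using compact_attains_sup[OF cp] False by auto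
  show ?thesis using a b pos by blast
qed

lemma nn_integral_speed_bound:
  assumes h: "riemannian_metric M h" and ne: "X \<noteq> {}"
  shows "(\<integral>\<^sup>+x. ennreal (speed_bound h x) \<partial>vol) = ennreal (\<integral>x. speed_bound h x \<partial>vol)" "0 < (\<integral>x. speed_bound h x \<partial>vol)"
proof -
  obtain c C where c: "0 < c" "\<And>x. x \<in> X \<Longrightarrow> c \<le> speed_bound h x \<and> speed_bound h x \<le> C"
    using continuous_positive_bounds[OF speed_bound_continuous[OF h] speed_bound_pos[OF h]] by blast
  have m: "speed_bound h \<in> borel_measurable vol" by (rule speed_bound_measurable[OF h])
  have b: "c \<le> speed_bound h x \<and> speed_bound h x \<le> C" "0 \<le> speed_bound h x \<and> speed_bound h x \<le> C" if "x \<in> space vol" for x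
    using c(1) c(2)[of x] that by (auto simp: space_vol)
  have "0 < emeasure vol X" by (rule emeasure_open_pos[OF openin_topspace ne])
  then have V: "0 < measure vol (space vol)" by (simp add: vol.emeasure_eq_measure space_vol)
  show "(\<integral>\<^sup>+x. ennreal (speed_bound h x) \<partial>vol) = ennreal (\<integral>x. speed_bound h x \<partial>vol)"
    using b(2) by (intro nn_integral_eq_integral vol.integrable_bounded[OF m b(2)]) (auto intro: AE_I2)
  show "0 < (\<integral>x. speed_bound h x \<partial>vol)" by (rule vol.integral_pos_bounded[OF m c(1) b(1) V])
qed

lemma good_pair_Un:
  assumes UV: "good_pair U V" and UV': "good_pair U' V'"
  shows "good_pair (U \<inter> U') (V \<union> V')"
proof -
  let ?I = "\<lambda>h. \<integral>\<^sup>+x. ennreal (speed_bound h x) \<partial>vol"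
  have op: "openin (points M) U" "openin (points M) V" "openin (points M) U'" "openin (points M) V'"
    using UV UV' unfolding good_pair_def by blast+
  note ms = open_sets_vol[OF op(1)] open_sets_vol[OF op(2)] open_sets_vol[OF op(3)] open_sets_vol[OF op(4)]
  obtain C\<^sub>1 where C1: "0 \<le> C\<^sub>1" "\<And>h. riemannian_metric M h \<Longrightarrow> (\<integral>\<^sup>+x. (\<integral>\<^sup>+y. ennreal (\<sigma> h x y) * indicator V y \<partial>vol) * indicator U x \<partial>vol) \<le> ennreal C\<^sub>1 * ?I h"
    using UV unfolding good_pair_def by blast
  obtain C\<^sub>2 where C2: "0 \<le> C\<^sub>2" "\<And>h. riemannian_metric M h \<Longrightarrow> (\<integral>\<^sup>+x. (\<integral>\<^sup>+y. ennreal (\<sigma> h x y) * indicator V' y \<partial>vol) * indicator U' x \<partial>vol) \<le> ennreal C\<^sub>2 * ?I h"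
    using UV' unfolding good_pair_def by blast
  have "(\<integral>\<^sup>+x. (\<integral>\<^sup>+y. ennreal (\<sigma> h x y) * indicator (V \<union> V') y \<partial>vol) * indicator (U \<inter> U') x \<partial>vol) \<le> ennreal (C\<^sub>1 + C\<^sub>2) * ?I h" (is "?L \<le> _")
    if h: "riemannian_metric M h" for h
  proof -
    let ?A = "\<lambda>V x. \<integral>\<^sup>+y. ennreal (\<sigma> h x y) * indicator V y \<partial>vol"
    have "?L \<le> (\<integral>\<^sup>+x. ?A V x * indicator U x + ?A V' x * indicator U' x \<partial>vol)"
    proof (rule nn_integral_mono)
      fix x assume "x \<in> space vol"
      then have x: "x \<in> X" by (simp add: space_vol)
      have sm: "(\<lambda>b. ennreal (\<sigma> h x b)) \<in> borel_measurable vol" using \<sigma>_measurable_right[OF h x] by measurable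
      have "?A (V \<union> V') x \<le> (\<integral>\<^sup>+y. ennreal (\<sigma> h x y) * indicator V y + ennreal (\<sigma> h x y) * indicator V' y \<partial>vol)"
        by (intro nn_integral_mono) (auto split: split_indicator)
      also have "\<dots> = ?A V x + ?A V' x"
        by (intro nn_integral_add borel_measurable_times_ennreal sm borel_measurable_indicator ms(2,4))
      finally show "?A (V \<union> V') x * indicator (U \<inter> U') x \<le> ?A V x * indicator U x + ?A V' x * indicator U' x"
        by (auto split: split_indicator)
    qed
    also have "\<dots> = (\<integral>\<^sup>+x. ?A V x * indicator U x \<partial>vol) + (\<integral>\<^sup>+x. ?A V' x * indicator U' x \<partial>vol)"
      by (intro nn_integral_add borel_measurable_times_ennreal section_measurable[OF h] borel_measurable_indicator ms)
    also have "\<dots> \<le> ennreal C\<^sub>1 * ?I h + ennreal C\<^sub>2 * ?I h" by (intro add_mono C1(2)[OF h] C2(2)[OF h])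
    also have "\<dots> = ennreal (C\<^sub>1 + C\<^sub>2) * ?I h" using C1(1) C2(1) by (simp add: distrib_right)
    finally show ?thesis .
  qed
  then show ?thesis unfolding good_pair_def using op C1(1) C2(1)
    by (intro conjI openin_Int openin_Un exI[of _ "C\<^sub>1 + C\<^sub>2"]) auto
qed

text \<open>The union of all open sets that are linked to some neighbourhood of \<open>x\<^sub>0\<close> is open by definition. It is closed,
  because by \<open>good_pair_trans\<close> a cubical chart that meets it is contained in it. So it is \<open>M\<close>, and finitely many of
  these open sets cover \<open>M\<close>.\<close>

lemma good_all:
  assumes x0: "x\<^sub>0 \<in> X"
  obtains U where "x\<^sub>0 \<in> U" "good_pair U X"
proof -
  define T where "T = \<Union>{V. \<exists>U. x\<^sub>0 \<in> U \<and> good_pair U V}"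
  have VT: "V \<subseteq> T" if "x\<^sub>0 \<in> U" "good_pair U V" for U V using that unfolding T_def by blast
  have To: "openin (points M) T" unfolding T_def by (rule openin_Union) (auto simp: good_pair_def)
  obtain \<Phi> U\<^sub>0 C where "cube_chart \<Phi> U\<^sub>0 C" and U0: "x\<^sub>0 \<in> U\<^sub>0" by (rule cube_chart_exists[OF x0])
  then have g0: "good_pair U\<^sub>0 U\<^sub>0" by (intro cube_chart_good)
  have "openin (points M) (X - T)"
  proof (subst openin_subopen, intro ballI)
    fix y assume y: "y \<in> X - T"
    then have "y \<in> X" by simp
    from cube_chart_exists[OF this] obtain \<Phi> W C where "cube_chart \<Phi> W C" and yW: "y \<in> W" by metis
    then have gW: "good_pair W W" by (intro cube_chart_good)
    have Wo: "openin (points M) W" using gW unfolding good_pair_def by (rule conjunct1)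
    have "W \<inter> T = {}"
    proof (rule ccontr)
      assume "W \<inter> T \<noteq> {}"
      then obtain U V where UV: "x\<^sub>0 \<in> U" "good_pair U V" "V \<inter> W \<noteq> {}" unfolding T_def by blast
      from VT[OF UV(1) good_pair_trans[OF UV(2) gW UV(3)]] yW y show False by blast
    qed
    then show "\<exists>W. openin (points M) W \<and> y \<in> W \<and> W \<subseteq> X - T" using Wo yW openin_subset[OF Wo] by blast
  qed
  then have "closedin (points M) T" using openin_subset[OF To] by (simp add: closedin_def)
  then have "T = {} \<or> T = X" using connected To unfolding connected_space_clopen_in by blast
  then have TX: "T = X" using VT[OF U0 g0] U0 by blast
  have "\<exists>W. \<exists>U. x\<^sub>0 \<in> U \<and> good_pair U W \<and> y \<in> W" if "y \<in> X" for y
    using that unfolding TX[symmetric] T_def by blast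
  then obtain W where W: "\<And>y. y \<in> X \<Longrightarrow> \<exists>U. x\<^sub>0 \<in> U \<and> good_pair U (W y) \<and> y \<in> W y" by metis
  have "openin (points M) (W y) \<and> y \<in> W y" if "y \<in> X" for y using W[OF that] unfolding good_pair_def by blast
  from finite_subcover[OF this] obtain F where F: "finite F" "F \<subseteq> X" "X \<subseteq> (\<Union>y\<in>F. W y)" by metis
  have "\<exists>U. x\<^sub>0 \<in> U \<and> good_pair U (\<Union>y\<in>F. W y)"
    using F(1,2)
  proof (induction F)
    case empty
    have "good_pair U\<^sub>0 {}" using g0 unfolding good_pair_def by (intro conjI exI[of _ 0]) auto
    then show ?case using U0 by auto
  next
    case (insert y F)
    then obtain U where U: "x\<^sub>0 \<in> U" "good_pair U (\<Union>y\<in>F. W y)" by auto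
    obtain U' where U': "x\<^sub>0 \<in> U'" "good_pair U' (W y)" using W[of y] insert.prems by auto
    show ?case using good_pair_Un[OF U'(2) U(2)] U(1) U'(1) by (intro exI[of _ "U' \<inter> U"]) simp
  qed
  then obtain U where U: "x\<^sub>0 \<in> U" "good_pair U (\<Union>y\<in>F. W y)" by blast
  have "openin (points M) (\<Union>y\<in>F. W y)" using U(2) unfolding good_pair_def by (elim conjE)
  then have "(\<Union>y\<in>F. W y) = X" using openin_subset F(3) by blast
  then show ?thesis using that U by simp
qed

text \<open>If every \<open>x\<^sub>0\<close> in \<open>U\<close> failed, then integrating over \<open>U\<close> would contradict \<open>good_pair U X\<close>. The point \<open>x\<^sub>0\<close>
  depends on \<open>h\<close>, but the constant does not.\<close>

lemma base_point:
  assumes ne: "X \<noteq> {}"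
  shows "\<exists>C>0. \<forall>h. riemannian_metric M h \<longrightarrow>
    (\<exists>x\<^sub>0\<in>X. (\<integral>\<^sup>+y. ennreal (\<sigma> h x\<^sub>0 y) \<partial>vol) \<le> ennreal (C * (\<integral>x. speed_bound h x \<partial>vol)))"
proof -
  obtain a where a: "a \<in> X" using ne by blast
  obtain U where U: "a \<in> U" "good_pair U X" by (rule good_all[OF a])
  have Uo: "openin (points M) U" using U(2) unfolding good_pair_def by (elim conjE)
  obtain C\<^sub>1 where C1: "0 \<le> C\<^sub>1" "\<And>h. riemannian_metric M h \<Longrightarrow> (\<integral>\<^sup>+x. (\<integral>\<^sup>+y. ennreal (\<sigma> h x y) * indicator X y \<partial>vol) * indicator U x \<partial>vol)
      \<le> ennreal C\<^sub>1 * (\<integral>\<^sup>+x. ennreal (speed_bound h x) \<partial>vol)"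
    using U(2) unfolding good_pair_def by blast
  define m where "m = measure vol U"
  have em: "emeasure vol U = ennreal m" by (simp add: m_def vol.emeasure_eq_measure)
  have m: "0 < m" using emeasure_open_pos[OF Uo] U(1) unfolding em by auto
  \<comment> \<open>One more than \<open>C\<^sub>1\<close>, so that the contradiction is strict.\<close>
  define C where "C = (C\<^sub>1 + 1) / m"
  have C: "0 < C" using C1 m by (simp add: C_def)
  have "\<exists>x\<^sub>0\<in>X. (\<integral>\<^sup>+y. ennreal (\<sigma> h x\<^sub>0 y) \<partial>vol) \<le> ennreal (C * (\<integral>x. speed_bound h x \<partial>vol))" if h: "riemannian_metric M h" for h
  proof (rule ccontr)
    let ?I = "\<integral>x. speed_bound h x \<partial>vol"
    note I = nn_integral_speed_bound[OF h ne]
    assume "\<not> ?thesis"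
    then have big: "ennreal (C * ?I) \<le> (\<integral>\<^sup>+y. ennreal (\<sigma> h x y) \<partial>vol)" if "x \<in> X" for x
      using that by (meson linear)
    have "ennreal ((C\<^sub>1 + 1) * ?I) = ennreal (C * ?I) * emeasure vol U"
    proof -
      have "(C\<^sub>1 + 1) * ?I = (C * ?I) * m" using m by (simp add: C_def)
      then show ?thesis using m C I(2) by (simp add: em ennreal_mult[symmetric])
    qed
    also have "\<dots> = (\<integral>\<^sup>+x. ennreal (C * ?I) * indicator U x \<partial>vol)"
      by (rule nn_integral_cmult_indicator[OF open_sets_vol[OF Uo], symmetric])
    also have "\<dots> \<le> (\<integral>\<^sup>+x. (\<integral>\<^sup>+y. ennreal (\<sigma> h x y) * indicator X y \<partial>vol) * indicator U x \<partial>vol)"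
    proof (rule nn_integral_mono)
      fix x assume "x \<in> space vol"
      then have x: "x \<in> X" by (simp add: space_vol)
      have "(\<integral>\<^sup>+y. ennreal (\<sigma> h x y) * indicator X y \<partial>vol) = (\<integral>\<^sup>+y. ennreal (\<sigma> h x y) \<partial>vol)"
        by (rule nn_integral_cong) (simp add: space_vol)
      then show "ennreal (C * ?I) * indicator U x \<le> (\<integral>\<^sup>+y. ennreal (\<sigma> h x y) * indicator X y \<partial>vol) * indicator U x"
        using big[OF x] by (simp add: mult_right_mono)
    qed
    also have "\<dots> \<le> ennreal C\<^sub>1 * ennreal ?I" using C1(2)[OF h] unfolding I(1) .
    also have "\<dots> = ennreal (C\<^sub>1 * ?I)" using C1(1) I(2) by (simp add: ennreal_mult)
    finally have "(C\<^sub>1 + 1) * ?I \<le> C\<^sub>1 * ?I" using C1(1) I(2) by (subst (asm) ennreal_le_iff) auto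
    then show False using I(2) by (simp add: distrib_right)
  qed
  then show ?thesis using C by (intro exI[of _ C]) simp
qed

section \<open>The Sobolev inequality on the manifold\<close>

lemma cube_chart_integral:
  assumes cc: "cube_chart \<Phi> U C" and \<phi>: "\<phi> \<in> borel_measurable vol" "\<And>x. x \<in> X \<Longrightarrow> 0 \<le> \<phi> x \<and> \<phi> x \<le> D"
  shows "(\<integral>y. \<phi> (\<Phi> y) \<partial>cube) \<le> C * (\<integral>x. \<phi> x \<partial>vol)"
    and "(\<integral>x. \<phi> x * indicator U x \<partial>vol) \<le> C * (\<integral>y. \<phi> (\<Phi> y) \<partial>cube)"
proof -
  have C: "0 < C" and Uo: "openin (points M) U" and pt: "\<And>y. y \<in> space cube \<Longrightarrow> \<Phi> y \<in> X"
    and \<Phi>m: "\<Phi> \<in> measurable cube vol"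
    using cc unfolding cube_chart_def by blast+
  have cb1: "\<forall>\<phi>\<in>borel_measurable vol. (\<integral>\<^sup>+y. \<phi> (\<Phi> y) \<partial>cube) \<le> ennreal C * (\<integral>\<^sup>+x. \<phi> x \<partial>vol)"
    using cc unfolding cube_chart_def by (elim conjE)
  have cb2: "\<forall>\<phi>\<in>borel_measurable vol. (\<integral>\<^sup>+x. \<phi> x * indicator U x \<partial>vol) \<le> ennreal C * (\<integral>\<^sup>+y. \<phi> (\<Phi> y) \<partial>cube)"
    using cc unfolding cube_chart_def by (elim conjE)
  have em: "(\<lambda>x. ennreal (\<phi> x)) \<in> borel_measurable vol" using \<phi>(1) by measurable
  have m1: "(\<integral>\<^sup>+y. ennreal (\<phi> (\<Phi> y)) \<partial>cube) \<le> ennreal C * (\<integral>\<^sup>+x. ennreal (\<phi> x) \<partial>vol)"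
    by (rule bspec[OF cb1 em])
  have m2: "(\<integral>\<^sup>+x. ennreal (\<phi> x) * indicator U x \<partial>vol) \<le> ennreal C * (\<integral>\<^sup>+y. ennreal (\<phi> (\<Phi> y)) \<partial>cube)"
    by (rule bspec[OF cb2 em])
  have b: "0 \<le> \<phi> x \<and> \<phi> x \<le> D" if "x \<in> space vol" for x using \<phi>(2)[of x] that by (simp add: space_vol)
  have bc: "0 \<le> \<phi> (\<Phi> y) \<and> \<phi> (\<Phi> y) \<le> D" if "y \<in> space cube" for y using \<phi>(2)[OF pt[OF that]] .
  have bU: "0 \<le> \<phi> x * indicator U x \<and> \<phi> x * indicator U x \<le> max D 0" if "x \<in> space vol" for x
    using b[OF that] by (auto split: split_indicator)
  have mc: "(\<lambda>y. \<phi> (\<Phi> y)) \<in> borel_measurable cube" by (rule measurable_compose[OF \<Phi>m \<phi>(1)])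
  have mU: "(\<lambda>x. \<phi> x * indicator U x) \<in> borel_measurable vol"
    by (intro borel_measurable_times \<phi>(1) borel_measurable_indicator open_sets_vol[OF Uo])
  have e1: "(\<integral>\<^sup>+y. ennreal (\<phi> (\<Phi> y)) \<partial>cube) = ennreal (\<integral>y. \<phi> (\<Phi> y) \<partial>cube)"
    by (intro nn_integral_eq_integral finite_measure.integrable_bounded[OF cubeM.finite_measure_axioms mc bc]) (auto intro!: AE_I2 simp: bc)
  have e2: "(\<integral>\<^sup>+x. ennreal (\<phi> x) \<partial>vol) = ennreal (\<integral>x. \<phi> x \<partial>vol)"
    by (intro nn_integral_eq_integral vol.integrable_bounded[OF \<phi>(1) b]) (auto intro!: AE_I2 simp: b)
  have "(\<integral>\<^sup>+x. ennreal (\<phi> x) * indicator U x \<partial>vol) = (\<integral>\<^sup>+x. ennreal (\<phi> x * indicator U x) \<partial>vol)"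
    by (rule nn_integral_cong) (auto split: split_indicator)
  also have "\<dots> = ennreal (\<integral>x. \<phi> x * indicator U x \<partial>vol)"
    by (intro nn_integral_eq_integral vol.integrable_bounded[OF mU bU] AE_I2) (assumption, rule conjunct1[OF bU])
  finally have e3: "(\<integral>\<^sup>+x. ennreal (\<phi> x) * indicator U x \<partial>vol) = ennreal (\<integral>x. \<phi> x * indicator U x \<partial>vol)" .
  have n1: "0 \<le> (\<integral>y. \<phi> (\<Phi> y) \<partial>cube)" by (rule Bochner_Integration.integral_nonneg) (simp add: bc)
  have n2: "0 \<le> (\<integral>x. \<phi> x \<partial>vol)" by (rule Bochner_Integration.integral_nonneg) (simp add: b)
  show "(\<integral>y. \<phi> (\<Phi> y) \<partial>cube) \<le> C * (\<integral>x. \<phi> x \<partial>vol)"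
    using m1 n2 C unfolding e1 e2 by (simp add: ennreal_mult[symmetric])
  show "(\<integral>x. \<phi> x * indicator U x \<partial>vol) \<le> C * (\<integral>y. \<phi> (\<Phi> y) \<partial>cube)"
    using m2 n1 C unfolding e1 e3 by (simp add: ennreal_mult[symmetric])
qed

text \<open>Functions that are 1-Lipschitz for \<open>h\<close>, and hence have the upper gradient \<open>speed_bound h\<close>; positivity allows
  arbitrary real powers.\<close>

definition positive_lipschitz :: "('a, 'i, 'n) tensor2 \<Rightarrow> ('a \<Rightarrow> real) \<Rightarrow> bool" where
  "positive_lipschitz h u \<longleftrightarrow> continuous_map (points M) euclideanreal u \<and> (\<forall>x\<in>X. 0 < u x) \<and>
     (\<forall>x\<in>X. \<forall>y\<in>X. \<bar>u x - u y\<bar> \<le> \<sigma> h x y)"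

text \<open>The oscillation hypothesis of \<open>sobolev_cube\<close> for the power \<open>u^\<gamma>\<close>.\<close>

lemma cube_chart_powr_line:
  assumes cc: "cube_chart \<Phi> U C" and h: "riemannian_metric M h" and u: "positive_lipschitz h u" and \<gamma>: "1 \<le> \<gamma>"
    and y: "y \<in> space cube" and t: "t \<in> {0..1}"
  shows "u (\<Phi> y) powr \<gamma> \<le> u (\<Phi> (y(k := t))) powr \<gamma>
    + line_avg k (\<lambda>y. \<gamma> * u (\<Phi> y) powr (\<gamma> - 1) * (C * speed_bound h (\<Phi> y))) y"
proof -
  interpret h: connected_riem_mfd M h by (rule connected_riem_mfd[OF h])
  have C: "0 < C" and pt: "\<And>y. y \<in> space cube \<Longrightarrow> \<Phi> y \<in> X"
    and line: "continuous_map (top_of_set {0..1}) (points M) (\<lambda>r. \<Phi> (y(k := r)))"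
    using cc y unfolding cube_chart_def by blast+
  have uc: "continuous_map (points M) euclideanreal u" and up: "\<And>x. x \<in> X \<Longrightarrow> 0 < u x"
    and ul: "\<And>x y. x \<in> X \<Longrightarrow> y \<in> X \<Longrightarrow> \<bar>u x - u y\<bar> \<le> \<sigma> h x y"
    using u unfolding positive_lipschitz_def by blast+
  have ptl: "\<Phi> (y(k := r)) \<in> X" if "r \<in> {0..1}" for r using pt[OF fun_upd_space_cube[OF y that]] .
  let ?w = "\<lambda>r. u (\<Phi> (y(k := r)))" and ?F = "\<lambda>r. C * speed_bound h (\<Phi> (y(k := r)))"
  let ?H = "\<lambda>r. \<gamma> * ?w r powr (\<gamma> - 1) * ?F r"
  have yk: "y k \<in> {0..1}" using y by (simp add: space_cube)
  have cw: "continuous_on {0..1} ?w" using continuous_map_compose[OF line uc] by (simp add: o_def)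
  have cF: "continuous_on {0..1} ?F" by (intro continuous_intros cube_chart_line(1)[OF cc h y])
  have wp: "0 < ?w r" if "r \<in> {0..1}" for r using up[OF ptl[OF that]] .
  have Fp: "0 \<le> ?F r" if "r \<in> {0..1}" for r using speed_bound_pos[OF h ptl[OF that]] C by simp
  have "continuous_on {0..1} (\<lambda>r. ?w r powr (\<gamma> - 1))"
    by (rule continuous_on_powr[OF cw continuous_on_const]) (use wp in force)
  then have cH: "continuous_on {0..1} ?H" by (intro continuous_on_mult continuous_on_const cF)
  have H0: "0 \<le> ?H r" if "r \<in> {0..1}" for r using Fp[OF that] \<gamma> by (intro mult_nonneg_nonneg[of _ "?F r"]) auto
  have bnd: "\<bar>?w b powr \<gamma> - ?w a powr \<gamma>\<bar> \<le> integral {0..1} ?H" if ab: "0 \<le> a" "a \<le> b" "b \<le> 1" for a b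
  proof -
    have s: "{a..b} \<subseteq> {0..1}" using ab by auto
    have "\<bar>?w b powr \<gamma> - ?w a powr \<gamma>\<bar> \<le> integral {a..b} ?H"
    proof (rule powr_upper_gradient[OF ab(2) continuous_on_subset[OF cw s] continuous_on_subset[OF cF s] _ _ _ \<gamma>])
      show "0 < ?w t" "0 \<le> ?F t" if "t \<in> {a..b}" for t using wp[of t] Fp[of t] s that by blast+
      show "\<bar>?w t - ?w s\<bar> \<le> integral {s..t} ?F" if st: "a \<le> s" "s \<le> t" "t \<le> b" for s t
      proof -
        have "\<bar>?w t - ?w s\<bar> = \<bar>?w s - ?w t\<bar>" by simp
        also have "\<dots> \<le> \<sigma> h (\<Phi> (y(k := s))) (\<Phi> (y(k := t)))" using st ab by (intro ul ptl) auto
        also have "\<dots> \<le> integral {s..t} ?F" using st ab by (intro cube_chart_line(2)[OF cc h y]) auto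
        finally show ?thesis .
      qed
    qed
    also have "\<dots> \<le> integral {0..1} ?H"
    proof (rule integral_subset_le[OF s])
      show "?H integrable_on {a..b}" by (rule integrable_continuous_real[OF continuous_on_subset[OF cH s]])
      show "?H integrable_on {0..1}" by (rule integrable_continuous_real[OF cH])
    qed (use H0 in auto)
    finally show ?thesis .
  qed
  have "\<bar>?w (y k) powr \<gamma> - ?w t powr \<gamma>\<bar> \<le> integral {0..1} ?H"
  proof (cases "t \<le> y k")
    case True
    then show ?thesis using yk t by (intro bnd) auto
  next
    case False
    then show ?thesis using yk t by (subst abs_minus_commute) (intro bnd; simp)
  qed
  moreover have "integral {0..1} ?H = line_avg k (\<lambda>y. \<gamma> * u (\<Phi> y) powr (\<gamma> - 1) * (C * speed_bound h (\<Phi> y))) y"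
    by (simp only: line_avg_def unit_interval_continuous(2)[OF cH])
  ultimately show ?thesis by simp
qed

text \<open>The inequality on the cube for \<open>v = u^\<gamma>\<close> and its upper gradient \<open>G = \<gamma> u^(\<gamma>-1) C f\<close>, carried over to \<open>U\<close>.\<close>

lemma cube_chart_sobolev:
  assumes n: "2 \<le> CARD('n)" and cc: "cube_chart \<Phi> U C" and h: "riemannian_metric M h" and u: "positive_lipschitz h u" and \<gamma>: "1 \<le> \<gamma>"
  defines "e \<equiv> real CARD('n) / real (CARD('n) - 1)"
  shows "(\<integral>x. u x powr (\<gamma> * e) * indicator U x \<partial>vol)
    \<le> C * ((1 + \<gamma> * C) * C) powr e * (\<integral>x. u x powr \<gamma> + u x powr (\<gamma> - 1) * speed_bound h x \<partial>vol) powr e"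
proof -
  let ?f = "speed_bound h"
  have C: "0 < C" and pt: "\<And>y. y \<in> space cube \<Longrightarrow> \<Phi> y \<in> X" and \<Phi>m: "\<Phi> \<in> measurable cube vol"
    using cc unfolding cube_chart_def by blast+
  have e: "0 < e" using n by (simp add: e_def)
  have uc: "continuous_map (points M) euclideanreal u" and up: "\<And>x. x \<in> X \<Longrightarrow> 0 < u x"
    using u unfolding positive_lipschitz_def by blast+
  obtain cu Cu where cu: "0 < cu" "\<And>x. x \<in> X \<Longrightarrow> cu \<le> u x \<and> u x \<le> Cu"
    using continuous_positive_bounds[OF uc up] by blast
  obtain cf Cf where cf: "0 < cf" "\<And>x. x \<in> X \<Longrightarrow> cf \<le> ?f x \<and> ?f x \<le> Cf"
    using continuous_positive_bounds[OF speed_bound_continuous[OF h] speed_bound_pos[OF h]] by blast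
  have um: "u \<in> borel_measurable vol" by (rule continuous_measurable_vol[OF uc])
  have fm: "?f \<in> borel_measurable vol" by (rule speed_bound_measurable[OF h])
  define v where "v y = u (\<Phi> y) powr \<gamma>" for y
  define G where "G y = \<gamma> * u (\<Phi> y) powr (\<gamma> - 1) * (C * ?f (\<Phi> y))" for y
  define \<psi> where "\<psi> x = u x powr \<gamma> + u x powr (\<gamma> - 1) * ?f x" for x
  have umc: "(\<lambda>y. u (\<Phi> y)) \<in> borel_measurable cube" and fmc: "(\<lambda>y. ?f (\<Phi> y)) \<in> borel_measurable cube"
    by (rule measurable_compose[OF \<Phi>m um], rule measurable_compose[OF \<Phi>m fm])
  have vm: "v \<in> borel_measurable cube" unfolding v_def using umc by measurable
  have Gm: "G \<in> borel_measurable cube" unfolding G_def using umc fmc by measurable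
  have \<psi>m: "\<psi> \<in> borel_measurable vol" unfolding \<psi>_def using um fm by measurable
  have pw: "cu powr s \<le> u x powr s \<and> u x powr s \<le> Cu powr s" if "x \<in> X" "0 \<le> s" for x s
    using cu that by (intro conjI powr_mono2) (auto intro: less_imp_le order_trans)
  have vb: "cu powr \<gamma> \<le> v y \<and> v y \<le> Cu powr \<gamma>" if "y \<in> space cube" for y
    using pw[OF pt[OF that], of \<gamma>] \<gamma> by (simp add: v_def)
  have uf: "0 \<le> u x powr (\<gamma> - 1) * ?f x \<and> u x powr (\<gamma> - 1) * ?f x \<le> Cu powr (\<gamma> - 1) * Cf" if "x \<in> X" for x
    using pw[OF that, of "\<gamma> - 1"] cf(1) cf(2)[OF that] \<gamma> by (auto intro!: mult_mono mult_nonneg_nonneg)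
  have Gb: "0 \<le> G y \<and> G y \<le> \<gamma> * C * (Cu powr (\<gamma> - 1) * Cf)" if "y \<in> space cube" for y
  proof -
    have "G y = \<gamma> * C * (u (\<Phi> y) powr (\<gamma> - 1) * ?f (\<Phi> y))" by (simp add: G_def)
    moreover have "0 \<le> \<gamma> * C" using \<gamma> C by simp
    ultimately show ?thesis using uf[OF pt[OF that]] by (auto intro: mult_left_mono)
  qed
  have \<psi>b: "0 \<le> \<psi> x \<and> \<psi> x \<le> Cu powr \<gamma> + Cu powr (\<gamma> - 1) * Cf" if "x \<in> X" for x
    using pw[OF that, of \<gamma>] uf[OF that] \<gamma> unfolding \<psi>_def by (auto intro: add_mono)
  have S: "(\<integral>y. v y powr e \<partial>cube) \<le> (\<integral>y. v y + G y \<partial>cube) powr e"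
    unfolding e_def
  proof (rule sobolev_cube[OF n vm _ vb Gm Gb])
    show "0 < cu powr \<gamma>" using cu(1) by simp
    show "v y \<le> v (y(k := t)) + line_avg k G y" if "y \<in> space cube" "t \<in> {0..1}" for y k t
      unfolding v_def G_def by (rule cube_chart_powr_line[OF cc h u \<gamma> that])
  qed
  have \<psi>c: "0 \<le> \<psi> (\<Phi> y) \<and> \<psi> (\<Phi> y) \<le> Cu powr \<gamma> + Cu powr (\<gamma> - 1) * Cf" if "y \<in> space cube" for y using \<psi>b[OF pt[OF that]] .
  have \<psi>mc: "(\<lambda>y. \<psi> (\<Phi> y)) \<in> borel_measurable cube" by (rule measurable_compose[OF \<Phi>m \<psi>m])
  have vG: "0 \<le> v y + G y \<and> v y + G y \<le> (1 + \<gamma> * C) * \<psi> (\<Phi> y)" if "y \<in> space cube" for y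
  proof -
    let ?a = "u (\<Phi> y) powr (\<gamma> - 1) * ?f (\<Phi> y)"
    have "0 \<le> ?a" "0 \<le> \<gamma> * C" "0 \<le> v y" using uf[OF pt[OF that]] \<gamma> C by (auto simp: v_def)
    then have "0 \<le> ?a + \<gamma> * C * v y" by simp
    moreover have "(1 + \<gamma> * C) * \<psi> (\<Phi> y) = v y + G y + (?a + \<gamma> * C * v y)"
      by (simp add: \<psi>_def v_def G_def algebra_simps)
    moreover have "0 \<le> v y + G y" using \<open>0 \<le> v y\<close> Gb[OF that] by simp
    ultimately show ?thesis by simp
  qed
  have iv: "(\<integral>y. v y + G y \<partial>cube) \<le> (\<integral>y. (1 + \<gamma> * C) * \<psi> (\<Phi> y) \<partial>cube)"
  proof (rule integral_mono)
    show "integrable cube (\<lambda>y. (1 + \<gamma> * C) * \<psi> (\<Phi> y))"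
      by (intro integrable_mult_right finite_measure.integrable_bounded[OF cubeM.finite_measure_axioms \<psi>mc \<psi>c])
    have "0 \<le> v y" "0 \<le> G y" if "y \<in> space cube" for y using Gb[OF that] by (auto simp: v_def)
    then show "integrable cube (\<lambda>y. v y + G y)"
      using finite_measure.integrable_bounded[OF cubeM.finite_measure_axioms vm, of "Cu powr \<gamma>"] finite_measure.integrable_bounded[OF cubeM.finite_measure_axioms Gm Gb] vb by (intro Bochner_Integration.integrable_add) auto
  qed (use vG in blast)
  have ci: "(\<integral>y. \<psi> (\<Phi> y) \<partial>cube) \<le> C * (\<integral>x. \<psi> x \<partial>vol)" by (rule cube_chart_integral(1)[OF cc \<psi>m \<psi>b])
  have "(\<integral>y. v y + G y \<partial>cube) \<le> (1 + \<gamma> * C) * (\<integral>y. \<psi> (\<Phi> y) \<partial>cube)" using iv by simp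
  also have "\<dots> \<le> (1 + \<gamma> * C) * (C * (\<integral>x. \<psi> x \<partial>vol))" using ci \<gamma> C by (intro mult_left_mono) auto
  finally have vG2: "(\<integral>y. v y + G y \<partial>cube) \<le> (1 + \<gamma> * C) * C * (\<integral>x. \<psi> x \<partial>vol)" by (simp add: mult.assoc)
  have i0: "0 \<le> (\<integral>x. \<psi> x \<partial>vol)" by (rule Bochner_Integration.integral_nonneg) (simp add: \<psi>b space_vol)
  have v0: "0 \<le> (\<integral>y. v y + G y \<partial>cube)" by (rule Bochner_Integration.integral_nonneg) (use vG in blast)
  have "(\<integral>x. u x powr (\<gamma> * e) * indicator U x \<partial>vol) \<le> C * (\<integral>y. u (\<Phi> y) powr (\<gamma> * e) \<partial>cube)"
  proof (rule cube_chart_integral(2)[OF cc])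
    show "(\<lambda>x. u x powr (\<gamma> * e)) \<in> borel_measurable vol" using um by measurable
    show "0 \<le> u x powr (\<gamma> * e) \<and> u x powr (\<gamma> * e) \<le> Cu powr (\<gamma> * e)" if "x \<in> X" for x
      using pw[OF that, of "\<gamma> * e"] \<gamma> e by simp
  qed
  also have "(\<integral>y. u (\<Phi> y) powr (\<gamma> * e) \<partial>cube) = (\<integral>y. v y powr e \<partial>cube)" by (simp only: v_def powr_powr)
  also have "C * \<dots> \<le> C * (((1 + \<gamma> * C) * C * (\<integral>x. \<psi> x \<partial>vol)) powr e)"
    using S powr_mono2[OF less_imp_le[OF e] v0 vG2] C by (intro mult_left_mono) auto
  also have "((1 + \<gamma> * C) * C * (\<integral>x. \<psi> x \<partial>vol)) powr e = ((1 + \<gamma> * C) * C) powr e * (\<integral>x. \<psi> x \<partial>vol) powr e"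
    by (rule powr_mult)
  finally show ?thesis by (simp only: \<psi>_def mult.assoc)
qed

text \<open>Summation of the local inequalities over a finite cover by cubical charts.\<close>

lemma sobolev:
  assumes n: "2 \<le> CARD('n)" and \<gamma>: "1 \<le> \<gamma>"
  defines "e \<equiv> real CARD('n) / real (CARD('n) - 1)"
  shows "\<exists>K>0. \<forall>h u. riemannian_metric M h \<longrightarrow> positive_lipschitz h u \<longrightarrow>
     (\<integral>x. u x powr (\<gamma> * e) \<partial>vol) \<le> K * (\<integral>x. u x powr \<gamma> + u x powr (\<gamma> - 1) * speed_bound h x \<partial>vol) powr e"
proof -
  define Q where "Q U K \<longleftrightarrow> (\<forall>h u. riemannian_metric M h \<longrightarrow> positive_lipschitz h u \<longrightarrow>
     (\<integral>x. u x powr (\<gamma> * e) * indicator U x \<partial>vol)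
       \<le> K * (\<integral>x. u x powr \<gamma> + u x powr (\<gamma> - 1) * speed_bound h x \<partial>vol) powr e)" for U K
  have "\<exists>U K. openin (points M) U \<and> x \<in> U \<and> 0 \<le> K \<and> Q U K" if xX: "x \<in> X" for x
  proof -
    obtain \<Phi> U C where cc: "cube_chart \<Phi> U C" and x: "x \<in> U" by (rule cube_chart_exists[OF xX])
    have C: "0 < C" and U: "openin (points M) U" using cc unfolding cube_chart_def by blast+
    have "Q U (C * ((1 + \<gamma> * C) * C) powr e)"
      unfolding Q_def e_def by (intro allI impI) (rule cube_chart_sobolev[OF n cc _ _ \<gamma>])
    moreover have "0 \<le> C * ((1 + \<gamma> * C) * C) powr e" using C by simp
    ultimately show ?thesis using U x by blast
  qed
  then obtain U K where op: "\<And>x. x \<in> X \<Longrightarrow> openin (points M) (U x) \<and> x \<in> U x" and K: "\<And>x. x \<in> X \<Longrightarrow> 0 \<le> K x"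
    and Q: "\<And>x. x \<in> X \<Longrightarrow> Q (U x) (K x)"
    by metis
  have S: "(\<integral>z. u z powr (\<gamma> * e) * indicator (U x) z \<partial>vol)
     \<le> K x * (\<integral>x. u x powr \<gamma> + u x powr (\<gamma> - 1) * speed_bound h x \<partial>vol) powr e"
    if "x \<in> X" "riemannian_metric M h" "positive_lipschitz h u" for x h u
    using Q[OF that(1)] that(2,3) unfolding Q_def by blast
  obtain F where F: "finite F" "F \<subseteq> X" "X \<subseteq> (\<Union>x\<in>F. U x)" by (rule finite_subcover[OF op])
  define L where "L = (\<Sum>x\<in>F. K x) + 1"
  have K0: "0 \<le> (\<Sum>x\<in>F. K x)" using F(2) K by (intro sum_nonneg) auto
  show ?thesis
  proof (intro exI[of _ L] conjI allI impI)
    show "0 < L" using K0 by (simp add: L_def)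
    fix h u assume h: "riemannian_metric M h" and u: "positive_lipschitz h u"
    have uc: "continuous_map (points M) euclideanreal u" and up: "\<And>x. x \<in> X \<Longrightarrow> 0 < u x"
      using u unfolding positive_lipschitz_def by blast+
    obtain cu Cu where cu: "0 < cu" "\<And>x. x \<in> X \<Longrightarrow> cu \<le> u x \<and> u x \<le> Cu"
      using continuous_positive_bounds[OF uc up] by blast
    let ?w = "\<lambda>x. u x powr (\<gamma> * e)" and ?J = "(\<integral>x. u x powr \<gamma> + u x powr (\<gamma> - 1) * speed_bound h x \<partial>vol) powr e"
    have e: "0 < e" using n by (simp add: e_def)
    have wm: "?w \<in> borel_measurable vol" using continuous_measurable_vol[OF uc] by measurable
    have wb: "0 \<le> ?w x \<and> ?w x \<le> Cu powr (\<gamma> * e)" if "x \<in> space vol" for x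
      using cu(1) cu(2)[of x] that \<gamma> e by (auto simp: space_vol intro!: powr_mono2)
    have i: "integrable vol (\<lambda>z. ?w z * indicator (U x) z)" if "x \<in> F" for x
    proof (rule vol.integrable_bounded[where C="Cu powr (\<gamma> * e)"])
      have "openin (points M) (U x)" using op that F(2) by blast
      then show "(\<lambda>z. ?w z * indicator (U x) z) \<in> borel_measurable vol"
        by (intro borel_measurable_times wm borel_measurable_indicator open_sets_vol)
      show "0 \<le> ?w z * indicator (U x) z \<and> ?w z * indicator (U x) z \<le> Cu powr (\<gamma> * e)" if "z \<in> space vol" for z
        using wb[OF that] by (auto split: split_indicator)
    qed
    have "(\<integral>z. ?w z \<partial>vol) \<le> (\<integral>z. (\<Sum>x\<in>F. ?w z * indicator (U x) z) \<partial>vol)"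
    proof (rule integral_mono)
      show "integrable vol ?w" by (rule vol.integrable_bounded[OF wm wb])
      show "integrable vol (\<lambda>z. \<Sum>x\<in>F. ?w z * indicator (U x) z)" by (intro Bochner_Integration.integrable_sum i)
      fix z assume z: "z \<in> space vol"
      then obtain x where x: "x \<in> F" "z \<in> U x" using F(3) by (auto simp: space_vol)
      have "?w z = ?w z * indicator (U x) z" using x by simp
      also have "\<dots> \<le> (\<Sum>x\<in>F. ?w z * indicator (U x) z)" using x(1) F(1) by (intro member_le_sum) auto
      finally show "?w z \<le> (\<Sum>x\<in>F. ?w z * indicator (U x) z)" .
    qed
    also have "\<dots> = (\<Sum>x\<in>F. \<integral>z. ?w z * indicator (U x) z \<partial>vol)" by (intro Bochner_Integration.integral_sum i)
    also have "\<dots> \<le> (\<Sum>x\<in>F. K x * ?J)" using F(2) by (intro sum_mono S[OF _ h u]) auto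
    also have "\<dots> = (\<Sum>x\<in>F. K x) * ?J" by (simp add: sum_distrib_right)
    also have "\<dots> \<le> L * ?J" by (intro mult_right_mono) (auto simp: L_def)
    finally show "(\<integral>z. ?w z \<partial>vol) \<le> L * ?J" .
  qed
qed

end

section \<open>The estimate of the distance function\<close>

lemma le_one_plus_powr: "0 \<le> x \<Longrightarrow> r \<le> s \<Longrightarrow> 0 \<le> r \<Longrightarrow> x powr r \<le> 1 + x powr s" for x :: real
  by (cases "x \<le> 1") (auto intro: order_trans[OF powr_le1] order_trans[OF powr_mono])

lemma powr_add_le:
  fixes a b s :: real
  assumes "0 \<le> a" "0 \<le> b" "0 \<le> s"
  shows "(a + b) powr s \<le> 2 powr s * (a powr s + b powr s)"
proof -
  have "(a + b) powr s \<le> (2 * max a b) powr s" using assms by (intro powr_mono2) auto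
  also have "\<dots> = 2 powr s * max a b powr s" by (rule powr_mult)
  also have "\<dots> \<le> 2 powr s * (a powr s + b powr s)" by (intro mult_left_mono) (auto simp: max_def)
  finally show ?thesis .
qed

lemma (in finite_measure) integral_le_powr_norm:
  fixes f :: "'a \<Rightarrow> real"
  assumes f: "f \<in> borel_measurable M" "\<And>x. x \<in> space M \<Longrightarrow> 0 \<le> f x \<and> f x \<le> C" and p: "1 \<le> p"
    and B: "0 < B" "(\<integral>x. f x powr p \<partial>M) = B powr p"
  shows "(\<integral>x. f x \<partial>M) \<le> B * (measure M (space M) + 1)"
proof -
  have fp: "integrable M (\<lambda>x. f x powr p)"
  proof (rule integrable_bounded[where C="C powr p"])
    show "(\<lambda>x. f x powr p) \<in> borel_measurable M" using f(1) by measurable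
  qed (use f(2) p in \<open>auto intro!: powr_mono2\<close>)
  have "(\<integral>x. f x \<partial>M) \<le> (\<integral>x. B * (1 + f x powr p / B powr p) \<partial>M)"
  proof (rule integral_mono)
    show "integrable M f" by (rule integrable_bounded[OF f])
    show "integrable M (\<lambda>x. B * (1 + f x powr p / B powr p))" using fp by simp
    fix x assume x: "x \<in> space M"
    have "f x = B * (f x / B) powr 1" using f(2)[OF x] B by simp
    also have "\<dots> \<le> B * (1 + (f x / B) powr p)" using f(2)[OF x] B p by (intro mult_left_mono le_one_plus_powr) auto
    finally show "f x \<le> B * (1 + f x powr p / B powr p)" using f(2)[OF x] B by (simp add: powr_divide)
  qed
  also have "\<dots> = B * (measure M (space M) + (\<integral>x. f x powr p \<partial>M) / B powr p)"
    using fp by (simp add: distrib_left)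
  also have "\<dots> = B * (measure M (space M) + 1)" using B by simp
  finally show ?thesis .
qed

text \<open>The only place where the Sobolev exponent \<open>n p / (n - p)\<close> enters. Raising \<open>q\<close> to at least \<open>e = n / (n - 1)\<close>, the
  Sobolev exponent of \<open>p = 1\<close>, makes the power \<open>\<gamma> = max q e / e\<close> at least \<open>1\<close>.\<close>

lemma sobolev_exponent:
  fixes n p q :: real
  assumes n: "2 \<le> n" and p: "1 \<le> p" "p < n" and q: "q < n * p / (n - p)"
  defines "e \<equiv> n / (n - 1)"
  shows "max q e \<le> p * (max q e - max q e / e + 1)"
proof -
  let ?r = "max q e"
  have "e \<le> n * p / (n - p)"
  proof -
    have "n * (n - p) \<le> n * (p * (n - 1))" using mult_right_mono[of 1 p n] n p by (intro mult_left_mono) (auto simp: algebra_simps)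
    then show ?thesis using n p unfolding e_def by (simp add: field_simps)
  qed
  then have "?r \<le> n * p / (n - p)" using q by simp
  then have "?r * (n - p) \<le> n * p" using p by (subst (asm) pos_le_divide_eq) auto
  then have "?r * n \<le> p * ?r + n * p" by (simp only: right_diff_distrib mult.commute[of p] diff_le_eq add.commute)
  moreover have "t * n \<le> p * t + n * p \<longleftrightarrow> t \<le> p * (t / n + 1)" for t using n by (simp add: field_simps)
  moreover have "?r - ?r / e = ?r / n" using n by (simp add: e_def field_simps)
  ultimately show ?thesis by (simp only:)
qed

context closed_connected_riem_mfd begin

lemma sum_powr_integral:
  assumes u: "u \<in> borel_measurable vol" "\<And>x. x \<in> X \<Longrightarrow> 0 \<le> u x \<and> u x \<le> C"
  shows "integrable (vol \<Otimes>\<^sub>M vol) (\<lambda>p. u (fst p) + u (snd p))" (is "integrable ?P _")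
    and "(\<integral>p. u (fst p) + u (snd p) \<partial>(vol \<Otimes>\<^sub>M vol)) = 2 * measure vol X * (\<integral>x. u x \<partial>vol)"
    and "measure (vol \<Otimes>\<^sub>M vol) (X \<times> X) = measure vol X * measure vol X" "finite_measure (vol \<Otimes>\<^sub>M vol)"
proof -
  interpret pair_sigma_finite vol vol by (intro pair_sigma_finite.intro vol.sigma_finite_measure_axioms)
  have X: "X \<in> sets vol" by (rule open_sets_vol[OF openin_topspace])
  have em: "emeasure ?P (X \<times> X) = ennreal (measure vol X * measure vol X)"
    by (simp add: vol.emeasure_pair_measure_Times[OF X X] vol.emeasure_eq_measure ennreal_mult)
  then show "measure ?P (X \<times> X) = measure vol X * measure vol X" by (simp add: measure_def)
  show fin: "finite_measure ?P"
    using em by (intro finite_measureI) (simp add: space_pair_measure space_vol)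
  have iu: "integrable vol u" using u by (intro vol.integrable_bounded[of u C]) (auto simp: space_vol)
  have i1: "integrable ?P (\<lambda>p. u (fst p))" and i2: "integrable ?P (\<lambda>p. u (snd p))"
    using measurable_compose[OF measurable_fst u(1)] measurable_compose[OF measurable_snd u(1)] u(2)
    by (auto intro!: finite_measure.integrable_bounded[OF fin, where C=C] simp: space_pair_measure space_vol)
  show "integrable ?P (\<lambda>p. u (fst p) + u (snd p))" using i1 i2 by (rule Bochner_Integration.integrable_add)
  have "(\<integral>p. u (fst p) + u (snd p) \<partial>?P) = (\<integral>p. u (fst p) \<partial>?P) + (\<integral>p. u (snd p) \<partial>?P)"
    by (rule Bochner_Integration.integral_add[OF i1 i2])
  also have "\<dots> = (\<integral>x. (\<integral>y. u x \<partial>vol) \<partial>vol) + (\<integral>x. (\<integral>y. u y \<partial>vol) \<partial>vol)"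
    using integral_fst'[OF i1] integral_fst'[OF i2] by simp
  also have "\<dots> = 2 * measure vol X * (\<integral>x. u x \<partial>vol)" by (simp add: space_vol)
  finally show "(\<integral>p. u (fst p) + u (snd p) \<partial>?P) = 2 * measure vol X * (\<integral>x. u x \<partial>vol)" .
qed

text \<open>The Sobolev inequality for \<open>u = \<sigma> h x\<^sub>0 _ + B\<close>. Its hypothesis \<open>\<integral> u \<le> K\<^sub>2 * B\<close> is the Poincare inequality
  \<open>base_point\<close> together with Hoelder's inequality \<open>\<integral> f \<le> (V + 1) * B\<close>. The constant is fixed before \<open>p\<close> and \<open>h\<close>.\<close>

lemma shifted_dist_norm:
  assumes n: "2 \<le> CARD('n)" and ne: "X \<noteq> {}" and q: "1 \<le> q"
  defines "r \<equiv> max q (real CARD('n) / real (CARD('n) - 1))"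
  shows "\<exists>C>0. \<forall>p h B. 1 \<le> p \<longrightarrow> p < real CARD('n) \<longrightarrow> q < real CARD('n) * p / (real CARD('n) - p) \<longrightarrow> riemannian_metric M h \<longrightarrow>
       B = (\<integral>x. speed_bound h x powr p \<partial>vol) powr (1 / p) \<longrightarrow>
       0 < B \<and> (\<exists>x\<^sub>0\<in>X. (\<integral>x. (\<sigma> h x\<^sub>0 x + B) powr r \<partial>vol) powr (1 / r) \<le> C * B)"
proof -
  define e where "e = real CARD('n) / real (CARD('n) - 1)"
  define \<gamma> where "\<gamma> = r / e"
  have e: "1 < e" using n by (simp add: e_def field_simps)
  have r: "e \<le> r" "q \<le> r" by (simp_all add: r_def e_def)
  have \<gamma>: "1 \<le> \<gamma>" and re: "r = \<gamma> * e" using e r by (simp_all add: \<gamma>_def)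
  obtain K where "0 < K \<and> (\<forall>h u. riemannian_metric M h \<longrightarrow> positive_lipschitz h u \<longrightarrow>
     (\<integral>x. u x powr (\<gamma> * e) \<partial>vol) \<le> K * (\<integral>x. u x powr \<gamma> + u x powr (\<gamma> - 1) * speed_bound h x \<partial>vol) powr e)"
    using sobolev[OF n \<gamma>] unfolding e_def by (rule exE)
  note K = conjunct1[OF this] conjunct2[OF this, rule_format]
  obtain C\<^sub>1 where "0 < C\<^sub>1 \<and> (\<forall>h. riemannian_metric M h \<longrightarrow>
      (\<exists>x\<^sub>0\<in>X. (\<integral>\<^sup>+y. ennreal (\<sigma> h x\<^sub>0 y) \<partial>vol) \<le> ennreal (C\<^sub>1 * (\<integral>x. speed_bound h x \<partial>vol))))"
    using base_point[OF ne] by (rule exE)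
  note C1 = conjunct1[OF this] conjunct2[OF this, rule_format]
  define V where "V = measure vol (space vol)"
  define K\<^sub>2 where "K\<^sub>2 = C\<^sub>1 * (V + 1) + V"
  define K' where "K' = K powr (1 / e)"
  define C where "C = 2 * K' * ((2 * K') powr ((\<gamma> - 1) / (r - \<gamma>)) * K\<^sub>2 + 2 + V)"
  have "0 < emeasure vol X" by (rule emeasure_open_pos[OF openin_topspace ne])
  then have V: "0 < V" by (simp add: V_def vol.emeasure_eq_measure space_vol)
  have "0 < K\<^sub>2" "0 < K'" using V C1(1) K(1) by (simp_all add: K\<^sub>2_def K'_def add_pos_pos)
  then have C0: "0 < C" unfolding C_def using V by (intro mult_pos_pos add_nonneg_pos add_pos_pos) auto
  have main: "0 < B \<and> (\<exists>x\<^sub>0\<in>X. (\<integral>x. (\<sigma> h x\<^sub>0 x + B) powr r \<partial>vol) powr (1 / r) \<le> C * B)"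
    if p: "1 \<le> p" "p < real CARD('n)" "q < real CARD('n) * p / (real CARD('n) - p)" and h: "riemannian_metric M h"
      and B: "B = (\<integral>x. speed_bound h x powr p \<partial>vol) powr (1 / p)" for p h B
  proof -
    interpret h: connected_riem_mfd M h by (rule connected_riem_mfd[OF h])
    let ?f = "speed_bound h"
    obtain cf Cf where cf: "0 < cf" "\<And>x. x \<in> X \<Longrightarrow> cf \<le> ?f x \<and> ?f x \<le> Cf"
      using continuous_positive_bounds[OF speed_bound_continuous[OF h] speed_bound_pos[OF h]] by blast
    have fm: "?f \<in> borel_measurable vol" by (rule speed_bound_measurable[OF h])
    have fb: "cf \<le> ?f x \<and> ?f x \<le> Cf" if "x \<in> space vol" for x using cf(2)[of x] that by (simp add: space_vol)
    have I: "0 < (\<integral>x. ?f x powr p \<partial>vol)"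
    proof (rule vol.integral_pos_bounded)
      show "(\<lambda>x. ?f x powr p) \<in> borel_measurable vol" using fm by measurable
      show "0 < cf powr p" "0 < measure vol (space vol)" using cf(1) V by (simp_all add: V_def)
      show "cf powr p \<le> ?f x powr p \<and> ?f x powr p \<le> Cf powr p" if "x \<in> space vol" for x
        using fb[OF that] cf(1) p(1) by (auto intro!: powr_mono2)
    qed
    have B0: "0 < B" using I unfolding B by simp
    have Bp: "(\<integral>x. ?f x powr p \<partial>vol) = B powr p" using I p(1) unfolding B by (simp add: powr_powr)
    obtain x\<^sub>0 where x0: "x\<^sub>0 \<in> X" "(\<integral>\<^sup>+y. ennreal (\<sigma> h x\<^sub>0 y) \<partial>vol) \<le> ennreal (C\<^sub>1 * (\<integral>x. ?f x \<partial>vol))"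
      using C1(2)[OF h] by blast
    define u where "u x = \<sigma> h x\<^sub>0 x + B" for x
    have sc: "continuous_map (points M) euclideanreal (\<sigma> h x\<^sub>0)" by (rule h.sym_dist_continuous_right[OF x0(1)])
    have uc: "continuous_map (points M) euclideanreal u"
      unfolding u_def by (intro continuous_map_add sc) simp
    have s0: "0 \<le> \<sigma> h x\<^sub>0 x" if "x \<in> X" for x by (rule h.sym_dist_nonneg[OF x0(1) that])
    have up: "0 < u x" if "x \<in> X" for x using s0[OF that] B0 by (simp add: u_def)
    have ul: "\<bar>u x - u y\<bar> \<le> \<sigma> h x y" if "x \<in> X" "y \<in> X" for x y
      using h.sym_dist_triangle[OF x0(1) that] h.sym_dist_triangle[OF x0(1) that(2,1)] h.sym_dist_commute[of x y]
      by (simp add: u_def abs_le_iff)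
    have pl: "positive_lipschitz h u" unfolding positive_lipschitz_def using uc up ul by blast
    obtain cu Cu where cu: "0 < cu" "\<And>x. x \<in> X \<Longrightarrow> cu \<le> u x \<and> u x \<le> Cu"
      using continuous_positive_bounds[OF uc up] by blast
    have um: "u \<in> borel_measurable vol" by (rule continuous_measurable_vol[OF uc])
    have ub: "cu \<le> u x \<and> u x \<le> Cu" if "x \<in> space vol" for x using cu(2)[of x] that by (simp add: space_vol)
    have sm: "\<sigma> h x\<^sub>0 \<in> borel_measurable vol" by (rule \<sigma>_measurable_right[OF h x0(1)])
    have sb: "0 \<le> \<sigma> h x\<^sub>0 x \<and> \<sigma> h x\<^sub>0 x \<le> Cu" if "x \<in> space vol" for x
      using s0[of x] ub[OF that] B0 that by (simp add: u_def space_vol)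
    have si: "integrable vol (\<sigma> h x\<^sub>0)" by (rule vol.integrable_bounded[OF sm sb])
    have "ennreal (\<integral>x. \<sigma> h x\<^sub>0 x \<partial>vol) = (\<integral>\<^sup>+y. ennreal (\<sigma> h x\<^sub>0 y) \<partial>vol)"
      by (rule nn_integral_eq_integral[OF si, symmetric]) (rule AE_I2, rule conjunct1[OF sb])
    moreover have fi: "(\<integral>x. ?f x \<partial>vol) \<le> B * (V + 1)" unfolding V_def
      by (rule vol.integral_le_powr_norm[OF fm _ p(1) B0 Bp, of Cf]) (use fb cf(1) in force)
    moreover have "C\<^sub>1 * (\<integral>x. ?f x \<partial>vol) \<le> C\<^sub>1 * (B * (V + 1))" using fi C1(1) by (intro mult_left_mono) auto
    ultimately have "ennreal (\<integral>x. \<sigma> h x\<^sub>0 x \<partial>vol) \<le> ennreal (C\<^sub>1 * (B * (V + 1)))"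
      using x0(2) by (metis ennreal_leI order_trans)
    then have "(\<integral>x. \<sigma> h x\<^sub>0 x \<partial>vol) \<le> C\<^sub>1 * (B * (V + 1))"
      using C1(1) B0 V by (subst (asm) ennreal_le_iff) auto
    moreover have "(\<integral>x. u x \<partial>vol) = (\<integral>x. \<sigma> h x\<^sub>0 x \<partial>vol) + B * V"
      unfolding u_def using si by (simp add: V_def)
    ultimately have A: "(\<integral>x. u x \<partial>vol) \<le> K\<^sub>2 * B" by (simp add: K\<^sub>2_def algebra_simps)
    have "r \<le> p * (r - r / e + 1)"
      using sobolev_exponent[of "real CARD('n)" p q] n p by (simp add: r_def e_def of_nat_diff)
    then have pe: "r \<le> p * (r - \<gamma> + 1)" by (simp add: \<gamma>_def)
    have "(\<integral>x. u x powr r \<partial>vol) powr (1 / r) \<le> C * B"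
      unfolding C_def K'_def V_def
      by (rule vol.sobolev_absorb[OF um cu(1) ub fm cf(1) fb _ \<gamma> e re p(1) pe K(1) _ B A])
         (use V K(2)[OF h pl] in \<open>simp_all add: V_def re\<close>)
    then show ?thesis using B0 x0(1) unfolding u_def by blast
  qed
  show ?thesis by (intro exI[of _ C] conjI[OF C0] allI impI) (rule main)
qed

text \<open>\<open>d_h(x, y)\<close> is at most \<open>u x + u y\<close>, and on a space of finite measure the \<open>L^q\<close> norm is controlled by the \<open>L^r\<close>
  norm for \<open>q \<le> r\<close>. Everything is divided by \<open>B\<close> first, so that the estimate is homogeneous.\<close>

lemma dist_norm_bound:
  assumes n: "2 \<le> CARD('n)" and ne: "X \<noteq> {}" and q: "1 \<le> q"
  shows "\<exists>C>0. \<forall>p h. 1 \<le> p \<longrightarrow> p < real CARD('n) \<longrightarrow> q < real CARD('n) * p / (real CARD('n) - p) \<longrightarrow> riemannian_metric M h \<longrightarrow>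
       Lr_norm q (vol \<Otimes>\<^sub>M vol) (\<lambda>(x, y). riemannian_dist M h x y) \<le> C * (\<integral>x. speed_bound h x powr p \<partial>vol) powr (1 / p)"
proof -
  define r where "r = max q (real CARD('n) / real (CARD('n) - 1))"
  have r: "1 \<le> r" "q \<le> r" using q by (simp_all add: r_def)
  obtain C\<^sub>1 where "0 < C\<^sub>1 \<and> (\<forall>p h B. 1 \<le> p \<longrightarrow> p < real CARD('n) \<longrightarrow> q < real CARD('n) * p / (real CARD('n) - p) \<longrightarrow> riemannian_metric M h \<longrightarrow>
       B = (\<integral>x. speed_bound h x powr p \<partial>vol) powr (1 / p) \<longrightarrow>
       0 < B \<and> (\<exists>x\<^sub>0\<in>X. (\<integral>x. (\<sigma> h x\<^sub>0 x + B) powr r \<partial>vol) powr (1 / r) \<le> C\<^sub>1 * B))"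
    using shifted_dist_norm[OF n ne q] unfolding r_def by (rule exE)
  note C1 = conjunct1[OF this] and main = conjunct2[OF this, rule_format]
  define V where "V = measure vol X"
  define D where "D = V * V + 2 powr r * (2 * V * C\<^sub>1 powr r)"
  have "0 < emeasure vol X" by (rule emeasure_open_pos[OF openin_topspace ne])
  then have V: "0 < V" by (simp add: V_def vol.emeasure_eq_measure)
  have D: "0 < D" using V by (auto simp: D_def intro!: add_pos_nonneg)
  have est: "Lr_norm q (vol \<Otimes>\<^sub>M vol) (\<lambda>(x, y). riemannian_dist M h x y) \<le> D powr (1 / q) * (\<integral>x. speed_bound h x powr p \<partial>vol) powr (1 / p)"
    if p: "1 \<le> p" "p < real CARD('n)" "q < real CARD('n) * p / (real CARD('n) - p)" and h: "riemannian_metric M h" for p h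
  proof -
    interpret h: connected_riem_mfd M h by (rule connected_riem_mfd[OF h])
    define B where "B = (\<integral>x. speed_bound h x powr p \<partial>vol) powr (1 / p)"
    obtain x\<^sub>0 where B: "0 < B" and x0: "x\<^sub>0 \<in> X" and est: "(\<integral>x. (\<sigma> h x\<^sub>0 x + B) powr r \<partial>vol) powr (1 / r) \<le> C\<^sub>1 * B"
      using main[OF p h B_def] by blast
    define w where "w x = ((\<sigma> h x\<^sub>0 x + B) / B) powr r" for x
    let ?d = "\<lambda>z. riemannian_dist M h (fst z) (snd z)" and ?P = "vol \<Otimes>\<^sub>M vol"
    have s0: "0 \<le> \<sigma> h x\<^sub>0 x" if "x \<in> X" for x by (rule h.sym_dist_nonneg[OF x0 that])
    have uc: "continuous_map (points M) euclideanreal (\<lambda>x. \<sigma> h x\<^sub>0 x + B)"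
      by (intro continuous_map_add h.sym_dist_continuous_right[OF x0]) simp
    have up: "0 < \<sigma> h x\<^sub>0 x + B" if "x \<in> X" for x using s0[OF that] B by simp
    obtain cu Cu where cu: "0 < cu" "\<And>x. x \<in> X \<Longrightarrow> cu \<le> \<sigma> h x\<^sub>0 x + B \<and> \<sigma> h x\<^sub>0 x + B \<le> Cu"
      using continuous_positive_bounds[OF uc up] by blast
    have wm: "w \<in> borel_measurable vol" unfolding w_def using continuous_measurable_vol[OF uc] by measurable
    have wb: "0 \<le> w x \<and> w x \<le> (Cu / B) powr r" if "x \<in> X" for x
      using cu(2)[OF that] up[OF that] B r by (auto simp: w_def intro!: powr_mono2 divide_right_mono)
    have J0: "0 \<le> (\<integral>x. (\<sigma> h x\<^sub>0 x + B) powr r \<partial>vol)" by (rule Bochner_Integration.integral_nonneg) simp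
    have "(\<integral>x. (\<sigma> h x\<^sub>0 x + B) powr r \<partial>vol) = ((\<integral>x. (\<sigma> h x\<^sub>0 x + B) powr r \<partial>vol) powr (1 / r)) powr r"
      using J0 r by (simp add: powr_powr)
    also have "\<dots> \<le> (C\<^sub>1 * B) powr r" using est r by (intro powr_mono2) auto
    finally have J: "(\<integral>x. (\<sigma> h x\<^sub>0 x + B) powr r \<partial>vol) \<le> C\<^sub>1 powr r * B powr r" by (simp add: powr_mult)
    have "(\<integral>x. w x \<partial>vol) = (\<integral>x. (\<sigma> h x\<^sub>0 x + B) powr r / B powr r \<partial>vol)"
      by (rule Bochner_Integration.integral_cong[OF refl]) (simp add: w_def powr_divide)
    also have "\<dots> = (\<integral>x. (\<sigma> h x\<^sub>0 x + B) powr r \<partial>vol) / B powr r" by simp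
    also have "\<dots> \<le> C\<^sub>1 powr r" using J B by (simp add: divide_le_eq)
    finally have W: "(\<integral>x. w x \<partial>vol) \<le> C\<^sub>1 powr r" .
    have pw: "\<bar>?d z\<bar> powr q \<le> B powr q * (1 + 2 powr r * (w (fst z) + w (snd z)))" if "z \<in> space ?P" for z
    proof -
      have xy: "fst z \<in> X" "snd z \<in> X" using that by (auto simp: space_pair_measure space_vol)
      let ?a = "(\<sigma> h x\<^sub>0 (fst z) + B) / B" and ?b = "(\<sigma> h x\<^sub>0 (snd z) + B) / B"
      have ab: "0 \<le> ?a" "0 \<le> ?b" using up[OF xy(1)] up[OF xy(2)] B by auto
      have d0: "0 \<le> ?d z" by (rule h.riemannian_dist_nonneg[OF connected xy])
      have "?d z \<le> \<sigma> h (fst z) x\<^sub>0 + \<sigma> h x\<^sub>0 (snd z)"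
        using h.riemannian_dist_le_sym_dist[OF xy] h.sym_dist_triangle[OF xy(1) x0 xy(2)] by simp
      also have "\<sigma> h (fst z) x\<^sub>0 = \<sigma> h x\<^sub>0 (fst z)" by (rule h.sym_dist_commute)
      finally have "?d z \<le> (\<sigma> h x\<^sub>0 (fst z) + B) + (\<sigma> h x\<^sub>0 (snd z) + B)" using B by simp
      then have dab: "?d z / B \<le> ?a + ?b" unfolding add_divide_distrib[symmetric] using B by (intro divide_right_mono) auto
      have "\<bar>?d z\<bar> powr q = B powr q * (?d z / B) powr q" using d0 B by (simp add: powr_divide)
      also have "\<dots> \<le> B powr q * (1 + (?d z / B) powr r)"
        using d0 B q r by (intro mult_left_mono le_one_plus_powr) auto
      also have "\<dots> \<le> B powr q * (1 + (?a + ?b) powr r)"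
        using d0 B r dab by (intro mult_left_mono add_left_mono powr_mono2) auto
      also have "\<dots> \<le> B powr q * (1 + 2 powr r * (?a powr r + ?b powr r))"
        using ab r by (intro mult_left_mono add_left_mono powr_add_le) auto
      finally show ?thesis by (simp only: w_def)
    qed
    note s = sum_powr_integral[OF wm wb]
    interpret P: finite_measure ?P by (rule s(4))
    have dP: "(\<lambda>z. \<bar>(\<lambda>(x, y). riemannian_dist M h x y) z\<bar> powr q) = (\<lambda>z. \<bar>?d z\<bar> powr q)" by (simp add: fun_eq_iff case_prod_unfold)
    have "(\<integral>z. \<bar>?d z\<bar> powr q \<partial>?P) \<le> B powr q * D"
    proof (cases "integrable ?P (\<lambda>z. \<bar>?d z\<bar> powr q)")
      case True
      have iw: "integrable ?P (\<lambda>z. 2 powr r * (w (fst z) + w (snd z)))" by (rule integrable_mult_right[OF s(1)])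
      have "(\<integral>z. \<bar>?d z\<bar> powr q \<partial>?P) \<le> (\<integral>z. B powr q * (1 + 2 powr r * (w (fst z) + w (snd z))) \<partial>?P)"
        by (rule integral_mono[OF True _ pw]) (intro integrable_mult_right Bochner_Integration.integrable_add iw P.integrable_const)
      also have "\<dots> = B powr q * (\<integral>z. 1 + 2 powr r * (w (fst z) + w (snd z)) \<partial>?P)" by (rule integral_mult_right_zero)
      also have "(\<integral>z. 1 + 2 powr r * (w (fst z) + w (snd z)) \<partial>?P) = V * V + 2 powr r * (2 * V * (\<integral>x. w x \<partial>vol))"
        unfolding Bochner_Integration.integral_add[OF P.integrable_const iw] integral_mult_right_zero s(2) V_def
        by (simp add: space_pair_measure space_vol s(2,3))
      also have "B powr q * \<dots> \<le> B powr q * D"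
        unfolding D_def using W V by (intro mult_left_mono add_left_mono) auto
      finally show ?thesis .
    next
      \<comment> \<open>By convention, the integral of a function that is not integrable is \<open>0\<close>.\<close>
      case False
      then show ?thesis using B D by (simp add: not_integrable_integral_eq)
    qed
    moreover have "0 \<le> (\<integral>z. \<bar>?d z\<bar> powr q \<partial>?P)" by (rule Bochner_Integration.integral_nonneg) simp
    ultimately have "Lr_norm q ?P (\<lambda>(x, y). riemannian_dist M h x y) \<le> (B powr q * D) powr (1 / q)"
      unfolding Lr_norm_def dP using q by (intro powr_mono2) auto
    also have "\<dots> = D powr (1 / q) * B" using B q by (simp add: powr_mult powr_powr mult.commute)
    finally show ?thesis by (simp only: B_def)
  qed
  have "0 < D powr (1 / q)" using D by simp
  from conjI[OF this] show ?thesis by (rule exI) (intro allI impI, rule est)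
qed

lemma tensor_Lr_norm:
  assumes h: "riemannian_metric M h" and p: "1 \<le> p"
  shows "Lr_norm (p / 2) vol (tensor_norm M g h) powr (1 / 2) = (\<integral>x. speed_bound h x powr p \<partial>vol) powr (1 / p)"
proof -
  have "(\<integral>x. \<bar>tensor_norm M g h x\<bar> powr (p / 2) \<partial>vol) = (\<integral>x. speed_bound h x powr p \<partial>vol)"
  proof (rule Bochner_Integration.integral_cong[OF refl])
    fix x assume "x \<in> space vol"
    then have "0 < tensor_norm M g h x" using tensor_norm_pos[OF h] by (simp add: space_vol)
    then show "\<bar>tensor_norm M g h x\<bar> powr (p / 2) = speed_bound h x powr p"
      by (simp add: speed_bound_def powr_half_sqrt[symmetric] powr_powr)
  qed
  then show ?thesis using p by (simp add: Lr_norm_def powr_powr)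
qed

end

theorem theorem1p1:
  fixes M :: "('a, 'i, 'n::finite) mfd" and g :: "('a, 'i, 'n) tensor2" and q :: real
  assumes "closed_manifold M" and "connected_space (points M)" and "oriented M"
    and "riemannian_metric M g"
    and "1 \<le> q"
  shows "\<exists>C>0. \<forall>p::real. 1 \<le> p \<and> p < real CARD('n) \<and>
             q < real CARD('n) * p / (real CARD('n) - p) \<longrightarrow>
           (\<forall>h. riemannian_metric M h \<longrightarrow>
             Lr_norm q (riemannian_volume (prod_mfd M M) (prod_riemannian_metric g g))
               (\<lambda>(x, y). riemannian_dist M h x y)
             \<le> C * Lr_norm (p / 2) (riemannian_volume M g) (tensor_norm M g h) powr (1 / 2))"
proof -
  interpret closed_connected_riem_mfd M g
    using assms by unfold_locales (auto simp: closed_manifold_def)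
  have "\<exists>C>0. \<forall>p h. 1 \<le> p \<longrightarrow> p < real CARD('n) \<longrightarrow> q < real CARD('n) * p / (real CARD('n) - p) \<longrightarrow> riemannian_metric M h \<longrightarrow>
       Lr_norm q (vol \<Otimes>\<^sub>M vol) (\<lambda>(x, y). riemannian_dist M h x y) \<le> C * (\<integral>x. speed_bound h x powr p \<partial>vol) powr (1 / p)"
  \<comment> \<open>In dimension 1 there is no \<open>p\<close> with \<open>1 \<le> p < n\<close>; on the empty manifold both sides vanish.\<close>
  proof (cases "X = {} \<or> CARD('n) < 2")
    case True
    have "Lr_norm q (vol \<Otimes>\<^sub>M vol) (\<lambda>(x, y). riemannian_dist M h x y) \<le> 1 * (\<integral>x. speed_bound h x powr p \<partial>vol) powr (1 / p)"
      if "1 \<le> p" "p < real CARD('n)" for p h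
    proof -
      have "X = {}" using True that by auto
      then have "(\<integral>z. \<bar>case z of (x, y) \<Rightarrow> riemannian_dist M h x y\<bar> powr q \<partial>(vol \<Otimes>\<^sub>M vol)) = (\<integral>z. 0 \<partial>(vol \<Otimes>\<^sub>M vol))"
        by (intro Bochner_Integration.integral_cong) (auto simp: space_pair_measure space_vol)
      then show ?thesis by (simp add: Lr_norm_def)
    qed
    then show ?thesis by (intro exI[of _ 1] conjI allI impI) auto
  next
    case False
    then have "2 \<le> CARD('n)" "X \<noteq> {}" by auto
    from dist_norm_bound[OF this assms(5)] show ?thesis .
  qed
  then obtain C where "0 < C \<and> (\<forall>p h. 1 \<le> p \<longrightarrow> p < real CARD('n) \<longrightarrow> q < real CARD('n) * p / (real CARD('n) - p) \<longrightarrow> riemannian_metric M h \<longrightarrow>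
       Lr_norm q (vol \<Otimes>\<^sub>M vol) (\<lambda>(x, y). riemannian_dist M h x y) \<le> C * (\<integral>x. speed_bound h x powr p \<partial>vol) powr (1 / p))"
    by (rule exE)
  note C = conjunct1[OF this] conjunct2[OF this, rule_format]
  show ?thesis
  proof (intro exI[of _ C] conjI C(1) allI impI)
    fix p h assume p: "1 \<le> p \<and> p < real CARD('n) \<and> q < real CARD('n) * p / (real CARD('n) - p)" and h: "riemannian_metric M h"
    then have p': "1 \<le> p" "p < real CARD('n)" "q < real CARD('n) * p / (real CARD('n) - p)" by blast+
    show "Lr_norm q (riemannian_volume (prod_mfd M M) (prod_riemannian_metric g g)) (\<lambda>(x, y). riemannian_dist M h x y)
             \<le> C * Lr_norm (p / 2) vol (tensor_norm M g h) powr (1 / 2)"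
      unfolding riemannian_volume_prod tensor_Lr_norm[OF h p'(1)] by (rule C(2)[OF p' h])
  qed
qed

end
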